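(* Let $Ax=b$ be a consistent linear system with symmetric positive semidefinite $A\in\mathbb{R}^{n\times n}$ and solution $x^*$. The SC-RCD method with approximation rank $d\ge0$ and block size $\ell\ge1$, combined with the boosting procedure (both described in the context), computes an approximate solution $x^k$ that satisfies $$\mathbb{E}\|x^k-x^*\|_A^2\le\epsilon\cdot\|x^0-x^*\|_A^2\quad\text{after}\quad k=\left\lceil4\,(n/\ell)\,\bar\kappa_r(A)\log(2/\epsilon)\right\rceil\ \text{iterations}.$$ In total, $$O\bigl(nd^2\log(1/\epsilon)\bigr)+O\left(\Bigl(\frac{n^2(d+\ell)}{\ell}+n\ell^2+n\ell d\Bigr)\cdot\bar\kappa_r(A)\log(1/\epsilon)\right)\quad\text{operations}$$ are required, where $r$ is the largest integer satisfying $$d\ge r+r\log(1/\eta_r),\qquad \eta_r:=\frac{\sum_{i>r}\lambda_i(A)}{\sum_{i=1}^n\lambda_i(A)},$$ and $\bar\kappa_r(A)$ is the normalized tail condition number of $A$, $$\bar\kappa_r(A):=\frac{1}{n-r}\,\frac{\sum_{i>r}\lambda_i(A)}{\lambda_{\min}^+(A)}\qquad\text{for } r<\operatorname{rank}(A).$$ Moreover, $O(nd\log(1/\epsilon))+O(n^2\cdot\bar\kappa_r(A)\log(1/\epsilon))$ entry evaluations of $A$, and $O(n(d+\ell))$ storage are required. Here, big $O$ notation is used to hide absolute constants.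
   Context: Notation: $\epsilon$ is the target relative error; $\lambda_1(A)\ge\dots\ge\lambda_n(A)\ge0$ are the eigenvalues of $A$ and $\lambda_{\min}^+(A)$ is the smallest non-zero one; $\|z\|_A=\sqrt{z^{\mathsf T}Az}$; $M^\dagger$ is the Moore–Penrose pseudoinverse; $[n]=\{1,\dots,n\}$; $M_{\mathcal I,\mathcal J}$ denotes a submatrix (":" means all indices) and $v_{\mathcal J}$ a subvector. For $\mathcal S\subseteq[n]$, $A\langle\mathcal S\rangle:=A_{:,\mathcal S}(A_{\mathcal S,\mathcal S})^\dagger A_{\mathcal S,:}$ is the Nyström approximation and $A^\circ:=A-A\langle\mathcal S\rangle$ is the residual matrix. RPCholesky (randomly pivoted Cholesky) with rank parameter $d$: set $A^{(0)}=A$, $\mathcal S=\emptyset$; for $i=1,\dots,d$ (stopping early if $A^{(i-1)}=0$), sample $s_i\in[n]$ with probability $A^{(i-1)}_{s_i,s_i}/\operatorname{tr}(A^{(i-1)})$, add it to $\mathcal S$, and set $A^{(i)}=A^{(i-1)}-A^{(i-1)}_{:,s_i}A^{(i-1)}_{s_i,:}/A^{(i-1)}_{s_i,s_i}$. It is implemented without forming the residual matrices and outputs $\mathcal S$ and a factor $F\in\mathbb{R}^{n\times d}$ with $A\langle\mathcal S\rangle=FF^{\mathsf T}$, where $F_{\mathcal S,:}$ is invertible and lower triangular when rows are ordered by pivots. One run costs $O(d^2n)$ arithmetic operations, $O(dn)$ entry evaluations of $A$ and $O(dn)$ storage. Boosting procedure: run RPCholesky independently $T$ times, with $T=\lceil\log_2(2/\epsilon)\rceil$,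 and keep the output with the smallest residual trace $\operatorname{tr}(A-A\langle\mathcal S\rangle)$. SC-RCD method (subspace-constrained randomized coordinate descent), given $\mathcal S$ and $F$: (1) Compute $\beta\leftarrow(F_{\mathcal S,:})^{-\mathsf T}(F_{\mathcal S,:})^{-1}b_{\mathcal S}$ by triangular solves; set $x\leftarrow0$, $x_{\mathcal S}\leftarrow\beta$ (this is $x^0$, which solves $A_{\mathcal S,:}x^0=b_{\mathcal S}$), and the residual vector $\mathsf r\leftarrow A_{:,\mathcal S}\beta-b$. (2) Compute $C\leftarrow(F_{\mathcal S,:})^{-\mathsf T}F^{\mathsf T}\in\mathbb{R}^{d\times n}$ by triangular solves; set $p_j\leftarrow A_{j,j}-F_{j,:}(F_{j,:})^{\mathsf T}$ for $j\in[n]\setminus\mathcal S$ and $p_j\leftarrow0$ for $j\in\mathcal S$; normalize $p$ to sum to 1. (3) For $k=1,2,\dots$: sample $\mathcal J=\{j_1,\dots,j_\ell\}$ with $j_1,\dots,j_\ell$ i.i.d. from $p$; find the minimum-norm solution $\alpha\in\mathbb{R}^\ell$ of $\bigl(A_{\mathcal J,\mathcal J}-F_{\mathcal J,:}(F_{\mathcal J,:})^{\mathsf T}\bigr)\alpha=\mathsf r_{\mathcal J}$ (by a direct method, $O(\ell^3)$ operations); set $\beta\leftarrow C_{:,\mathcal J}\alpha$; update $x_{\mathcal J}\leftarrow x_{\mathcal J}-\alpha$, $x_{\mathcal S}\leftarrow x_{\mathcal S}+\beta$ (the new iterate $x^k$), and $\mathsf r\leftarrow\mathsf r-\bigl(A_{:,\mathcal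 J}\alpha-F((F_{\mathcal J,:})^{\mathsf T}\alpha)\bigr)$. The matrix $A$ is accessed through entry evaluations and need not be stored.
   Formalization: A is nonzero; as x^0 is random, the expected ratio of squared errors is bounded by ε<1; cost constants are uniform for ε≤ε0, any fixed ε0<1; since k is rounded up, κ̄_r(A)log(1/ε) is replaced in the costs by its maximum with ℓ/n. *)

theory Defs
  imports
    "HOL-Probability.Probability"
    "Jordan_Normal_Form.Char_Poly"
    "Jordan_Normal_Form.Gauss_Jordan_Elimination"
begin

text \<open>
  Matrices and vectors are those of \<^theory>\<open>Jordan_Normal_Form.Matrix\<close>, because the dimension is
  quantified inside the statement: the constants hidden in the big O must not depend on it.
  The clashing notions of \<^theory>\<open>HOL-Analysis.Finite_Cartesian_Product\<close> are hidden.
\<close>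

unbundle no vec_syntax
unbundle no inner_syntax
hide_const (open) Finite_Cartesian_Product.vec Finite_Cartesian_Product.mat
  Finite_Cartesian_Product.row Finite_Cartesian_Product.transpose


section \<open>Linear algebra\<close>

definition psd :: "nat \<Rightarrow> real mat \<Rightarrow> bool" where
  "psd n A \<longleftrightarrow> A \<in> carrier_mat n n \<and> A\<^sup>T = A \<and> (\<forall>v\<in>carrier_vec n. 0 \<le> v \<bullet> (A *\<^sub>v v))"

text \<open>Indices are \<open>0, \<dots>, n - 1\<close>.  Index sets that carry an order (the pivots) are lists, and
  a submatrix takes its rows and columns in the order of these lists.\<close>

definition submat :: "'a mat \<Rightarrow> nat list \<Rightarrow> nat list \<Rightarrow> 'a mat" where
  "submat M I J = mat (length I) (length J) (\<lambda>(i, j). M $$ (I ! i, J ! j))"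

abbreviation rows_of :: "'a mat \<Rightarrow> nat list \<Rightarrow> 'a mat" where
  "rows_of M I \<equiv> submat M I [0..<dim_col M]"

abbreviation cols_of :: "'a mat \<Rightarrow> nat list \<Rightarrow> 'a mat" where
  "cols_of M J \<equiv> submat M [0..<dim_row M] J"

definition subvec :: "'a vec \<Rightarrow> nat list \<Rightarrow> 'a vec" where
  "subvec v J = vec (length J) (\<lambda>t. v $ (J ! t))"

text \<open>The update \<open>x\<^sub>J \<leftarrow> x\<^sub>J + v\<close>, for distinct \<open>J\<close>.\<close>

definition add_at :: "real vec \<Rightarrow> nat list \<Rightarrow> real vec \<Rightarrow> real vec" where
  "add_at x J v = vec (dim_vec x) (\<lambda>i. x $ i + (\<Sum>t<length J. if J ! t = i then v $ t else 0))"

definition tr :: "real mat \<Rightarrow> real" where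
  "tr M = (\<Sum>i<dim_row M. M $$ (i, i))"

definition pinv :: "real mat \<Rightarrow> real mat" where
  "pinv M = (THE X. X \<in> carrier_mat (dim_col M) (dim_row M) \<and>
     M * X * M = M \<and> X * M * X = X \<and> (M * X)\<^sup>T = M * X \<and> (X * M)\<^sup>T = X * M)"

abbreviation inv_mat :: "real mat \<Rightarrow> real mat" where
  "inv_mat M \<equiv> the (mat_inverse M)"

definition min_norm_sol :: "real mat \<Rightarrow> real vec \<Rightarrow> real vec" where
  "min_norm_sol G v = (THE a. a \<in> carrier_vec (dim_col G) \<and> G *\<^sub>v a = v \<and>
     (\<forall>a'\<in>carrier_vec (dim_col G). G *\<^sub>v a' = v \<longrightarrow> sqrt (a \<bullet> a) \<le> sqrt (a' \<bullet> a')))"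

definition energy_norm :: "real mat \<Rightarrow> real vec \<Rightarrow> real" where
  "energy_norm A z = sqrt (z \<bullet> (A *\<^sub>v z))"

text \<open>The eigenvalues with multiplicity, in decreasing order; \<open>\<lambda>\<^sub>i(A)\<close> is \<open>eigvals A ! (i - 1)\<close>.\<close>

definition eigvals :: "real mat \<Rightarrow> real list" where
  "eigvals A = (THE es. sorted_wrt (\<ge>) es \<and> char_poly A = (\<Prod>e\<leftarrow>es. [:- e, 1:]))"

definition lambda_min_pos :: "real mat \<Rightarrow> real" where
  "lambda_min_pos A = Min {e. eigenvalue A e \<and> e \<noteq> 0}"

definition tail_sum :: "real mat \<Rightarrow> nat \<Rightarrow> real" where
  "tail_sum A r = (\<Sum>e\<leftarrow>drop r (eigvals A). e)"

definition eta :: "real mat \<Rightarrow> nat \<Rightarrow> real" where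
  "eta A r = tail_sum A r / tail_sum A 0"

text \<open>The largest \<open>r\<close> with \<open>d \<ge> r + r log (1 / \<eta>\<^sub>r)\<close>.  If \<open>\<eta>\<^sub>r = 0\<close> then \<open>log (1 / \<eta>\<^sub>r) = \<infinity>\<close> and the
  inequality fails; in HOL, \<open>ln (1 / 0) = 0\<close>, so this has to be said explicitly.  For
  positive semidefinite \<open>A \<noteq> 0\<close>, \<open>\<eta>\<^sub>r > 0\<close> means \<open>r < rank A\<close>.\<close>

definition approx_rank :: "real mat \<Rightarrow> nat \<Rightarrow> nat" where
  "approx_rank A d =
     (GREATEST r. eta A r > 0 \<and> real d \<ge> real r + real r * ln (1 / eta A r))"

definition tail_cond :: "real mat \<Rightarrow> nat \<Rightarrow> real" where
  "tail_cond A r = 1 / (real (dim_row A) - real r) * (tail_sum A r / lambda_min_pos A)"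

definition nystrom :: "real mat \<Rightarrow> nat list \<Rightarrow> real mat" where
  "nystrom A S = cols_of A S * pinv (submat A S S) * rows_of A S"


section \<open>The randomized algorithms\<close>

text \<open>The index \<open>j < n\<close> is drawn with probability \<open>w j / (\<Sum>i<n. w i)\<close>.\<close>

definition index_pmf :: "nat \<Rightarrow> (nat \<Rightarrow> real) \<Rightarrow> nat pmf" where
  "index_pmf n w =
     (if (\<forall>j<n. 0 \<le> w j) \<and> 0 < (\<Sum>i<n. w i)
      then pmf_of_list (map (\<lambda>j. (j, w j / (\<Sum>i<n. w i))) [0..<n])
      else return_pmf 0)"

text \<open>The state of RPCholesky consists of the pivots, the columns of \<open>F\<close>, and the residual matrix.
  When the residual vanishes, the remaining steps do nothing, and \<open>F\<close> has fewer than \<open>d\<close>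
  columns.\<close>

type_synonym rpc_state = "nat list \<times> real vec list \<times> real mat"

definition rpc_step :: "rpc_state \<Rightarrow> rpc_state pmf" where
  "rpc_step = (\<lambda>(S, cs, R). let n = dim_row R in
     if R = 0\<^sub>m n n then return_pmf (S, cs, R)
     else do {
       s \<leftarrow> index_pmf n (\<lambda>j. R $$ (j, j));
       return_pmf
         (S @ [s],
          cs @ [vec n (\<lambda>i. R $$ (i, s) / sqrt (R $$ (s, s)))],
          mat n n (\<lambda>(i, j). R $$ (i, j) - R $$ (i, s) * R $$ (s, j) / R $$ (s, s)))
     })"

primrec rpc_iter :: "nat \<Rightarrow> rpc_state \<Rightarrow> rpc_state pmf" where
  "rpc_iter 0 st = return_pmf st"
| "rpc_iter (Suc m) st = do { st' \<leftarrow> rpc_step st; rpc_iter m st' }"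

definition rpcholesky :: "real mat \<Rightarrow> nat \<Rightarrow> (nat list \<times> real mat) pmf" where
  "rpcholesky A d =
     map_pmf (\<lambda>(S, cs, R). (S, mat_of_cols (dim_row A) cs)) (rpc_iter d ([], [], A))"

text \<open>\<^const>\<open>arg_min_list\<close> resolves ties in favour of the earliest run.\<close>

definition boosted_rpcholesky :: "real mat \<Rightarrow> nat \<Rightarrow> nat \<Rightarrow> (nat list \<times> real mat) pmf" where
  "boosted_rpcholesky A d T =
     map_pmf (arg_min_list (\<lambda>(S, F). tr (A - nystrom A S))) (replicate_pmf T (rpcholesky A d))"

definition boost_runs :: "real \<Rightarrow> nat" where
  "boost_runs \<epsilon> = nat \<lceil>log 2 (2 / \<epsilon>)\<rceil>"

text \<open>The state of SC-RCD consists of the iterate \<open>x\<close> and the residual vector.\<close>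

definition scrcd_init :: "real mat \<Rightarrow> real vec \<Rightarrow> nat list \<Rightarrow> real mat \<Rightarrow> real vec \<times> real vec" where
  "scrcd_init A b S F =
     (let L = inv_mat (rows_of F S);
          \<beta> = L\<^sup>T *\<^sub>v (L *\<^sub>v subvec b S)
      in (add_at (0\<^sub>v (dim_row A)) S \<beta>, cols_of A S *\<^sub>v \<beta> - b))"

definition scrcd_weight :: "real mat \<Rightarrow> nat list \<Rightarrow> real mat \<Rightarrow> nat \<Rightarrow> real" where
  "scrcd_weight A S F j = (if j \<in> set S then 0 else A $$ (j, j) - row F j \<bullet> row F j)"

text \<open>The block is the set \<open>{j\<^sub>1, \<dots>, j\<^sub>l}\<close>, so repeated indices count once.  If all weights vanish, they
  cannot be normalized; then \<open>A\<langle>S\<rangle> = A\<close>, \<open>x\<^sup>0\<close> is an exact solution, and the iteration keeps it.\<close>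

definition scrcd_step ::
  "real mat \<Rightarrow> nat \<Rightarrow> nat list \<Rightarrow> real mat \<Rightarrow> real vec \<times> real vec \<Rightarrow> (real vec \<times> real vec) pmf" where
  "scrcd_step A l S F = (\<lambda>(x, res).
     let n = dim_row A; p = scrcd_weight A S F; C = (inv_mat (rows_of F S))\<^sup>T * F\<^sup>T in
     if (\<Sum>j<n. p j) = 0 then return_pmf (x, res)
     else do {
       js \<leftarrow> replicate_pmf l (index_pmf n p);
       let J = remdups js;
       let FJ = rows_of F J;
       let \<alpha> = min_norm_sol (submat A J J - FJ * FJ\<^sup>T) (subvec res J);
       let \<beta> = cols_of C J *\<^sub>v \<alpha>;
       return_pmf
         (add_at (add_at x J (- \<alpha>)) S \<beta>,
          res - (cols_of A J *\<^sub>v \<alpha> - F *\<^sub>v (FJ\<^sup>T *\<^sub>v \<alpha>)))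
     })"

primrec scrcd_iter ::
  "nat \<Rightarrow> real mat \<Rightarrow> nat \<Rightarrow> nat list \<Rightarrow> real mat \<Rightarrow> real vec \<times> real vec \<Rightarrow> (real vec \<times> real vec) pmf" where
  "scrcd_iter 0 A l S F st = return_pmf st"
| "scrcd_iter (Suc k) A l S F st = do { st' \<leftarrow> scrcd_step A l S F st; scrcd_iter k A l S F st' }"

text \<open>The joint law of \<open>(S, F, x\<^sup>0, x\<^sup>k)\<close> when \<open>(S, F)\<close> comes from \<open>T\<close> runs of RPCholesky.\<close>

definition boosted_scrcd ::
  "real mat \<Rightarrow> real vec \<Rightarrow> nat \<Rightarrow> nat \<Rightarrow> nat \<Rightarrow> nat \<Rightarrow> (nat list \<times> real mat \<times> real vec \<times> real vec) pmf" where
  "boosted_scrcd A b d l T k = do {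
     (S, F) \<leftarrow> boosted_rpcholesky A d T;
     let st = scrcd_init A b S F;
     (x, res) \<leftarrow> scrcd_iter k A l S F st;
     return_pmf (S, F, fst st, x)
   }"


section \<open>Cost model: a randomized real RAM\<close>

text \<open>
  Programs act on index registers, on index arrays, and on two-dimensional real arrays (vectors use
  column \<open>0\<close>); registers and arrays are named by natural numbers.  A program is a fixed finite
  term, so it uses a constant number of registers and of temporaries.  The matrix \<open>A\<close> is not stored:
  it is accessible only through \<open>Entry\<close>.  A loop evaluates its bound once, on entry.
\<close>

datatype iexp = Num nat | Reg nat | Idx nat iexp | IAdd iexp iexp | ISub iexp iexp

datatype rexp =
    Lit nat
  | Cell nat iexp iexp
  | Rhs iexp
  | Entry iexp iexp
  | Add rexp rexp
  | Sub rexp rexp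
  | Mul rexp rexp
  | Div rexp rexp
  | Sqrt rexp

datatype com =
    Skip
  | Seq com com
  | SetReg nat iexp
  | SetIdx nat iexp iexp
  | SetCell nat iexp iexp rexp
  | Sample nat nat iexp
  | IfLess rexp rexp com com
  | IfIdxLess iexp iexp com com
  | For nat iexp com

text \<open>Besides its contents, a store records the number of operations and of entry evaluations performed
  so far, and the array positions written so far.\<close>

record store =
  regs :: "nat \<Rightarrow> nat"
  idxs :: "nat \<Rightarrow> nat \<Rightarrow> nat"
  cells :: "nat \<Rightarrow> nat \<Rightarrow> nat \<Rightarrow> real"
  ops :: nat
  evals :: nat
  used_idxs :: "(nat \<times> nat) set"
  used_cells :: "(nat \<times> nat \<times> nat) set"

definition storage :: "store \<Rightarrow> nat" where
  "storage s = card (used_idxs s) + card (used_cells s)"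

primrec ival :: "iexp \<Rightarrow> store \<Rightarrow> nat" where
  "ival (Num m) s = m"
| "ival (Reg v) s = regs s v"
| "ival (Idx a e) s = idxs s a (ival e s)"
| "ival (IAdd e f) s = ival e s + ival f s"
| "ival (ISub e f) s = ival e s - ival f s"

primrec rval :: "real mat \<Rightarrow> real vec \<Rightarrow> rexp \<Rightarrow> store \<Rightarrow> real" where
  "rval A b (Lit m) s = real m"
| "rval A b (Cell a e f) s = cells s a (ival e s) (ival f s)"
| "rval A b (Rhs e) s = b $ ival e s"
| "rval A b (Entry e f) s = A $$ (ival e s, ival f s)"
| "rval A b (Add p q) s = rval A b p s + rval A b q s"
| "rval A b (Sub p q) s = rval A b p s - rval A b q s"
| "rval A b (Mul p q) s = rval A b p s * rval A b q s"
| "rval A b (Div p q) s = rval A b p s / rval A b q s"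
| "rval A b (Sqrt p) s = sqrt (rval A b p s)"

primrec icost :: "iexp \<Rightarrow> nat" where
  "icost (Num m) = 1"
| "icost (Reg v) = 1"
| "icost (Idx a e) = 1 + icost e"
| "icost (IAdd e f) = 1 + icost e + icost f"
| "icost (ISub e f) = 1 + icost e + icost f"

primrec rcost :: "rexp \<Rightarrow> nat" where
  "rcost (Lit m) = 1"
| "rcost (Cell a e f) = 1 + icost e + icost f"
| "rcost (Rhs e) = 1 + icost e"
| "rcost (Entry e f) = 1 + icost e + icost f"
| "rcost (Add p q) = 1 + rcost p + rcost q"
| "rcost (Sub p q) = 1 + rcost p + rcost q"
| "rcost (Mul p q) = 1 + rcost p + rcost q"
| "rcost (Div p q) = 1 + rcost p + rcost q"
| "rcost (Sqrt p) = 1 + rcost p"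

primrec entry_count :: "rexp \<Rightarrow> nat" where
  "entry_count (Lit m) = 0"
| "entry_count (Cell a e f) = 0"
| "entry_count (Rhs e) = 0"
| "entry_count (Entry e f) = 1"
| "entry_count (Add p q) = entry_count p + entry_count q"
| "entry_count (Sub p q) = entry_count p + entry_count q"
| "entry_count (Mul p q) = entry_count p + entry_count q"
| "entry_count (Div p q) = entry_count p + entry_count q"
| "entry_count (Sqrt p) = entry_count p"

definition charge :: "nat \<Rightarrow> nat \<Rightarrow> store \<Rightarrow> store" where
  "charge c e s = s\<lparr>ops := ops s + c, evals := evals s + e\<rparr>"

definition set_reg :: "nat \<Rightarrow> nat \<Rightarrow> store \<Rightarrow> store" where
  "set_reg v m s = s\<lparr>regs := (regs s)(v := m)\<rparr>"

definition set_idx :: "nat \<Rightarrow> nat \<Rightarrow> nat \<Rightarrow> store \<Rightarrow> store" where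
  "set_idx a i m s = s\<lparr>
     idxs := (idxs s)(a := (idxs s a)(i := m)),
     used_idxs := insert (a, i) (used_idxs s)\<rparr>"

definition set_cell :: "nat \<Rightarrow> nat \<Rightarrow> nat \<Rightarrow> real \<Rightarrow> store \<Rightarrow> store" where
  "set_cell a i j y s = s\<lparr>
     cells := (cells s)(a := (cells s a)(i := (cells s a i)(j := y))),
     used_cells := insert (a, i, j) (used_cells s)\<rparr>"

text \<open>\<open>Sample v a e\<close> draws an index \<open>j\<close> below the value \<open>m\<close> of \<open>e\<close> with probability proportional to
  entry \<open>(j, 0)\<close> of array \<open>a\<close>, as by a linear scan of the \<open>m\<close> weights, and costs \<open>m\<close> operations.\<close>

primrec run :: "real mat \<Rightarrow> real vec \<Rightarrow> com \<Rightarrow> store \<Rightarrow> store pmf" where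
  "run A b Skip s = return_pmf s"
| "run A b (Seq c c') s = bind_pmf (run A b c s) (run A b c')"
| "run A b (SetReg v e) s = return_pmf (charge (1 + icost e) 0 (set_reg v (ival e s) s))"
| "run A b (SetIdx a e f) s =
     return_pmf (charge (1 + icost e + icost f) 0 (set_idx a (ival e s) (ival f s) s))"
| "run A b (SetCell a e f p) s =
     return_pmf (charge (1 + icost e + icost f + rcost p) (entry_count p)
       (set_cell a (ival e s) (ival f s) (rval A b p s) s))"
| "run A b (Sample v a e) s =
     map_pmf (\<lambda>j. charge (1 + icost e + ival e s) 0 (set_reg v j s))
       (index_pmf (ival e s) (\<lambda>j. cells s a j 0))"
| "run A b (IfLess p q c c') s =
     (if rval A b p s < rval A b q s then run A b c else run A b c')
       (charge (1 + rcost p + rcost q) (entry_count p + entry_count q) s)"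
| "run A b (IfIdxLess e f c c') s =
     (if ival e s < ival f s then run A b c else run A b c')
       (charge (1 + icost e + icost f) 0 s)"
| "run A b (For v e c) s =
     fold (\<lambda>i m. bind_pmf m (\<lambda>s'. run A b c (charge 1 0 (set_reg v i s')))) [0..<ival e s]
       (return_pmf (charge (1 + icost e) 0 s))"

definition input_store :: "nat \<Rightarrow> nat \<Rightarrow> nat \<Rightarrow> nat \<Rightarrow> nat \<Rightarrow> store" where
  "input_store n d l T k = \<lparr>
     regs = (\<lambda>_. 0)(0 := n, 1 := d, 2 := l, 3 := T, 4 := k),
     idxs = (\<lambda>_ _. 0), cells = (\<lambda>_ _ _. 0), ops = 0, evals = 0,
     used_idxs = {}, used_cells = {}\<rparr>"

text \<open>A final store represents \<open>(S, F, x\<^sup>0, x\<^sup>k)\<close>: register \<open>0\<close> holds the number of pivots, index array \<open>0\<close> the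
  pivots, and the real arrays \<open>0\<close>, \<open>1\<close>, \<open>2\<close> hold \<open>x\<^sup>k\<close>, \<open>x\<^sup>0\<close> and \<open>F\<close>.\<close>

definition result :: "nat \<Rightarrow> store \<Rightarrow> nat list \<times> real mat \<times> real vec \<times> real vec" where
  "result n s =
     (map (idxs s 0) [0..<regs s 0],
      mat n (regs s 0) (\<lambda>(i, j). cells s 2 i j),
      vec n (\<lambda>i. cells s 1 i 0),
      vec n (\<lambda>i. cells s 0 i 0))"

text \<open>The program is uniform: one and the same term serves all dimensions and parameters.\<close>

definition implements_scrcd :: "com \<Rightarrow> bool" where
  "implements_scrcd prog \<longleftrightarrow>
     (\<forall>n A b d l T k. 0 < n \<and> psd n A \<and> (\<exists>x\<in>carrier_vec n. A *\<^sub>v x = b) \<and> 0 < l \<and> 0 < T \<longrightarrow>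
        map_pmf (result n) (run A b prog (input_store n d l T k)) = boosted_scrcd A b d l T k)"

definition scrcd_iterations :: "real mat \<Rightarrow> nat \<Rightarrow> nat \<Rightarrow> real \<Rightarrow> nat" where
  "scrcd_iterations A d l \<epsilon> =
     nat \<lceil>4 * (real (dim_row A) / real l) * tail_cond A (approx_rank A d) * ln (2 / \<epsilon>)\<rceil>"


text \<open>
  Conventions of the theorem:

  \<^item> \<open>x\<^sup>0\<close> depends on the random pivots, so \<open>\<parallel>x\<^sup>0 - x\<^sup>*\<parallel>\<^sub>A\<^sup>2\<close> is itself random.  The accuracy bound is
    stated for the relative error, \<open>E (\<parallel>x\<^sup>k - x\<^sup>*\<parallel>\<^sub>A\<^sup>2 / \<parallel>x\<^sup>0 - x\<^sup>*\<parallel>\<^sub>A\<^sup>2) \<le> \<epsilon>\<close>, in \<^typ>\<open>ennreal\<close>, where \<open>0 / 0 = 0\<close> but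
    \<open>y / 0 = \<infinity>\<close> for \<open>y > 0\<close>.

  \<^item> Since \<open>log (1 / \<epsilon>)\<close> vanishes at \<open>\<epsilon> = 1\<close> whereas the cost does not, the constant of the cost bounds is
    absolute for \<open>\<epsilon>\<close> bounded away from \<open>1\<close>.

  \<^item> The number of iterations is rounded up, so it is of order \<open>(n / l) K\<close> with
    \<open>K = max (\<kappa> log (1 / \<epsilon>)) (l / n)\<close>; \<open>K = \<kappa> log (1 / \<epsilon>)\<close> as soon as \<open>(n / l) \<kappa> log (1 / \<epsilon>) \<ge> 1\<close>.
\<close>

end

theory Submission
  imports Defs
begin

text \<open>
  Let \<open>R\<close> be the residual matrix of RPCholesky and \<open>a\<close> the trace of its compression to the \<open>r\<close> leading eigenvectors
  of \<open>A\<close>.  One step decreases \<open>a\<close> in expectation by at least \<open>a\<^sup>2 / (r (a + B))\<close>, where \<open>B\<close> is the sum of the other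
  eigenvalues of \<open>A\<close>; as \<open>a - a\<^sup>2 / (r (a + B))\<close> is concave in \<open>a\<close>, the expectations satisfy the same recursion.  The
  potential \<open>ln a - B / a\<close> drops by at least \<open>1 / r\<close> per step, so that \<open>a \<le> B\<close>, and hence \<open>tr R \<le> 2 B\<close> in expectation,
  after \<open>r + r ln (1 / \<eta>\<^sub>r)\<close> steps.  By Markov's inequality and independence, the best of \<open>T\<close> runs has trace at most \<open>4 B\<close>
  except with probability \<open>2\<^sup>-\<^sup>T \<le> \<epsilon> / 2\<close>.

  All iterates solve the equations of the pivots, so the error \<open>z\<close> satisfies \<open>A z = R z\<close>, and a block step minimizes
  the quadratic form of \<open>R\<close> over the drawn coordinates.  It beats \<open>l\<close> successive steps along single coordinates, each of
  which contracts the form by \<open>1 - \<lambda>\<^sub>m\<^sub>i\<^sub>n\<^sup>+(A) / tr R\<close> in expectation.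

  The program keeps the diagonal of \<open>R\<close> up to date, which yields the pivots, the traces to be compared, and the
  weights of the blocks.  It obtains the minimum-norm solution of a block system by Gram-Schmidt
  orthogonalization of its rows.
\<close>

section \<open>Spectral theory of symmetric real matrices\<close>

text \<open>Vectors are functions on the naturals, read only below \<open>n\<close>. This avoids
  carrier conditions, and in the product topology of this function space a Rayleigh quotient attains
  its maximum, which is where eigenbases come from. The 4 in the threshold \<open>4 B\<close>, and
  in the number of iterations, is the 2 of the expected trace times the 2 of Markov's inequality.
  The logarithm is that of 2 / \<epsilon> because bad pivots and the unfinished iteration each
  receive \<epsilon> / 2. The error is measured relative to a random initial error, so bad pivots
  cannot be discarded; on them the proof relies on the error not growing, whatever is drawn. The
  rate involves the smallest nonzero eigenvalue of \<open>A\<close> although the form is that of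
  \<open>R\<close>: a correction on the pivots turns the form of \<open>R\<close> into that of
  \<open>A\<close>. Correctness of the program means equality of laws, so each command is coupled
  with the random object that it computes, and one coupling yields both the output law and
  worst-case costs.\<close>

definition ip :: "nat \<Rightarrow> (nat \<Rightarrow> real) \<Rightarrow> (nat \<Rightarrow> real) \<Rightarrow> real" where
  "ip n u v = (\<Sum>i<n. u i * v i)"

definition mvf :: "nat \<Rightarrow> (nat \<Rightarrow> nat \<Rightarrow> real) \<Rightarrow> (nat \<Rightarrow> real) \<Rightarrow> nat \<Rightarrow> real" where
  "mvf n M u i = (\<Sum>j<n. M i j * u j)"

definition symf :: "nat \<Rightarrow> (nat \<Rightarrow> nat \<Rightarrow> real) \<Rightarrow> bool" where
  "symf n M \<longleftrightarrow> (\<forall>i<n. \<forall>j<n. M i j = M j i)"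

definition psdf :: "nat \<Rightarrow> (nat \<Rightarrow> nat \<Rightarrow> real) \<Rightarrow> bool" where
  "psdf n M \<longleftrightarrow> symf n M \<and> (\<forall>z. 0 \<le> ip n z (mvf n M z))"

lemma ip_comm: "ip n u v = ip n v u"
  by (simp add: ip_def mult.commute)

lemma ip_cong: "(\<And>i. i < n \<Longrightarrow> u i = u' i) \<Longrightarrow> (\<And>i. i < n \<Longrightarrow> v i = v' i) \<Longrightarrow> ip n u v = ip n u' v'"
  by (simp add: ip_def)

lemma mvf_cong: "(\<And>j. j < n \<Longrightarrow> u j = u' j) \<Longrightarrow> mvf n M u i = mvf n M u' i"
  by (simp add: mvf_def)

lemma ip_add_right: "ip n u (\<lambda>i. v i + w i) = ip n u v + ip n u w"
  by (simp add: ip_def algebra_simps sum.distrib)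

lemma ip_diff_right: "ip n u (\<lambda>i. v i - w i) = ip n u v - ip n u w"
  by (simp add: ip_def algebra_simps sum_subtractf)

lemma ip_scale_right: "ip n u (\<lambda>i. c * v i) = c * ip n u v"
  by (simp add: ip_def algebra_simps sum_distrib_left)

lemma ip_add_left: "ip n (\<lambda>i. v i + w i) u = ip n v u + ip n w u"
  by (simp add: ip_def algebra_simps sum.distrib)

lemma ip_diff_left: "ip n (\<lambda>i. v i - w i) u = ip n v u - ip n w u"
  by (simp add: ip_def algebra_simps sum_subtractf)

lemma ip_scale_left: "ip n (\<lambda>i. c * v i) u = c * ip n v u"
  by (simp add: ip_def algebra_simps sum_distrib_left)

lemma ip_sum_right: "ip n u (\<lambda>i. \<Sum>k\<in>K. v k i) = (\<Sum>k\<in>K. ip n u (v k))"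
  unfolding ip_def sum_distrib_left by (rule sum.swap)

lemma mvf_add: "mvf n M (\<lambda>i. v i + w i) = (\<lambda>i. mvf n M v i + mvf n M w i)"
  by (rule ext) (simp add: mvf_def algebra_simps sum.distrib)

lemma mvf_diff: "mvf n M (\<lambda>i. v i - w i) = (\<lambda>i. mvf n M v i - mvf n M w i)"
  by (rule ext) (simp add: mvf_def algebra_simps sum_subtractf)

lemma mvf_scale: "mvf n M (\<lambda>i. c * v i) = (\<lambda>i. c * mvf n M v i)"
  by (rule ext) (simp add: mvf_def algebra_simps sum_distrib_left)

lemmas ip_simps = ip_add_right ip_diff_right ip_scale_right ip_add_left ip_diff_left ip_scale_left
  mvf_add mvf_diff mvf_scale

lemma ip_self_nonneg: "0 \<le> ip n u u"
  by (simp add: ip_def sum_nonneg)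

lemma ip_self_eq_0: "ip n u u = 0 \<longleftrightarrow> (\<forall>i<n. u i = 0)"
  by (auto simp: ip_def sum_nonneg_eq_0_iff)

lemma ip_mvf_sym:
  assumes "symf n M"
  shows "ip n u (mvf n M v) = ip n (mvf n M u) v"
proof -
  have "ip n u (mvf n M v) = (\<Sum>i<n. \<Sum>j<n. u i * (M i j * v j))"
    by (simp add: ip_def mvf_def sum_distrib_left)
  also have "\<dots> = (\<Sum>j<n. \<Sum>i<n. u i * (M i j * v j))" by (rule sum.swap)
  also have "\<dots> = ip n (mvf n M u) v"
    unfolding ip_def mvf_def sum_distrib_right
    using assms by (intro sum.cong) (auto simp: symf_def)
  finally show ?thesis .
qed

section \<open>Existence of an orthonormal eigenbasis\<close>

text \<open>Near 0 the linear term dominates the quadratic one, and \<open>t\<close> may have either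
  sign. This replaces differentiation at a Rayleigh maximizer and at a zero of a semidefinite
  form.\<close>

lemma linear_le_quadratic_imp_0:
  fixes a b :: real
  assumes "\<And>t. t * a + t\<^sup>2 * b \<le> 0"
  shows "a = 0"
proof (rule ccontr)
  assume a: "a \<noteq> 0"
  \<comment> \<open>At \<open>t = a / c\<close> the left-hand side is
    \<open>a\<^sup>2 (c + b) / c\<^sup>2\<close>, and this \<open>c\<close> makes
    \<open>c + b\<close> positive.\<close>
  define c where "c = \<bar>b\<bar> + 1"
  have c: "c > 0" by (simp add: c_def)
  have "(a / c) * a + (a / c)\<^sup>2 * b \<le> 0" by (rule assms)
  then have "a\<^sup>2 * (c + b) \<le> 0"
    using c by (simp add: field_simps power2_eq_square)
  moreover have "c + b > 0" by (simp add: c_def abs_if)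
  ultimately show False
    using a by (smt (verit) mult_pos_pos zero_less_power2)
qed

text \<open>\<open>K\<close> is a closed subset of a product of intervals \<open>[-1, 1]\<close>,
  which is compact by Tychonoff, and the form is a polynomial in finitely many coordinates. Setting
  the coordinates from \<open>n\<close> on to 0 is what places \<open>K\<close> inside this
  product.\<close>

lemma rayleigh_attained:
  fixes q :: "nat \<Rightarrow> nat \<Rightarrow> real" and n m :: nat
  defines "K \<equiv> {z. (\<forall>i\<ge>n. z i = 0) \<and> ip n z z = 1 \<and> (\<forall>k<m. ip n (q k) z = 0)}"
  assumes "K \<noteq> {}"
  shows "\<exists>z\<in>K. \<forall>w\<in>K. ip n w (mvf n M w) \<le> ip n z (mvf n M z)"
proof -
  let ?B = "Pi\<^sub>E UNIV (\<lambda>_::nat. {-1..1::real})"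
  have "compactin (product_topology (\<lambda>_. euclidean) UNIV) ?B"
    by (subst compactin_PiE) auto
  then have B: "compact ?B"
    by (simp add: euclidean_product_topology)
  have cont: "continuous_on UNIV (\<lambda>z::nat\<Rightarrow>real. z i)" for i
    by (rule continuous_on_product_coordinates)
  have K_Int: "K = ?B \<inter> ((\<Inter>i\<in>{n..}. {z. z i = 0}) \<inter> {z. ip n z z = 1} \<inter> (\<Inter>k\<in>{..<m}. {z. ip n (q k) z = 0}))"
  proof -
    have "z i \<in> {-1..1}" if z: "z \<in> K" for z i
    proof (cases "i < n")
      case True
      have "(z i)\<^sup>2 \<le> ip n z z"
        unfolding ip_def power2_eq_square using True by (intro member_le_sum) auto
      then show ?thesis using z by (auto simp: K_def abs_square_le_1 abs_le_iff)
    next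
      case False
      then show ?thesis using z by (auto simp: K_def)
    qed
    then show ?thesis by (auto simp: K_def)
  qed
  have "closed ((\<Inter>i\<in>{n..}. {z::nat\<Rightarrow>real. z i = 0}) \<inter> {z. ip n z z = 1} \<inter> (\<Inter>k\<in>{..<m}. {z. ip n (q k) z = 0}))"
    unfolding ip_def
    by (intro closed_Int closed_INT ballI closed_Collect_eq continuous_intros cont)
  then have "compact K"
    unfolding K_Int using B by (rule compact_Int_closed[rotated])
  moreover have "continuous_on K (\<lambda>z. ip n z (mvf n M z))"
    unfolding ip_def mvf_def
    by (intro continuous_intros continuous_on_subset[OF cont]) auto
  ultimately show ?thesis
    using continuous_attains_sup assms(2) by blast
qed

text \<open>The squared lengths of the projections of the \<open>n\<close> coordinate vectors onto
  the span of the \<open>q k\<close> add up to \<open>m < n\<close>, so some coordinate vector has a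
  projection shorter than 1. Its component orthogonal to the \<open>q k\<close> is nonzero and gets
  normalized.\<close>

lemma exists_orthogonal_unit:
  fixes q :: "nat \<Rightarrow> nat \<Rightarrow> real"
  assumes on: "\<And>k l. k < m \<Longrightarrow> l < m \<Longrightarrow> ip n (q k) (q l) = (if k = l then 1 else 0)" and "m < n"
  shows "{z. (\<forall>i\<ge>n. z i = 0) \<and> ip n z z = 1 \<and> (\<forall>k<m. ip n (q k) z = 0)} \<noteq> {}"
proof -
  have "(\<Sum>i<n. \<Sum>k<m. (q k i)\<^sup>2) = (\<Sum>k<m. \<Sum>i<n. (q k i)\<^sup>2)" by (rule sum.swap)
  also have "\<dots> = (\<Sum>k<m. 1)"
    using on by (intro sum.cong) (auto simp: ip_def power2_eq_square)
  also have "\<dots> < (\<Sum>i<n. 1::real)" using \<open>m < n\<close> by simp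
  finally have "\<not> (\<forall>i\<in>{..<n}. (1::real) \<le> (\<Sum>k<m. (q k i)\<^sup>2))"
    using sum_mono[of "{..<n}" "\<lambda>_. 1::real" "\<lambda>i. \<Sum>k<m. (q k i)\<^sup>2"] by (metis not_le)
  then obtain i where i: "i < n" "(\<Sum>k<m. (q k i)\<^sup>2) < 1"
    by (auto simp: not_le)
  define z where "z = (\<lambda>j. (if j = i then 1 else 0) - (\<Sum>k<m. q k i * q k j))"
  have ipe: "ip n u (\<lambda>j. if j = i then 1 else 0) = u i" for u
    using i(1) by (simp add: ip_def if_distrib[of "(*) _"] cong: if_cong)
  have orth: "ip n (q k) z = 0" if "k < m" for k
  proof -
    have "(\<Sum>l<m. q l i * ip n (q k) (q l)) = (\<Sum>l<m. if l = k then q l i else 0)"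
      using that on by (intro sum.cong) auto
    then show ?thesis
      using that by (simp add: z_def ip_diff_right ipe ip_sum_right ip_scale_right)
  qed
  \<comment> \<open>\<open>z\<close> is orthogonal to everything that was subtracted from the
    coordinate vector, so its squared length is its own entry at \<open>i\<close>.\<close>
  have "ip n z z = ip n z (\<lambda>j. if j = i then 1 else 0) - (\<Sum>k<m. q k i * ip n z (q k))"
    by (subst (2) z_def) (simp add: ip_diff_right ip_sum_right ip_scale_right)
  also have "\<dots> = z i" using orth ipe[of z] by (simp add: ip_comm[of n z "q _"])
  also have "\<dots> > 0" using i(2) by (simp add: z_def power2_eq_square)
  finally have zz: "ip n z z > 0" .
  define c where "c = 1 / sqrt (ip n z z)"
  have c2: "c * (c * ip n z z) = 1" using zz by (simp add: c_def)
  define y where "y = (\<lambda>j. if j < n then c * z j else 0)"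
  have "ip n y y = ip n (\<lambda>j. c * z j) (\<lambda>j. c * z j)"
    by (rule ip_cong) (auto simp: y_def)
  then have "ip n y y = 1" using c2 by (simp add: ip_scale_left ip_scale_right)
  moreover have "ip n (q k) y = 0" if "k < m" for k
  proof -
    have "ip n (q k) y = ip n (q k) (\<lambda>j. c * z j)"
      by (rule ip_cong) (auto simp: y_def)
    then show ?thesis using orth[OF that] by (simp add: ip_scale_right)
  qed
  ultimately show ?thesis by (auto simp: y_def intro!: exI[of _ y])
qed

text \<open>The number \<open>m\<close> of eigenpairs is separate from \<open>n\<close> because they
  are found one at a time; \<open>m = n\<close> is a complete eigenbasis.\<close>

definition spectral :: "nat \<Rightarrow> (nat \<Rightarrow> nat \<Rightarrow> real) \<Rightarrow> nat \<Rightarrow> (nat \<Rightarrow> nat \<Rightarrow> real) \<Rightarrow> (nat \<Rightarrow> real) \<Rightarrow> bool" where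
  "spectral n M m q e \<longleftrightarrow>
    (\<forall>k<m. \<forall>l<m. ip n (q k) (q l) = (if k = l then 1 else 0)) \<and>
    (\<forall>k<m. \<forall>i<n. mvf n M (q k) i = e k * q k i) \<and>
    (\<forall>l<m. \<forall>k\<le>l. e l \<le> e k)"

lemma spectralD:
  assumes "spectral n M m q e"
  shows "k < m \<Longrightarrow> l < m \<Longrightarrow> ip n (q k) (q l) = (if k = l then 1 else 0)"
    and "k < m \<Longrightarrow> i < n \<Longrightarrow> mvf n M (q k) i = e k * q k i"
    and "l < m \<Longrightarrow> k \<le> l \<Longrightarrow> e l \<le> e k"
  using assms unfolding spectral_def by blast+

text \<open>Each eigenvector maximizes the Rayleigh quotient on the orthogonal complement of its
  predecessors. The second conclusion, that every eigenvalue found so far bounds the quotient on the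
  current complement, carries the ordering through the induction.\<close>

lemma spectral_aux:
  assumes sym: "symf n M" and "m \<le> n"
  shows "\<exists>q e. spectral n M m q e \<and>
    (\<forall>k<m. \<forall>z. (\<forall>i\<ge>n. z i = 0) \<longrightarrow> ip n z z = 1 \<longrightarrow> (\<forall>k<m. ip n (q k) z = 0) \<longrightarrow> ip n z (mvf n M z) \<le> e k)"
  using \<open>m \<le> n\<close>
proof (induction m)
  case 0
  then show ?case by (simp add: spectral_def)
next
  case (Suc m)
  from Suc.IH[OF Suc_leD[OF Suc.prems]] obtain q e where sp: "spectral n M m q e"
    and mx0: "\<forall>k<m. \<forall>z. (\<forall>i\<ge>n. z i = 0) \<longrightarrow> ip n z z = 1 \<longrightarrow> (\<forall>k<m. ip n (q k) z = 0) \<longrightarrow> ip n z (mvf n M z) \<le> e k"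
    by (elim exE conjE)
  have mx: "\<And>k z. k < m \<Longrightarrow> (\<And>i. i \<ge> n \<Longrightarrow> z i = 0) \<Longrightarrow> ip n z z = 1 \<Longrightarrow> (\<And>k. k < m \<Longrightarrow> ip n (q k) z = 0) \<Longrightarrow> ip n z (mvf n M z) \<le> e k"
    using mx0 by simp
  note on = spectralD(1)[OF sp] and ev = spectralD(2)[OF sp] and dec = spectralD(3)[OF sp]
  define K where "K = {z::nat \<Rightarrow> real. (\<forall>i\<ge>n. z i = 0) \<and> ip n z z = 1 \<and> (\<forall>k<m. ip n (q k) z = 0)}"
  have "K \<noteq> {}" unfolding K_def by (rule exists_orthogonal_unit) (use on Suc.prems in auto)
  then obtain z where z: "z \<in> K" and zmax: "\<And>w. w \<in> K \<Longrightarrow> ip n w (mvf n M w) \<le> ip n z (mvf n M z)"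
    using rayleigh_attained[of n m q M] unfolding K_def by blast
  define \<mu> where "\<mu> = ip n z (mvf n M z)"
  have z1: "ip n z z = 1" and zq: "\<And>k. k < m \<Longrightarrow> ip n (q k) z = 0" and z0: "\<And>i. i \<ge> n \<Longrightarrow> z i = 0"
    using z by (auto simp: K_def)
  have hom: "ip n w (mvf n M w) \<le> \<mu> * ip n w w" if wq: "\<And>k. k < m \<Longrightarrow> ip n (q k) w = 0" for w
  proof (cases "ip n w w = 0")
    case True
    then have "\<forall>i<n. w i = 0" by (simp add: ip_self_eq_0)
    then have "ip n w (mvf n M w) = 0" by (simp add: ip_def)
    then show ?thesis using True by simp
  next
    case False
    then have pos: "ip n w w > 0" using ip_self_nonneg[of n w] by simp
    define c where "c = 1 / sqrt (ip n w w)"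
    have c2: "c * c * ip n w w = 1" using pos by (simp add: c_def)
    define y where "y = (\<lambda>j. if j < n then c * w j else 0)"
    have y: "ip n u y = c * ip n u w" for u
      unfolding ip_scale_right[symmetric] by (rule ip_cong) (auto simp: y_def)
    have "y \<in> K"
    proof -
      have "y i = 0" if "n \<le> i" for i using that by (simp add: y_def)
      moreover have "ip n y y = 1" using c2 by (simp add: y ip_comm[of n y w])
      ultimately show ?thesis using wq by (simp add: K_def y)
    qed
    from zmax[OF this] have "ip n y (mvf n M y) \<le> \<mu>" by (simp add: \<mu>_def)
    moreover have "ip n y (mvf n M y) = c * c * ip n w (mvf n M w)"
    proof -
      have "mvf n M y = (\<lambda>i. c * mvf n M w i)"
        unfolding mvf_scale[symmetric] by (auto simp: mvf_def y_def)
      then show ?thesis using y[of "mvf n M w"] by (simp add: ip_scale_right ip_comm)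
    qed
    ultimately have "c * c * ip n w (mvf n M w) \<le> c * c * (\<mu> * ip n w w)"
      using c2 by (simp add: algebra_simps)
    moreover have "c * c > 0" using pos by (simp add: c_def)
    ultimately show ?thesis by (simp only: mult_le_cancel_left_pos)
  qed
  define w where "w = (\<lambda>i. mvf n M z i - \<mu> * z i)"
  have wq: "ip n (q k) w = 0" if "k < m" for k
  proof -
    have "ip n (q k) (mvf n M z) = ip n (\<lambda>i. e k * q k i) z"
      unfolding ip_mvf_sym[OF sym] by (rule ip_cong) (auto simp: ev that)
    then show ?thesis using zq[OF that] by (simp add: w_def ip_diff_right ip_scale_right ip_scale_left)
  qed
  have wz: "ip n w z = 0" using z1 by (simp add: w_def ip_diff_left ip_scale_left \<mu>_def ip_comm)
  \<comment> \<open>\<open>w = M z - \<mu> z\<close> is orthogonal to \<open>z\<close> and to the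
    \<open>q k\<close>, hence an admissible direction. The slope along it is twice its squared
    length, and maximality at \<open>z\<close> makes the slope vanish.\<close>
  have "2 * ip n w w = 0"
  proof (rule linear_le_quadratic_imp_0)
    fix t :: real
    let ?y = "\<lambda>i. z i + t * w i"
    have "ip n ?y (mvf n M ?y) \<le> \<mu> * ip n ?y ?y"
      using zq wq by (intro hom) (simp add: ip_add_right ip_scale_right)
    moreover have "ip n ?y ?y = 1 + t\<^sup>2 * ip n w w"
      using wz z1 by (simp add: ip_simps ip_comm[of n z w] power2_eq_square)
    moreover have "ip n z (mvf n M w) = ip n w (mvf n M z)"
      unfolding ip_mvf_sym[OF sym, of z] by (rule ip_comm)
    then have "ip n ?y (mvf n M ?y) = \<mu> + 2 * t * ip n w (mvf n M z) + t\<^sup>2 * ip n w (mvf n M w)"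
      by (simp add: ip_simps \<mu>_def power2_eq_square algebra_simps)
    moreover have "ip n w (mvf n M z) = ip n w w"
      using wz by (subst (2) w_def) (simp add: ip_simps)
    ultimately show "t * (2 * ip n w w) + t\<^sup>2 * (ip n w (mvf n M w) - \<mu> * ip n w w) \<le> 0"
      by (simp add: algebra_simps)
  qed
  then have zev: "mvf n M z i = \<mu> * z i" if "i < n" for i
    using that by (simp add: ip_self_eq_0 w_def)
  define q' where "q' = q(m := z)"
  define e' where "e' = e(m := \<mu>)"
  have "spectral n M (Suc m) q' e'"
    unfolding spectral_def
  proof (intro conjI allI impI)
    fix k l assume "k < Suc m" "l < Suc m"
    then show "ip n (q' k) (q' l) = (if k = l then 1 else 0)"
      using on[of k l] zq[of k] zq[of l] z1 by (cases "l = m"; cases "k = m") (simp_all add: q'_def ip_comm[of n z "q _"])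
  next
    fix k i assume "k < Suc m" "i < n"
    then show "mvf n M (q' k) i = e' k * q' k i"
      using ev[of k i] zev[of i] by (cases "k = m") (simp_all add: q'_def e'_def)
  next
    fix k l assume "l < Suc m" "k \<le> l"
    then show "e' l \<le> e' k"
      using dec[of l k] mx[OF _ z0 z1 zq, of k] by (cases "l = m"; cases "k = m") (simp_all add: e'_def \<mu>_def)
  qed
  moreover have "ip n y (mvf n M y) \<le> e' k" if "k < Suc m" "\<forall>i\<ge>n. y i = 0" "ip n y y = 1" "\<forall>k<Suc m. ip n (q' k) y = 0" for k y
  proof -
    have yq: "\<And>k. k < m \<Longrightarrow> ip n (q k) y = 0"
      using that(4) by (metis fun_upd_other less_Suc_eq less_irrefl q'_def)
    show ?thesis
    proof (cases "k < m")
      case True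
      then show ?thesis using mx[OF True _ that(3) yq] that(2) by (simp add: e'_def)
    next
      case False
      then have "k = m" using that(1) by simp
      moreover have "y \<in> K" using that(2,3) yq by (simp add: K_def)
      ultimately show ?thesis using zmax by (simp add: e'_def \<mu>_def)
    qed
  qed
  ultimately show ?case by blast
qed

lemma spectral_theorem: "symf n M \<Longrightarrow> \<exists>q e. spectral n M n q e"
  using spectral_aux[of n M n] by auto

section \<open>Expansions in an eigenbasis\<close>

text \<open>Orthonormal rows of a square array have orthonormal columns: the defect
  \<open>z i\<close> is a coordinate vector minus its projection, so \<open>z i i\<close> is a
  squared length, and these entries add up to \<open>n - n\<close>.\<close>

lemma spectral_dual:
  assumes sp: "spectral n M n q e" and "i < n" "j < n"
  shows "(\<Sum>k<n. q k i * q k j) = (if i = j then 1 else 0)"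
proof -
  have on: "\<And>k l. k < n \<Longrightarrow> l < n \<Longrightarrow> ip n (q k) (q l) = (if k = l then 1 else 0)"
    by (rule spectralD(1)[OF sp])
  define z where "z = (\<lambda>i j. (if j = i then 1 else 0) - (\<Sum>k<n. q k i * q k j))"
  have ipe: "ip n u (\<lambda>j. if j = i then 1 else 0) = u i" if "i < n" for u i
    using that by (simp add: ip_def if_distrib[of "(*) _"] cong: if_cong)
  have orth: "ip n (q k) (z i) = 0" if "k < n" "i < n" for k i
  proof -
    have "(\<Sum>l<n. q l i * ip n (q k) (q l)) = (\<Sum>l<n. if l = k then q l i else 0)"
      using that on by (intro sum.cong) auto
    then show ?thesis
      using that by (simp add: z_def ip_diff_right ipe ip_sum_right ip_scale_right)
  qed
  have zz: "ip n (z i) (z i) = z i i" if "i < n" for i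
  proof -
    have "ip n (z i) (z i) = ip n (z i) (\<lambda>j. if j = i then 1 else 0) - (\<Sum>k<n. q k i * ip n (z i) (q k))"
      by (subst (2) z_def) (simp add: ip_diff_right ip_sum_right ip_scale_right)
    also have "\<dots> = z i i" using orth that ipe[OF that, of "z i"] by (simp add: ip_comm[of n "z i" "q _"])
    finally show ?thesis .
  qed
  have "(\<Sum>i<n. \<Sum>k<n. q k i * q k i) = (\<Sum>k<n. \<Sum>i<n. q k i * q k i)" by (rule sum.swap)
  also have "\<dots> = (\<Sum>k<n. 1)" using on by (intro sum.cong) (auto simp: ip_def)
  finally have "(\<Sum>i<n. z i i) = 0" by (simp add: z_def sum_subtractf)
  moreover have "0 \<le> z i i" if "i < n" for i
    using zz[OF that] ip_self_nonneg[of n "z i"] by simp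
  ultimately have "z i i = 0"
    using \<open>i < n\<close> sum_nonneg_eq_0_iff[of "{..<n}" "\<lambda>i. z i i"] by auto
  then have "z i j = 0" using zz[OF \<open>i < n\<close>] \<open>j < n\<close> by (simp add: ip_self_eq_0)
  then show ?thesis by (auto simp: z_def)
qed

lemma spectral_expand:
  assumes sp: "spectral n M n q e" and "i < n"
  shows "u i = (\<Sum>k<n. ip n (q k) u * q k i)"
proof -
  have "(\<Sum>k<n. ip n (q k) u * q k i) = (\<Sum>j<n. \<Sum>k<n. (q k j * u j) * q k i)"
    unfolding ip_def sum_distrib_right by (rule sum.swap)
  also have "\<dots> = (\<Sum>j<n. u j * (\<Sum>k<n. q k i * q k j))"
    by (simp add: sum_distrib_left algebra_simps)
  also have "\<dots> = (\<Sum>j<n. u j * (if i = j then 1 else 0))"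
    by (intro sum.cong refl arg_cong2[where f="(*)"]) (simp add: spectral_dual[OF sp \<open>i < n\<close>])
  also have "\<dots> = u i" using \<open>i < n\<close> by (simp add: if_distrib[of "(*) _"] cong: if_cong)
  finally show ?thesis by simp
qed

lemma spectral_parseval:
  assumes sp: "spectral n M n q e"
  shows "ip n u v = (\<Sum>k<n. ip n (q k) u * ip n (q k) v)"
proof -
  have "ip n u v = ip n (\<lambda>i. \<Sum>k<n. ip n (q k) u * q k i) v"
    by (rule ip_cong) (auto simp: spectral_expand[OF sp, symmetric])
  also have "\<dots> = (\<Sum>k<n. ip n (q k) u * ip n (q k) v)"
    unfolding ip_comm[of n _ v] ip_sum_right by (simp add: ip_scale_right)
  finally show ?thesis .
qed

lemma spectral_ip_mvf:
  assumes "symf n M" and sp: "spectral n M n q e" and "k < n"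
  shows "ip n (q k) (mvf n M u) = e k * ip n (q k) u"
proof -
  have "ip n (q k) (mvf n M u) = ip n (\<lambda>i. e k * q k i) u"
    unfolding ip_mvf_sym[OF assms(1)] by (intro ip_cong refl) (rule spectralD(2)[OF sp \<open>k < n\<close>])
  then show ?thesis by (simp add: ip_scale_left)
qed

text \<open>\<open>N\<close> is arbitrary and only the basis comes from \<open>M\<close>, because
  residual matrices will be measured in the eigenbasis of \<open>A\<close>.\<close>

lemma spectral_trace:
  assumes sp: "spectral n M n q e"
  shows "(\<Sum>k<n. ip n (q k) (mvf n N (q k))) = (\<Sum>i<n. N i i)"
proof -
  have "(\<Sum>k<n. ip n (q k) (mvf n N (q k))) = (\<Sum>k<n. \<Sum>i<n. \<Sum>j<n. N i j * (q k i * q k j))"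
    unfolding ip_def mvf_def sum_distrib_left by (intro sum.cong refl) (simp add: mult_ac)
  also have "\<dots> = (\<Sum>i<n. \<Sum>k<n. \<Sum>j<n. N i j * (q k i * q k j))"
    by (rule sum.swap)
  also have "\<dots> = (\<Sum>i<n. \<Sum>j<n. \<Sum>k<n. N i j * (q k i * q k j))"
    by (rule sum.cong[OF refl], rule sum.swap)
  also have "\<dots> = (\<Sum>i<n. \<Sum>j<n. N i j * (if i = j then 1 else 0))"
    unfolding sum_distrib_left[symmetric]
    by (intro sum.cong refl arg_cong2[where f="(*)"]) (simp add: spectral_dual[OF sp])
  also have "\<dots> = (\<Sum>i<n. N i i)" by (simp add: if_distrib[of "(*) _"] cong: if_cong)
  finally show ?thesis .
qed

lemma spectral_ev_eq:
  assumes sp: "spectral n M n q e" and "k < n"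
  shows "ip n (q k) (mvf n M (q k)) = e k"
proof -
  have "ip n (q k) (mvf n M (q k)) = ip n (q k) (\<lambda>i. e k * q k i)"
    by (intro ip_cong refl) (rule spectralD(2)[OF assms])
  then show ?thesis using spectralD(1)[OF sp \<open>k < n\<close> \<open>k < n\<close>] by (simp add: ip_scale_right)
qed

lemma spectral_ev_nonneg:
  assumes "psdf n M" and sp: "spectral n M n q e" and "k < n"
  shows "0 \<le> e k"
proof -
  have "0 \<le> ip n (q k) (mvf n M (q k))" using assms(1) unfolding psdf_def by blast
  then show ?thesis using spectral_ev_eq[OF sp \<open>k < n\<close>] by simp
qed

text \<open>Fredholm alternative in coordinates: each coefficient of \<open>v\<close> is divided by
  its eigenvalue. Division by the eigenvalue 0 gives 0, which is right because the hypothesis makes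
  that coefficient of \<open>v\<close> vanish.\<close>

lemma symf_solvable:
  assumes sym: "symf n M" and v: "\<And>w. (\<And>i. i < n \<Longrightarrow> mvf n M w i = 0) \<Longrightarrow> ip n w v = 0"
  shows "\<exists>y. \<forall>i<n. mvf n M y i = v i"
proof -
  obtain q e where sp: "spectral n M n q e" using spectral_theorem[OF sym] by blast
  have ev: "mvf n M (q k) i = e k * q k i" if "k < n" "i < n" for k i
    using spectralD(2)[OF sp that] .
  define c where "c = (\<lambda>k. ip n (q k) v / e k)"
  define y where "y = (\<lambda>i. \<Sum>k<n. c k * q k i)"
  have "mvf n M y i = v i" if "i < n" for i
  proof -
    have "mvf n M y i = (\<Sum>j<n. M i j * (\<Sum>k<n. c k * q k j))"
      by (simp only: mvf_def y_def)
    also have "\<dots> = (\<Sum>j<n. \<Sum>k<n. M i j * (c k * q k j))"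
      by (simp only: sum_distrib_left)
    also have "(\<Sum>j<n. \<Sum>k<n. M i j * (c k * q k j)) = (\<Sum>k<n. \<Sum>j<n. M i j * (c k * q k j))"
      by (rule sum.swap)
    also have "\<dots> = (\<Sum>k<n. c k * mvf n M (q k) i)"
      unfolding mvf_def sum_distrib_left by (intro sum.cong refl) (simp add: mult_ac)
    also have "\<dots> = (\<Sum>k<n. ip n (q k) v * q k i)"
    proof (intro sum.cong refl)
      fix k assume k: "k \<in> {..<n}"
      show "c k * mvf n M (q k) i = ip n (q k) v * q k i"
      proof (cases "e k = 0")
        case True
        have "ip n (q k) v = 0"
        proof (rule v)
          fix i assume "i < n"
          then show "mvf n M (q k) i = 0" using ev[of k i] k True by simp
        qed
        then show ?thesis using True by (simp add: c_def)
      qed (use ev k that in \<open>simp add: c_def\<close>)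
    qed
    also have "\<dots> = v i" using spectral_expand[OF sp that] by simp
    finally show ?thesis .
  qed
  then show ?thesis by (intro exI[of _ y]) simp
qed

section \<open>Matrices as functions, and their eigenvalue lists\<close>

abbreviation fn_of_mat :: "real mat \<Rightarrow> nat \<Rightarrow> nat \<Rightarrow> real" where
  "fn_of_mat A \<equiv> (\<lambda>i j. A $$ (i, j))"

abbreviation fn_of_vec :: "real vec \<Rightarrow> nat \<Rightarrow> real" where
  "fn_of_vec v \<equiv> (\<lambda>i. v $ i)"

lemma scalar_prod_eq_ip: "dim_vec v = n \<Longrightarrow> u \<bullet> v = ip n (fn_of_vec u) (fn_of_vec v)"
  by (simp add: scalar_prod_def ip_def lessThan_atLeast0)

lemma mult_mat_vec_index:
  "A \<in> carrier_mat m n \<Longrightarrow> dim_vec v = n \<Longrightarrow> i < m \<Longrightarrow> (A *\<^sub>v v) $ i = mvf n (fn_of_mat A) (fn_of_vec v) i"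
  by (auto simp: scalar_prod_def mvf_def lessThan_atLeast0)

lemma psd_psdf:
  assumes "psd n A"
  shows "psdf n (fn_of_mat A)"
proof -
  have A: "A \<in> carrier_mat n n" and T: "A\<^sup>T = A"
    using assms by (auto simp: psd_def)
  have "symf n (fn_of_mat A)"
    unfolding symf_def
  proof (intro allI impI)
    fix i j assume "i < n" "j < n"
    then have "A\<^sup>T $$ (i, j) = A $$ (j, i)" using A by simp
    then show "A $$ (i, j) = A $$ (j, i)" using T by simp
  qed
  moreover have "0 \<le> ip n z (mvf n (fn_of_mat A) z)" for z
  proof -
    have "0 \<le> vec n z \<bullet> (A *\<^sub>v vec n z)" using assms by (auto simp: psd_def)
    also have "\<dots> = ip n (fn_of_vec (vec n z)) (fn_of_vec (A *\<^sub>v vec n z))"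
      using A by (intro scalar_prod_eq_ip) simp
    also have "\<dots> = ip n z (mvf n (fn_of_mat A) z)"
      using A by (intro ip_cong) (auto simp: mult_mat_vec_index[OF A] simp del: index_mult_mat_vec intro!: mvf_cong)
    finally show ?thesis .
  qed
  ultimately show ?thesis by (simp add: psdf_def)
qed

lemma energy_norm_eq:
  assumes "A \<in> carrier_mat n n" "dim_vec z = n"
  shows "energy_norm A z = sqrt (ip n (fn_of_vec z) (mvf n (fn_of_mat A) (fn_of_vec z)))"
proof -
  have "z \<bullet> (A *\<^sub>v z) = ip n (fn_of_vec z) (fn_of_vec (A *\<^sub>v z))"
    using assms by (intro scalar_prod_eq_ip) simp
  also have "\<dots> = ip n (fn_of_vec z) (mvf n (fn_of_mat A) (fn_of_vec z))"
    using assms by (intro ip_cong) (auto simp: mult_mat_vec_index[OF assms(1)] simp del: index_mult_mat_vec)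
  finally show ?thesis by (simp add: energy_norm_def)
qed

lemma energy_norm_sq:
  assumes "psd n A" "dim_vec z = n"
  shows "(energy_norm A z)\<^sup>2 = ip n (fn_of_vec z) (mvf n (fn_of_mat A) (fn_of_vec z))"
  using psd_psdf[OF assms(1)] assms energy_norm_eq[of A n z]
  by (auto simp: psdf_def psd_def)

lemma proots_prod_list_linear: "proots (\<Prod>e\<leftarrow>es. [:- e, 1:]) = mset (es :: real list)"
proof (induction es)
  case Nil
  then show ?case by simp
next
  case (Cons x es)
  have "(\<Prod>e\<leftarrow>es. [:- e, 1:]) \<noteq> (0 :: real poly)"
    by (auto simp: prod_list_zero_iff)
  then show ?case using Cons by (simp add: proots_mult del: mult_pCons_left)
qed

text \<open>A product of linear factors determines the multiset of its roots, and the ordering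
  determines the list; so the description in \<open>eigvals\<close> is unique. The lists are
  reversed because sorting refers to increasing order.\<close>

lemma eigvals_eqI:
  assumes "sorted_wrt (\<ge>) es" "char_poly A = (\<Prod>e\<leftarrow>es. [:- e, 1:])"
  shows "eigvals A = es"
  unfolding eigvals_def
proof (rule the_equality)
  fix fs :: "real list"
  assume fs: "sorted_wrt (\<ge>) fs \<and> char_poly A = (\<Prod>e\<leftarrow>fs. [:- e, 1:])"
  have "mset fs = mset es"
    using fs assms(2) by (metis proots_prod_list_linear)
  then have "rev fs = rev es"
    using fs assms(1) by (metis mset_rev properties_for_sort sorted_wrt_rev sort_key_id_if_sorted sorted_sort_id)
  then show "fs = es" by simp
qed (use assms in simp)

text \<open>Ties the eigenbasis to the list \<open>eigvals\<close> and to
  \<open>lambda_min_pos\<close>. The last condition has a premise because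
  \<open>lambda_min_pos\<close> is a \<open>Min\<close> over the empty set when all eigenvalues are
  0.\<close>

definition eigsys :: "nat \<Rightarrow> real mat \<Rightarrow> (nat \<Rightarrow> nat \<Rightarrow> real) \<Rightarrow> (nat \<Rightarrow> real) \<Rightarrow> bool" where
  "eigsys n A q e \<longleftrightarrow> spectral n (fn_of_mat A) n q e \<and> eigvals A = map e [0..<n] \<and>
     (\<forall>k<n. 0 \<le> e k) \<and> (\<forall>k<n. e k \<noteq> 0 \<longrightarrow> lambda_min_pos A \<le> e k) \<and>
     ((\<exists>k<n. e k \<noteq> 0) \<longrightarrow> 0 < lambda_min_pos A)"

text \<open>With the eigenvectors as columns of an orthogonal matrix \<open>P\<close>,
  \<open>A\<close> is similar to the diagonal matrix \<open>D\<close>. Similar matrices share the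
  characteristic polynomial, from which the eigenvalue list and the set behind
  \<open>lambda_min_pos\<close> are read off.\<close>

lemma psd_eigsys:
  assumes "psd n A"
  shows "\<exists>q e. eigsys n A q e"
proof -
  have A: "A \<in> carrier_mat n n" using assms by (simp add: psd_def)
  have pf: "psdf n (fn_of_mat A)" by (rule psd_psdf[OF assms])
  then have sym: "symf n (fn_of_mat A)" by (simp add: psdf_def)
  obtain q e where sp: "spectral n (fn_of_mat A) n q e"
    using spectral_theorem[OF sym] by blast
  define P where "P = mat n n (\<lambda>(i, k). q k i)"
  define D where "D = mat n n (\<lambda>(i, k). if i = k then e k else 0)"
  have c: "P \<in> carrier_mat n n" "D \<in> carrier_mat n n" "P\<^sup>T \<in> carrier_mat n n"
    by (auto simp: P_def D_def)
  have "P\<^sup>T * P = 1\<^sub>m n"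
  proof (rule eq_matI)
    fix i j assume "i < dim_row (1\<^sub>m n :: real mat)" "j < dim_col (1\<^sub>m n :: real mat)"
    then have ij: "i < n" "j < n" by auto
    have "(P\<^sup>T * P) $$ (i, j) = ip n (q i) (q j)"
      using ij by (simp add: P_def scalar_prod_def ip_def lessThan_atLeast0)
    then show "(P\<^sup>T * P) $$ (i, j) = 1\<^sub>m n $$ (i, j)"
      using spectralD(1)[OF sp ij] ij by simp
  qed (auto simp: P_def)
  moreover have "P * P\<^sup>T = 1\<^sub>m n"
  proof (rule eq_matI)
    fix i j assume "i < dim_row (1\<^sub>m n :: real mat)" "j < dim_col (1\<^sub>m n :: real mat)"
    then have ij: "i < n" "j < n" by auto
    have "(P * P\<^sup>T) $$ (i, j) = (\<Sum>k<n. q k i * q k j)"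
      using ij by (simp add: P_def scalar_prod_def lessThan_atLeast0)
    then show "(P * P\<^sup>T) $$ (i, j) = 1\<^sub>m n $$ (i, j)"
      using spectral_dual[OF sp ij] ij by simp
  qed (auto simp: P_def)
  moreover have "A = P * D * P\<^sup>T"
  proof (rule eq_matI)
    fix i j assume "i < dim_row (P * D * P\<^sup>T)" "j < dim_col (P * D * P\<^sup>T)"
    then have ij: "i < n" "j < n" by (auto simp: P_def)
    have PD: "(P * D) $$ (i, k) = q k i * e k" if "k < n" for k
    proof -
      have "(P * D) $$ (i, k) = (\<Sum>l<n. q l i * (if l = k then e k else 0))"
        using ij that by (simp add: P_def D_def scalar_prod_def lessThan_atLeast0)
      also have "\<dots> = (\<Sum>l<n. if l = k then q k i * e k else 0)" by (intro sum.cong) auto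
      finally show ?thesis using that by simp
    qed
    have "(P * D * P\<^sup>T) $$ (i, j) = (\<Sum>k<n. (P * D) $$ (i, k) * P\<^sup>T $$ (k, j))"
      using ij c by (subst index_mult_mat(1)) (auto simp: scalar_prod_def lessThan_atLeast0 intro!: sum.cong)
    also have "\<dots> = (\<Sum>k<n. (q k i * e k) * q k j)"
      using PD ij by (intro sum.cong refl arg_cong2[where f="(*)"]) (auto simp: P_def)
    also have "\<dots> = (\<Sum>k<n. ip n (q k) (\<lambda>i. A $$ (i, j)) * q k i)"
    proof (intro sum.cong refl)
      fix k assume "k \<in> {..<n}"
      then have k: "k < n" by simp
      have "ip n (q k) (\<lambda>i. A $$ (i, j)) = mvf n (fn_of_mat A) (q k) j"
        unfolding ip_def mvf_def using sym ij
        by (intro sum.cong refl) (simp add: symf_def)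
      then show "(q k i * e k) * q k j = ip n (q k) (\<lambda>i. A $$ (i, j)) * q k i"
        using spectralD(2)[OF sp k ij(2)] by simp
    qed
    also have "\<dots> = A $$ (i, j)" by (rule spectral_expand[OF sp ij(1), symmetric])
    finally show "A $$ (i, j) = (P * D * P\<^sup>T) $$ (i, j)" by simp
  qed (use A in \<open>auto simp: P_def\<close>)
  ultimately have "similar_mat A D"
    unfolding similar_mat_def similar_mat_wit_def Let_def using A c
    by (intro exI[of _ P] exI[of _ "P\<^sup>T"]) auto
  then have "char_poly A = char_poly D" by (rule char_poly_similar)
  also have "\<dots> = (\<Prod>a\<leftarrow>diag_mat D. [:- a, 1:])"
    by (rule char_poly_upper_triangular[of _ n]) (auto simp: D_def)
  also have "diag_mat D = map e [0..<n]"
    by (auto simp: diag_mat_def D_def)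
  finally have cp: "char_poly A = (\<Prod>a\<leftarrow>map e [0..<n]. [:- a, 1:])" .
  have ei: "eigvals A = map e [0..<n]"
    using cp spectralD(3)[OF sp] by (intro eigvals_eqI) (auto simp: sorted_wrt_iff_nth_less)
  have "poly (char_poly A) x = (\<Prod>a\<leftarrow>map e [0..<n]. x - a)" for x
    unfolding cp by (simp add: poly_prod_list o_def)
  then have "eigenvalue A x \<longleftrightarrow> (\<exists>k<n. x = e k)" for x
    unfolding eigenvalue_root_char_poly[OF A] by (auto simp: prod_list_zero_iff)
  then have set: "{x. eigenvalue A x \<and> x \<noteq> 0} = {x \<in> e ` {..<n}. x \<noteq> 0}" by auto
  have nn: "\<forall>k<n. 0 \<le> e k" using spectral_ev_nonneg[OF pf sp] by blast
  have "lambda_min_pos A \<le> e k" if "k < n" "e k \<noteq> 0" for k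
    unfolding lambda_min_pos_def set using that by (intro Min_le) auto
  moreover have "0 < lambda_min_pos A" if "k < n" "e k \<noteq> 0" for k
    unfolding lambda_min_pos_def set using that nn
    by (subst Min_gr_iff) (auto simp: less_le)
  ultimately show ?thesis
    using sp ei nn unfolding eigsys_def by blast
qed

text \<open>The inequality holds term by term in the eigenbasis: either \<open>e k = 0\<close> and
  both sides vanish, or \<open>e k\<close> is at least the smallest nonzero eigenvalue. Components
  of \<open>z\<close> in the kernel therefore do no harm.\<close>

lemma eigsys_rayleigh:
  assumes "psd n A" "eigsys n A q e"
  shows "lambda_min_pos A * ip n z (mvf n (fn_of_mat A) z) \<le> ip n (mvf n (fn_of_mat A) z) (mvf n (fn_of_mat A) z)"
proof -
  have sym: "symf n (fn_of_mat A)" using psd_psdf[OF assms(1)] by (simp add: psdf_def)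
  have sp: "spectral n (fn_of_mat A) n q e" using assms(2) by (simp add: eigsys_def)
  note iq = spectral_ip_mvf[OF sym sp]
  have "lambda_min_pos A * ip n z (mvf n (fn_of_mat A) z) = (\<Sum>k<n. lambda_min_pos A * (ip n (q k) z * (e k * ip n (q k) z)))"
    unfolding spectral_parseval[OF sp, of z] sum_distrib_left using iq by simp
  also have "\<dots> \<le> (\<Sum>k<n. (e k * ip n (q k) z) * (e k * ip n (q k) z))"
  proof (rule sum_mono)
    fix k assume "k \<in> {..<n}"
    then have "lambda_min_pos A * e k \<le> e k * e k"
      using assms(2) by (cases "e k = 0") (auto simp: eigsys_def intro!: mult_right_mono)
    then have "(lambda_min_pos A * e k) * (ip n (q k) z)\<^sup>2 \<le> (e k * e k) * (ip n (q k) z)\<^sup>2"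
      by (rule mult_right_mono) simp
    then show "lambda_min_pos A * (ip n (q k) z * (e k * ip n (q k) z)) \<le> (e k * ip n (q k) z) * (e k * ip n (q k) z)"
      by (simp add: power2_eq_square mult_ac)
  qed
  also have "\<dots> = ip n (mvf n (fn_of_mat A) z) (mvf n (fn_of_mat A) z)"
    unfolding spectral_parseval[OF sp, of "mvf n (fn_of_mat A) z"] using iq by simp
  finally show ?thesis .
qed

lemma tail_sum_eigsys:
  assumes "eigsys n A q e"
  shows "tail_sum A r = (\<Sum>k\<in>{r..<n}. e k)"
proof -
  have "tail_sum A r = sum_list (map e [r..<n])"
    using assms by (simp add: tail_sum_def eigsys_def drop_map)
  then show ?thesis by (simp add: sum_list_distinct_conv_sum_set)
qed

lemma eigsys_trace:
  assumes "eigsys n A q e"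
  shows "(\<Sum>k<n. e k) = (\<Sum>i<n. A $$ (i, i))"
proof -
  have sp: "spectral n (fn_of_mat A) n q e" using assms by (simp add: eigsys_def)
  show ?thesis
    using spectral_trace[OF sp, of "fn_of_mat A"] spectral_ev_eq[OF sp] by simp
qed

section \<open>Sampling an index\<close>

lemma index_pmf_props:
  assumes nn: "\<And>j. j < n \<Longrightarrow> 0 \<le> w j" and pos: "0 < (\<Sum>i<n. w i)"
  shows pmf_index_pmf: "pmf (index_pmf n w) j = (if j < n then w j / (\<Sum>i<n. w i) else 0)"
    and set_index_pmf: "set_pmf (index_pmf n w) = {j. j < n \<and> 0 < w j}"
proof -
  define xs where "xs = map (\<lambda>j. (j, w j / (\<Sum>i<n. w i))) [0..<n]"
  have wf: "pmf_of_list_wf xs"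
  proof (rule pmf_of_list_wfI)
    fix x assume "x \<in> set (map snd xs)"
    then show "0 \<le> x" using nn pos by (auto simp: xs_def)
  next
    have "sum_list (map snd xs) = (\<Sum>j<n. w j / (\<Sum>i<n. w i))"
      by (simp add: xs_def o_def interv_sum_list_conv_sum_set_nat lessThan_atLeast0)
    then show "sum_list (map snd xs) = 1" using pos by (simp flip: sum_divide_distrib)
  qed
  have ix: "index_pmf n w = pmf_of_list xs"
    using nn pos by (simp add: index_pmf_def xs_def)
  have *: "pmf (index_pmf n w) j = (if j < n then w j / (\<Sum>i<n. w i) else 0)" for j
  proof -
    have "pmf (index_pmf n w) j = sum_list (map snd (filter (\<lambda>z. fst z = j) xs))"
      unfolding ix by (rule pmf_pmf_of_list[OF wf])
    also have "\<dots> = sum_list (map (\<lambda>i. w i / (\<Sum>i<n. w i)) (filter (\<lambda>i. i = j) [0..<n]))"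
      by (simp add: xs_def filter_map o_def)
    also have "\<dots> = (\<Sum>i\<in>{i. i < n \<and> i = j}. w i / (\<Sum>i<n. w i))"
      by (subst sum_list_distinct_conv_sum_set) (auto intro!: sum.cong)
    also have "\<dots> = (if j < n then w j / (\<Sum>i<n. w i) else 0)"
    proof (cases "j < n")
      case True
      then have "{i. i < n \<and> i = j} = {j}" by auto
      then show ?thesis using True by simp
    next
      case False
      then have "{i. i < n \<and> i = j} = {}" by auto
      then show ?thesis using False by (simp only: sum.empty if_False)
    qed
    finally show ?thesis .
  qed
  show "pmf (index_pmf n w) j = (if j < n then w j / (\<Sum>i<n. w i) else 0)" by (rule *)
  show "set_pmf (index_pmf n w) = {j. j < n \<and> 0 < w j}"
    using nn pos by (fastforce simp: set_pmf_iff * less_le split: if_splits)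
qed

lemma expectation_index_pmf:
  fixes f :: "nat \<Rightarrow> real"
  assumes nn: "\<And>j. j < n \<Longrightarrow> 0 \<le> w j" and pos: "0 < (\<Sum>i<n. w i)"
  shows "measure_pmf.expectation (index_pmf n w) f = (\<Sum>j<n. w j / (\<Sum>i<n. w i) * f j)"
proof -
  have "measure_pmf.expectation (index_pmf n w) f = (\<Sum>j<n. f j * pmf (index_pmf n w) j)"
    by (rule integral_measure_pmf_real) (use set_index_pmf[OF assms] in auto)
  also have "\<dots> = (\<Sum>j<n. w j / (\<Sum>i<n. w i) * f j)"
    by (intro sum.cong refl) (simp add: pmf_index_pmf[OF assms])
  finally show ?thesis .
qed

section \<open>Randomly pivoted Cholesky\<close>

definition unitf :: "nat \<Rightarrow> nat \<Rightarrow> real" where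
  "unitf s = (\<lambda>j. if j = s then 1 else 0)"

lemma ip_unitf: "s < n \<Longrightarrow> ip n u (unitf s) = u s"
  by (simp add: ip_def unitf_def if_distrib[of "(*) _"] cong: if_cong)

lemma mvf_unitf: "s < n \<Longrightarrow> mvf n M (unitf s) i = M i s"
  by (simp add: mvf_def unitf_def if_distrib[of "(*) _"] cong: if_cong)

text \<open>A parabola in the step length \<open>t\<close>. Zero diagonal entries, Schur
  complements, kernels and coordinate descent are all treated by choosing \<open>t\<close> in
  it.\<close>

lemma quadratic_coord_step:
  assumes "symf n M" "s < n"
  shows "ip n (\<lambda>i. z i - t * unitf s i) (mvf n M (\<lambda>i. z i - t * unitf s i))
    = ip n z (mvf n M z) - 2 * t * mvf n M z s + t\<^sup>2 * M s s"
proof -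
  have "ip n z (mvf n M (unitf s)) = mvf n M z s"
    unfolding ip_mvf_sym[OF assms(1)] by (rule ip_unitf[OF assms(2)])
  moreover have "ip n (unitf s) (mvf n M z) = mvf n M z s"
    unfolding ip_comm[of n "unitf s" "mvf n M z"] by (rule ip_unitf[OF assms(2)])
  moreover have "ip n (unitf s) (mvf n M (unitf s)) = M s s"
    unfolding ip_comm[of n "unitf s" "mvf n M (unitf s)"] using assms(2) by (simp add: ip_unitf mvf_unitf)
  ultimately show ?thesis
    by (simp add: ip_simps power2_eq_square algebra_simps)
qed

lemma psdf_diag_nonneg: "psdf n M \<Longrightarrow> s < n \<Longrightarrow> 0 \<le> M s s"
proof -
  assume M: "psdf n M" "s < n"
  then have "0 \<le> ip n (unitf s) (mvf n M (unitf s))" by (simp add: psdf_def)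
  then show ?thesis
    unfolding ip_comm[of n "unitf s" "mvf n M (unitf s)"] using M(2) by (simp add: ip_unitf mvf_unitf)
qed

lemma psdf_diag_0:
  assumes M: "psdf n M" and "s < n" "i < n" "M s s = 0"
  shows "M i s = 0"
proof -
  have sym: "symf n M" using M by (simp add: psdf_def)
  have "0 \<le> M i i - 2 * t * M s i" for t
  proof -
    have "0 \<le> ip n (\<lambda>j. unitf i j - t * unitf s j) (mvf n M (\<lambda>j. unitf i j - t * unitf s j))"
      using M by (simp add: psdf_def)
    also have "\<dots> = M i i - 2 * t * M s i"
      unfolding quadratic_coord_step[OF sym \<open>s < n\<close>] ip_comm[of n "unitf i" "mvf n M (unitf i)"]
      using assms by (simp add: ip_unitf mvf_unitf)
    finally show ?thesis .
  qed
  \<comment> \<open>For \<open>M s i\<close> nonzero, this \<open>t\<close> makes the nonnegative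
    expression equal to -1.\<close>
  from this[of "(M i i + 1) / (2 * M s i)"] have "M s i = 0"
    by (cases "M s i = 0") (simp_all add: field_simps)
  then show ?thesis using sym \<open>s < n\<close> \<open>i < n\<close> by (simp add: symf_def)
qed

text \<open>The form of the Schur complement is the minimum over \<open>t\<close> of the form of
  \<open>M\<close> at \<open>z - t unitf s\<close>, hence nonnegative. The second fact gives the
  exact decrease caused by eliminating \<open>s\<close>.\<close>

lemma psdf_schur:
  assumes M: "psdf n M" and "s < n" "0 < M s s"
  shows "psdf n (\<lambda>i j. M i j - M i s * M s j / M s s)"
    and "ip n z (mvf n (\<lambda>i j. M i j - M i s * M s j / M s s) z) = ip n z (mvf n M z) - (mvf n M z s)\<^sup>2 / M s s"
proof -
  let ?M = "\<lambda>i j. M i j - M i s * M s j / M s s"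
  have sym: "symf n M" using M by (simp add: psdf_def)
  have 1: "ip n z (mvf n ?M z) = ip n z (mvf n M z) - (mvf n M z s)\<^sup>2 / M s s" for z
  proof -
    define c where "c = mvf n M z s / M s s"
    have "mvf n ?M z = (\<lambda>i. mvf n M z i - c * M i s)"
      by (rule ext) (simp add: mvf_def c_def left_diff_distrib right_diff_distrib sum_subtractf sum_divide_distrib sum_distrib_left sum_distrib_right mult_ac)
    moreover have "ip n z (\<lambda>i. M i s) = mvf n M z s"
      unfolding ip_def mvf_def using sym \<open>s < n\<close> by (intro sum.cong) (auto simp: symf_def)
    ultimately have "ip n z (mvf n ?M z) = ip n z (mvf n M z) - c * mvf n M z s"
      by (simp only: ip_diff_right ip_scale_right)
    then show ?thesis by (simp add: c_def power2_eq_square)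
  qed
  then show "ip n z (mvf n ?M z) = ip n z (mvf n M z) - (mvf n M z s)\<^sup>2 / M s s" .
  have "0 \<le> ip n z (mvf n ?M z)" for z
  proof -
    define t where "t = mvf n M z s / M s s"
    have "0 \<le> ip n (\<lambda>i. z i - t * unitf s i) (mvf n M (\<lambda>i. z i - t * unitf s i))"
      using M by (simp add: psdf_def)
    also have "\<dots> = ip n z (mvf n M z) - (mvf n M z s)\<^sup>2 / M s s"
      unfolding quadratic_coord_step[OF sym \<open>s < n\<close>] t_def
      using assms(3) by (simp add: power2_eq_square)
    finally show ?thesis using 1 by simp
  qed
  moreover have "symf n ?M" using sym \<open>s < n\<close> by (simp add: symf_def mult.commute)
  ultimately show "psdf n ?M" by (simp add: psdf_def)
qed

text \<open>A semidefinite matrix with zero diagonal vanishes. So the stopping rule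
  \<open>R = 0\<close>, which refers to a matrix that the program never forms, amounts to a test of
  the trace.\<close>

lemma psdf_trace_pos:
  assumes "psdf n (fn_of_mat R)" "R \<in> carrier_mat n n" "R \<noteq> 0\<^sub>m n n"
  shows "0 < (\<Sum>i<n. R $$ (i, i))"
proof (rule ccontr)
  assume "\<not> ?thesis"
  moreover have nn: "0 \<le> R $$ (i, i)" if "i < n" for i
    using psdf_diag_nonneg[OF assms(1) that] .
  moreover have "0 \<le> (\<Sum>i<n. R $$ (i, i))" using nn by (intro sum_nonneg) auto
  ultimately have "(\<Sum>i<n. R $$ (i, i)) = 0" by simp
  then have "R $$ (j, j) = 0" if "j < n" for j
    using that nn by (subst (asm) sum_nonneg_eq_0_iff) auto
  then have "R = 0\<^sub>m n n"
    using assms(2) psdf_diag_0[OF assms(1)] by (intro eq_matI) auto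
  then show False using assms(3) by simp
qed

text \<open>The last two conditions say that \<open>F\<close> restricted to the pivot rows is lower triangular with positive diagonal.\<close>

definition rpc_inv :: "nat \<Rightarrow> real mat \<Rightarrow> rpc_state \<Rightarrow> bool" where
  "rpc_inv n A = (\<lambda>(S, cs, R).
     length cs = length S \<and> set S \<subseteq> {..<n} \<and> distinct S \<and> (\<forall>c\<in>set cs. dim_vec c = n) \<and>
     R \<in> carrier_mat n n \<and> psdf n (fn_of_mat R) \<and>
     (\<forall>i<n. \<forall>j<n. A $$ (i, j) = R $$ (i, j) + (\<Sum>t<length S. cs ! t $ i * cs ! t $ j)) \<and>
     (\<forall>i<n. \<forall>s\<in>set S. R $$ (i, s) = 0) \<and>
     (\<forall>t<length S. \<forall>u<t. cs ! t $ (S ! u) = 0) \<and> (\<forall>t<length S. 0 < cs ! t $ (S ! t)))"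

lemma rpc_invD:
  assumes "rpc_inv n A (S, cs, R)"
  shows "length cs = length S" "set S \<subseteq> {..<n}" "distinct S" "c \<in> set cs \<Longrightarrow> dim_vec c = n"
    "R \<in> carrier_mat n n" "psdf n (fn_of_mat R)"
    "i < n \<Longrightarrow> j < n \<Longrightarrow> A $$ (i, j) = R $$ (i, j) + (\<Sum>t<length S. cs ! t $ i * cs ! t $ j)"
    "i < n \<Longrightarrow> s \<in> set S \<Longrightarrow> R $$ (i, s) = 0"
    "t < length S \<Longrightarrow> u < t \<Longrightarrow> cs ! t $ (S ! u) = 0" "t < length S \<Longrightarrow> 0 < cs ! t $ (S ! t)"
  using assms unfolding rpc_inv_def by auto

text \<open>The deterministic effect of a drawn pivot; a step becomes an image of the sampling
  law.\<close>

definition rpc_upd :: "rpc_state \<Rightarrow> nat \<Rightarrow> rpc_state" where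
  "rpc_upd = (\<lambda>(S, cs, R) s. let n = dim_row R in
     (S @ [s], cs @ [vec n (\<lambda>i. R $$ (i, s) / sqrt (R $$ (s, s)))],
      mat n n (\<lambda>(i, j). R $$ (i, j) - R $$ (i, s) * R $$ (s, j) / R $$ (s, s))))"

lemma rpc_step_eq:
  "rpc_step (S, cs, R) = (if R = 0\<^sub>m (dim_row R) (dim_row R) then return_pmf (S, cs, R)
     else map_pmf (rpc_upd (S, cs, R)) (index_pmf (dim_row R) (\<lambda>j. R $$ (j, j))))"
  by (simp add: rpc_step_def rpc_upd_def Let_def map_pmf_def)

text \<open>The outer product of the new column with itself is the rank-one term of the Schur
  complement. Residual rows of old pivots vanish, so the new column is 0 there, which gives the
  triangular shape, and a pivot with positive residual diagonal cannot be an old one.\<close>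

lemma rpc_inv_upd:
  assumes inv: "rpc_inv n A (S, cs, R)" and s: "s < n" "0 < R $$ (s, s)"
  shows "rpc_inv n A (rpc_upd (S, cs, R) s)"
proof -
  note I = rpc_invD[OF inv]
  have R: "dim_row R = n" using I(5) by auto
  define c where "c = vec n (\<lambda>i. R $$ (i, s) / sqrt (R $$ (s, s)))"
  define R' where "R' = mat n n (\<lambda>(i, j). R $$ (i, j) - R $$ (i, s) * R $$ (s, j) / R $$ (s, s))"
  have u: "rpc_upd (S, cs, R) s = (S @ [s], cs @ [c], R')"
    by (simp add: rpc_upd_def R c_def R'_def)
  have sym: "R $$ (i, j) = R $$ (j, i)" if "i < n" "j < n" for i j
    using I(6) that by (simp add: psdf_def symf_def)
  have sS: "s \<notin> set S" using I(8)[OF s(1)] s(2) by auto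
  have "psdf n (\<lambda>i j. R $$ (i, j) - R $$ (i, s) * R $$ (s, j) / R $$ (s, s))"
    by (rule psdf_schur(1)[OF I(6) s])
  then have psd': "psdf n (fn_of_mat R')"
    by (auto simp: psdf_def symf_def R'_def ip_def mvf_def)
  have cc: "c $ i * c $ j = R $$ (i, s) * R $$ (s, j) / R $$ (s, s)" if "i < n" "j < n" for i j
    using that s sym[of j s] by (simp add: c_def field_simps)
  have nth: "(\<Sum>t<length S. (cs @ [c]) ! t $ i * (cs @ [c]) ! t $ j) = (\<Sum>t<length S. cs ! t $ i * cs ! t $ j)" for i j
    using I(1) by (intro sum.cong refl) (simp add: nth_append)
  have "A $$ (i, j) = R' $$ (i, j) + (\<Sum>t<length (S @ [s]). (cs @ [c]) ! t $ i * (cs @ [c]) ! t $ j)"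
    if "i < n" "j < n" for i j
    using I(7)[OF that] that cc[OF that] nth[of i j] I(1) by (simp add: R'_def nth_append)
  moreover have "R' $$ (i, u) = 0" if "i < n" "u \<in> set (S @ [s])" for i u
  proof (cases "u = s")
    case True
    then show ?thesis using that s by (simp add: R'_def)
  next
    case False
    then have "u \<in> set S" using that by simp
    then show ?thesis using I(8)[of _ u] I(2) that s by (auto simp: R'_def subset_iff)
  qed
  moreover have "(cs @ [c]) ! t $ ((S @ [s]) ! u) = 0" if "t < length (S @ [s])" "u < t" for t u
  proof (cases "t = length S")
    case True
    then have "S ! u \<in> set S" "S ! u < n" using that I(2) by (auto simp: subset_iff)
    then have "R $$ (S ! u, s) = 0" using I(8)[OF s(1), of "S ! u"] sym[OF s(1), of "S ! u"] by metis
    then show ?thesis using that True I(1) \<open>S ! u < n\<close> by (simp add: nth_append c_def)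
  next
    case False
    then show ?thesis using I(9)[of t u] that I(1) by (simp add: nth_append)
  qed
  moreover have "0 < (cs @ [c]) ! t $ ((S @ [s]) ! t)" if "t < length (S @ [s])" for t
    using that I(1) I(10)[of t] s by (cases "t = length S") (simp_all add: nth_append c_def)
  ultimately show ?thesis
    unfolding u rpc_inv_def using I(1-5) s sS psd'
    by (auto simp: c_def R'_def)
qed

lemma rpc_inv_step:
  assumes inv: "rpc_inv n A st" and "st' \<in> set_pmf (rpc_step st)"
  shows "rpc_inv n A st'" "length (fst st') \<le> Suc (length (fst st))"
proof -
  obtain S cs R where st: "st = (S, cs, R)" by (cases st)
  have I: "R \<in> carrier_mat n n" "psdf n (fn_of_mat R)" using rpc_invD[OF inv[unfolded st]] by blast+
  have R: "dim_row R = n" using I(1) by auto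
  have "rpc_inv n A st' \<and> length (fst st') \<le> Suc (length (fst st))"
  proof (cases "R = 0\<^sub>m n n")
    case True
    then show ?thesis using assms unfolding st rpc_step_eq R by simp
  next
    case False
    then obtain s where s: "s \<in> set_pmf (index_pmf n (\<lambda>j. R $$ (j, j)))" "st' = rpc_upd st s"
      using assms(2) unfolding st rpc_step_eq R by auto
    have "s < n" "0 < R $$ (s, s)"
      using s(1) set_index_pmf[of n "\<lambda>j. R $$ (j, j)"] psdf_trace_pos[OF I(2,1) False] psdf_diag_nonneg[OF I(2)] by auto
    then show ?thesis using rpc_inv_upd inv unfolding s(2) st by (auto simp: rpc_upd_def Let_def)
  qed
  then show "rpc_inv n A st'" "length (fst st') \<le> Suc (length (fst st))" by auto
qed

text \<open>The definition splits off the initial step, whereas invariants and expectations advance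
  by a final one.\<close>

lemma rpc_iter_Suc2: "rpc_iter (Suc m) st = bind_pmf (rpc_iter m st) rpc_step"
proof (induction m arbitrary: st)
  case 0
  then show ?case by (simp add: bind_return_pmf bind_return_pmf')
next
  case (Suc m)
  have "rpc_iter (Suc (Suc m)) st = bind_pmf (rpc_step st) (\<lambda>st'. rpc_iter (Suc m) st')"
    by simp
  also have "\<dots> = bind_pmf (rpc_step st) (\<lambda>st'. bind_pmf (rpc_iter m st') rpc_step)"
    unfolding Suc.IH ..
  finally show ?case by (simp add: bind_assoc_pmf)
qed

lemma rpc_inv_iter:
  assumes "rpc_inv n A st" "st' \<in> set_pmf (rpc_iter m st)"
  shows "rpc_inv n A st'"
  using assms(2)
proof (induction m arbitrary: st')
  case (Suc m)
  then obtain st1 where "st1 \<in> set_pmf (rpc_iter m st)" "st' \<in> set_pmf (rpc_step st1)"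
    unfolding rpc_iter_Suc2 set_bind_pmf by blast
  then show ?case using Suc.IH rpc_inv_step(1) by blast
qed (use assms(1) in simp)

lemma rpc_inv_init: "psd n A \<Longrightarrow> rpc_inv n A ([], [], A)"
  using psd_psdf[of n A] by (auto simp: rpc_inv_def psd_def)

lemma finite_set_index_pmf: "finite (set_pmf (index_pmf n w))"
proof (cases "(\<forall>j<n. 0 \<le> w j) \<and> 0 < (\<Sum>i<n. w i)")
  case True
  then show ?thesis using set_index_pmf[of n w] by simp
next
  case False
  then show ?thesis unfolding index_pmf_def by (simp only: if_False) simp
qed

lemma finite_set_rpc_step: "finite (set_pmf (rpc_step st))"
  by (cases st) (auto simp: rpc_step_eq finite_set_index_pmf)

lemma finite_set_rpc_iter: "finite (set_pmf (rpc_iter m st))"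
  by (induction m arbitrary: st) (auto simp: finite_set_rpc_step)

text \<open>The laws to which this is applied have finite support, so every real function is
  integrable and nested expectations are finite sums.\<close>

lemma expectation_bind_finite:
  fixes h :: "'b \<Rightarrow> real"
  assumes "finite (set_pmf p)" "\<And>x. finite (set_pmf (f x))"
  shows "measure_pmf.expectation (bind_pmf p f) h = measure_pmf.expectation p (\<lambda>x. measure_pmf.expectation (f x) h)"
  by (subst pmf_expectation_bind[OF assms(1) _ order_refl])
     (simp_all add: assms integral_measure_pmf[OF assms(1)])

lemma expectation_mono_finite:
  fixes f g :: "'b \<Rightarrow> real"
  assumes "finite (set_pmf p)" "\<And>x. x \<in> set_pmf p \<Longrightarrow> f x \<le> g x"
  shows "measure_pmf.expectation p f \<le> measure_pmf.expectation p g"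
  using assms by (intro integral_mono_AE integrable_measure_pmf_finite) (auto simp: AE_measure_pmf_iff)

text \<open>The squares are what RPCholesky has removed from the form of \<open>A\<close>; dropping
  them shows that the residual is dominated by \<open>A\<close> in every direction.\<close>

lemma rpc_inv_le:
  assumes inv: "rpc_inv n A (S, cs, R)"
  shows "ip n z (mvf n (fn_of_mat A) z) = ip n z (mvf n (fn_of_mat R) z) + (\<Sum>t<length S. (ip n (fn_of_vec (cs ! t)) z)\<^sup>2)"
proof -
  note I = rpc_invD[OF inv]
  have "mvf n (fn_of_mat A) z i = mvf n (fn_of_mat R) z i + (\<Sum>t<length S. ip n (fn_of_vec (cs ! t)) z * cs ! t $ i)"
    if "i < n" for i
  proof -
    have "mvf n (fn_of_mat A) z i = (\<Sum>j<n. (R $$ (i, j) + (\<Sum>t<length S. cs ! t $ i * cs ! t $ j)) * z j)"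
      unfolding mvf_def using I(7)[OF that] by simp
    also have "\<dots> = mvf n (fn_of_mat R) z i + (\<Sum>j<n. \<Sum>t<length S. cs ! t $ i * cs ! t $ j * z j)"
      by (simp add: mvf_def distrib_right sum.distrib sum_distrib_right)
    also have "(\<Sum>j<n. \<Sum>t<length S. cs ! t $ i * cs ! t $ j * z j) = (\<Sum>t<length S. \<Sum>j<n. cs ! t $ i * cs ! t $ j * z j)"
      by (rule sum.swap)
    also have "\<dots> = (\<Sum>t<length S. ip n (fn_of_vec (cs ! t)) z * cs ! t $ i)"
      unfolding ip_def sum_distrib_right by (intro sum.cong refl) (simp add: mult_ac)
    finally show ?thesis .
  qed
  then have "ip n z (mvf n (fn_of_mat A) z) = ip n z (\<lambda>i. mvf n (fn_of_mat R) z i + (\<Sum>t<length S. ip n (fn_of_vec (cs ! t)) z * cs ! t $ i))"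
    by (intro ip_cong) auto
  then show ?thesis
    by (simp add: ip_add_right ip_sum_right ip_scale_right power2_eq_square ip_comm[of n z "fn_of_vec _"])
qed

text \<open>For the leading eigenvectors \<open>q k\<close> of \<open>A\<close>, this is the part of the trace of \<open>R\<close> that RPCholesky contracts.\<close>

definition pot :: "nat \<Rightarrow> nat set \<Rightarrow> (nat \<Rightarrow> nat \<Rightarrow> real) \<Rightarrow> real mat \<Rightarrow> real" where
  "pot n K q R = (\<Sum>k\<in>K. ip n (q k) (mvf n (fn_of_mat R) (q k)))"

lemma pot_nonneg: "psdf n (fn_of_mat R) \<Longrightarrow> 0 \<le> pot n K q R"
  unfolding pot_def by (intro sum_nonneg) (simp add: psdf_def)

lemma trace_eq_pot:
  assumes sp: "spectral n M n q e" and "r \<le> n"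
  shows "(\<Sum>i<n. R $$ (i, i)) = pot n {..<r} q R + pot n {r..<n} q R"
proof -
  have "(\<Sum>i<n. R $$ (i, i)) = pot n {..<n} q R"
    unfolding pot_def by (rule spectral_trace[OF sp, symmetric])
  moreover have "pot n ({..<r} \<union> {r..<n}) q R = pot n {..<r} q R + pot n {r..<n} q R"
    unfolding pot_def by (rule sum.union_disjoint) auto
  moreover have "{..<r} \<union> {r..<n} = {..<n}" using \<open>r \<le> n\<close> by auto
  ultimately show ?thesis by simp
qed

lemma rpc_inv_pot_le: "rpc_inv n A (S, cs, R) \<Longrightarrow> pot n K q R \<le> pot n K q A"
  unfolding pot_def using rpc_inv_le by (intro sum_mono) (simp add: sum_nonneg)

section \<open>Expected decay of the residual trace\<close>

lemma sum_squared_le_card: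
  fixes x :: "nat \<Rightarrow> real"
  assumes "finite K"
  shows "(\<Sum>k\<in>K. x k)\<^sup>2 \<le> real (card K) * (\<Sum>k\<in>K. (x k)\<^sup>2)"
  using Cauchy_Schwarz_ineq_sum[of "\<lambda>_. 1" x K] by simp

text \<open>Drawing \<open>j\<close> with weight \<open>R $$ (j, j)\<close> cancels the denominator
  of the Schur complement, so the expected decrease is the sum over \<open>k < r\<close> of the
  squared lengths of \<open>R\<close> applied to \<open>q k\<close>, divided by the trace of
  \<open>R\<close>. By Bessel and Cauchy-Schwarz the sum is at least \<open>a\<^sup>2 / r\<close>;
  the trace is at most \<open>a + B\<close>, as its tail part never exceeds that of
  \<open>A\<close>.\<close>

lemma rpc_step_pot:
  assumes inv: "rpc_inv n A (S, cs, R)" and es: "eigsys n A q e"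
    and r: "0 < r" "r \<le> n" and B: "B = pot n {r..<n} q A" "0 < B"
  shows "measure_pmf.expectation (rpc_step (S, cs, R)) (\<lambda>(S, cs, R). pot n {..<r} q R)
    \<le> pot n {..<r} q R - (pot n {..<r} q R)\<^sup>2 / (real r * (pot n {..<r} q R + B))"
proof -
  note I = rpc_invD[OF inv]
  have R: "dim_row R = n" using I(5) by auto
  have sp: "spectral n (fn_of_mat A) n q e" using es by (simp add: eigsys_def)
  define a where "a = pot n {..<r} q R"
  have a0: "0 \<le> a" unfolding a_def by (rule pot_nonneg[OF I(6)])
  show ?thesis
  proof (cases "R = 0\<^sub>m n n")
    case True
    have "a = 0" unfolding a_def pot_def True ip_def mvf_def by simp
    then show ?thesis unfolding rpc_step_eq R using True by (simp add: a_def)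
  next
    case False
    define \<tau> where "\<tau> = (\<Sum>i<n. R $$ (i, i))"
    have \<tau>: "0 < \<tau>" unfolding \<tau>_def by (rule psdf_trace_pos[OF I(6,5) False])
    have nn: "\<And>j. j < n \<Longrightarrow> 0 \<le> R $$ (j, j)" using psdf_diag_nonneg[OF I(6)] .
    have tr: "\<tau> = a + pot n {r..<n} q R"
      unfolding \<tau>_def a_def by (rule trace_eq_pot[OF sp r(2)])
    then have \<tau>B: "\<tau> \<le> a + B" using rpc_inv_pot_le[OF inv] B(1) by simp
    \<comment> \<open>Multiplication by the probability covers indices of weight 0, where the whole
      row of \<open>R\<close> vanishes and a division by \<open>R $$ (j, j)\<close> would be
      meaningless.\<close>
    have upd: "(R $$ (j, j) / \<tau>) * pot n {..<r} q (snd (snd (rpc_upd (S, cs, R) j)))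
      = (R $$ (j, j) / \<tau>) * a - (\<Sum>k<r. (mvf n (fn_of_mat R) (q k) j)\<^sup>2) / \<tau>" if j: "j < n" for j
    proof (cases "R $$ (j, j) = 0")
      case True
      have "mvf n (fn_of_mat R) (q k) j = 0" for k
      proof -
        have "R $$ (j, i) = 0" if "i < n" for i
          using psdf_diag_0[OF I(6) j that True] I(6) j that by (simp add: psdf_def symf_def)
        then show ?thesis by (simp add: mvf_def)
      qed
      then show ?thesis using True by simp
    next
      case False
      then have jp: "0 < R $$ (j, j)" using nn[OF j] by simp
      have "pot n {..<r} q (snd (snd (rpc_upd (S, cs, R) j)))
        = (\<Sum>k<r. ip n (q k) (mvf n (\<lambda>i l. R $$ (i, l) - R $$ (i, j) * R $$ (j, l) / R $$ (j, j)) (q k)))"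
        unfolding pot_def rpc_upd_def Let_def R
        by (intro sum.cong refl ip_cong) (auto simp: mvf_def R)
      also have "\<dots> = a - (\<Sum>k<r. (mvf n (fn_of_mat R) (q k) j)\<^sup>2 / R $$ (j, j))"
        unfolding psdf_schur(2)[OF I(6) j jp] a_def pot_def sum_subtractf ..
      finally show ?thesis using jp by (simp add: right_diff_distrib sum_distrib_left sum_divide_distrib)
    qed
    have "measure_pmf.expectation (rpc_step (S, cs, R)) (\<lambda>(S, cs, R). pot n {..<r} q R)
      = measure_pmf.expectation (index_pmf n (\<lambda>j. R $$ (j, j))) (\<lambda>j. pot n {..<r} q (snd (snd (rpc_upd (S, cs, R) j))))"
      unfolding rpc_step_eq R using False by (simp add: case_prod_beta)
    also have "\<dots> = (\<Sum>j<n. R $$ (j, j) / \<tau> * pot n {..<r} q (snd (snd (rpc_upd (S, cs, R) j))))"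
      unfolding \<tau>_def by (rule expectation_index_pmf) (use nn \<tau> \<tau>_def in auto)
    also have "\<dots> = (\<Sum>j<n. (R $$ (j, j) / \<tau>) * a - (\<Sum>k<r. (mvf n (fn_of_mat R) (q k) j)\<^sup>2) / \<tau>)"
      by (intro sum.cong refl upd) simp
    also have "\<dots> = a - (\<Sum>j<n. \<Sum>k<r. (mvf n (fn_of_mat R) (q k) j)\<^sup>2) / \<tau>"
    proof -
      have "(\<Sum>j<n. (R $$ (j, j) / \<tau>) * a) = a"
        using \<tau> unfolding sum_distrib_right[symmetric] sum_divide_distrib[symmetric] \<tau>_def[symmetric] by simp
      then show ?thesis by (simp add: sum_subtractf sum_divide_distrib)
    qed
    also have "(\<Sum>j<n. \<Sum>k<r. (mvf n (fn_of_mat R) (q k) j)\<^sup>2) = (\<Sum>k<r. ip n (mvf n (fn_of_mat R) (q k)) (mvf n (fn_of_mat R) (q k)))"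
      unfolding ip_def power2_eq_square by (rule sum.swap)
    also have "a - \<dots> / \<tau> \<le> a - a\<^sup>2 / (real r * (a + B))"
    proof -
      have "a\<^sup>2 \<le> real r * (\<Sum>k<r. (ip n (q k) (mvf n (fn_of_mat R) (q k)))\<^sup>2)"
        unfolding a_def pot_def using sum_squared_le_card[of "{..<r}"] by simp
      also have "\<dots> \<le> real r * (\<Sum>k<r. ip n (mvf n (fn_of_mat R) (q k)) (mvf n (fn_of_mat R) (q k)))"
      proof (intro mult_left_mono sum_mono)
        fix k assume k: "k \<in> {..<r}"
        let ?v = "mvf n (fn_of_mat R) (q k)"
        have "(ip n (q k) ?v)\<^sup>2 \<le> (\<Sum>l<n. ip n (q l) ?v * ip n (q l) ?v)"
          unfolding power2_eq_square using k r by (intro member_le_sum) auto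
        then show "(ip n (q k) ?v)\<^sup>2 \<le> ip n ?v ?v"
          using spectral_parseval[OF sp, of ?v ?v] by simp
      qed simp
      finally have 1: "a\<^sup>2 / real r \<le> (\<Sum>k<r. ip n (mvf n (fn_of_mat R) (q k)) (mvf n (fn_of_mat R) (q k)))" (is "_ \<le> ?X")
        using r by (simp add: field_simps)
      have "a\<^sup>2 / (real r * (a + B)) = (a\<^sup>2 / real r) / (a + B)" by simp
      also have "\<dots> \<le> ?X / (a + B)" using 1 a0 B(2) by (intro divide_right_mono) auto
      also have "\<dots> \<le> ?X / \<tau>"
        using \<tau>B \<tau> by (intro divide_left_mono sum_nonneg mult_pos_pos) (auto simp: ip_self_nonneg)
      finally show ?thesis by simp
    qed
    finally show ?thesis by (simp add: a_def)
  qed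
qed

text \<open>Tangent at \<open>c\<close> of the convex function
  \<open>x\<^sup>2 / (x + B) = x - B + B\<^sup>2 / (x + B)\<close>. With \<open>u = x + B\<close>
  and \<open>v = c + B\<close> the gap is
  \<open>B\<^sup>2 (u - v)\<^sup>2 / (u v\<^sup>2)\<close>.\<close>

lemma contraction_tangent:
  fixes x c B :: real
  assumes "0 \<le> x" "0 \<le> c" "0 < B"
  shows "c\<^sup>2 / (c + B) + (1 - B\<^sup>2 / (c + B)\<^sup>2) * (x - c) \<le> x\<^sup>2 / (x + B)"
proof -
  define u v where "u = x + B" and "v = c + B"
  have uv: "0 < u" "0 < v" using assms by (auto simp: u_def v_def)
  have sq: "y\<^sup>2 / (y + B) = y - B + B\<^sup>2 / (y + B)" if "0 \<le> y" for y
  proof -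
    have "0 < y + B" using that assms(3) by simp
    then show ?thesis by (simp add: field_simps power2_eq_square)
  qed
  have "0 \<le> (u - v)\<^sup>2 / (u * v\<^sup>2)" using uv by simp
  also have "\<dots> = 1 / u - 2 / v + u / v\<^sup>2"
    using uv by (simp add: field_simps power2_eq_square)
  finally have "0 \<le> B\<^sup>2 * (1 / u - 2 / v + u / v\<^sup>2)" by simp
  also have "\<dots> = x\<^sup>2 / (x + B) - (c\<^sup>2 / (c + B) + (1 - B\<^sup>2 / (c + B)\<^sup>2) * (x - c))"
  proof -
    have xc: "x = u - B" "c = v - B" by (auto simp: u_def v_def)
    show ?thesis unfolding sq[OF assms(1)] sq[OF assms(2)] u_def[symmetric] v_def[symmetric]
      using uv unfolding xc by (simp add: field_simps power2_eq_square)
  qed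
  finally show ?thesis by simp
qed

text \<open>Jensen's inequality by hand: the convex term is replaced by its tangent at the mean
  \<open>c\<close>, and the linear part of the tangent has expectation 0.\<close>

lemma expectation_contraction_le:
  fixes X :: "'b \<Rightarrow> real"
  assumes fin: "finite (set_pmf p)" and nn: "\<And>x. x \<in> set_pmf p \<Longrightarrow> 0 \<le> X x" and "0 < B" "0 < r"
  defines "c \<equiv> measure_pmf.expectation p X"
  shows "measure_pmf.expectation p (\<lambda>x. X x - (X x)\<^sup>2 / (r * (X x + B))) \<le> c - c\<^sup>2 / (r * (c + B))"
proof -
  have int: "integrable (measure_pmf p) f" for f :: "'b \<Rightarrow> real"
    by (rule integrable_measure_pmf_finite[OF fin])
  have c0: "0 \<le> c" unfolding c_def
    using nn by (intro integral_nonneg_AE) (auto simp: AE_measure_pmf_iff)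
  define k where "k = 1 - B\<^sup>2 / (c + B)\<^sup>2"
  have "measure_pmf.expectation p (\<lambda>x. X x - (X x)\<^sup>2 / (r * (X x + B)))
    \<le> measure_pmf.expectation p (\<lambda>x. X x - (c\<^sup>2 / (c + B) + k * (X x - c)) / r)"
  proof (rule expectation_mono_finite[OF fin])
    fix x assume "x \<in> set_pmf p"
    then have "(c\<^sup>2 / (c + B) + k * (X x - c)) / r \<le> ((X x)\<^sup>2 / (X x + B)) / r"
      unfolding k_def using nn c0 assms(3,4) by (intro divide_right_mono contraction_tangent) auto
    then show "X x - (X x)\<^sup>2 / (r * (X x + B)) \<le> X x - (c\<^sup>2 / (c + B) + k * (X x - c)) / r"
      by (simp add: mult.commute)
  qed
  also have "\<dots> = c - (c\<^sup>2 / (c + B) + k * (c - c)) / r"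
    using int by (simp add: c_def)
  finally show ?thesis by (simp add: mult.commute)
qed

text \<open>The potential \<open>ln x - B / x\<close> solves the differential equation behind the recursion; it is concave, so
  every step decreases it by at least \<open>1 / r\<close>.\<close>

lemma contraction_recursion:
  fixes \<alpha> :: "nat \<Rightarrow> real" and r B :: real
  assumes rec: "\<And>i. \<alpha> (Suc i) \<le> \<alpha> i - (\<alpha> i)\<^sup>2 / (r * (\<alpha> i + B))"
    and B: "0 < B" and r: "0 < r" and d: "r + r * ln ((\<alpha> 0 + B) / B) \<le> real d" and nn: "\<And>i. 0 \<le> \<alpha> i"
  shows "\<alpha> d \<le> B"
proof (rule ccontr)
  assume "\<not> \<alpha> d \<le> B"
  then have aB: "B < \<alpha> d" by simp
  have dec: "\<alpha> (Suc i) \<le> \<alpha> i" for i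
    using rec[of i] nn[of i] B r by (smt (verit) divide_nonneg_nonneg mult_nonneg_nonneg zero_le_power2)
  have gt: "B < \<alpha> i" if "i \<le> d" for i
    using aB lift_Suc_antimono_le[of \<alpha>, OF dec that] by simp
  define g where "g = (\<lambda>x. ln x - B / x)"
  \<comment> \<open>Both concave summands of \<open>g\<close> lie below their tangents at
    \<open>x\<close>. The combined slope \<open>(x + B) / x\<^sup>2\<close> times the guaranteed
    decrease is exactly \<open>1 / r\<close>.\<close>
  have step: "g (\<alpha> (Suc i)) \<le> g (\<alpha> i) - 1 / r" if "Suc i \<le> d" for i
  proof -
    define x y where "x = \<alpha> i" and "y = \<alpha> (Suc i)"
    have xy: "0 < x" "0 < y" using gt[of i] gt[of "Suc i"] that B by (auto simp: x_def y_def)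
    have "ln (y / x) \<le> y / x - 1" using xy by (intro ln_le_minus_one) simp
    then have 1: "ln y \<le> ln x + (y - x) / x" using xy by (simp add: ln_div field_simps)
    have "0 \<le> B * ((x - y)\<^sup>2 / (x\<^sup>2 * y))" using xy B by simp
    also have "\<dots> = B / y - B / x + B * (y - x) / x\<^sup>2"
      using xy by (simp add: field_simps power2_eq_square)
    finally have "g y \<le> g x + (y - x) / x + B * (y - x) / x\<^sup>2"
      using 1 by (simp add: g_def)
    also have "\<dots> = g x + (x + B) / x\<^sup>2 * (y - x)"
      using xy by (simp add: field_simps power2_eq_square)
    also have "\<dots> \<le> g x + (x + B) / x\<^sup>2 * (- (x\<^sup>2 / (r * (x + B))))"
      using rec[of i] xy B by (intro add_left_mono mult_left_mono) (auto simp: x_def y_def)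
    also have "(x + B) / x\<^sup>2 * (- (x\<^sup>2 / (r * (x + B)))) = - (1 / r)"
    proof -
      have "x + B \<noteq> 0" using xy B by simp
      then show ?thesis using xy r by simp
    qed
    finally show ?thesis by (simp add: x_def y_def)
  qed
  have "g (\<alpha> i) \<le> g (\<alpha> 0) - real i / r" if "i \<le> d" for i
    using that
  proof (induction i)
    case (Suc i)
    then show ?case using step[of i] by (simp add: add_divide_distrib)
  qed simp
  \<comment> \<open>From a start of at most \<open>ln (\<alpha> 0 + B)\<close>, \<open>g\<close>
    falls by at least \<open>1 + ln ((\<alpha> 0 + B) / B)\<close>, that is, to at most
    \<open>ln B - 1 = g B\<close>. This contradicts \<open>B < \<alpha> d\<close>.\<close>
  then have "g (\<alpha> d) \<le> g (\<alpha> 0) - real d / r" by simp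
  moreover have "g B < g (\<alpha> d)"
  proof -
    have "ln B < ln (\<alpha> d)" using aB B by simp
    moreover have "B / \<alpha> d \<le> B / B" using aB B by (intro divide_left_mono) auto
    ultimately show ?thesis by (simp add: g_def)
  qed
  moreover have "real d / r \<ge> 1 + ln ((\<alpha> 0 + B) / B)"
    using d r by (simp add: field_simps)
  moreover have "ln ((\<alpha> 0 + B) / B) = ln (\<alpha> 0 + B) - ln B"
    using nn[of 0] B by (subst ln_div) auto
  moreover have "ln (\<alpha> 0) \<le> ln (\<alpha> 0 + B)" "0 \<le> B / \<alpha> 0"
    using gt[of 0] B by auto
  ultimately show False using B by (simp add: g_def)
qed

text \<open>The leading part of the trace is at most \<open>B\<close> in expectation by the
  recursion, and the tail part is at most \<open>B\<close> always. Initially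
  \<open>\<alpha> 0 + B\<close> is the trace of \<open>A\<close>, which turns the logarithm of the
  recursion into \<open>ln (1 / eta A r)\<close>.\<close>

lemma rpc_expected_trace:
  assumes psd: "psd n A" and r: "r < n" and B: "0 < tail_sum A r"
    and d: "real r + real r * ln (1 / eta A r) \<le> real d"
  shows "measure_pmf.expectation (rpc_iter d ([], [], A)) (\<lambda>(S, cs, R). \<Sum>i<n. R $$ (i, i)) \<le> 2 * tail_sum A r"
proof -
  obtain q e where es: "eigsys n A q e" using psd_eigsys[OF psd] by blast
  have sp: "spectral n (fn_of_mat A) n q e" using es by (simp add: eigsys_def)
  let ?st = "([], [], A) :: rpc_state"
  have inv0: "rpc_inv n A ?st" by (rule rpc_inv_init[OF psd])
  have inv: "rpc_inv n A st'" if "st' \<in> set_pmf (rpc_iter m ?st)" for m st'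
    using rpc_inv_iter[OF inv0 that] .
  define B where "B = tail_sum A r"
  have potA: "pot n K q A = (\<Sum>k\<in>K. e k)" if "K \<subseteq> {..<n}" for K
    unfolding pot_def using spectral_ev_eq[OF sp] that by (intro sum.cong) auto
  have Bp: "B = pot n {r..<n} q A"
    unfolding B_def tail_sum_eigsys[OF es] by (rule potA[symmetric]) auto
  define X where "X = (\<lambda>st::rpc_state. pot n {..<r} q (snd (snd st)))"
  have X0: "0 \<le> X st" if "rpc_inv n A st" for st
    using that rpc_invD(6) unfolding X_def by (cases st) (auto intro!: pot_nonneg)
  define \<alpha> where "\<alpha> = (\<lambda>m. measure_pmf.expectation (rpc_iter m ?st) X)"
  have \<alpha>d: "\<alpha> d \<le> B"
  proof (cases "r = 0")
    \<comment> \<open>The leading part is an empty sum here; the recursion divides by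
      \<open>r\<close>.\<close>
    case True
    then show ?thesis using B by (simp add: \<alpha>_def X_def pot_def B_def)
  next
    case False
    show ?thesis
    proof (rule contraction_recursion[where \<alpha> = \<alpha> and r = "real r" and B = B and d = d])
      fix m
      have "\<alpha> (Suc m) = measure_pmf.expectation (rpc_iter m ?st) (\<lambda>st. measure_pmf.expectation (rpc_step st) X)"
        unfolding \<alpha>_def rpc_iter_Suc2 by (intro expectation_bind_finite finite_set_rpc_iter finite_set_rpc_step)
      also have "\<dots> \<le> measure_pmf.expectation (rpc_iter m ?st) (\<lambda>st. X st - (X st)\<^sup>2 / (real r * (X st + B)))"
      proof (rule expectation_mono_finite[OF finite_set_rpc_iter])
        fix st assume "st \<in> set_pmf (rpc_iter m ?st)"
        then have "rpc_inv n A st" by (rule inv)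
        moreover have "(\<lambda>(S, cs, R). pot n {..<r} q R) = X" by (auto simp: X_def fun_eq_iff)
        ultimately show "measure_pmf.expectation (rpc_step st) X \<le> X st - (X st)\<^sup>2 / (real r * (X st + B))"
          using rpc_step_pot[OF _ es, of "fst st" "fst (snd st)" "snd (snd st)" r B] False r B Bp
          by (simp add: X_def B_def)
      qed
      also have "\<dots> \<le> \<alpha> m - (\<alpha> m)\<^sup>2 / (real r * (\<alpha> m + B))"
        unfolding \<alpha>_def using False B X0[OF inv]
        by (intro expectation_contraction_le finite_set_rpc_iter) (auto simp: B_def)
      finally show "\<alpha> (Suc m) \<le> \<alpha> m - (\<alpha> m)\<^sup>2 / (real r * (\<alpha> m + B))" .
    next
      show "0 < B" "0 < real r" using B False by (auto simp: B_def)
      show "0 \<le> \<alpha> i" for i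
        unfolding \<alpha>_def using X0[OF inv] by (intro integral_nonneg_AE) (auto simp: AE_measure_pmf_iff)
      have "\<alpha> 0 + B = (\<Sum>k\<in>{..<r}. e k) + (\<Sum>k\<in>{r..<n}. e k)"
        using r potA[of "{..<r}"] unfolding B_def tail_sum_eigsys[OF es] by (simp add: \<alpha>_def X_def)
      also have "\<dots> = (\<Sum>k\<in>{..<r} \<union> {r..<n}. e k)" by (subst sum.union_disjoint) auto
      also have "{..<r} \<union> {r..<n} = {0..<n}" using r by auto
      finally have "\<alpha> 0 + B = tail_sum A 0" unfolding tail_sum_eigsys[OF es, of 0] .
      then show "real r + real r * ln ((\<alpha> 0 + B) / B) \<le> real d"
        using d by (simp add: eta_def B_def)
    qed
  qed
  have "measure_pmf.expectation (rpc_iter d ?st) (\<lambda>(S, cs, R). \<Sum>i<n. R $$ (i, i))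
    \<le> measure_pmf.expectation (rpc_iter d ?st) (\<lambda>st. X st + B)"
  proof (rule expectation_mono_finite[OF finite_set_rpc_iter])
    fix st assume "st \<in> set_pmf (rpc_iter d ?st)"
    then have "rpc_inv n A st" by (rule inv)
    moreover obtain S cs R where st: "st = (S, cs, R)" by (cases st)
    ultimately have "pot n {r..<n} q R \<le> B" unfolding Bp using rpc_inv_pot_le by simp
    moreover have "(\<Sum>i<n. R $$ (i, i)) = pot n {..<r} q R + pot n {r..<n} q R"
      using r by (intro trace_eq_pot[OF sp]) simp
    ultimately show "(case st of (S, cs, R) \<Rightarrow> \<Sum>i<n. R $$ (i, i)) \<le> X st + B"
      by (simp add: st X_def)
  qed
  also have "\<dots> = \<alpha> d + B"
    by (simp add: \<alpha>_def integrable_measure_pmf_finite[OF finite_set_rpc_iter])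
  finally show ?thesis using \<alpha>d by (simp add: B_def)
qed

section \<open>The Nystrom approximation in factored form\<close>

lemma submat_carrier [simp]: "submat M I J \<in> carrier_mat (length I) (length J)"
  by (simp add: submat_def)

lemma submat_index [simp]:
  "i < length I \<Longrightarrow> j < length J \<Longrightarrow> submat M I J $$ (i, j) = M $$ (I ! i, J ! j)"
  by (simp add: submat_def)

lemma submat_dim [simp]: "dim_row (submat M I J) = length I" "dim_col (submat M I J) = length J"
  by (simp_all add: submat_def)

lemma mult_mat_index:
  fixes A B :: "real mat"
  assumes "A \<in> carrier_mat m k" "B \<in> carrier_mat k p" "i < m" "j < p"
  shows "(A * B) $$ (i, j) = (\<Sum>t<k. A $$ (i, t) * B $$ (t, j))"
  using assms by (subst index_mult_mat(1)) (auto simp: scalar_prod_def lessThan_atLeast0 intro!: sum.cong)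

text \<open>Uniqueness comes from \<open>Y = X M Y M X = X\<close>, by \<open>M Y M = M\<close> and
  the two-sided inverse \<open>X\<close>.\<close>

lemma pinv_invertible:
  assumes M: "M \<in> carrier_mat m m" and X: "X \<in> carrier_mat m m" and MX: "M * X = 1\<^sub>m m" "X * M = 1\<^sub>m m"
  shows "pinv M = X"
  unfolding pinv_def
proof (rule the_equality)
  show "X \<in> carrier_mat (dim_col M) (dim_row M) \<and> M * X * M = M \<and> X * M * X = X \<and> (M * X)\<^sup>T = M * X \<and> (X * M)\<^sup>T = X * M"
    using M X by (simp add: MX transpose_one left_mult_one_mat[OF M] left_mult_one_mat[OF X])
next
  fix Y assume Y: "Y \<in> carrier_mat (dim_col M) (dim_row M) \<and> M * Y * M = M \<and> Y * M * Y = Y \<and> (M * Y)\<^sup>T = M * Y \<and> (Y * M)\<^sup>T = Y * M"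
  then have Yc: "Y \<in> carrier_mat m m" and MYM: "M * Y * M = M" using M by auto
  have c1: "M * Y \<in> carrier_mat m m" "Y * M \<in> carrier_mat m m" using M Yc by auto
  have "Y = X * M * Y" using MX(2) left_mult_one_mat[OF Yc] by simp
  also have "\<dots> = X * M * Y * (M * X)" using MX right_mult_one_mat[OF Yc] left_mult_one_mat[OF Yc] by simp
  also have "\<dots> = X * (M * Y) * (M * X)" by (simp only: assoc_mult_mat[OF X M Yc])
  also have "\<dots> = X * ((M * Y) * (M * X))" by (rule assoc_mult_mat) (use X M Yc in auto)
  also have "(M * Y) * (M * X) = (M * Y * M) * X" by (rule assoc_mult_mat[symmetric]) (use X M Yc in auto)
  also have "X * (M * Y * M * X) = X" unfolding MYM MX(1) by (rule right_mult_one_mat[OF X])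
  finally show "Y = X" .
qed

locale rpc_output =
  fixes n :: nat and A :: "real mat" and S :: "nat list" and cs :: "real vec list" and R F FS L :: "real mat"
  assumes inv: "rpc_inv n A (S, cs, R)" and A: "A \<in> carrier_mat n n"
  defines "F \<equiv> mat_of_cols n cs" and "FS \<equiv> submat F S [0..<length S]"
    and "L \<equiv> inv_mat FS"
begin

lemmas rpcI = rpc_invD[OF inv]

lemma S_nth: "t < length S \<Longrightarrow> S ! t < n"
  using rpcI(2) nth_mem[of t S] by (auto simp: subset_iff)

lemma F_carrier: "F \<in> carrier_mat n (length S)"
  using rpcI(1) by (simp add: F_def mat_of_cols_def)

lemma F_index: "i < n \<Longrightarrow> t < length S \<Longrightarrow> F $$ (i, t) = cs ! t $ i"
  using rpcI(1) by (simp add: F_def mat_of_cols_index)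

lemma rows_of_F: "rows_of F I = submat F I [0..<length S]"
  using F_carrier by auto

lemma FS_carrier: "FS \<in> carrier_mat (length S) (length S)"
  by (simp add: FS_def submat_def)

lemma FS_index: "u < length S \<Longrightarrow> t < length S \<Longrightarrow> FS $$ (u, t) = cs ! t $ (S ! u)"
  by (simp add: FS_def F_index S_nth)

text \<open>\<open>FS\<close> is lower triangular with positive diagonal, so its determinant is
  nonzero and \<open>mat_inverse\<close> succeeds.\<close>

lemma L_props: "L \<in> carrier_mat (length S) (length S)" "FS * L = 1\<^sub>m (length S)" "L * FS = 1\<^sub>m (length S)"
proof -
  have "det FS = prod_list (diag_mat FS)"
    by (rule det_lower_triangular[OF _ FS_carrier]) (simp add: FS_index rpcI(9))
  also have "\<dots> \<noteq> 0"
    using FS_carrier by (auto simp: prod_list_zero_iff diag_mat_def FS_index) (metis rpcI(10) less_irrefl)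
  finally have "FS \<in> Units (ring_mat TYPE(real) (length S) ())"
    by (rule det_non_zero_imp_unit[OF FS_carrier])
  then have "mat_inverse FS \<noteq> None"
    using mat_inverse(1)[OF FS_carrier, where b = "()"] by blast
  then have "mat_inverse FS = Some L" by (simp add: L_def)
  from mat_inverse(2)[OF FS_carrier this]
  show "L \<in> carrier_mat (length S) (length S)" "FS * L = 1\<^sub>m (length S)" "L * FS = 1\<^sub>m (length S)"
    by auto
qed

lemma A_index: "i < n \<Longrightarrow> j < n \<Longrightarrow> A $$ (i, j) = R $$ (i, j) + (\<Sum>t<length S. F $$ (i, t) * F $$ (j, t))"
  using rpcI(7) by (simp add: F_index)

lemma R_sym: "i < n \<Longrightarrow> j < n \<Longrightarrow> R $$ (i, j) = R $$ (j, i)"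
  using rpcI(6) by (simp add: psdf_def symf_def)

lemma A_eq: "A = F * F\<^sup>T + R"
proof (rule eq_matI)
  fix i j assume "i < dim_row (F * F\<^sup>T + R)" "j < dim_col (F * F\<^sup>T + R)"
  then have ij: "i < n" "j < n" using rpcI(5) by auto
  have "(F * F\<^sup>T) $$ (i, j) = (\<Sum>t<length S. F $$ (i, t) * F $$ (j, t))"
    using F_carrier ij by (subst mult_mat_index[of _ n "length S" _ n]) auto
  then show "A $$ (i, j) = (F * F\<^sup>T + R) $$ (i, j)"
    using A_index[OF ij] rpcI(5) ij F_carrier by simp
qed (use A rpcI(5) in auto)

text \<open>Rows and columns of \<open>R\<close> at the pivots vanish, so there \<open>A\<close>
  coincides with \<open>F F^T\<close>. The factors of the Nystrom matrix become
  \<open>F FS^T\<close>, the inverse \<open>L^T L\<close> of \<open>FS FS^T\<close>, and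
  \<open>FS F^T\<close>, and the inner factors cancel.\<close>

lemma nystrom_eq: "nystrom A S = F * F\<^sup>T"
proof -
  note Fc = F_carrier and FSc = FS_carrier and Lc = L_props(1)
  have SS: "submat A S S = FS * FS\<^sup>T"
  proof (rule eq_matI)
    fix i j assume "i < dim_row (FS * FS\<^sup>T)" "j < dim_col (FS * FS\<^sup>T)"
    then have ij: "i < length S" "j < length S" using FSc by auto
    have "(FS * FS\<^sup>T) $$ (i, j) = (\<Sum>t<length S. FS $$ (i, t) * FS $$ (j, t))"
      using FSc ij by (subst mult_mat_index[of _ "length S" "length S" _ "length S"]) auto
    then show "submat A S S $$ (i, j) = (FS * FS\<^sup>T) $$ (i, j)"
      using ij A_index[of "S ! i" "S ! j"] rpcI(8)[of "S ! i" "S ! j"] S_nth by (simp add: FS_index F_index)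
  qed (use FSc in auto)
  have CS: "cols_of A S = F * FS\<^sup>T"
  proof (rule eq_matI)
    fix i j assume "i < dim_row (F * FS\<^sup>T)" "j < dim_col (F * FS\<^sup>T)"
    then have ij: "i < n" "j < length S" using FSc Fc by auto
    have "(F * FS\<^sup>T) $$ (i, j) = (\<Sum>t<length S. F $$ (i, t) * FS $$ (j, t))"
      using FSc Fc ij by (subst mult_mat_index[of _ n "length S" _ "length S"]) auto
    then show "cols_of A S $$ (i, j) = (F * FS\<^sup>T) $$ (i, j)"
      using ij A A_index[of i "S ! j"] rpcI(8)[of i "S ! j"] S_nth by (simp add: FS_index F_index)
  qed (use FSc Fc A in auto)
  have RS: "rows_of A S = FS * F\<^sup>T"
  proof (rule eq_matI)
    fix i j assume "i < dim_row (FS * F\<^sup>T)" "j < dim_col (FS * F\<^sup>T)"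
    then have ij: "i < length S" "j < n" using FSc Fc by auto
    have "(FS * F\<^sup>T) $$ (i, j) = (\<Sum>t<length S. FS $$ (i, t) * F $$ (j, t))"
      using FSc Fc ij by (subst mult_mat_index[of _ "length S" "length S" _ n]) auto
    then show "rows_of A S $$ (i, j) = (FS * F\<^sup>T) $$ (i, j)"
      using ij A A_index[of "S ! i" j] rpcI(8)[of j "S ! i"] R_sym[of "S ! i" j] S_nth by (simp add: FS_index F_index)
  qed (use FSc Fc A in auto)
  have T: "FS\<^sup>T * L\<^sup>T = 1\<^sub>m (length S)" "L\<^sup>T * FS\<^sup>T = 1\<^sub>m (length S)"
    by (simp_all only: L_props(2,3) transpose_one transpose_mult[OF Lc FSc, symmetric] transpose_mult[OF FSc Lc, symmetric])
  let ?m = "length S"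
  have c: "FS\<^sup>T \<in> carrier_mat ?m ?m" "L\<^sup>T \<in> carrier_mat ?m ?m" "F\<^sup>T \<in> carrier_mat ?m n" using FSc Lc Fc by auto
  have pinv: "pinv (submat A S S) = L\<^sup>T * L"
    unfolding SS
  proof (rule pinv_invertible)
    have "FS * FS\<^sup>T * (L\<^sup>T * L) = FS * (FS\<^sup>T * (L\<^sup>T * L))"
      by (rule assoc_mult_mat) (use c Lc FSc in auto)
    also have "FS\<^sup>T * (L\<^sup>T * L) = FS\<^sup>T * L\<^sup>T * L"
      by (rule assoc_mult_mat[symmetric]) (use c Lc FSc in auto)
    finally show "FS * FS\<^sup>T * (L\<^sup>T * L) = 1\<^sub>m ?m" using Lc L_props T by simp
    have "L\<^sup>T * L * (FS * FS\<^sup>T) = L\<^sup>T * (L * (FS * FS\<^sup>T))"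
      by (rule assoc_mult_mat) (use c Lc FSc in auto)
    also have "L * (FS * FS\<^sup>T) = L * FS * FS\<^sup>T"
      by (rule assoc_mult_mat[symmetric]) (use c Lc FSc in auto)
    finally show "L\<^sup>T * L * (FS * FS\<^sup>T) = 1\<^sub>m ?m" using c L_props T by simp
  qed (use c Lc FSc in auto)
  have "nystrom A S = (F * FS\<^sup>T) * (L\<^sup>T * L) * (FS * F\<^sup>T)"
    unfolding nystrom_def pinv CS RS ..
  also have "(F * FS\<^sup>T) * (L\<^sup>T * L) = F * L"
  proof -
    have "(F * FS\<^sup>T) * (L\<^sup>T * L) = F * (FS\<^sup>T * (L\<^sup>T * L))"
      by (rule assoc_mult_mat) (use c Lc Fc in auto)
    also have "FS\<^sup>T * (L\<^sup>T * L) = FS\<^sup>T * L\<^sup>T * L"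
      by (rule assoc_mult_mat[symmetric]) (use c Lc FSc in auto)
    finally show ?thesis using T Lc by simp
  qed
  also have "F * L * (FS * F\<^sup>T) = F * (L * (FS * F\<^sup>T))"
    by (rule assoc_mult_mat) (use c Lc Fc FSc in auto)
  also have "L * (FS * F\<^sup>T) = L * FS * F\<^sup>T"
    by (rule assoc_mult_mat[symmetric]) (use c Lc Fc FSc in auto)
  finally show ?thesis using L_props c by simp
qed

lemma tr_residual: "tr (A - nystrom A S) = (\<Sum>i<n. R $$ (i, i))"
proof -
  have "A - nystrom A S = R"
    unfolding nystrom_eq using A_eq rpcI(5) F_carrier by (intro eq_matI) auto
  then show ?thesis using rpcI(5) by (simp add: tr_def)
qed

lemma scrcd_weight_eq:
  assumes "j < n"
  shows "scrcd_weight A S F j = R $$ (j, j)"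
proof (cases "j \<in> set S")
  case True
  then show ?thesis using rpcI(8)[OF assms True] by (simp add: scrcd_weight_def)
next
  case False
  have "row F j \<bullet> row F j = (\<Sum>t<length S. F $$ (j, t) * F $$ (j, t))"
    using F_carrier assms by (simp add: scalar_prod_def lessThan_atLeast0)
  then show ?thesis using False A_index[OF assms assms] by (simp add: scrcd_weight_def)
qed

lemma LT_solves:
  assumes "dim_vec y = length S" "t < length S"
  shows "(\<Sum>u<length S. F $$ (S ! u, t) * (L\<^sup>T *\<^sub>v y) $ u) = y $ t"
proof -
  have c: "FS\<^sup>T \<in> carrier_mat (length S) (length S)" "L\<^sup>T \<in> carrier_mat (length S) (length S)"
    using FS_carrier L_props by auto
  have y: "y \<in> carrier_vec (length S)" using assms(1) by (metis carrier_vec_dim_vec)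
  have T: "FS\<^sup>T * L\<^sup>T = 1\<^sub>m (length S)"
    using transpose_mult[OF L_props(1) FS_carrier] L_props by (simp add: transpose_one)
  have "FS\<^sup>T *\<^sub>v (L\<^sup>T *\<^sub>v y) = y"
    using assoc_mult_mat_vec[OF c y] T y by simp
  then have "y $ t = (FS\<^sup>T *\<^sub>v (L\<^sup>T *\<^sub>v y)) $ t" by simp
  also have "\<dots> = (\<Sum>u<length S. F $$ (S ! u, t) * (L\<^sup>T *\<^sub>v y) $ u)"
    unfolding mult_mat_vec_index[OF c(1) _ assms(2), of "L\<^sup>T *\<^sub>v y", simplified dim_mult_mat_vec, OF carrier_matD(1)[OF c(2)]] mvf_def
    using assms(2) FS_carrier by (intro sum.cong refl) (simp add: FS_def)
  finally show ?thesis by simp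
qed

text \<open>Connects a vector known only through its triangular system, as substitution produces it,
  with the expression by inverses in the algorithm.\<close>

lemma LT_unique:
  assumes "dim_vec y = length S" "dim_vec \<beta> = length S"
    and "\<And>t. t < length S \<Longrightarrow> (\<Sum>u<length S. F $$ (S ! u, t) * \<beta> $ u) = y $ t"
  shows "\<beta> = L\<^sup>T *\<^sub>v y"
proof -
  have c: "FS\<^sup>T \<in> carrier_mat (length S) (length S)" "L\<^sup>T \<in> carrier_mat (length S) (length S)"
    using FS_carrier L_props by auto
  have b: "\<beta> \<in> carrier_vec (length S)" using assms(2) by (metis carrier_vec_dim_vec)
  have T: "L\<^sup>T * FS\<^sup>T = 1\<^sub>m (length S)"
    using transpose_mult[OF FS_carrier L_props(1)] L_props by (simp add: transpose_one)
  have "FS\<^sup>T *\<^sub>v \<beta> = y"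
  proof (rule eq_vecI)
    fix t assume "t < dim_vec y"
    then have t: "t < length S" using assms(1) by simp
    have "(FS\<^sup>T *\<^sub>v \<beta>) $ t = (\<Sum>u<length S. F $$ (S ! u, t) * \<beta> $ u)"
      unfolding mult_mat_vec_index[OF c(1) assms(2) t] mvf_def
      using t FS_carrier by (intro sum.cong refl) (simp add: FS_def)
    then show "(FS\<^sup>T *\<^sub>v \<beta>) $ t = y $ t" using assms(3)[OF t] by simp
  qed (use assms(1) FS_carrier in simp)
  then have "L\<^sup>T *\<^sub>v y = (L\<^sup>T * FS\<^sup>T) *\<^sub>v \<beta>"
    using assoc_mult_mat_vec[OF c(2,1) b] by simp
  then show ?thesis using T b by simp
qed

lemma L_solves:
  assumes "dim_vec y = length S" "t < length S"
  shows "(\<Sum>u<length S. F $$ (S ! t, u) * (L *\<^sub>v y) $ u) = y $ t"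
proof -
  have y: "y \<in> carrier_vec (length S)" using assms(1) by (metis carrier_vec_dim_vec)
  have "FS *\<^sub>v (L *\<^sub>v y) = y"
    using assoc_mult_mat_vec[OF FS_carrier L_props(1) y] L_props y by simp
  then have "y $ t = (FS *\<^sub>v (L *\<^sub>v y)) $ t" by simp
  also have "\<dots> = (\<Sum>u<length S. F $$ (S ! t, u) * (L *\<^sub>v y) $ u)"
    unfolding mult_mat_vec_index[OF FS_carrier _ assms(2), of "L *\<^sub>v y", simplified dim_mult_mat_vec, OF carrier_matD(1)[OF L_props(1)]] mvf_def
    using assms(2) by (intro sum.cong refl) (simp add: FS_def)
  finally show ?thesis by simp
qed

end

lemma rpcholesky_inv:
  assumes "psd n A" "(S, F) \<in> set_pmf (rpcholesky A d)"
  shows "\<exists>cs R. F = mat_of_cols n cs \<and> rpc_inv n A (S, cs, R)"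
proof -
  obtain cs R where "F = mat_of_cols (dim_row A) cs" "(S, cs, R) \<in> set_pmf (rpc_iter d ([], [], A))"
    using assms(2) by (auto simp: rpcholesky_def)
  moreover from this have "rpc_inv n A (S, cs, R)"
    by (intro rpc_inv_iter[OF rpc_inv_init[OF assms(1)]])
  ultimately show ?thesis using assms(1) by (auto simp: psd_def)
qed

section \<open>Boosting, and the choice of the rank\<close>

lemma boosted_in_rpcholesky:
  assumes "(S, F) \<in> set_pmf (boosted_rpcholesky A d T)" "0 < T"
  shows "(S, F) \<in> set_pmf (rpcholesky A d)"
proof -
  obtain xs where xs: "xs \<in> set_pmf (replicate_pmf T (rpcholesky A d))"
    and "(S, F) = arg_min_list (\<lambda>(S, F). tr (A - nystrom A S)) xs"
    using assms(1) unfolding boosted_rpcholesky_def by auto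
  moreover have "set xs \<subseteq> set_pmf (rpcholesky A d)" "xs \<noteq> []"
    using xs assms(2) by (auto simp: set_replicate_pmf)
  ultimately show ?thesis using arg_min_list_in[of xs] by (metis subsetD)
qed

text \<open>Markov's inequality with expectation at most \<open>2 B\<close> and threshold
  \<open>4 B\<close>.\<close>

lemma rpcholesky_residual_markov:
  assumes psd: "psd n A" and r: "r < n" and B: "0 < tail_sum A r"
    and d: "real r + real r * ln (1 / eta A r) \<le> real d"
  shows "measure_pmf.prob (rpcholesky A d) {(S, F). 4 * tail_sum A r < tr (A - nystrom A S)} \<le> 1 / 2"
proof -
  let ?p = "rpc_iter d ([], [], A)" and ?B = "tail_sum A r"
  let ?f = "\<lambda>(S, cs, R). \<Sum>i<n. R $$ (i, i)"
  have A: "A \<in> carrier_mat n n" using psd by (simp add: psd_def)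
  have inv: "rpc_inv n A st" if "st \<in> set_pmf ?p" for st
    using rpc_inv_iter[OF rpc_inv_init[OF psd] that] .
  have "measure_pmf.prob (rpcholesky A d) {(S, F). 4 * ?B < tr (A - nystrom A S)}
    = measure_pmf.prob ?p {st. 4 * ?B < tr (A - nystrom A (fst st))}"
    unfolding rpcholesky_def measure_map_pmf
    by (rule arg_cong[where f = "measure_pmf.prob ?p"]) auto
  also have "\<dots> = measure_pmf.expectation ?p (indicator {st. 4 * ?B < tr (A - nystrom A (fst st))})"
    by simp
  also have "\<dots> \<le> measure_pmf.expectation ?p (\<lambda>st. ?f st / (4 * ?B))"
  proof (rule expectation_mono_finite[OF finite_set_rpc_iter])
    fix st assume "st \<in> set_pmf ?p"
    then have i: "rpc_inv n A st" by (rule inv)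
    obtain S cs R where st: "st = (S, cs, R)" by (cases st)
    have "tr (A - nystrom A S) = (\<Sum>i<n. R $$ (i, i))" by (rule rpc_output.tr_residual[OF rpc_output.intro[OF i[unfolded st] A]])
    moreover have "0 \<le> (\<Sum>i<n. R $$ (i, i))"
      using rpc_invD(6)[OF i[unfolded st]] by (intro sum_nonneg) (auto intro: psdf_diag_nonneg)
    ultimately show "indicator {st. 4 * ?B < tr (A - nystrom A (fst st))} st \<le> ?f st / (4 * ?B)"
      using B by (auto simp: st indicator_def field_simps)
  qed
  also have "\<dots> = measure_pmf.expectation ?p ?f / (4 * ?B)" by simp
  also have "\<dots> \<le> 2 * ?B / (4 * ?B)"
    using rpc_expected_trace[OF assms] B by (intro divide_right_mono) auto
  finally show ?thesis using B by simp
qed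

text \<open>Independence, by induction on the number of runs. In the extended reals the double
  integral of a product of indicators factors without integrability conditions.\<close>

lemma prob_replicate_all:
  "measure_pmf.prob (replicate_pmf T p) {xs. \<forall>x\<in>set xs. P x} = (measure_pmf.prob p {x. P x}) ^ T"
proof -
  have "emeasure (measure_pmf (replicate_pmf T p)) {xs. \<forall>x\<in>set xs. P x} = (emeasure (measure_pmf p) {x. P x}) ^ T"
  proof (induction T)
    case 0
    then show ?case by (simp add: measure_pmf.emeasure_eq_measure)
  next
    case (Suc T)
    let ?X = "{xs. \<forall>x\<in>set xs. P x}"
    have "emeasure (measure_pmf (replicate_pmf (Suc T) p)) ?X
      = (\<integral>\<^sup>+ x. \<integral>\<^sup>+ xs. indicator {x. P x} x * indicator ?X xs \<partial>measure_pmf (replicate_pmf T p) \<partial>measure_pmf p)"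
      unfolding nn_integral_indicator[symmetric, of ?X "measure_pmf (replicate_pmf (Suc T) p)", simplified]
      by (auto simp: nn_integral_indicator[symmetric] simp del: nn_integral_indicator intro!: nn_integral_cong split: split_indicator)
    also have "\<dots> = emeasure (measure_pmf p) {x. P x} * emeasure (measure_pmf (replicate_pmf T p)) ?X"
      by (simp add: nn_integral_cmult nn_integral_multc)
    finally show ?case using Suc.IH by simp
  qed
  then show ?thesis
    by (simp add: measure_pmf.emeasure_eq_measure ennreal_power)
qed

text \<open>The selected run has the smallest residual trace, so it is bad only if all
  \<open>T\<close> independent runs are bad.\<close>

lemma boosted_residual_prob:
  assumes psd: "psd n A" and r: "r < n" and B: "0 < tail_sum A r"
    and d: "real r + real r * ln (1 / eta A r) \<le> real d" and T: "0 < T"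
  shows "measure_pmf.prob (boosted_rpcholesky A d T) {(S, F). 4 * tail_sum A r < tr (A - nystrom A S)} \<le> (1 / 2) ^ T"
proof -
  let ?f = "\<lambda>(S, F :: real mat). tr (A - nystrom A S)" and ?p = "rpcholesky A d" and ?B = "tail_sum A r"
  have "measure_pmf.prob (boosted_rpcholesky A d T) {(S, F). 4 * ?B < tr (A - nystrom A S)}
    = measure_pmf.prob (replicate_pmf T ?p) {xs. 4 * ?B < ?f (arg_min_list ?f xs)}"
    unfolding boosted_rpcholesky_def measure_map_pmf
    by (rule arg_cong[where f = "measure_pmf.prob _"]) auto
  also have "\<dots> \<le> measure_pmf.prob (replicate_pmf T ?p) {xs. \<forall>x\<in>set xs. 4 * ?B < ?f x}"
  proof (rule measure_pmf.finite_measure_mono_AE)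
    show "AE xs in measure_pmf (replicate_pmf T ?p). xs \<in> {xs. 4 * ?B < ?f (arg_min_list ?f xs)} \<longrightarrow> xs \<in> {xs. \<forall>x\<in>set xs. 4 * ?B < ?f x}"
    proof (rule AE_pmfI, intro impI, unfold mem_Collect_eq, intro ballI)
      fix xs x assume xs: "xs \<in> set_pmf (replicate_pmf T ?p)" "4 * ?B < ?f (arg_min_list ?f xs)" and x: "x \<in> set xs"
      have "?f (arg_min_list ?f xs) = Min (?f ` set xs)" using x by (intro f_arg_min_list_f) auto
      also have "\<dots> \<le> ?f x" using x by (intro Min_le) auto
      finally show "4 * ?B < ?f x" using xs(2) by simp
    qed
  qed simp
  also have "\<dots> = (measure_pmf.prob ?p {x. 4 * ?B < ?f x}) ^ T" by (rule prob_replicate_all)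
  also have "{x. 4 * ?B < ?f x} = {(S, F). 4 * ?B < tr (A - nystrom A S)}" by auto
  also have "(measure_pmf.prob ?p \<dots>) ^ T \<le> (1 / 2) ^ T"
    by (intro power_mono rpcholesky_residual_markov[OF psd r B d]) simp
  finally show ?thesis .
qed

text \<open>The \<open>GREATEST\<close> exists: 0 satisfies its condition because
  \<open>eta A 0 = 1\<close>, and a positive \<open>eta A r\<close> forces
  \<open>r < n\<close>.\<close>

lemma approx_rank_props:
  assumes psd: "psd n A" and nz: "A \<noteq> 0\<^sub>m n n"
  shows "approx_rank A d < n" "0 < tail_sum A (approx_rank A d)"
    "real (approx_rank A d) + real (approx_rank A d) * ln (1 / eta A (approx_rank A d)) \<le> real d"
proof -
  obtain q e where es: "eigsys n A q e" using psd_eigsys[OF psd] by blast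
  have A: "A \<in> carrier_mat n n" using psd by (simp add: psd_def)
  have t0: "0 < tail_sum A 0"
    using psdf_trace_pos[OF psd_psdf[OF psd] A nz] eigsys_trace[OF es]
    by (simp add: tail_sum_eigsys[OF es] lessThan_atLeast0)
  let ?P = "\<lambda>r. eta A r > 0 \<and> real d \<ge> real r + real r * ln (1 / eta A r)"
  have lt: "r < n" if "0 < eta A r" for r
  proof (rule ccontr)
    assume "\<not> r < n"
    then have "tail_sum A r = 0" by (simp add: tail_sum_eigsys[OF es])
    then show False using that by (simp add: eta_def)
  qed
  have "?P 0" using t0 by (simp add: eta_def)
  then have "?P (approx_rank A d)"
    unfolding approx_rank_def by (rule GreatestI_nat[where b = n]) (use lt in \<open>auto simp: less_imp_le\<close>)
  then show "approx_rank A d < n" "0 < tail_sum A (approx_rank A d)"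
    "real (approx_rank A d) + real (approx_rank A d) * ln (1 / eta A (approx_rank A d)) \<le> real d"
    using lt t0 by (auto simp: eta_def zero_less_divide_iff)
qed

section \<open>Subspace-constrained coordinate descent\<close>

text \<open>The full-length vector that \<open>add_at\<close> adds: the coefficients
  \<open>v\<close> placed at the positions \<open>J\<close>. Sums over all coordinates collapse on
  it to sums over \<open>J\<close>.\<close>

definition emb :: "nat list \<Rightarrow> real vec \<Rightarrow> nat \<Rightarrow> real" where
  "emb J v i = (\<Sum>t<length J. if J ! t = i then v $ t else 0)"

lemma add_at_index: "i < dim_vec x \<Longrightarrow> add_at x J v $ i = x $ i + emb J v i"
  by (simp add: add_at_def emb_def)

lemma dim_add_at [simp]: "dim_vec (add_at x J v) = dim_vec x"
  by (simp add: add_at_def)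

lemma sum_emb:
  assumes "set J \<subseteq> {..<n}"
  shows "(\<Sum>i<n. g i * emb J v i) = (\<Sum>t<length J. g (J ! t) * v $ t)"
proof -
  have "(\<Sum>i<n. g i * emb J v i) = (\<Sum>i<n. \<Sum>t<length J. if J ! t = i then g i * v $ t else 0)"
    unfolding emb_def sum_distrib_left by (intro sum.cong refl) simp
  also have "\<dots> = (\<Sum>t<length J. \<Sum>i<n. if J ! t = i then g i * v $ t else 0)"
    by (rule sum.swap)
  also have "\<dots> = (\<Sum>t<length J. g (J ! t) * v $ t)"
    using assms nth_mem[of _ J] by (intro sum.cong refl) (auto simp: subset_iff)
  finally show ?thesis .
qed

lemma mvf_emb: "set J \<subseteq> {..<n} \<Longrightarrow> mvf n M (emb J v) i = (\<Sum>t<length J. M i (J ! t) * v $ t)"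
  unfolding mvf_def by (rule sum_emb)

lemma ip_emb: "set J \<subseteq> {..<n} \<Longrightarrow> ip n u (emb J v) = (\<Sum>t<length J. u (J ! t) * v $ t)"
  unfolding ip_def by (rule sum_emb)

lemma emb_not_in: "i \<notin> set J \<Longrightarrow> emb J v i = 0"
  unfolding emb_def by (intro sum.neutral) auto

lemma emb_surj:
  assumes "\<And>i. i \<notin> set J \<Longrightarrow> w i = 0" "distinct J"
  shows "w = emb J (vec (length J) (\<lambda>t. w (J ! t)))"
proof
  fix i
  show "w i = emb J (vec (length J) (\<lambda>t. w (J ! t))) i"
  proof (cases "i \<in> set J")
    case True
    then obtain t where t: "t < length J" "J ! t = i" by (auto simp: in_set_conv_nth)
    have "emb J (vec (length J) (\<lambda>t. w (J ! t))) i = (\<Sum>u<length J. if u = t then w i else 0)"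
      unfolding emb_def using t assms(2) by (intro sum.cong refl) (auto simp: nth_eq_iff_index_eq)
    then show ?thesis using t by simp
  qed (simp add: assms emb_not_in)
qed

section \<open>Kernels and minimum-norm solutions\<close>

text \<open>A zero of a nonnegative form is a minimum, so the slope along every coordinate
  vanishes.\<close>

lemma psdf_kernel:
  assumes M: "psdf n M" and z: "ip n z (mvf n M z) = 0" and i: "i < n"
  shows "mvf n M z i = 0"
proof -
  have sym: "symf n M" using M by (simp add: psdf_def)
  have "2 * mvf n M z i = 0"
  proof (rule linear_le_quadratic_imp_0)
    fix t
    have "0 \<le> ip n (\<lambda>j. z j - t * unitf i j) (mvf n M (\<lambda>j. z j - t * unitf i j))"
      using M by (simp add: psdf_def)
    then show "t * (2 * mvf n M z i) + t\<^sup>2 * (- M i i) \<le> 0"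
      unfolding quadratic_coord_step[OF sym i] z by simp
  qed
  then show ?thesis by simp
qed

text \<open>Remove from any solution its components along eigenvectors of eigenvalue 0: the image
  under \<open>M\<close> stays the same, and the rest is orthogonal to the kernel.\<close>

lemma symf_min_norm:
  assumes sym: "symf n M" and v: "\<And>w. (\<And>i. i < n \<Longrightarrow> mvf n M w i = 0) \<Longrightarrow> ip n w v = 0"
  shows "\<exists>y. (\<forall>i<n. mvf n M y i = v i) \<and> (\<forall>w. (\<forall>i<n. mvf n M w i = 0) \<longrightarrow> ip n y w = 0)"
proof -
  obtain y where y: "\<forall>i<n. mvf n M y i = v i" using symf_solvable[OF assms] by blast
  obtain q e where sp: "spectral n M n q e" using spectral_theorem[OF sym] by blast
  define x where "x = (\<lambda>i. \<Sum>k<n. (if e k = 0 then 0 else ip n (q k) y) * q k i)"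
  have xk: "ip n x u = (\<Sum>k<n. (if e k = 0 then 0 else ip n (q k) y) * ip n (q k) u)" for u
    unfolding x_def ip_comm[of n "\<lambda>i. \<Sum>k<n. (if e k = 0 then 0 else ip n (q k) y) * q k i" u] ip_sum_right ip_scale_right
    by (intro sum.cong refl arg_cong2[where f="(*)"]) (rule ip_comm)
  have qx: "ip n (q k) x = (if e k = 0 then 0 else ip n (q k) y)" if "k < n" for k
  proof -
    have "ip n (q k) x = (\<Sum>l<n. if l = k then (if e l = 0 then 0 else ip n (q l) y) else 0)"
      unfolding ip_comm[of n "q k" x] xk using spectralD(1)[OF sp _ that] by (intro sum.cong refl) auto
    then show ?thesis using that by simp
  qed
  have "mvf n M x i = mvf n M y i" if "i < n" for i
    unfolding spectral_expand[OF sp that, of "mvf n M x"] spectral_expand[OF sp that, of "mvf n M y"]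
    by (intro sum.cong refl arg_cong2[where f="(*)"]) (simp add: spectral_ip_mvf[OF sym sp] qx)
  moreover have "ip n x w = 0" if w: "\<forall>i<n. mvf n M w i = 0" for w
  proof -
    have "(if e k = 0 then 0 else ip n (q k) y) * ip n (q k) w = 0" if "k < n" for k
    proof -
      have "e k * ip n (q k) w = ip n (q k) (mvf n M w)" by (rule spectral_ip_mvf[OF sym sp that, symmetric])
      also have "\<dots> = 0" using w by (simp add: ip_def)
      finally show ?thesis by auto
    qed
    then show ?thesis unfolding xk by (intro sum.neutral) auto
  qed
  ultimately show ?thesis using y by (intro exI[of _ x]) simp
qed

text \<open>Any other solution differs from \<open>a\<close> by a kernel vector, which is orthogonal
  to \<open>a\<close>. Pythagoras gives minimality and, for equal lengths, uniqueness.\<close>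

lemma min_norm_sol_eqI:
  assumes G: "G \<in> carrier_mat m p" and a: "a \<in> carrier_vec p" "G *\<^sub>v a = v"
    and ker: "\<And>w. (\<And>i. i < m \<Longrightarrow> mvf p (fn_of_mat G) w i = 0) \<Longrightarrow> ip p (fn_of_vec a) w = 0"
  shows "min_norm_sol G v = a"
proof -
  have pyth: "a' \<bullet> a' = a \<bullet> a + ip p (\<lambda>i. a' $ i - a $ i) (\<lambda>i. a' $ i - a $ i)"
    if a': "a' \<in> carrier_vec p" "G *\<^sub>v a' = v" for a'
  proof -
    define w where "w = (\<lambda>i. a' $ i - a $ i)"
    have "mvf p (fn_of_mat G) w i = 0" if "i < m" for i
      using arg_cong[OF a(2), of "\<lambda>x. x $ i"] arg_cong[OF a'(2), of "\<lambda>x. x $ i"] that a(1) a'(1)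
      by (simp add: w_def mvf_diff mult_mat_vec_index[OF G _ that, symmetric] del: index_mult_mat_vec)
    then have 0: "ip p (fn_of_vec a) w = 0" by (rule ker)
    have "a' \<bullet> a' = ip p (\<lambda>i. a $ i + w i) (\<lambda>i. a $ i + w i)"
      using a' by (simp add: scalar_prod_eq_ip w_def)
    also have "\<dots> = a \<bullet> a + ip p w w"
      using 0 a by (simp add: scalar_prod_eq_ip ip_simps ip_comm[of p w "fn_of_vec a"])
    finally show ?thesis by (simp add: w_def)
  qed
  show ?thesis
    unfolding min_norm_sol_def
  proof (rule the_equality)
    show "a \<in> carrier_vec (dim_col G) \<and> G *\<^sub>v a = v \<and> (\<forall>a'\<in>carrier_vec (dim_col G). G *\<^sub>v a' = v \<longrightarrow> sqrt (a \<bullet> a) \<le> sqrt (a' \<bullet> a'))"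
    proof (intro conjI ballI impI)
      fix a' assume "a' \<in> carrier_vec (dim_col G)" "G *\<^sub>v a' = v"
      then have "a' \<bullet> a' = a \<bullet> a + ip p (\<lambda>i. a' $ i - a $ i) (\<lambda>i. a' $ i - a $ i)" using G by (intro pyth) auto
      then show "sqrt (a \<bullet> a) \<le> sqrt (a' \<bullet> a')"
        using ip_self_nonneg[of p "\<lambda>i. a' $ i - a $ i"] by simp
    qed (use a G in auto)
  next
    fix a' assume a': "a' \<in> carrier_vec (dim_col G) \<and> G *\<^sub>v a' = v \<and> (\<forall>a\<in>carrier_vec (dim_col G). G *\<^sub>v a = v \<longrightarrow> sqrt (a' \<bullet> a') \<le> sqrt (a \<bullet> a))"
    then have c: "a' \<in> carrier_vec p" "G *\<^sub>v a' = v" "a' \<bullet> a' \<le> a \<bullet> a" using G a by auto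
    then have "ip p (\<lambda>i. a' $ i - a $ i) (\<lambda>i. a' $ i - a $ i) = 0"
      using pyth[OF c(1,2)] ip_self_nonneg[of p "\<lambda>i. a' $ i - a $ i"] by simp
    then show "a' = a" using c a by (intro eq_vecI) (auto simp: ip_self_eq_0)
  qed
qed

text \<open>
  The block step minimizes the error over the span of the drawn coordinates, so it is at least as good as
  consecutive exact steps along these coordinates, whose expected contraction is elementary.
\<close>

definition coord_descent :: "nat \<Rightarrow> (nat \<Rightarrow> nat \<Rightarrow> real) \<Rightarrow> (nat \<Rightarrow> real) \<Rightarrow> nat \<Rightarrow> nat \<Rightarrow> real" where
  "coord_descent n M z j = (\<lambda>i. z i - (mvf n M z j / M j j) * unitf j i)"

text \<open>The total displacement is confined to the drawn coordinates, which makes the outcome of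
  the single steps a competitor of the block step.\<close>

lemma coord_descent_support:
  "\<exists>w. foldl (coord_descent n M) z js = (\<lambda>i. z i - w i) \<and> (\<forall>i. i \<notin> set js \<longrightarrow> w i = 0)"
proof (induction js arbitrary: z)
  case Nil
  then show ?case by (intro exI[of _ "\<lambda>_. 0"]) simp
next
  case (Cons j js)
  from Cons.IH[of "coord_descent n M z j"] obtain w where
    w: "foldl (coord_descent n M) (coord_descent n M z j) js = (\<lambda>i. coord_descent n M z j i - w i)" "\<forall>i. i \<notin> set js \<longrightarrow> w i = 0"
    by blast
  have "foldl (coord_descent n M) z (j # js) = (\<lambda>i. coord_descent n M z j i - w i)"
    using w(1) by simp
  also have "\<dots> = (\<lambda>i. z i - ((mvf n M z j / M j j) * unitf j i + w i))"
    by (rule ext) (simp add: coord_descent_def)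
  finally show ?case
    using w(2) by (intro exI[of _ "\<lambda>i. (mvf n M z j / M j j) * unitf j i + w i"] conjI) (auto simp: unitf_def)
qed

lemma finite_set_replicate_pmf: "finite (set_pmf p) \<Longrightarrow> finite (set_pmf (replicate_pmf l p))"
  by (induction l) auto

text \<open>An exact step along \<open>j\<close> lowers the form by the square of
  \<open>mvf n M z j\<close> over \<open>M j j\<close>; drawing \<open>j\<close> with weight
  \<open>M j j\<close> turns the expected decrease into the squared length of \<open>M z\<close>
  over the trace. Iterating the bound multiplies by the factor, which must be nonnegative for this:
  hence the second claim.\<close>

lemma coord_descent_expectation:
  assumes M: "psdf n M" and \<tau>: "0 < (\<Sum>i<n. M i i)" (is "0 < ?\<tau>")
    and lam: "\<And>z. lam * ip n z (mvf n M z) \<le> ip n (mvf n M z) (mvf n M z)"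
  shows "measure_pmf.expectation (replicate_pmf l (index_pmf n (\<lambda>j. M j j)))
      (\<lambda>js. ip n (foldl (coord_descent n M) z js) (mvf n M (foldl (coord_descent n M) z js)))
    \<le> (1 - lam / ?\<tau>) ^ l * ip n z (mvf n M z)"
    and "0 \<le> 1 - lam / ?\<tau>"
proof -
  let ?p = "index_pmf n (\<lambda>j. M j j)" and ?q = "\<lambda>z. ip n z (mvf n M z)" and ?c = "1 - lam / ?\<tau>"
  have sym: "symf n M" using M by (simp add: psdf_def)
  have nn: "\<And>j. j < n \<Longrightarrow> 0 \<le> M j j" using psdf_diag_nonneg[OF M] .
  have q0: "0 \<le> ?q z" for z using M by (simp add: psdf_def)
  have step: "measure_pmf.expectation ?p (\<lambda>j. ?q (coord_descent n M z j)) \<le> ?c * ?q z" for z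
  proof -
    have "measure_pmf.expectation ?p (\<lambda>j. ?q (coord_descent n M z j)) = (\<Sum>j<n. M j j / ?\<tau> * ?q (coord_descent n M z j))"
      by (rule expectation_index_pmf[OF nn \<tau>])
    also have "\<dots> = (\<Sum>j<n. M j j / ?\<tau> * ?q z - (mvf n M z j)\<^sup>2 / ?\<tau>)"
    proof (intro sum.cong refl)
      fix j assume "j \<in> {..<n}"
      then have j: "j < n" by simp
      show "M j j / ?\<tau> * ?q (coord_descent n M z j) = M j j / ?\<tau> * ?q z - (mvf n M z j)\<^sup>2 / ?\<tau>"
      proof (cases "M j j = 0")
        case True
        have "mvf n M z j = 0"
          unfolding mvf_def using psdf_diag_0[OF M j _ True] sym j by (intro sum.neutral) (auto simp: symf_def)
        then show ?thesis using True by simp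
      next
        case False
        have "?q (coord_descent n M z j) = ?q z - (mvf n M z j)\<^sup>2 / M j j"
          unfolding coord_descent_def quadratic_coord_step[OF sym j] using False by (simp add: power2_eq_square)
        then show ?thesis using False by (simp add: right_diff_distrib)
      qed
    qed
    also have "\<dots> = ?q z - ip n (mvf n M z) (mvf n M z) / ?\<tau>"
    proof -
      have "(\<Sum>j<n. M j j / ?\<tau> * ?q z) = ?q z"
        using \<tau> unfolding sum_distrib_right[symmetric] sum_divide_distrib[symmetric] by simp
      then show ?thesis by (simp add: sum_subtractf ip_def power2_eq_square sum_divide_distrib)
    qed
    also have "\<dots> \<le> ?q z - lam * ?q z / ?\<tau>"
      using lam[of z] \<tau> by (intro diff_left_mono divide_right_mono) auto
    finally show ?thesis by (simp add: left_diff_distrib)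
  qed
  show c0: "0 \<le> ?c"
  proof -
    \<comment> \<open>After a step from a coordinate vector of positive form, the form is still
      nonnegative, so the factor that bounds its expectation cannot be negative.\<close>
    obtain j where j: "j < n" "0 < M j j"
      using \<tau> sum_nonpos[of "{..<n}" "\<lambda>j. M j j"] by (meson lessThan_iff not_le)
    have "0 \<le> measure_pmf.expectation ?p (\<lambda>i. ?q (coord_descent n M (unitf j) i))"
      using q0 by (intro integral_nonneg_AE) auto
    also have "\<dots> \<le> ?c * ?q (unitf j)" by (rule step)
    also have "?q (unitf j) = M j j"
      unfolding ip_comm[of n "unitf j" "mvf n M (unitf j)"] using j by (simp add: ip_unitf mvf_unitf)
    finally show ?thesis using j by (simp add: zero_le_mult_iff)
  qed
  show "measure_pmf.expectation (replicate_pmf l ?p) (\<lambda>js. ?q (foldl (coord_descent n M) z js)) \<le> ?c ^ l * ?q z"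
  proof (induction l arbitrary: z)
    case 0
    then show ?case by simp
  next
    case (Suc l)
    have "measure_pmf.expectation (replicate_pmf (Suc l) ?p) (\<lambda>js. ?q (foldl (coord_descent n M) z js))
      = measure_pmf.expectation ?p (\<lambda>j. measure_pmf.expectation (replicate_pmf l ?p) (\<lambda>js. ?q (foldl (coord_descent n M) (coord_descent n M z j) js)))"
      unfolding replicate_pmf.simps map_pmf_def[symmetric]
      by (subst expectation_bind_finite) (auto simp: finite_set_index_pmf finite_set_replicate_pmf)
    also have "\<dots> \<le> measure_pmf.expectation ?p (\<lambda>j. ?c ^ l * ?q (coord_descent n M z j))"
      by (intro expectation_mono_finite finite_set_index_pmf Suc.IH)
    also have "\<dots> = ?c ^ l * measure_pmf.expectation ?p (\<lambda>j. ?q (coord_descent n M z j))" by simp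
    also have "\<dots> \<le> ?c ^ l * (?c * ?q z)"
      using c0 by (intro mult_left_mono step) simp
    finally show ?case by (simp add: mult_ac)
  qed
qed

definition sc_upd :: "real mat \<Rightarrow> nat list \<Rightarrow> real mat \<Rightarrow> real vec \<times> real vec \<Rightarrow> nat list \<Rightarrow> real vec \<times> real vec" where
  "sc_upd A S F = (\<lambda>(x, res) js.
     let C = (inv_mat (rows_of F S))\<^sup>T * F\<^sup>T; J = remdups js; FJ = rows_of F J;
         \<alpha> = min_norm_sol (submat A J J - FJ * FJ\<^sup>T) (subvec res J);
         \<beta> = cols_of C J *\<^sub>v \<alpha>
     in (add_at (add_at x J (- \<alpha>)) S \<beta>, res - (cols_of A J *\<^sub>v \<alpha> - F *\<^sub>v (FJ\<^sup>T *\<^sub>v \<alpha>))))"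

lemma scrcd_step_eq:
  "scrcd_step A l S F st = (let p = scrcd_weight A S F in
     if (\<Sum>j<dim_row A. p j) = 0 then return_pmf st
     else map_pmf (sc_upd A S F st) (replicate_pmf l (index_pmf (dim_row A) p)))"
  by (cases st) (simp add: scrcd_step_def sc_upd_def Let_def map_pmf_def)

section \<open>The block step in terms of the residual matrix\<close>

context rpc_output
begin

lemma psd_R: "psdf n (fn_of_mat R)" and R_carrier: "R \<in> carrier_mat n n" and S_sub: "set S \<subseteq> {..<n}"
  using rpcI by auto

text \<open>The minimum-norm solution of the block system by two linear conditions: it solves the
  system and is orthogonal to the kernel. The block is one of \<open>R\<close>, which equals
  \<open>A - F F^T\<close>.\<close>

definition is_alpha :: "nat list \<Rightarrow> real vec \<Rightarrow> real vec \<Rightarrow> bool" where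
  "is_alpha J res \<alpha> \<longleftrightarrow> dim_vec \<alpha> = length J \<and>
     (\<forall>a<length J. mvf (length J) (\<lambda>a b. R $$ (J ! a, J ! b)) (fn_of_vec \<alpha>) a = res $ (J ! a)) \<and>
     (\<forall>w. (\<forall>a<length J. mvf (length J) (\<lambda>a b. R $$ (J ! a, J ! b)) w a = 0) \<longrightarrow> ip (length J) (fn_of_vec \<alpha>) w = 0)"

text \<open>The block system is consistent: a kernel vector \<open>w\<close> of the block, padded by
  zeros to \<open>W\<close>, is a zero of the form of \<open>R\<close>, hence
  \<open>R W = 0\<close>, hence \<open>w\<close> is orthogonal to the restriction of
  \<open>R z\<close>.\<close>

lemma is_alpha_exists:
  assumes J: "set J \<subseteq> {..<n}" and res: "\<And>i. i < n \<Longrightarrow> res $ i = mvf n (fn_of_mat R) z i"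
  shows "\<exists>\<alpha>. is_alpha J res \<alpha>"
proof -
  let ?q = "length J" and ?G = "\<lambda>a b. R $$ (J ! a, J ! b)"
  have Jn: "J ! a < n" if "a < ?q" for a using J nth_mem[OF that] by auto
  have sym: "symf n (fn_of_mat R)" using psd_R by (simp add: psdf_def)
  have symG: "symf ?q ?G" unfolding symf_def using R_sym Jn by blast
  have "\<exists>y. (\<forall>a<?q. mvf ?q ?G y a = res $ (J ! a)) \<and> (\<forall>w. (\<forall>i<?q. mvf ?q ?G w i = 0) \<longrightarrow> ip ?q y w = 0)"
  proof (rule symf_min_norm[OF symG])
    fix w assume w: "\<And>i. i < ?q \<Longrightarrow> mvf ?q ?G w i = 0"
    define W where "W = emb J (vec ?q w)"
    have RW: "mvf n (fn_of_mat R) W i = (\<Sum>b<?q. R $$ (i, J ! b) * w b)" for i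
      unfolding W_def mvf_emb[OF J] by simp
    have "ip n W (mvf n (fn_of_mat R) W) = ip n (mvf n (fn_of_mat R) W) W" by (rule ip_comm)
    also have "\<dots> = (\<Sum>a<?q. mvf n (fn_of_mat R) W (J ! a) * w a)"
      unfolding ip_emb[OF J, of "mvf n (fn_of_mat R) W" "vec ?q w", folded W_def] by simp
    also have "\<dots> = 0"
      using w[unfolded mvf_def] unfolding RW by (intro sum.neutral) simp
    finally have "ip n W (mvf n (fn_of_mat R) W) = 0" .
    then have "ip n (mvf n (fn_of_mat R) W) z = 0"
      using psdf_kernel[OF psd_R] by (simp add: ip_def)
    then have "ip n (mvf n (fn_of_mat R) z) W = 0"
      using ip_mvf_sym[OF sym, of z W] by (simp add: ip_comm)
    then have "(\<Sum>a<?q. mvf n (fn_of_mat R) z (J ! a) * w a) = 0"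
      unfolding ip_emb[OF J, of "mvf n (fn_of_mat R) z" "vec ?q w", folded W_def] by simp
    then show "ip ?q w (\<lambda>a. res $ (J ! a)) = 0"
      using res Jn by (simp add: ip_def mult.commute)
  qed
  then obtain y where y: "\<forall>a<?q. mvf ?q ?G y a = res $ (J ! a)" "\<forall>w. (\<forall>i<?q. mvf ?q ?G w i = 0) \<longrightarrow> ip ?q y w = 0"
    by blast
  have "mvf ?q ?G (fn_of_vec (vec ?q y)) a = mvf ?q ?G y a" for a by (rule mvf_cong) simp
  moreover have "ip ?q (fn_of_vec (vec ?q y)) w = ip ?q y w" for w by (rule ip_cong) auto
  ultimately have "is_alpha J res (vec ?q y)" using y by (simp add: is_alpha_def)
  then show ?thesis by blast
qed

text \<open>Writes the update with plain sums and describes \<open>\<alpha>\<close> and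
  \<open>\<beta>\<close> by the equations that they solve. The analysis of the error and the
  verification of the program both start from this form.\<close>

lemma sc_upd_eq:
  assumes J: "J = remdups js" "set js \<subseteq> {..<n}" and x: "dim_vec x = n" "dim_vec res = n"
    and al: "is_alpha J res \<alpha>" and \<beta>: "dim_vec \<beta> = length S"
      "\<And>t. t < length S \<Longrightarrow> (\<Sum>u<length S. F $$ (S ! u, t) * \<beta> $ u) = (\<Sum>j<length J. F $$ (J ! j, t) * \<alpha> $ j)"
  shows "sc_upd A S F (x, res) js =
    (vec n (\<lambda>i. x $ i + emb J (- \<alpha>) i + emb S \<beta> i),
     vec n (\<lambda>i. res $ i - ((\<Sum>j<length J. A $$ (i, J ! j) * \<alpha> $ j) -
       (\<Sum>t<length S. F $$ (i, t) * (\<Sum>j<length J. F $$ (J ! j, t) * \<alpha> $ j)))))"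
proof -
  let ?q = "length J" and ?m = "length S"
  have Jn: "J ! a < n" if "a < ?q" for a using J nth_mem[OF that] by auto
  have \<alpha>: "dim_vec \<alpha> = ?q" using al by (simp add: is_alpha_def)
  have Fd: "dim_row F = n" "dim_col F = ?m" using F_carrier by auto
  define FJ where "FJ = rows_of F J"
  have FJ: "FJ \<in> carrier_mat ?q ?m" "\<And>a t. a < ?q \<Longrightarrow> t < ?m \<Longrightarrow> FJ $$ (a, t) = F $$ (J ! a, t)"
    by (auto simp: FJ_def Fd submat_def)
  define G where "G = submat A J J - FJ * FJ\<^sup>T"
  have G: "G \<in> carrier_mat ?q ?q" unfolding G_def
    by (intro minus_carrier_mat mult_carrier_mat[of _ _ ?m]) (use FJ in auto)
  have Gi: "G $$ (a, b) = R $$ (J ! a, J ! b)" if "a < ?q" "b < ?q" for a b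
  proof -
    have "(FJ * FJ\<^sup>T) $$ (a, b) = (\<Sum>t<?m. F $$ (J ! a, t) * F $$ (J ! b, t))"
      using FJ that by (subst mult_mat_index[of _ ?q ?m _ ?q]) auto
    then show ?thesis using that FJ(1) A_index[OF Jn Jn, OF that] by (simp add: G_def)
  qed
  have Gm: "mvf ?q (fn_of_mat G) w a = mvf ?q (\<lambda>a b. R $$ (J ! a, J ! b)) w a" if "a < ?q" for w a
    unfolding mvf_def using Gi[OF that] by (intro sum.cong) auto
  have mn: "min_norm_sol G (subvec res J) = \<alpha>"
  proof (rule min_norm_sol_eqI[OF G])
    show "\<alpha> \<in> carrier_vec ?q" using \<alpha> by (metis carrier_vec_dim_vec)
    show "G *\<^sub>v \<alpha> = subvec res J"
    proof (rule eq_vecI)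
      fix a assume "a < dim_vec (subvec res J)"
      then have a: "a < ?q" by (simp add: subvec_def)
      show "(G *\<^sub>v \<alpha>) $ a = subvec res J $ a"
        unfolding mult_mat_vec_index[OF G \<alpha> a] Gm[OF a] using al a by (simp add: is_alpha_def subvec_def)
    qed (use G in \<open>simp add: subvec_def\<close>)
    fix w assume "\<And>i. i < ?q \<Longrightarrow> mvf ?q (fn_of_mat G) w i = 0"
    then show "ip ?q (fn_of_vec \<alpha>) w = 0" using al Gm by (simp add: is_alpha_def)
  qed
  define y where "y = vec ?m (\<lambda>t. \<Sum>j<?q. F $$ (J ! j, t) * \<alpha> $ j)"
  have y: "FJ\<^sup>T *\<^sub>v \<alpha> = y"
  proof (rule eq_vecI)
    fix t assume "t < dim_vec y"
    then have t: "t < ?m" by (simp add: y_def)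
    have c: "FJ\<^sup>T \<in> carrier_mat ?m ?q" using FJ by simp
    show "(FJ\<^sup>T *\<^sub>v \<alpha>) $ t = y $ t"
      unfolding mult_mat_vec_index[OF c \<alpha> t] mvf_def using t FJ by (simp add: y_def)
  qed (use FJ in \<open>simp add: y_def\<close>)
  have \<beta>y: "\<beta> = L\<^sup>T *\<^sub>v y"
    using \<beta> by (intro LT_unique) (auto simp: y_def)
  define C where "C = (inv_mat (rows_of F S))\<^sup>T * F\<^sup>T"
  have C_eq: "C = L\<^sup>T * F\<^sup>T" unfolding C_def rows_of_F L_def FS_def ..
  have c: "L\<^sup>T \<in> carrier_mat ?m ?m" "F\<^sup>T \<in> carrier_mat ?m n" "C \<in> carrier_mat ?m n"
    using L_props(1) F_carrier by (auto simp: C_eq)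
  have CJ: "cols_of C J \<in> carrier_mat ?m ?q" using c by (intro carrier_matI) auto
  have "cols_of C J *\<^sub>v \<alpha> = L\<^sup>T *\<^sub>v y"
  proof (rule eq_vecI)
    fix u assume "u < dim_vec (L\<^sup>T *\<^sub>v y)"
    then have u: "u < ?m" using c by simp
    have "(cols_of C J *\<^sub>v \<alpha>) $ u = (\<Sum>j<?q. C $$ (u, J ! j) * \<alpha> $ j)"
      unfolding mult_mat_vec_index[OF CJ \<alpha> u] mvf_def using u c by (intro sum.cong refl) (simp add: submat_def)
    also have "\<dots> = (\<Sum>j<?q. \<Sum>t<?m. L\<^sup>T $$ (u, t) * (F $$ (J ! j, t) * \<alpha> $ j))"
    proof (intro sum.cong refl)
      fix j assume "j \<in> {..<?q}"
      then have j: "J ! j < n" using Jn by simp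
      have "C $$ (u, J ! j) = (\<Sum>t<?m. L\<^sup>T $$ (u, t) * F\<^sup>T $$ (t, J ! j))"
        unfolding C_eq by (rule mult_mat_index[OF c(1,2) u j])
      then show "C $$ (u, J ! j) * \<alpha> $ j = (\<Sum>t<?m. L\<^sup>T $$ (u, t) * (F $$ (J ! j, t) * \<alpha> $ j))"
        using j F_carrier by (simp add: sum_distrib_right mult.assoc)
    qed
    also have "\<dots> = (\<Sum>t<?m. L\<^sup>T $$ (u, t) * y $ t)"
      by (subst sum.swap) (simp add: sum_distrib_left y_def)
    also have "\<dots> = (L\<^sup>T *\<^sub>v y) $ u"
      by (subst mult_mat_vec_index[OF c(1) _ u]) (auto simp: mvf_def y_def)
    finally show "(cols_of C J *\<^sub>v \<alpha>) $ u = (L\<^sup>T *\<^sub>v y) $ u" .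
  qed (use c CJ in auto)
  then have bt: "cols_of C J *\<^sub>v \<alpha> = \<beta>" using \<beta>y by simp
  have AJ: "cols_of A J \<in> carrier_mat n ?q" using A by (intro carrier_matI) auto
  have "sc_upd A S F (x, res) js = (add_at (add_at x J (- \<alpha>)) S \<beta>, res - (cols_of A J *\<^sub>v \<alpha> - F *\<^sub>v y))"
    unfolding sc_upd_def Let_def prod.case J(1)[symmetric] FJ_def[symmetric] G_def[symmetric] C_def[symmetric] mn bt y ..
  moreover have "add_at (add_at x J (- \<alpha>)) S \<beta> = vec n (\<lambda>i. x $ i + emb J (- \<alpha>) i + emb S \<beta> i)"
    using x by (intro eq_vecI) (auto simp: add_at_index)
  moreover have "res - (cols_of A J *\<^sub>v \<alpha> - F *\<^sub>v y) =
    vec n (\<lambda>i. res $ i - ((\<Sum>j<?q. A $$ (i, J ! j) * \<alpha> $ j) - (\<Sum>t<?m. F $$ (i, t) * (\<Sum>j<?q. F $$ (J ! j, t) * \<alpha> $ j))))" (is "_ = ?v")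
  proof (rule eq_vecI)
    fix i assume "i < dim_vec ?v"
    then have i: "i < n" by simp
    have "(cols_of A J *\<^sub>v \<alpha>) $ i = (\<Sum>j<?q. A $$ (i, J ! j) * \<alpha> $ j)"
      unfolding mult_mat_vec_index[OF AJ \<alpha> i] mvf_def using i A by (intro sum.cong refl) (simp add: submat_def)
    moreover have "(F *\<^sub>v y) $ i = (\<Sum>t<?m. F $$ (i, t) * (\<Sum>j<?q. F $$ (J ! j, t) * \<alpha> $ j))"
      by (subst mult_mat_vec_index[OF F_carrier _ i]) (auto simp: mvf_def y_def)
    moreover have "(res - (cols_of A J *\<^sub>v \<alpha> - F *\<^sub>v y)) $ i = res $ i - ((cols_of A J *\<^sub>v \<alpha>) $ i - (F *\<^sub>v y) $ i)"
      using i AJ Fd x by (simp del: index_mult_mat_vec)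
    ultimately show "(res - (cols_of A J *\<^sub>v \<alpha> - F *\<^sub>v y)) $ i = ?v $ i"
      using i by simp
  qed (use AJ Fd in auto)
  ultimately show ?thesis by simp
qed

definition sc_inv :: "real vec \<Rightarrow> real vec \<times> real vec \<Rightarrow> bool" where
  "sc_inv xs = (\<lambda>(x, res). dim_vec x = n \<and> dim_vec res = n \<and>
     (\<forall>i<n. res $ i = mvf n (fn_of_mat A) (\<lambda>i. x $ i - xs $ i) i) \<and> (\<forall>s\<in>set S. res $ s = 0))"

lemma mvf_A:
  assumes "i < n"
  shows "mvf n (fn_of_mat A) z i = mvf n (fn_of_mat R) z i + (\<Sum>t<length S. F $$ (i, t) * (\<Sum>j<n. F $$ (j, t) * z j))"
proof -
  have "mvf n (fn_of_mat A) z i = (\<Sum>j<n. (R $$ (i, j) + (\<Sum>t<length S. F $$ (i, t) * F $$ (j, t))) * z j)"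
    unfolding mvf_def using A_index[OF assms] by simp
  also have "\<dots> = mvf n (fn_of_mat R) z i + (\<Sum>j<n. \<Sum>t<length S. F $$ (i, t) * (F $$ (j, t) * z j))"
    by (simp add: mvf_def distrib_right sum.distrib sum_distrib_right mult.assoc)
  also have "(\<Sum>j<n. \<Sum>t<length S. F $$ (i, t) * (F $$ (j, t) * z j)) = (\<Sum>t<length S. \<Sum>j<n. F $$ (i, t) * (F $$ (j, t) * z j))"
    by (rule sum.swap)
  finally show ?thesis by (simp add: sum_distrib_left)
qed

lemma mvf_R_S: "u < length S \<Longrightarrow> mvf n (fn_of_mat R) z (S ! u) = 0"
  unfolding mvf_def using R_sym[of "S ! u"] rpcI(8)[of _ "S ! u"] S_nth[of u] by (intro sum.neutral) auto

lemma mvf_R_emb_S: "i < n \<Longrightarrow> mvf n (fn_of_mat R) (emb S \<beta>) i = 0"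
  unfolding mvf_emb[OF S_sub] using rpcI(8)[of i] by (intro sum.neutral) simp

text \<open>\<open>R\<close> vanishes at the pivots, so the hypothesis says that \<open>FS\<close>
  annihilates \<open>F^T z\<close>. Forward substitution in the triangular \<open>FS\<close> yields
  the zero entries one after the other, hence the strong induction.\<close>

lemma FT_zero:
  assumes z: "\<And>u. u < length S \<Longrightarrow> mvf n (fn_of_mat A) z (S ! u) = 0" and "t < length S"
  shows "(\<Sum>j<n. F $$ (j, t) * z j) = 0"
  using \<open>t < length S\<close>
proof (induction t rule: less_induct)
  case (less t)
  have "0 = (\<Sum>u<length S. F $$ (S ! t, u) * (\<Sum>j<n. F $$ (j, u) * z j))"
    using z[OF less.prems] mvf_A[OF S_nth[OF less.prems], of z] mvf_R_S[OF less.prems] by simp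
  also have "\<dots> = (\<Sum>u<length S. if u = t then F $$ (S ! t, t) * (\<Sum>j<n. F $$ (j, t) * z j) else 0)"
  proof (intro sum.cong refl)
    fix u assume "u \<in> {..<length S}"
    then have u: "u < length S" by simp
    show "F $$ (S ! t, u) * (\<Sum>j<n. F $$ (j, u) * z j) = (if u = t then F $$ (S ! t, t) * (\<Sum>j<n. F $$ (j, t) * z j) else 0)"
      using less.IH[of u] u rpcI(9)[OF u, of t] F_index[OF S_nth[OF less.prems] u]
      by (cases u t rule: linorder_cases) auto
  qed
  also have "\<dots> = F $$ (S ! t, t) * (\<Sum>j<n. F $$ (j, t) * z j)" using less.prems by simp
  finally show ?case
    using rpcI(10)[OF less.prems] F_index[OF S_nth[OF less.prems] less.prems] by simp
qed

lemma mvf_A_eq_R: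
  assumes "\<And>u. u < length S \<Longrightarrow> mvf n (fn_of_mat A) z (S ! u) = 0" and "i < n"
  shows "mvf n (fn_of_mat A) z i = mvf n (fn_of_mat R) z i"
  using mvf_A[OF assms(2), of z] FT_zero[OF assms(1)] by simp

lemma tri_solvable:
  "\<exists>\<beta>. dim_vec \<beta> = length S \<and> (\<forall>t<length S. (\<Sum>u<length S. F $$ (S ! u, t) * \<beta> $ u) = y t)"
  using LT_solves[of "vec (length S) y"] L_props(1)
  by (intro exI[of _ "L\<^sup>T *\<^sub>v vec (length S) y"]) auto

text \<open>Let \<open>w\<close> be \<open>z\<close> corrected on the pivots so that
  \<open>F^T w = 0\<close>. Corrections on the pivots are invisible to \<open>R\<close>, so
  \<open>A w = R w = R z\<close>, and the form of \<open>A\<close> at \<open>w\<close> is that of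
  \<open>R\<close> at \<open>z\<close>. The bound for \<open>A\<close> at \<open>w\<close> is the
  claim, without any look at the eigenvalues of \<open>R\<close>.\<close>

lemma lambda_min_residual:
  assumes psd: "psd n A"
  shows "lambda_min_pos A * ip n z (mvf n (fn_of_mat R) z) \<le> ip n (mvf n (fn_of_mat R) z) (mvf n (fn_of_mat R) z)"
proof -
  obtain \<beta> where \<beta>: "\<forall>t<length S. (\<Sum>u<length S. F $$ (S ! u, t) * \<beta> $ u) = - (\<Sum>j<n. F $$ (j, t) * z j)"
    using tri_solvable[of "\<lambda>t. - (\<Sum>j<n. F $$ (j, t) * z j)"] by blast
  define w where "w = (\<lambda>i. z i + emb S \<beta> i)"
  have symR: "symf n (fn_of_mat R)" using psd_R by (simp add: psdf_def)
  have "(\<Sum>j<n. F $$ (j, t) * w j) = 0" if "t < length S" for t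
    using \<beta> that by (simp add: w_def distrib_left sum.distrib sum_emb[OF S_sub])
  then have Aw: "mvf n (fn_of_mat A) w i = mvf n (fn_of_mat R) w i" if "i < n" for i
    using mvf_A[OF that, of w] by simp
  have Rw: "mvf n (fn_of_mat R) w i = mvf n (fn_of_mat R) z i" if "i < n" for i
    unfolding w_def mvf_add mvf_R_emb_S[OF that] by simp
  obtain q e where es: "eigsys n A q e" using psd_eigsys[OF psd] by blast
  have "ip n w (mvf n (fn_of_mat A) w) = ip n w (mvf n (fn_of_mat R) z)"
    by (intro ip_cong refl trans[OF Aw Rw])
  also have "\<dots> = ip n (mvf n (fn_of_mat R) w) z" by (rule ip_mvf_sym[OF symR])
  also have "\<dots> = ip n (mvf n (fn_of_mat R) z) z" by (intro ip_cong refl Rw)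
  finally have 1: "ip n w (mvf n (fn_of_mat A) w) = ip n z (mvf n (fn_of_mat R) z)" by (simp add: ip_comm)
  have "ip n (mvf n (fn_of_mat A) w) (mvf n (fn_of_mat A) w) = ip n (mvf n (fn_of_mat R) z) (mvf n (fn_of_mat R) z)"
    by (intro ip_cong trans[OF Aw Rw])
  then show ?thesis using eigsys_rayleigh[OF psd es, of w] 1 by simp
qed

definition err :: "real vec \<Rightarrow> real vec \<times> real vec \<Rightarrow> real" where
  "err xs st = ip n (\<lambda>i. fst st $ i - xs $ i) (mvf n (fn_of_mat A) (\<lambda>i. fst st $ i - xs $ i))"

lemma sc_inv_err:
  assumes "sc_inv xs (x, res)"
  shows "i < n \<Longrightarrow> res $ i = mvf n (fn_of_mat R) (\<lambda>i. x $ i - xs $ i) i"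
    and "err xs (x, res) = ip n (\<lambda>i. x $ i - xs $ i) (mvf n (fn_of_mat R) (\<lambda>i. x $ i - xs $ i))"
proof -
  have z: "mvf n (fn_of_mat A) (\<lambda>i. x $ i - xs $ i) (S ! u) = 0" if "u < length S" for u
    using assms S_nth[OF that] nth_mem[OF that] by (auto simp: sc_inv_def)
  show "i < n \<Longrightarrow> res $ i = mvf n (fn_of_mat R) (\<lambda>i. x $ i - xs $ i) i"
    using assms mvf_A_eq_R[OF z] by (simp add: sc_inv_def)
  show "err xs (x, res) = ip n (\<lambda>i. x $ i - xs $ i) (mvf n (fn_of_mat R) (\<lambda>i. x $ i - xs $ i))"
    unfolding err_def fst_conv using mvf_A_eq_R[OF z] by (intro ip_cong) auto
qed

text \<open>Let \<open>u = z - v\<close> with the block correction \<open>v\<close>. By the block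
  equations \<open>R u\<close> vanishes on the drawn indices, so for \<open>d\<close> supported
  there the form at \<open>u + d\<close> is the sum of the forms at \<open>u\<close> and at
  \<open>d\<close>: no displacement \<open>w\<close> of the drawn coordinates does better. The pivot
  correction by \<open>\<beta>\<close> restores the pivot equations and leaves the form of
  \<open>R\<close> unchanged.\<close>

lemma sc_upd_props:
  assumes inv: "sc_inv xs (x, res)" and js: "set js \<subseteq> {..<n}"
  shows "sc_inv xs (sc_upd A S F (x, res) js)"
    and "(\<forall>i. i \<notin> set js \<longrightarrow> w i = 0) \<Longrightarrow> err xs (sc_upd A S F (x, res) js) \<le>
      ip n (\<lambda>i. (x $ i - xs $ i) - w i) (mvf n (fn_of_mat R) (\<lambda>i. (x $ i - xs $ i) - w i))"
proof -
  define z where "z = (\<lambda>i. x $ i - xs $ i)"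
  have x: "dim_vec x = n" "dim_vec res = n" using inv by (auto simp: sc_inv_def)
  have resR: "\<And>i. i < n \<Longrightarrow> res $ i = mvf n (fn_of_mat R) z i" unfolding z_def by (rule sc_inv_err(1)[OF inv])
  have resA: "\<And>i. i < n \<Longrightarrow> res $ i = mvf n (fn_of_mat A) z i" using inv by (simp add: sc_inv_def z_def)
  define J where "J = remdups js"
  have J: "set J \<subseteq> {..<n}" "distinct J" using js by (auto simp: J_def)
  have Jn: "J ! a < n" if "a < length J" for a using J nth_mem[OF that] by auto
  obtain \<alpha> where al: "is_alpha J res \<alpha>" using is_alpha_exists[OF J(1) resR] by blast
  obtain \<beta> where \<beta>: "dim_vec \<beta> = length S"
    "\<forall>t<length S. (\<Sum>u<length S. F $$ (S ! u, t) * \<beta> $ u) = (\<Sum>j<length J. F $$ (J ! j, t) * \<alpha> $ j)"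
    using tri_solvable[of "\<lambda>t. \<Sum>j<length J. F $$ (J ! j, t) * \<alpha> $ j"] by blast
  obtain x' res' where st': "sc_upd A S F (x, res) js = (x', res')" by (cases "sc_upd A S F (x, res) js")
  note upd = sc_upd_eq[OF J_def js x al \<beta>(1), unfolded st', OF \<beta>(2)[rule_format]]
  have x': "x' = vec n (\<lambda>i. x $ i + emb J (- \<alpha>) i + emb S \<beta> i)"
    and res': "res' = vec n (\<lambda>i. res $ i - ((\<Sum>j<length J. A $$ (i, J ! j) * \<alpha> $ j) -
       (\<Sum>t<length S. F $$ (i, t) * (\<Sum>j<length J. F $$ (J ! j, t) * \<alpha> $ j))))"
    using upd by auto
  define v where "v = emb J \<alpha>"
  have al_dim: "dim_vec \<alpha> = length J" using al by (simp add: is_alpha_def)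
  have neg: "emb J (- \<alpha>) i = - v i" for i
    unfolding v_def emb_def sum_negf[symmetric] using al_dim by (intro sum.cong) auto
  have Fv: "(\<Sum>j<n. F $$ (j, t) * v j) = (\<Sum>j<length J. F $$ (J ! j, t) * \<alpha> $ j)" for t
    unfolding v_def by (rule sum_emb[OF J(1)])
  have symR: "symf n (fn_of_mat R)" using psd_R by (simp add: psdf_def)
  have Av: "(\<Sum>j<length J. A $$ (i, J ! j) * \<alpha> $ j) = mvf n (fn_of_mat A) v i" for i
    unfolding v_def by (rule mvf_emb[OF J(1), symmetric])
  have r1: "res' $ i = mvf n (fn_of_mat R) (\<lambda>i. z i - v i) i" if "i < n" for i
    using that mvf_A[OF that, of v] resR[OF that] by (simp add: res' Av Fv mvf_diff)
  have z': "mvf n M (\<lambda>i. x' $ i - xs $ i) i = mvf n M z i - mvf n M v i + mvf n M (emb S \<beta>) i" for M i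
  proof -
    have "mvf n M (\<lambda>i. x' $ i - xs $ i) i = mvf n M (\<lambda>i. z i - v i + emb S \<beta> i) i"
      by (rule mvf_cong) (simp add: x' neg z_def)
    then show ?thesis by (simp add: mvf_add mvf_diff)
  qed
  have FS\<beta>: "(\<Sum>j<n. F $$ (j, t) * emb S \<beta> j) = (\<Sum>j<n. F $$ (j, t) * v j)" if "t < length S" for t
    unfolding sum_emb[OF S_sub] Fv using \<beta>(2) that by simp
  have r2: "res' $ i = mvf n (fn_of_mat A) (\<lambda>i. x' $ i - xs $ i) i" if "i < n" for i
  proof -
    have "res' $ i = mvf n (fn_of_mat R) z i - mvf n (fn_of_mat R) v i"
      unfolding r1[OF that] mvf_diff ..
    moreover have "mvf n (fn_of_mat R) z i = mvf n (fn_of_mat A) z i"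
      using resA[OF that] resR[OF that] by simp
    moreover have "mvf n (fn_of_mat A) (emb S \<beta>) i = mvf n (fn_of_mat A) v i - mvf n (fn_of_mat R) v i"
      using mvf_A[OF that, of v] mvf_A[OF that, of "emb S \<beta>"] mvf_R_emb_S[OF that] FS\<beta> by simp
    ultimately show ?thesis using z'[of "fn_of_mat A" i] by linarith
  qed
  have r3: "res' $ s = 0" if "s \<in> set S" for s
  proof -
    obtain u where "u < length S" "S ! u = s" using \<open>s \<in> set S\<close> by (auto simp: in_set_conv_nth)
    then show ?thesis using r1[of s] mvf_R_S[of u] S_nth[of u] by simp
  qed
  show inv': "sc_inv xs (sc_upd A S F (x, res) js)"
    unfolding st' sc_inv_def using r2 r3 by (simp add: x' res')
  assume w: "\<forall>i. i \<notin> set js \<longrightarrow> w i = 0"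
  define u where "u = (\<lambda>i. z i - v i)"
  have Ru_J: "mvf n (fn_of_mat R) u (J ! a) = 0" if "a < length J" for a
  proof -
    have "mvf n (fn_of_mat R) v (J ! a) = res $ (J ! a)"
      unfolding v_def mvf_emb[OF J(1)] using al that by (simp add: is_alpha_def mvf_def)
    then show ?thesis using resR[OF Jn[OF that]] by (simp add: u_def mvf_diff)
  qed
  have "err xs (sc_upd A S F (x, res) js) = ip n (\<lambda>i. x' $ i - xs $ i) (mvf n (fn_of_mat R) (\<lambda>i. x' $ i - xs $ i))"
    using sc_inv_err(2)[OF inv'[unfolded st']] by (simp add: st')
  also have "\<dots> = ip n (\<lambda>i. u i + emb S \<beta> i) (mvf n (fn_of_mat R) u)"
  proof (rule ip_cong)
    fix i assume i: "i < n"
    show "x' $ i - xs $ i = u i + emb S \<beta> i" using i by (simp add: x' neg u_def z_def)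
    show "mvf n (fn_of_mat R) (\<lambda>i. x' $ i - xs $ i) i = mvf n (fn_of_mat R) u i"
      unfolding z' mvf_R_emb_S[OF i] by (simp add: u_def mvf_diff)
  qed
  also have "\<dots> = ip n u (mvf n (fn_of_mat R) u)"
  proof -
    have "ip n (mvf n (fn_of_mat R) u) (emb S \<beta>) = 0"
      unfolding ip_emb[OF S_sub] using mvf_R_S by (intro sum.neutral) simp
    then show ?thesis by (simp add: ip_add_left ip_comm[of n "emb S \<beta>" "mvf n (fn_of_mat R) u"])
  qed
  also have "\<dots> \<le> ip n (\<lambda>i. z i - w i) (mvf n (fn_of_mat R) (\<lambda>i. z i - w i))"
  proof -
    define d where "d = (\<lambda>i. v i - w i)"
    have zw: "(\<lambda>i. z i - w i) = (\<lambda>i. u i + d i)" by (simp add: d_def u_def fun_eq_iff)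
    have "d = emb J (vec (length J) (\<lambda>t. d (J ! t)))"
    proof (rule emb_surj[OF _ J(2)])
      fix i assume "i \<notin> set J"
      then show "d i = 0" using w by (simp add: d_def v_def emb_not_in J_def)
    qed
    then have "ip n (mvf n (fn_of_mat R) u) d = ip n (mvf n (fn_of_mat R) u) (emb J (vec (length J) (\<lambda>t. d (J ! t))))"
      by (rule arg_cong)
    also have "\<dots> = 0"
      unfolding ip_emb[OF J(1)] using Ru_J by (intro sum.neutral) simp
    finally have 0: "ip n (mvf n (fn_of_mat R) u) d = 0" .
    have "ip n u (mvf n (fn_of_mat R) d) = 0" unfolding ip_mvf_sym[OF symR] by (rule 0)
    moreover have "0 \<le> ip n d (mvf n (fn_of_mat R) d)" using psd_R by (simp add: psdf_def)
    moreover have "ip n d (mvf n (fn_of_mat R) u) = 0" using 0 by (simp add: ip_comm)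
    ultimately show ?thesis unfolding zw by (simp add: ip_add_left ip_add_right mvf_add)
  qed
  finally show "err xs (sc_upd A S F (x, res) js) \<le> ip n (\<lambda>i. (x $ i - xs $ i) - w i) (mvf n (fn_of_mat R) (\<lambda>i. (x $ i - xs $ i) - w i))"
    by (simp add: z_def)
qed

end

lemma index_pmf_cong: "(\<And>j. j < n \<Longrightarrow> w j = w' j) \<Longrightarrow> index_pmf n w = index_pmf n w'"
proof -
  assume w: "\<And>j. j < n \<Longrightarrow> w j = w' j"
  then have "(\<Sum>i<n. w i) = (\<Sum>i<n. w' i)" by simp
  moreover have "map (\<lambda>j. (j, w j / s)) [0..<n] = map (\<lambda>j. (j, w' j / s)) [0..<n]" for s
    using w by simp
  moreover have "(\<forall>j<n. 0 \<le> w j) \<longleftrightarrow> (\<forall>j<n. 0 \<le> w' j)" using w by auto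
  ultimately show ?thesis unfolding index_pmf_def by (simp only:)
qed

context rpc_output
begin

lemma scrcd_step_R:
  "scrcd_step A l S F st = (if R = 0\<^sub>m n n then return_pmf st
     else map_pmf (sc_upd A S F st) (replicate_pmf l (index_pmf n (\<lambda>j. R $$ (j, j)))))"
proof -
  have dA: "dim_row A = n" using A by simp
  have s: "(\<Sum>j<n. scrcd_weight A S F j) = (\<Sum>j<n. R $$ (j, j))"
    by (intro sum.cong refl scrcd_weight_eq) simp
  have "(\<Sum>j<n. R $$ (j, j)) = 0 \<longleftrightarrow> R = 0\<^sub>m n n"
    using psdf_trace_pos[OF psd_R R_carrier] by fastforce
  moreover have "index_pmf n (scrcd_weight A S F) = index_pmf n (\<lambda>j. R $$ (j, j))"
    by (intro index_pmf_cong scrcd_weight_eq)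
  ultimately show ?thesis by (simp add: scrcd_step_eq Let_def dA s)
qed

lemma set_index_pmf_R:
  assumes "R \<noteq> 0\<^sub>m n n"
  shows "set_pmf (index_pmf n (\<lambda>j. R $$ (j, j))) \<subseteq> {..<n}"
  using set_index_pmf[of n "\<lambda>j. R $$ (j, j)"] psdf_diag_nonneg[OF psd_R] psdf_trace_pos[OF psd_R R_carrier assms]
  by auto

text \<open>The zero displacement is a competitor of the block step, so the error does not grow,
  whatever is drawn.\<close>

lemma sc_step_support:
  assumes "sc_inv xs st" "st' \<in> set_pmf (scrcd_step A l S F st)"
  shows "sc_inv xs st' \<and> err xs st' \<le> err xs st"
proof (cases "R = 0\<^sub>m n n")
  case True
  then show ?thesis using assms by (simp add: scrcd_step_R)
next
  case False
  then obtain js where js: "js \<in> set_pmf (replicate_pmf l (index_pmf n (\<lambda>j. R $$ (j, j))))" "st' = sc_upd A S F st js"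
    using assms(2) by (auto simp: scrcd_step_R)
  then have sub: "set js \<subseteq> {..<n}"
    using set_index_pmf_R[OF False] by (auto simp: set_replicate_pmf)
  obtain x res where st: "st = (x, res)" by (cases st)
  show ?thesis
    using sc_upd_props(1)[OF assms(1)[unfolded st] sub] sc_upd_props(2)[OF assms(1)[unfolded st] sub, of "\<lambda>_. 0"]
      sc_inv_err(2)[OF assms(1)[unfolded st]]
    unfolding js(2) st by simp
qed

lemma sc_iter_support:
  assumes "sc_inv xs st" "st' \<in> set_pmf (scrcd_iter k A l S F st)"
  shows "sc_inv xs st' \<and> err xs st' \<le> err xs st"
  using assms
proof (induction k arbitrary: st)
  case 0
  then show ?case by simp
next
  case (Suc k)
  from Suc.prems(2) obtain st1 where st1: "st1 \<in> set_pmf (scrcd_step A l S F st)" "st' \<in> set_pmf (scrcd_iter k A l S F st1)"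
    unfolding scrcd_iter.simps set_bind_pmf by blast
  from sc_step_support[OF Suc.prems(1) st1(1)] Suc.IH[OF _ st1(2)] show ?case by auto
qed

lemma finite_set_scrcd_step: "finite (set_pmf (scrcd_step A l S F st))"
  by (simp add: scrcd_step_R finite_set_replicate_pmf finite_set_index_pmf)

lemma finite_set_scrcd_iter: "finite (set_pmf (scrcd_iter k A l S F st))"
  by (induction k arbitrary: st) (auto simp: finite_set_scrcd_step)

text \<open>Repeated draws do not spoil the exponent: removing duplicates leaves the set of
  admissible coordinates unchanged, so a block counts as \<open>l\<close> single steps even if it
  has fewer than \<open>l\<close> distinct indices.\<close>

lemma sc_iter_expectation:
  assumes psd: "psd n A" and inv: "sc_inv xs st" and R: "R \<noteq> 0\<^sub>m n n"
  defines "c \<equiv> 1 - lambda_min_pos A / (\<Sum>i<n. R $$ (i, i))"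
  shows "measure_pmf.expectation (scrcd_iter k A l S F st) (err xs) \<le> c ^ (l * k) * err xs st" and "0 \<le> c"
proof -
  let ?p = "replicate_pmf l (index_pmf n (\<lambda>j. R $$ (j, j)))" and ?M = "fn_of_mat R"
  note \<tau> = psdf_trace_pos[OF psd_R R_carrier R]
  note cd = coord_descent_expectation[OF psd_R \<tau> lambda_min_residual[OF psd], folded c_def]
  show c0: "0 \<le> c" by (rule cd(2))
  have step: "measure_pmf.expectation (scrcd_step A l S F st) (err xs) \<le> c ^ l * err xs st" if inv: "sc_inv xs st" for st
  proof -
    obtain x res where st: "st = (x, res)" by (cases st)
    define z where "z = (\<lambda>i. x $ i - xs $ i)"
    have "measure_pmf.expectation (scrcd_step A l S F st) (err xs) = measure_pmf.expectation ?p (\<lambda>js. err xs (sc_upd A S F st js))"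
      using R by (simp add: scrcd_step_R)
    also have "\<dots> \<le> measure_pmf.expectation ?p (\<lambda>js. ip n (foldl (coord_descent n ?M) z js) (mvf n ?M (foldl (coord_descent n ?M) z js)))"
    proof (rule expectation_mono_finite)
      fix js assume "js \<in> set_pmf ?p"
      then have sub: "set js \<subseteq> {..<n}" using set_index_pmf_R[OF R] by (auto simp: set_replicate_pmf)
      obtain w where w: "foldl (coord_descent n ?M) z js = (\<lambda>i. z i - w i)" "\<forall>i. i \<notin> set js \<longrightarrow> w i = 0"
        using coord_descent_support[of n ?M z js] by blast
      show "err xs (sc_upd A S F st js) \<le> ip n (foldl (coord_descent n ?M) z js) (mvf n ?M (foldl (coord_descent n ?M) z js))"
        using sc_upd_props(2)[OF inv[unfolded st] sub w(2)] unfolding w(1) st by (simp add: z_def)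
    qed (simp add: finite_set_replicate_pmf finite_set_index_pmf)
    also have "\<dots> \<le> c ^ l * ip n z (mvf n ?M z)" by (rule cd(1))
    also have "ip n z (mvf n ?M z) = err xs st"
      unfolding st z_def by (rule sc_inv_err(2)[OF inv[unfolded st], symmetric])
    finally show ?thesis .
  qed
  show "measure_pmf.expectation (scrcd_iter k A l S F st) (err xs) \<le> c ^ (l * k) * err xs st"
    using inv
  proof (induction k arbitrary: st)
    case 0
    then show ?case by simp
  next
    case (Suc k)
    have "measure_pmf.expectation (scrcd_iter (Suc k) A l S F st) (err xs)
      = measure_pmf.expectation (scrcd_step A l S F st) (\<lambda>st1. measure_pmf.expectation (scrcd_iter k A l S F st1) (err xs))"
      unfolding scrcd_iter.simps by (intro expectation_bind_finite finite_set_scrcd_step finite_set_scrcd_iter)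
    also have "\<dots> \<le> measure_pmf.expectation (scrcd_step A l S F st) (\<lambda>st1. c ^ (l * k) * err xs st1)"
      using sc_step_support[OF Suc.prems] by (intro expectation_mono_finite finite_set_scrcd_step Suc.IH) auto
    also have "\<dots> = c ^ (l * k) * measure_pmf.expectation (scrcd_step A l S F st) (err xs)" by simp
    also have "\<dots> \<le> c ^ (l * k) * (c ^ l * err xs st)"
      using c0 by (intro mult_left_mono step Suc.prems) simp
    also have "\<dots> = c ^ (l * Suc k) * err xs st" by (simp add: power_add mult_ac)
    finally show ?case .
  qed
qed

text \<open>The two triangular solves compose to the equation with matrix \<open>FS FS^T\<close>,
  which is the block of \<open>A\<close> at the pivots, so the initial residual vanishes there.
  Consistency expresses the residual as \<open>A\<close> applied to the error.\<close>

lemma sc_init_inv: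
  assumes xs: "xs \<in> carrier_vec n" "A *\<^sub>v xs = b"
  shows "sc_inv xs (scrcd_init A b S F)"
proof -
  define y where "y = L *\<^sub>v subvec b S"
  define \<beta> where "\<beta> = L\<^sup>T *\<^sub>v y"
  have d: "dim_vec (subvec b S) = length S" "dim_vec y = length S" "dim_vec \<beta> = length S"
    using L_props(1) by (auto simp: subvec_def y_def \<beta>_def)
  have dA: "dim_row A = n" using A by simp
  have Si: "scrcd_init A b S F = (add_at (0\<^sub>v n) S \<beta>, cols_of A S *\<^sub>v \<beta> - b)"
    unfolding scrcd_init_def Let_def dA rows_of_F FS_def[symmetric] L_def[symmetric] y_def[symmetric] \<beta>_def[symmetric] ..
  have CS: "submat A [0..<n] S \<in> carrier_mat n (length S)" by (intro carrier_matI) auto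
  have db: "dim_vec b = n" using assms A by auto
  have bi: "b $ i = mvf n (fn_of_mat A) (fn_of_vec xs) i" if "i < n" for i
    unfolding xs(2)[symmetric] by (rule mult_mat_vec_index[OF A _ that]) (use xs in auto)
  have r1: "(submat A [0..<n] S *\<^sub>v \<beta>) $ i = mvf n (fn_of_mat A) (emb S \<beta>) i" if "i < n" for i
    unfolding mult_mat_vec_index[OF CS d(3) that] mvf_emb[OF S_sub] mvf_def[of "length S"]
    using that by (intro sum.cong refl) (simp add: submat_def)
  have "mvf n (fn_of_mat A) (emb S \<beta>) (S ! t) = b $ (S ! t)" if t: "t < length S" for t
  proof -
    have "mvf n (fn_of_mat A) (emb S \<beta>) (S ! t) = (\<Sum>v<length S. F $$ (S ! t, v) * (\<Sum>u<length S. F $$ (S ! u, v) * \<beta> $ u))"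
      unfolding mvf_A[OF S_nth[OF t], of "emb S \<beta>"] mvf_R_S[OF t] sum_emb[OF S_sub] by simp
    also have "\<dots> = (\<Sum>v<length S. F $$ (S ! t, v) * y $ v)"
      unfolding \<beta>_def by (intro sum.cong refl) (simp add: LT_solves[OF d(2)])
    also have "\<dots> = b $ (S ! t)"
      unfolding y_def L_solves[OF d(1) t] using t by (simp add: subvec_def)
    finally show ?thesis .
  qed
  then have "mvf n (fn_of_mat A) (emb S \<beta>) s = b $ s" if "s \<in> set S" for s
    using that by (metis in_set_conv_nth)
  moreover have "s < n" if "s \<in> set S" for s using S_sub that by auto
  ultimately have r2: "(submat A [0..<n] S *\<^sub>v \<beta> - b) $ s = 0" if "s \<in> set S" for s
    using that r1 db by (simp del: index_mult_mat_vec)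
  have "(submat A [0..<n] S *\<^sub>v \<beta> - b) $ i = mvf n (fn_of_mat A) (\<lambda>j. add_at (0\<^sub>v n) S \<beta> $ j - xs $ j) i" if i: "i < n" for i
  proof -
    have "mvf n (fn_of_mat A) (\<lambda>j. add_at (0\<^sub>v n) S \<beta> $ j - xs $ j) i = mvf n (fn_of_mat A) (\<lambda>j. emb S \<beta> j - xs $ j) i"
      by (rule mvf_cong) (simp add: add_at_index)
    also have "\<dots> = mvf n (fn_of_mat A) (emb S \<beta>) i - b $ i"
      unfolding mvf_diff bi[OF i] ..
    finally show ?thesis using r1[OF i] i db by (simp del: index_mult_mat_vec)
  qed
  then show ?thesis
    unfolding Si sc_inv_def dA using r2 db by simp
qed

lemma energy_err:
  assumes psd: "psd n A" and "xs \<in> carrier_vec n" "dim_vec x = n"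
  shows "(energy_norm A (x - xs))\<^sup>2 = err xs (x, res)"
proof -
  have "(energy_norm A (x - xs))\<^sup>2 = ip n (fn_of_vec (x - xs)) (mvf n (fn_of_mat A) (fn_of_vec (x - xs)))"
    by (rule energy_norm_sq[OF psd]) (use assms in auto)
  also have "\<dots> = err xs (x, res)"
    unfolding err_def fst_conv using assms by (intro ip_cong mvf_cong) auto
  finally show ?thesis .
qed

lemma err_nonneg: "psd n A \<Longrightarrow> 0 \<le> err xs st"
  using psd_psdf[of n A] by (simp add: err_def psdf_def)

text \<open>The unconditional bound \<open>1\<close> covers the event of a large residual.\<close>

lemma relative_error_bound:
  assumes psd: "psd n A" and xs: "xs \<in> carrier_vec n" "A *\<^sub>v xs = b" and \<epsilon>: "0 < \<epsilon>"
    and lam: "0 < lambda_min_pos A"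
  shows "(\<integral>\<^sup>+ (x, res). ennreal ((energy_norm A (x - xs))\<^sup>2) / ennreal ((energy_norm A (fst (scrcd_init A b S F) - xs))\<^sup>2)
      \<partial>measure_pmf (scrcd_iter k A l S F (scrcd_init A b S F)))
    \<le> (if (\<Sum>i<n. R $$ (i, i)) * ln (2 / \<epsilon>) \<le> real (l * k) * lambda_min_pos A then ennreal (\<epsilon> / 2) else 1)"
    (is "?I \<le> ?bound")
proof -
  define st where "st = scrcd_init A b S F"
  let ?p = "scrcd_iter k A l S F st"
  define e where "e = err xs st"
  have inv: "sc_inv xs st" unfolding st_def by (rule sc_init_inv[OF xs])
  have e0: "0 \<le> e" unfolding e_def by (rule err_nonneg[OF psd])
  have dim: "dim_vec (fst st') = n" if "sc_inv xs st'" for st'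
    using that by (auto simp: sc_inv_def split: prod.splits)
  have supp: "sc_inv xs st'" "err xs st' \<le> e" if "st' \<in> set_pmf ?p" for st'
    using sc_iter_support[OF inv that] by (auto simp: e_def)
  have nrm: "(energy_norm A (fst st' - xs))\<^sup>2 = err xs st'" if "sc_inv xs st'" for st'
    using energy_err[OF psd xs(1) dim[OF that], of "snd st'"] by simp
  have I: "?I = (\<integral>\<^sup>+ st'. ennreal (err xs st') / ennreal e \<partial>measure_pmf ?p)"
    unfolding st_def[symmetric] nrm[OF inv] e_def[symmetric]
    using nrm supp by (intro nn_integral_cong_AE AE_pmfI) (auto split: prod.splits simp: case_prod_beta)
  show ?thesis
  proof (cases "e = 0")
    case True
    \<comment> \<open>The error stays 0, and the convention \<open>0 / 0 = 0\<close>
      applies.\<close>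
    have "?I = (\<integral>\<^sup>+ st'. 0 \<partial>measure_pmf ?p)"
      unfolding I
    proof (intro nn_integral_cong_AE AE_pmfI)
      fix st' assume "st' \<in> set_pmf ?p"
      then have "err xs st' = 0" using supp(2) err_nonneg[OF psd, of xs st'] True by fastforce
      then show "ennreal (err xs st') / ennreal e = 0" by simp
    qed
    then show ?thesis by simp
  next
    case False
    then have ep: "0 < e" using e0 by simp
    have "?I = (\<integral>\<^sup>+ st'. ennreal (err xs st' / e) \<partial>measure_pmf ?p)"
      unfolding I using ep by (intro nn_integral_cong) (simp add: divide_ennreal err_nonneg[OF psd])
    also have "\<dots> = ennreal (measure_pmf.expectation ?p (\<lambda>st'. err xs st' / e))"
      using ep by (intro nn_integral_eq_integral integrable_measure_pmf_finite finite_set_scrcd_iter) (auto simp: err_nonneg[OF psd])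
    finally have I2: "?I = ennreal (measure_pmf.expectation ?p (err xs) / e)" by simp
    show ?thesis
    proof (cases "(\<Sum>i<n. R $$ (i, i)) * ln (2 / \<epsilon>) \<le> real (l * k) * lambda_min_pos A")
      case True
      \<comment> \<open>A zero residual matrix would mean a zero initial error.\<close>
      have R: "R \<noteq> 0\<^sub>m n n"
      proof
        assume "R = 0\<^sub>m n n"
        then have "e = 0"
          using sc_inv_err(2)[of xs "fst st" "snd st"] inv unfolding e_def by (simp add: ip_def mvf_def)
        then show False using False by simp
      qed
      note \<tau> = psdf_trace_pos[OF psd_R R_carrier R]
      define \<tau> where "\<tau> = (\<Sum>i<n. R $$ (i, i))"
      define c where "c = 1 - lambda_min_pos A / \<tau>"
      have c: "0 \<le> c" "measure_pmf.expectation ?p (err xs) \<le> c ^ (l * k) * e"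
        using sc_iter_expectation[OF psd inv R] by (auto simp: c_def \<tau>_def e_def)
      \<comment> \<open>\<open>1 - x \<le> exp (- x)\<close>, once for each of the
        \<open>l k\<close> coordinate steps.\<close>
      have "c ^ (l * k) \<le> exp (- (lambda_min_pos A / \<tau>)) ^ (l * k)"
        using c(1) exp_ge_add_one_self[of "- (lambda_min_pos A / \<tau>)"] by (intro power_mono) (auto simp: c_def)
      also have "\<dots> = exp (- (real (l * k) * lambda_min_pos A / \<tau>))"
        by (simp flip: exp_of_nat_mult)
      also have "\<dots> \<le> exp (- ln (2 / \<epsilon>))"
        using True \<tau> unfolding \<tau>_def[symmetric] by (simp add: field_simps)
      also have "\<dots> = \<epsilon> / 2" using \<epsilon> by (simp add: exp_minus)
      finally have "measure_pmf.expectation ?p (err xs) \<le> \<epsilon> / 2 * e"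
        using c(2) ep by (meson mult_right_mono order_trans less_imp_le)
      then have "measure_pmf.expectation ?p (err xs) / e \<le> \<epsilon> / 2"
        using ep by (simp add: pos_divide_le_eq)
      then show ?thesis using True unfolding I2 by (simp add: ennreal_leI)
    next
      case F: False
      have "measure_pmf.expectation ?p (err xs) \<le> measure_pmf.expectation ?p (\<lambda>_. e)"
        using supp(2) by (intro expectation_mono_finite finite_set_scrcd_iter)
      then have "measure_pmf.expectation ?p (err xs) / e \<le> 1" using ep by simp
      then have "ennreal (measure_pmf.expectation ?p (err xs) / e) \<le> ennreal 1" by (rule ennreal_leI)
      then show ?thesis unfolding I2 if_not_P[OF F] by simp
    qed
  qed
qed

end

section \<open>Accuracy of the boosted method\<close>

lemma boost_runs_bound:
  assumes "0 < \<epsilon>" "\<epsilon> < 1"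
  shows "0 < boost_runs \<epsilon>" "(1 / 2) ^ boost_runs \<epsilon> \<le> \<epsilon> / 2"
proof -
  have "0 < log 2 (2 / \<epsilon>)" using assms by simp
  then show "0 < boost_runs \<epsilon>" by (simp add: boost_runs_def)
  have "2 / \<epsilon> = 2 powr log 2 (2 / \<epsilon>)" using assms by simp
  also have "\<dots> \<le> 2 powr real (boost_runs \<epsilon>)"
    by (intro powr_mono) (auto simp: boost_runs_def, linarith)
  also have "\<dots> = 2 ^ boost_runs \<epsilon>" by (simp add: powr_realpow)
  finally show "(1 / 2) ^ boost_runs \<epsilon> \<le> \<epsilon> / 2"
    using assms by (simp add: power_one_over field_simps)
qed

lemma lambda_min_pos_gt_0:
  assumes "psd n A" "A \<noteq> 0\<^sub>m n n"
  shows "0 < lambda_min_pos A"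
proof -
  obtain q e where es: "eigsys n A q e" using psd_eigsys[OF assms(1)] by blast
  have A: "A \<in> carrier_mat n n" using assms(1) by (simp add: psd_def)
  have "(\<Sum>k<n. e k) \<noteq> 0"
    using psdf_trace_pos[OF psd_psdf[OF assms(1)] A assms(2)] eigsys_trace[OF es] by simp
  then have "\<exists>k<n. e k \<noteq> 0" by (metis lessThan_iff sum.neutral)
  then show ?thesis using es unfolding eigsys_def by blast
qed

text \<open>Given the pivots, the expected relative error is at most \<epsilon> / 2 if they are good
  and at most 1 if they are bad; bad pivots have probability at most \<epsilon> / 2.\<close>

lemma scrcd_accuracy:
  assumes psd: "psd n A" and nz: "A \<noteq> 0\<^sub>m n n" and xs: "xs \<in> carrier_vec n" "A *\<^sub>v xs = b"
    and l: "1 \<le> l" and \<epsilon>: "0 < \<epsilon>" "\<epsilon> < 1"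
  shows "(\<integral>\<^sup>+ (S, F, x0, xk).
            ennreal ((energy_norm A (xk - xs))\<^sup>2) / ennreal ((energy_norm A (x0 - xs))\<^sup>2)
          \<partial>measure_pmf (boosted_scrcd A b d l (boost_runs \<epsilon>) (scrcd_iterations A d l \<epsilon>)))
        \<le> ennreal \<epsilon>"
proof -
  define r where "r = approx_rank A d"
  define T where "T = boost_runs \<epsilon>"
  define k where "k = scrcd_iterations A d l \<epsilon>"
  define B where "B = tail_sum A r"
  let ?p = "boosted_rpcholesky A d T"
  let ?bad = "{(S, F). 4 * tail_sum A r < tr (A - nystrom A S)}"
  note r = approx_rank_props[OF psd nz, of d, folded r_def]
  have lam: "0 < lambda_min_pos A" by (rule lambda_min_pos_gt_0[OF psd nz])
  have A: "A \<in> carrier_mat n n" using psd by (simp add: psd_def)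
  have T: "0 < T" "(1 / 2) ^ T \<le> \<epsilon> / 2" unfolding T_def using boost_runs_bound[OF \<epsilon>] by auto
  have ln0: "0 < ln (2 / \<epsilon>)" using \<epsilon> by simp
  \<comment> \<open>\<open>tail_cond\<close> contributes a factor
    \<open>n / (n - r) \<ge> 1\<close>. Dropping it leaves the number of coordinate steps that a
    trace of \<open>4 B\<close> calls for.\<close>
  have k: "4 * B * ln (2 / \<epsilon>) \<le> real (l * k) * lambda_min_pos A"
  proof -
    have "4 * (real n / real l) * (1 / (real n - real r) * (B / lambda_min_pos A)) * ln (2 / \<epsilon>) \<le> real k"
      using A by (simp add: k_def scrcd_iterations_def tail_cond_def r_def B_def) linarith
    then have "real l * (4 * (real n / real l) * (1 / (real n - real r) * (B / lambda_min_pos A)) * ln (2 / \<epsilon>)) * lambda_min_pos A \<le> real l * real k * lambda_min_pos A"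
      using lam l by (intro mult_right_mono mult_left_mono) auto
    moreover have "real l * (4 * (real n / real l) * (1 / (real n - real r) * (B / lambda_min_pos A)) * ln (2 / \<epsilon>)) * lambda_min_pos A
      = (real n / (real n - real r)) * (4 * B * ln (2 / \<epsilon>))"
    proof -
      have "u * (4 * (v / u) * (1 / w * (B / y)) * x) * y = v / w * (4 * B * x)" if "u \<noteq> 0" "y \<noteq> 0" for u v w x y :: real
        using that by (cases "w = 0") (simp_all add: field_simps)
      then show ?thesis using l lam by simp
    qed
    moreover have "1 * (4 * B * ln (2 / \<epsilon>)) \<le> (real n / (real n - real r)) * (4 * B * ln (2 / \<epsilon>))"
      using r(1,2) ln0 by (intro mult_right_mono) (auto simp: B_def field_simps)
    ultimately show ?thesis by simp
  qed
  have "(\<integral>\<^sup>+ (S, F, x0, xk). ennreal ((energy_norm A (xk - xs))\<^sup>2) / ennreal ((energy_norm A (x0 - xs))\<^sup>2)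
          \<partial>measure_pmf (boosted_scrcd A b d l T k))
    = (\<integral>\<^sup>+ (S, F). \<integral>\<^sup>+ (x, res). ennreal ((energy_norm A (x - xs))\<^sup>2) / ennreal ((energy_norm A (fst (scrcd_init A b S F) - xs))\<^sup>2)
      \<partial>measure_pmf (scrcd_iter k A l S F (scrcd_init A b S F)) \<partial>measure_pmf ?p)"
    unfolding boosted_scrcd_def Let_def by (auto intro!: nn_integral_cong simp: case_prod_beta)
  also have "\<dots> \<le> (\<integral>\<^sup>+ SF. ennreal (\<epsilon> / 2) + indicator ?bad SF \<partial>measure_pmf ?p)"
  proof (intro nn_integral_mono_AE AE_pmfI)
    fix SF assume "SF \<in> set_pmf ?p"
    then obtain S F where SF: "SF = (S, F)" "(S, F) \<in> set_pmf ?p" by (cases SF) auto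
    obtain cs R where F: "F = mat_of_cols n cs" and inv: "rpc_inv n A (S, cs, R)"
      using rpcholesky_inv[OF psd boosted_in_rpcholesky[OF SF(2) T(1)]] by blast
    interpret rpc_output n A S cs R F "submat F S [0..<length S]" "inv_mat (submat F S [0..<length S])"
      by (unfold_locales) (use inv A in \<open>simp_all add: F\<close>)
    have "(\<integral>\<^sup>+ (x, res). ennreal ((energy_norm A (x - xs))\<^sup>2) / ennreal ((energy_norm A (fst (scrcd_init A b S F) - xs))\<^sup>2)
      \<partial>measure_pmf (scrcd_iter k A l S F (scrcd_init A b S F)))
      \<le> (if (\<Sum>i<n. R $$ (i, i)) * ln (2 / \<epsilon>) \<le> real (l * k) * lambda_min_pos A then ennreal (\<epsilon> / 2) else 1)"
      using relative_error_bound[OF psd xs \<epsilon>(1) lam] by simp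
    also have "\<dots> \<le> ennreal (\<epsilon> / 2) + indicator ?bad (S, F)"
    proof (cases "(S, F) \<in> ?bad")
      case True
      then show ?thesis using \<epsilon> by (auto simp: add_increasing)
    next
      case False
      then have "(\<Sum>i<n. R $$ (i, i)) \<le> 4 * B" using tr_residual by (simp add: B_def)
      then have "(\<Sum>i<n. R $$ (i, i)) * ln (2 / \<epsilon>) \<le> 4 * B * ln (2 / \<epsilon>)"
        using ln0 by (intro mult_right_mono) auto
      then show ?thesis using k by simp
    qed
    finally show "(case SF of (S, F) \<Rightarrow> \<integral>\<^sup>+ (x, res). ennreal ((energy_norm A (x - xs))\<^sup>2) / ennreal ((energy_norm A (fst (scrcd_init A b S F) - xs))\<^sup>2)
      \<partial>measure_pmf (scrcd_iter k A l S F (scrcd_init A b S F))) \<le> ennreal (\<epsilon> / 2) + indicator ?bad SF"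
      by (simp add: SF(1))
  qed
  also have "\<dots> = ennreal (\<epsilon> / 2) + ennreal (measure_pmf.prob ?p ?bad)"
    by (subst nn_integral_add) (auto simp: measure_pmf.emeasure_eq_measure)
  also have "\<dots> \<le> ennreal (\<epsilon> / 2) + ennreal (\<epsilon> / 2)"
    using boosted_residual_prob[OF psd r T(1)] T(2) by (intro add_left_mono ennreal_leI) linarith
  also have "\<dots> = ennreal \<epsilon>" using \<epsilon> by (simp flip: ennreal_plus)
  finally show ?thesis by (simp add: T_def k_def)
qed

section \<open>A program logic for the cost model\<close>

text \<open>The law of a loop, with the kernel of the last pass composed at the end, in the order in
  which a loop invariant advances.\<close>

primrec iterp :: "(nat \<Rightarrow> 'b \<Rightarrow> 'b pmf) \<Rightarrow> nat \<Rightarrow> 'b \<Rightarrow> 'b pmf" where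
  "iterp g 0 x = return_pmf x"
| "iterp g (Suc i) x = bind_pmf (iterp g i x) (g i)"

lemma iterp_return: "iterp (\<lambda>_ _. return_pmf x) N x = return_pmf x"
  by (induction N) (auto simp: bind_return_pmf)

lemma run_For:
  "run A b (For v e c) s =
     iterp (\<lambda>i s'. run A b c (charge 1 0 (set_reg v i s'))) (ival e s) (charge (1 + icost e) 0 s)"
proof -
  have "fold (\<lambda>i m. bind_pmf m (\<lambda>s'. run A b c (charge 1 0 (set_reg v i s')))) [0..<N] (return_pmf t)
    = iterp (\<lambda>i s'. run A b c (charge 1 0 (set_reg v i s'))) N t" for N t
    by (induction N) auto
  then show ?thesis by simp
qed

lemma store_simps [simp]:
  "regs (charge w e s) = regs s" "idxs (charge w e s) = idxs s" "cells (charge w e s) = cells s"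
  "ops (charge w e s) = ops s + w" "evals (charge w e s) = evals s + e"
  "used_idxs (charge w e s) = used_idxs s" "used_cells (charge w e s) = used_cells s"
  "regs (set_reg v m s) = (regs s)(v := m)" "idxs (set_reg v m s) = idxs s" "cells (set_reg v m s) = cells s"
  "ops (set_reg v m s) = ops s" "evals (set_reg v m s) = evals s"
  "used_idxs (set_reg v m s) = used_idxs s" "used_cells (set_reg v m s) = used_cells s"
  "regs (set_idx a i m s) = regs s" "idxs (set_idx a i m s) = (idxs s)(a := (idxs s a)(i := m))" "cells (set_idx a i m s) = cells s"
  "ops (set_idx a i m s) = ops s" "evals (set_idx a i m s) = evals s"
  "used_idxs (set_idx a i m s) = insert (a, i) (used_idxs s)" "used_cells (set_idx a i m s) = used_cells s"
  "regs (set_cell a i j y s) = regs s" "idxs (set_cell a i j y s) = idxs s"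
  "cells (set_cell a i j y s) = (cells s)(a := (cells s a)(i := (cells s a i)(j := y)))"
  "ops (set_cell a i j y s) = ops s" "evals (set_cell a i j y s) = evals s"
  "used_idxs (set_cell a i j y s) = used_idxs s" "used_cells (set_cell a i j y s) = insert (a, i, j) (used_cells s)"
  by (simp_all add: charge_def set_reg_def set_idx_def set_cell_def)

primrec wregs :: "com \<Rightarrow> nat set" where
  "wregs Skip = {}"
| "wregs (Seq c c') = wregs c \<union> wregs c'"
| "wregs (SetReg v e) = {v}"
| "wregs (SetIdx a e f) = {}"
| "wregs (SetCell a e f p) = {}"
| "wregs (Sample v a e) = {v}"
| "wregs (IfLess p q c c') = wregs c \<union> wregs c'"
| "wregs (IfIdxLess e f c c') = wregs c \<union> wregs c'"
| "wregs (For v e c) = insert v (wregs c)"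

primrec widxs :: "com \<Rightarrow> nat set" where
  "widxs Skip = {}"
| "widxs (Seq c c') = widxs c \<union> widxs c'"
| "widxs (SetReg v e) = {}"
| "widxs (SetIdx a e f) = {a}"
| "widxs (SetCell a e f p) = {}"
| "widxs (Sample v a e) = {}"
| "widxs (IfLess p q c c') = widxs c \<union> widxs c'"
| "widxs (IfIdxLess e f c c') = widxs c \<union> widxs c'"
| "widxs (For v e c) = widxs c"

primrec wcells :: "com \<Rightarrow> nat set" where
  "wcells Skip = {}"
| "wcells (Seq c c') = wcells c \<union> wcells c'"
| "wcells (SetReg v e) = {}"
| "wcells (SetIdx a e f) = {}"
| "wcells (SetCell a e f p) = {a}"
| "wcells (Sample v a e) = {}"
| "wcells (IfLess p q c c') = wcells c \<union> wcells c'"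
| "wcells (IfIdxLess e f c c') = wcells c \<union> wcells c'"
| "wcells (For v e c) = wcells c"

definition agree :: "nat set \<Rightarrow> nat set \<Rightarrow> nat set \<Rightarrow> store \<Rightarrow> store \<Rightarrow> bool" where
  "agree V I C s s' \<longleftrightarrow> (\<forall>v. v \<notin> V \<longrightarrow> regs s' v = regs s v) \<and> (\<forall>a. a \<notin> I \<longrightarrow> idxs s' a = idxs s a) \<and>
     (\<forall>a. a \<notin> C \<longrightarrow> cells s' a = cells s a)"

lemma agree_trans: "agree V I C s s' \<Longrightarrow> agree V' I' C' s' s'' \<Longrightarrow> agree (V \<union> V') (I \<union> I') (C \<union> C') s s''"
  by (simp add: agree_def)

abbreviation frame :: "com \<Rightarrow> store \<Rightarrow> store \<Rightarrow> bool" where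
  "frame c \<equiv> agree (wregs c) (widxs c) (wcells c)"

text \<open>What a command never names as a target is preserved. The sequencing and loop rules pass
  this fact on, so specifications of commands speak only of what changes.\<close>

lemma run_frame: "s' \<in> set_pmf (run A b c s) \<Longrightarrow> frame c s s'"
proof (induction c arbitrary: s s')
  case (Seq c c')
  from Seq.prems obtain s1 where "s1 \<in> set_pmf (run A b c s)" "s' \<in> set_pmf (run A b c' s1)"
    by auto
  with Seq.IH have "frame c s s1" "frame c' s1 s'" by blast+
  then show ?case by (auto dest: agree_trans)
next
  case (IfLess p q c c')
  then have "frame c (charge (1 + rcost p + rcost q) (entry_count p + entry_count q) s) s'
    \<or> frame c' (charge (1 + rcost p + rcost q) (entry_count p + entry_count q) s) s'"
    by (auto split: if_splits)
  then show ?case by (auto simp: agree_def)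
next
  case (IfIdxLess e f c c')
  then have "frame c (charge (1 + icost e + icost f) 0 s) s' \<or> frame c' (charge (1 + icost e + icost f) 0 s) s'"
    by (auto split: if_splits)
  then show ?case by (auto simp: agree_def)
next
  case (For v e c)
  have "s' \<in> set_pmf (iterp (\<lambda>i s'. run A b c (charge 1 0 (set_reg v i s'))) N (charge (1 + icost e) 0 s)) \<Longrightarrow> frame (For v e c) s s'" for N
  proof (induction N arbitrary: s')
    case 0
    then show ?case by (simp add: agree_def)
  next
    case (Suc N)
    then obtain s1 where s1: "frame (For v e c) s s1" "s' \<in> set_pmf (run A b c (charge 1 0 (set_reg v N s1)))"
      by auto
    from For.IH[OF s1(2)] s1(1) show ?case by (auto simp: agree_def)
  qed
  then show ?case using For.prems unfolding run_For by blast
qed (auto simp: agree_def)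

text \<open>\<open>UI\<close> and \<open>UC\<close> are the positions that may be written, fixed in
  advance. Storage is bounded by the size of these sets, so that no rule has to count
  positions.\<close>

locale machine =
  fixes A :: "real mat" and b :: "real vec" and UI :: "(nat \<times> nat) set" and UC :: "(nat \<times> nat \<times> nat) set"
begin

definition costs :: "nat \<Rightarrow> nat \<Rightarrow> store \<Rightarrow> store \<Rightarrow> bool" where
  "costs w e s s' \<longleftrightarrow> ops s' \<le> ops s + w \<and> evals s' \<le> evals s + e \<and>
     used_idxs s' \<subseteq> used_idxs s \<union> UI \<and> used_cells s' \<subseteq> used_cells s \<union> UC"

text \<open>Running \<open>c\<close> from \<open>s\<close> couples with the law \<open>\<mu>\<close> so that \<open>Q\<close> holds, at the cost of at most \<open>w\<close> operations and
  \<open>e\<close> entry evaluations, writing only to positions in \<open>UI\<close> and \<open>UC\<close>.\<close>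

definition rt :: "com \<Rightarrow> store \<Rightarrow> nat \<Rightarrow> nat \<Rightarrow> 'b pmf \<Rightarrow> (store \<Rightarrow> 'b \<Rightarrow> bool) \<Rightarrow> bool" where
  "rt c s w e \<mu> Q \<longleftrightarrow> rel_pmf (\<lambda>s' x. costs w e s s' \<and> Q s' x) (run A b c s) \<mu>"

definition dt :: "com \<Rightarrow> store \<Rightarrow> nat \<Rightarrow> nat \<Rightarrow> (store \<Rightarrow> bool) \<Rightarrow> bool" where
  "dt c s w e Q \<longleftrightarrow> (\<forall>s'\<in>set_pmf (run A b c s). costs w e s s' \<and> Q s')"

text \<open>Through one-point laws, sequencing and loops are proved once, for couplings, and
  specialize to the triples \<open>dt\<close>.\<close>

lemma rt_return_iff: "rt c s w e (return_pmf x) Q \<longleftrightarrow> dt c s w e (\<lambda>s'. Q s' x)"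
  by (simp add: rt_def dt_def rel_pmf_return_pmf2)

lemma costs_trans: "costs w e s s' \<Longrightarrow> costs w' e' s' s'' \<Longrightarrow> costs (w + w') (e + e') s s''"
  by (auto simp: costs_def)

lemma costs_mono: "costs w e s s' \<Longrightarrow> w \<le> w' \<Longrightarrow> e \<le> e' \<Longrightarrow> costs w' e' s s'"
  by (auto simp: costs_def)

lemma rt_conseq:
  assumes "rt c s w e \<mu> P" "\<And>s' x. P s' x \<Longrightarrow> frame c s s' \<Longrightarrow> x \<in> set_pmf \<mu> \<Longrightarrow> Q s' x" "w \<le> w'" "e \<le> e'"
  shows "rt c s w' e' \<mu> Q"
  using assms(1) unfolding rt_def
  by (rule pmf.rel_mono_strong) (use assms(2-4) run_frame costs_mono in blast)

lemma rt_map: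
  assumes "rt c s w e \<mu> P" "\<And>s' x. P s' x \<Longrightarrow> Q s' (h x)"
  shows "rt c s w e (map_pmf h \<mu>) Q"
  using assms(1) unfolding rt_def pmf.rel_map
  by (rule pmf.rel_mono_strong) (use assms(2) in blast)

text \<open>Couplings compose along the binding of laws. The continuation also learns that
  \<open>x\<close> lies in the support of \<open>\<mu>\<close>, for instance that a drawn pivot has
  positive weight.\<close>

lemma rt_Seq:
  assumes c: "rt c s w1 e1 \<mu> P"
    and c': "\<And>s' x. P s' x \<Longrightarrow> frame c s s' \<Longrightarrow> x \<in> set_pmf \<mu> \<Longrightarrow> rt c' s' w2 e2 (f x) Q"
    and "w1 + w2 \<le> w" "e1 + e2 \<le> e"
  shows "rt (Seq c c') s w e (bind_pmf \<mu> f) Q"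
proof -
  have "rel_pmf (\<lambda>s' x. costs w1 e1 s s' \<and> P s' x \<and> frame c s s' \<and> x \<in> set_pmf \<mu>) (run A b c s) \<mu>"
    using c unfolding rt_def by (rule pmf.rel_mono_strong) (use run_frame in blast)
  then show ?thesis
    unfolding rt_def run.simps
  proof (rule rel_pmf_bindI)
    fix s' x assume *: "costs w1 e1 s s' \<and> P s' x \<and> frame c s s' \<and> x \<in> set_pmf \<mu>"
    then have "rt c' s' w2 e2 (f x) Q" using c' by blast
    then show "rel_pmf (\<lambda>s' x. costs w e s s' \<and> Q s' x) (run A b c' s') (f x)"
      unfolding rt_def
      by (rule pmf.rel_mono_strong) (use * assms(3,4) costs_trans costs_mono in blast)
  qed
qed

lemma rt_Seq_dt:
  assumes c: "dt c s w1 e1 P"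
    and c': "\<And>s'. P s' \<Longrightarrow> frame c s s' \<Longrightarrow> rt c' s' w2 e2 \<mu> Q"
    and "w1 + w2 \<le> w" "e1 + e2 \<le> e"
  shows "rt (Seq c c') s w e \<mu> Q"
proof -
  have "rt (Seq c c') s w e (bind_pmf (return_pmf ()) (\<lambda>_. \<mu>)) Q"
    by (rule rt_Seq[where P = "\<lambda>s' _. P s'" and ?w1.0 = w1 and ?w2.0 = w2 and ?e1.0 = e1 and ?e2.0 = e2])
      (use assms in \<open>auto simp: rt_return_iff\<close>)
  then show ?thesis by (simp add: bind_return_pmf)
qed

lemma dt_conseq:
  assumes "dt c s w e P" "\<And>s'. P s' \<Longrightarrow> frame c s s' \<Longrightarrow> Q s'" "w \<le> w'" "e \<le> e'"
  shows "dt c s w' e' Q"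
  using assms run_frame costs_mono unfolding dt_def by blast

lemma dt_Seq:
  assumes c: "dt c s w1 e1 P"
    and c': "\<And>s'. P s' \<Longrightarrow> frame c s s' \<Longrightarrow> dt c' s' w2 e2 Q"
    and "w1 + w2 \<le> w" "e1 + e2 \<le> e"
  shows "dt (Seq c c') s w e Q"
  using rt_Seq_dt[of c s w1 e1 P c' w2 e2 "return_pmf ()" "\<lambda>s' _. Q s'" w e] assms by (simp add: rt_return_iff)

lemma dt_Skip: "Q s \<Longrightarrow> dt Skip s w e Q"
  by (simp add: dt_def costs_def)

lemma dt_SetReg: "Q (charge (1 + icost f) 0 (set_reg v (ival f s) s)) \<Longrightarrow> 1 + icost f \<le> w \<Longrightarrow> dt (SetReg v f) s w e Q"
  by (auto simp: dt_def costs_def)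

lemma dt_SetIdx:
  "Q (charge (1 + icost f + icost g) 0 (set_idx a (ival f s) (ival g s) s)) \<Longrightarrow> (a, ival f s) \<in> UI \<Longrightarrow>
   1 + icost f + icost g \<le> w \<Longrightarrow> dt (SetIdx a f g) s w e Q"
  by (auto simp: dt_def costs_def)

lemma dt_SetCell:
  "Q (charge (1 + icost f + icost g + rcost p) (entry_count p) (set_cell a (ival f s) (ival g s) (rval A b p s) s)) \<Longrightarrow>
   (a, ival f s, ival g s) \<in> UC \<Longrightarrow> 1 + icost f + icost g + rcost p \<le> w \<Longrightarrow> entry_count p \<le> e \<Longrightarrow> dt (SetCell a f g p) s w e Q"
  by (auto simp: dt_def costs_def)

lemma rt_Sample:
  assumes "\<And>j. j \<in> set_pmf (index_pmf (ival f s) (\<lambda>j. cells s a j 0)) \<Longrightarrow>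
      Q (charge (1 + icost f + ival f s) 0 (set_reg v j s)) j"
    and "1 + icost f + ival f s \<le> w"
  shows "rt (Sample v a f) s w e (index_pmf (ival f s) (\<lambda>j. cells s a j 0)) Q"
  unfolding rt_def run.simps pmf.rel_map
  by (rule rel_pmf_reflI) (use assms in \<open>auto simp: costs_def\<close>)

lemma rt_IfLess:
  fixes p q s
  defines "s0 \<equiv> charge (1 + rcost p + rcost q) (entry_count p + entry_count q) s"
  assumes "rval A b p s < rval A b q s \<Longrightarrow> rt c s0 w1 e1 \<mu> Q"
    and "\<not> rval A b p s < rval A b q s \<Longrightarrow> rt c' s0 w1 e1 \<mu> Q"
    and "1 + rcost p + rcost q + w1 \<le> w" "entry_count p + entry_count q + e1 \<le> e"
  shows "rt (IfLess p q c c') s w e \<mu> Q"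
proof -
  let ?c = "if rval A b p s < rval A b q s then c else c'"
  have "rt ?c s0 w1 e1 \<mu> Q" using assms(2,3) by simp
  then have "rel_pmf (\<lambda>s' x. costs w e s s' \<and> Q s' x) (run A b ?c s0) \<mu>"
    unfolding rt_def by (rule pmf.rel_mono_strong) (use assms(4,5) in \<open>auto simp: costs_def s0_def\<close>)
  then show ?thesis by (simp add: rt_def s0_def if_distrib[of "run A b"] if_distribR)
qed

lemma dt_IfIdxLess:
  fixes f g s
  defines "s0 \<equiv> charge (1 + icost f + icost g) 0 s"
  assumes "ival f s < ival g s \<Longrightarrow> dt c s0 w1 e Q"
    and "\<not> ival f s < ival g s \<Longrightarrow> dt c' s0 w1 e Q"
    and "1 + icost f + icost g + w1 \<le> w"
  shows "dt (IfIdxLess f g c c') s w e Q"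
proof -
  let ?c = "if ival f s < ival g s then c else c'"
  have "dt ?c s0 w1 e Q" using assms(2,3) by simp
  then have "\<forall>s'\<in>set_pmf (run A b ?c s0). costs w e s s' \<and> Q s'"
    using assms(4) by (fastforce simp: dt_def costs_def s0_def)
  then show ?thesis by (simp add: dt_def s0_def if_distrib[of "run A b"] if_distribR)
qed

lemma rt_For:
  assumes N: "ival f s = N"
    and I0: "I 0 (charge (1 + icost f) 0 s) x0"
    and step: "\<And>i s' x. i < N \<Longrightarrow> I i s' x \<Longrightarrow> frame (For v f c) s s' \<Longrightarrow>
      rt c (charge 1 0 (set_reg v i s')) W E (g i x) (I (Suc i))"
    and fin: "\<And>s' x. I N s' x \<Longrightarrow> frame (For v f c) s s' \<Longrightarrow> Q s' x"
    and w: "1 + icost f + N * (1 + W) \<le> w" and e: "N * E \<le> e"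
  shows "rt (For v f c) s w e (iterp g N x0) Q"
proof -
  let ?g = "\<lambda>i s'. run A b c (charge 1 0 (set_reg v i s'))"
  \<comment> \<open>The frame of the whole loop is part of the induction, so that each pass knows
    what the earlier ones left alone.\<close>
  have "M \<le> N \<Longrightarrow> rel_pmf (\<lambda>s' x. costs (1 + icost f + M * (1 + W)) (M * E) s s' \<and> I M s' x \<and> frame (For v f c) s s')
    (iterp ?g M (charge (1 + icost f) 0 s)) (iterp g M x0)" for M
  proof (induction M)
    case 0
    then show ?case using I0 by (auto simp: rel_pmf_return_pmf1 costs_def agree_def)
  next
    case (Suc M)
    show ?case
      unfolding iterp.simps
    proof (rule rel_pmf_bindI[OF Suc.IH])
      show "M \<le> N" using Suc.prems by simp
      fix s' x assume *: "costs (1 + icost f + M * (1 + W)) (M * E) s s' \<and> I M s' x \<and> frame (For v f c) s s'"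
      then have "rt c (charge 1 0 (set_reg v M s')) W E (g M x) (I (Suc M))"
        using step Suc.prems by simp
      then show "rel_pmf (\<lambda>s' x. costs (1 + icost f + Suc M * (1 + W)) (Suc M * E) s s' \<and> I (Suc M) s' x \<and> frame (For v f c) s s')
        (run A b c (charge 1 0 (set_reg v M s'))) (g M x)"
        unfolding rt_def
      proof (rule pmf.rel_mono_strong)
        fix s2 y assume s2: "s2 \<in> set_pmf (run A b c (charge 1 0 (set_reg v M s')))"
          "costs W E (charge 1 0 (set_reg v M s')) s2 \<and> I (Suc M) s2 y"
        from run_frame[OF s2(1)] * s2(2)
        show "costs (1 + icost f + Suc M * (1 + W)) (Suc M * E) s s2 \<and> I (Suc M) s2 y \<and> frame (For v f c) s s2"
          by (auto simp: costs_def agree_def)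
      qed
    qed
  qed
  from this[of N] have "rel_pmf (\<lambda>s' x. costs (1 + icost f + N * (1 + W)) (N * E) s s' \<and> I N s' x \<and> frame (For v f c) s s')
    (run A b (For v f c) s) (iterp g N x0)"
    unfolding run_For N by simp
  then show ?thesis
    unfolding rt_def by (rule pmf.rel_mono_strong) (use fin w e costs_mono in blast)
qed

lemma dt_For:
  assumes N: "ival f s = N"
    and I0: "I 0 (charge (1 + icost f) 0 s)"
    and step: "\<And>i s'. i < N \<Longrightarrow> I i s' \<Longrightarrow> frame (For v f c) s s' \<Longrightarrow>
      dt c (charge 1 0 (set_reg v i s')) W E (I (Suc i))"
    and fin: "\<And>s'. I N s' \<Longrightarrow> frame (For v f c) s s' \<Longrightarrow> Q s'"
    and w: "1 + icost f + N * (1 + W) \<le> w" and e: "N * E \<le> e"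
  shows "dt (For v f c) s w e Q"
proof -
  have "rt (For v f c) s w e (iterp (\<lambda>_ _. return_pmf ()) N ()) (\<lambda>s' _. Q s')"
    by (rule rt_For[where I = "\<lambda>i s' _. I i s'" and W = W and E = E]) (use assms in \<open>auto simp: rt_return_iff\<close>)
  then show ?thesis by (simp only: iterp_return rt_return_iff)
qed

text \<open>Expressions of the language have no bounded sums; they are accumulated in the scratch
  cell of array \<open>z\<close>.\<close>

definition sumto :: "nat \<Rightarrow> nat \<Rightarrow> iexp \<Rightarrow> rexp \<Rightarrow> com" where
  "sumto z v f p = Seq (SetCell z (Num 0) (Num 0) (Lit 0))
     (For v f (SetCell z (Num 0) (Num 0) (Add (Cell z (Num 0) (Num 0)) p)))"

end

lemma (in machine) writes_sumto [simp]:
  "wregs (sumto z v f p) = {v}" "widxs (sumto z v f p) = {}" "wcells (sumto z v f p) = {z}"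
  by (simp_all add: sumto_def)

context machine
begin

lemma dt_sumto:
  assumes N: "\<And>s'. agree {} {} {z} s s' \<Longrightarrow> ival f s' = N"
    and p: "\<And>i s'. i < N \<Longrightarrow> agree {v} {} {z} s s' \<Longrightarrow> regs s' v = i \<Longrightarrow> rval A b p s' = h i"
    and z: "(z, 0, 0) \<in> UC"
    and w: "5 + icost f + N * (8 + rcost p) \<le> w" and e: "N * entry_count p \<le> e"
  shows "dt (sumto z v f p) s w e (\<lambda>s'. cells s' z 0 0 = (\<Sum>i<N. h i))"
  unfolding sumto_def
proof (rule dt_Seq)
  show "dt (SetCell z (Num 0) (Num 0) (Lit 0)) s 4 0 (\<lambda>s'. cells s' z 0 0 = 0)"
    by (rule dt_SetCell) (use z in auto)
next
  fix s1 assume s1: "cells s1 z 0 0 = 0" and fr: "frame (SetCell z (Num 0) (Num 0) (Lit 0)) s s1"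
  have fr1: "agree {} {} {z} s s1" using fr by simp
  show "dt (For v f (SetCell z (Num 0) (Num 0) (Add (Cell z (Num 0) (Num 0)) p))) s1
    (1 + icost f + N * (1 + (7 + rcost p))) (N * entry_count p) (\<lambda>s'. cells s' z 0 0 = (\<Sum>i<N. h i))"
  proof (rule dt_For[where I = "\<lambda>i s'. cells s' z 0 0 = (\<Sum>j<i. h j)" and W = "7 + rcost p" and E = "entry_count p"])
    show "ival f s1 = N" by (rule N[OF fr1])
    fix i s' assume i: "i < N" and s': "cells s' z 0 0 = (\<Sum>j<i. h j)"
      and fr': "frame (For v f (SetCell z (Num 0) (Num 0) (Add (Cell z (Num 0) (Num 0)) p))) s1 s'"
    have "agree {v} {} {z} s (charge 1 0 (set_reg v i s'))"
      using fr' fr1 by (auto simp: agree_def)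
    then have "rval A b p (charge 1 0 (set_reg v i s')) = h i" by (rule p[OF i]) simp
    then show "dt (SetCell z (Num 0) (Num 0) (Add (Cell z (Num 0) (Num 0)) p)) (charge 1 0 (set_reg v i s'))
      (7 + rcost p) (entry_count p) (\<lambda>s'. cells s' z 0 0 = (\<Sum>j<Suc i. h j))"
      using z s' by (intro dt_SetCell) auto
  qed (use s1 in auto)
qed (use w e in auto)

text \<open>No position is written twice, so the body may rely on the original contents of all later positions.\<close>

lemma dt_cells_loop:
  assumes N: "ival f s = N"
    and inj: "\<And>i j. i < N \<Longrightarrow> j < N \<Longrightarrow> px i = px j \<Longrightarrow> py i = py j \<Longrightarrow> i = j"
    and body: "\<And>i s'. i < N \<Longrightarrow> agree (insert v (wregs c)) (widxs c) (wcells c) s s' \<Longrightarrow> regs s' v = i \<Longrightarrow>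
      (\<And>i'. i' < i \<Longrightarrow> cells s' a (px i') (py i') = h i') \<Longrightarrow>
      (\<And>r q. (\<And>i'. i' < i \<Longrightarrow> px i' = r \<Longrightarrow> py i' \<noteq> q) \<Longrightarrow> cells s' a r q = cells s a r q) \<Longrightarrow>
      dt c s' W E (\<lambda>s2. cells s2 a = (cells s' a)(px i := (cells s' a (px i))(py i := h i)))"
    and w: "1 + icost f + N * (1 + W) \<le> w" and e: "N * E \<le> e"
  shows "dt (For v f c) s w e (\<lambda>s'. (\<forall>i<N. cells s' a (px i) (py i) = h i) \<and>
    (\<forall>r q. (\<forall>i<N. px i = r \<longrightarrow> py i \<noteq> q) \<longrightarrow> cells s' a r q = cells s a r q))"
proof (rule dt_For[where I = "\<lambda>i s'. (\<forall>i'<i. cells s' a (px i') (py i') = h i') \<and>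
    (\<forall>r q. (\<forall>i'<i. px i' = r \<longrightarrow> py i' \<noteq> q) \<longrightarrow> cells s' a r q = cells s a r q)" and W = W and E = E])
  fix i s' assume i: "i < N" and fr: "frame (For v f c) s s'"
    and I: "(\<forall>i'<i. cells s' a (px i') (py i') = h i') \<and>
      (\<forall>r q. (\<forall>i'<i. px i' = r \<longrightarrow> py i' \<noteq> q) \<longrightarrow> cells s' a r q = cells s a r q)"
  let ?s = "charge 1 0 (set_reg v i s')"
  have "dt c ?s W E (\<lambda>s2. cells s2 a = (cells ?s a)(px i := (cells ?s a (px i))(py i := h i)))"
  proof (rule body[OF i])
    show "agree (insert v (wregs c)) (widxs c) (wcells c) s ?s" using fr by (auto simp: agree_def)
  qed (use I in auto)
  then show "dt c ?s W E (\<lambda>s'. (\<forall>i'<Suc i. cells s' a (px i') (py i') = h i') \<and>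
      (\<forall>r q. (\<forall>i'<Suc i. px i' = r \<longrightarrow> py i' \<noteq> q) \<longrightarrow> cells s' a r q = cells s a r q))"
  proof (rule dt_conseq)
    fix s2 assume s2: "cells s2 a = (cells ?s a)(px i := (cells ?s a (px i))(py i := h i))"
    show "(\<forall>i'<Suc i. cells s2 a (px i') (py i') = h i') \<and>
      (\<forall>r q. (\<forall>i'<Suc i. px i' = r \<longrightarrow> py i' \<noteq> q) \<longrightarrow> cells s2 a r q = cells s a r q)"
    proof (intro conjI allI impI)
      fix i' assume "i' < Suc i"
      then show "cells s2 a (px i') (py i') = h i'"
      proof (cases "i' = i")
        case False
        then have "px i' \<noteq> px i \<or> py i' \<noteq> py i" using inj[of i' i] i \<open>i' < Suc i\<close> by auto
        then have "cells s2 a (px i') (py i') = cells s' a (px i') (py i')" unfolding s2 by auto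
        then show ?thesis using I False \<open>i' < Suc i\<close> by simp
      qed (simp add: s2)
    next
      fix r q assume "\<forall>i'<Suc i. px i' = r \<longrightarrow> py i' \<noteq> q"
      then show "cells s2 a r q = cells s a r q" using I unfolding s2 by auto
    qed
  qed auto
qed (use assms in auto)

end

section \<open>The program\<close>

lemma (in machine) dt_set:
  assumes "ival f s = r" "ival g s = q" "rval A b p s = y" "(a, r, q) \<in> UC"
    "1 + icost f + icost g + rcost p \<le> w" "entry_count p \<le> e"
  shows "dt (SetCell a f g p) s w e (\<lambda>s2. cells s2 a = (cells s a)(r := (cells s a r)(q := y)))"
  using assms by (intro dt_SetCell) auto

lemma (in machine) dt_sum_set:
  assumes N: "\<And>s'. agree {} {} {z} s s' \<Longrightarrow> ival f s' = N"
    and p: "\<And>i s'. i < N \<Longrightarrow> agree {v} {} {z} s s' \<Longrightarrow> regs s' v = i \<Longrightarrow> rval A b p s' = h i"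
    and z: "(z, 0, 0) \<in> UC" "a \<noteq> z"
    and set: "\<And>s2. agree {v} {} {z} s s2 \<Longrightarrow> cells s2 z 0 0 = (\<Sum>i<N. h i) \<Longrightarrow>
      ival f1 s2 = r \<and> ival f2 s2 = q \<and> rval A b g s2 = y"
    and UC: "(a, r, q) \<in> UC"
    and w: "6 + icost f + N * (8 + rcost p) + icost f1 + icost f2 + rcost g \<le> w"
    and e: "N * entry_count p + entry_count g \<le> e"
  shows "dt (Seq (sumto z v f p) (SetCell a f1 f2 g)) s w e
    (\<lambda>s2. cells s2 a = (cells s a)(r := (cells s a r)(q := y)))"
proof (rule dt_Seq)
  show "dt (sumto z v f p) s (5 + icost f + N * (8 + rcost p)) (N * entry_count p) (\<lambda>s'. cells s' z 0 0 = (\<Sum>i<N. h i))"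
    by (rule dt_sumto) (use N p z in auto)
next
  fix s' assume s': "cells s' z 0 0 = (\<Sum>i<N. h i)" and fr: "frame (sumto z v f p) s s'"
  have ag: "agree {v} {} {z} s s'" using fr by simp
  then have "cells s' a = cells s a" using z(2) by (simp add: agree_def)
  then show "dt (SetCell a f1 f2 g) s' (1 + icost f1 + icost f2 + rcost g) (entry_count g) (\<lambda>s2. cells s2 a = (cells s a)(r := (cells s a r)(q := y)))"
    using dt_set[of f1 s' r f2 q g y a] set[OF ag s'] UC by simp
qed (use w e in auto)

definition UIs :: "nat \<Rightarrow> nat \<Rightarrow> nat \<Rightarrow> (nat \<times> nat) set" where
  "UIs n d l = {(a, i). a < 10 \<and> i < n + d + l}"

text \<open>Vectors sit in column 0. The array of orthogonalized rows fits among the matrices with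
  \<open>n\<close> rows: a block has distinct indices, hence at most \<open>n\<close> rows, and at
  most \<open>l\<close> columns. This keeps an \<open>l\<^sup>2\<close> term out of the storage
  bound.\<close>

definition UCs :: "nat \<Rightarrow> nat \<Rightarrow> nat \<Rightarrow> (nat \<times> nat \<times> nat) set" where
  "UCs n d l = {(a, i, j). a < 20 \<and> (i < n \<and> j < d + l \<or> i < n + d + l \<and> j = 0)}"

lemma UIs_iff [simp]: "(a, i) \<in> UIs n d l \<longleftrightarrow> a < 10 \<and> i < n + d + l"
  by (simp add: UIs_def)

lemma UCs_iff [simp]: "(a, i, j) \<in> UCs n d l \<longleftrightarrow> a < 20 \<and> (i < n \<and> j < d + l \<or> i < n + d + l \<and> j = 0)"
  by (simp add: UCs_def)

locale scrcd_machine = machine A b "UIs n d l" "UCs n d l" for A b n d l +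
  assumes n: "0 < n" and l: "0 < l"
begin

text \<open>
  Registers \<open>6\<close>, \<open>7\<close>, \<open>9\<close> hold the number of current pivots, of best pivots, and of block indices; \<open>5\<close> is a flag,
  \<open>8\<close> a sample, and \<open>10\<close> to \<open>14\<close> are counters.  Index arrays: \<open>0\<close> best pivots, \<open>1\<close> current pivots, \<open>2\<close> samples,
  \<open>3\<close> block.  Real arrays: \<open>0\<close> iterate, \<open>1\<close> initial iterate, \<open>2\<close> best factor, \<open>3\<close> current factor, \<open>4\<close> current
  residual diagonal, \<open>5\<close> best residual diagonal, \<open>6\<close> triangular solves, \<open>7\<close> residual vector, \<open>8\<close> solution of
  the block system, \<open>9\<close> its orthogonalized rows, \<open>10\<close> to \<open>12\<close> scalars.
\<close>

abbreviation "scal z \<equiv> Cell z (Num 0) (Num 0)"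

text \<open>A column of the residual is recomputed from a column of \<open>A\<close> and the earlier
  columns of the factor, so the residual matrix is never formed and a new column takes
  \<open>n\<close> evaluations.\<close>

definition rpc_col :: com where
  "rpc_col = For 12 (Reg 0) (Seq
     (sumto 10 13 (Reg 6) (Mul (Cell 3 (Reg 12) (Reg 13)) (Cell 3 (Reg 8) (Reg 13))))
     (SetCell 3 (Reg 12) (Reg 6) (Div (Sub (Entry (Reg 12) (Reg 8)) (scal 10)) (Sqrt (Cell 4 (Reg 8) (Num 0))))))"

lemma dt_rpc_col:
  assumes s: "regs s 0 = n" "regs s 6 = m" "regs s 8 = j" "m < d" "j < n"
  shows "dt rpc_col s (2 + n * (1 + (30 + m * 20))) n (\<lambda>s'.
    (\<forall>i<n. cells s' 3 i m = (A $$ (i, j) - (\<Sum>t<m. cells s 3 i t * cells s 3 j t)) / sqrt (cells s 4 j 0)) \<and>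
    (\<forall>i t. t < m \<longrightarrow> cells s' 3 i t = cells s 3 i t))"
  unfolding rpc_col_def
proof (rule dt_conseq[OF dt_cells_loop[where a = 3 and px = "\<lambda>i. i" and py = "\<lambda>_. m" and N = n and W = "30 + m * 20" and E = 1
      and h = "\<lambda>i. (A $$ (i, j) - (\<Sum>t<m. cells s 3 i t * cells s 3 j t)) / sqrt (cells s 4 j 0)"]], goal_cases N inj body)
  case (body i s')
  have un: "cells s' 3 r t = cells s 3 r t" if "t < m" for r t using that by (intro body(5)) auto
  show ?case
    by (rule dt_sum_set[where N = m and h = "\<lambda>t. cells s 3 i t * cells s 3 j t"])
      (use body(1-3) s un n in \<open>auto simp: agree_def\<close>)
qed (use s in auto)

definition rpc_diag :: com where
  "rpc_diag = For 12 (Reg 0) (SetCell 4 (Reg 12) (Num 0)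
     (Sub (Cell 4 (Reg 12) (Num 0)) (Mul (Cell 3 (Reg 12) (Reg 6)) (Cell 3 (Reg 12) (Reg 6)))))"

lemma dt_rpc_diag:
  assumes s: "regs s 0 = n" "regs s 6 = m" "m < d"
  shows "dt rpc_diag s (2 + n * 30) 0 (\<lambda>s'. \<forall>i<n. cells s' 4 i 0 = cells s 4 i 0 - cells s 3 i m * cells s 3 i m)"
  unfolding rpc_diag_def
proof (rule dt_conseq[OF dt_cells_loop[where a = 4 and px = "\<lambda>i. i" and py = "\<lambda>_. 0" and N = n and W = 20 and E = 0
      and h = "\<lambda>i. cells s 4 i 0 - cells s 3 i m * cells s 3 i m"]], goal_cases N inj body)
  case (body i s')
  have un: "cells s' 4 i 0 = cells s 4 i 0" by (intro body(5)) auto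
  show ?case by (rule dt_set) (use body(1-3) s un n in \<open>auto simp: agree_def\<close>)
qed (use s in auto)

definition diag_init :: com where
  "diag_init = For 12 (Reg 0) (SetCell 4 (Reg 12) (Num 0) (Entry (Reg 12) (Reg 12)))"

lemma dt_diag_init:
  assumes s: "regs s 0 = n"
  shows "dt diag_init s (2 + n * 10) n (\<lambda>s'. \<forall>i<n. cells s' 4 i 0 = A $$ (i, i))"
  unfolding diag_init_def
proof (rule dt_conseq[OF dt_cells_loop[where a = 4 and px = "\<lambda>i. i" and py = "\<lambda>_. 0" and N = n and W = 9 and E = 1
      and h = "\<lambda>i. A $$ (i, i)"]], goal_cases N inj body)
  case (body i s')
  show ?case by (rule dt_set) (use body(1-3) s n in \<open>auto simp: agree_def\<close>)
qed (use s in auto)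

definition copy_idx :: com where
  "copy_idx = For 12 (Reg 6) (SetIdx 0 (Reg 12) (Idx 1 (Reg 12)))"

lemma dt_copy_idx:
  assumes s: "regs s 6 = m" "m \<le> d"
  shows "dt copy_idx s (2 + m * 10) 0 (\<lambda>s'. \<forall>t<m. idxs s' 0 t = idxs s 1 t)"
  unfolding copy_idx_def
proof (rule dt_For[where N = m and I = "\<lambda>i s'. \<forall>t<i. idxs s' 0 t = idxs s 1 t" and W = 9 and E = 0], goal_cases N I0 step)
  case (step i s')
  show ?case by (rule dt_SetIdx) (use step s n in \<open>auto simp: agree_def less_Suc_eq\<close>)
qed (use s in auto)

definition copy_diag :: com where
  "copy_diag = For 12 (Reg 0) (SetCell 5 (Reg 12) (Num 0) (Cell 4 (Reg 12) (Num 0)))"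

lemma dt_copy_diag:
  assumes s: "regs s 0 = n"
  shows "dt copy_diag s (2 + n * 10) 0 (\<lambda>s'. \<forall>i<n. cells s' 5 i 0 = cells s 4 i 0)"
  unfolding copy_diag_def
proof (rule dt_conseq[OF dt_cells_loop[where a = 5 and px = "\<lambda>i. i" and py = "\<lambda>_. 0" and N = n and W = 9 and E = 0
      and h = "\<lambda>i. cells s 4 i 0"]], goal_cases N inj body)
  case (body i s')
  show ?case by (rule dt_set) (use body(1-3) s n in \<open>auto simp: agree_def\<close>)
qed (use s in auto)

definition copy_factor :: com where
  "copy_factor = For 12 (Reg 0) (For 13 (Reg 6) (SetCell 2 (Reg 12) (Reg 13) (Cell 3 (Reg 12) (Reg 13))))"

lemma dt_copy_factor:
  assumes s: "regs s 0 = n" "regs s 6 = m" "m \<le> d"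
  shows "dt copy_factor s (2 + n * (1 + (2 + m * 10))) 0 (\<lambda>s'. \<forall>i<n. \<forall>t<m. cells s' 2 i t = cells s 3 i t)"
  unfolding copy_factor_def
proof (rule dt_For[where N = n and I = "\<lambda>i s'. \<forall>r<i. \<forall>t<m. cells s' 2 r t = cells s 3 r t" and W = "2 + m * 10" and E = 0], goal_cases N I0 step)
  case (step i s1)
  show ?case
  proof (rule dt_conseq[OF dt_cells_loop[where a = 2 and px = "\<lambda>_. i" and py = "\<lambda>t. t" and N = m and W = 9 and E = 0
      and h = "\<lambda>t. cells s 3 i t"]], goal_cases N inj body w e post)
    case (body t s')
    show ?case by (rule dt_set) (use body(1-3) step s n in \<open>auto simp: agree_def\<close>)
  next
    case (post s')
    then show ?case using step(2) by (auto simp: less_Suc_eq)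
  qed (use s step in \<open>auto simp: agree_def\<close>)
qed (use s in auto)

definition fwd :: com where
  "fwd = For 12 (Reg 7) (Seq
     (sumto 10 13 (Reg 12) (Mul (Cell 2 (Idx 0 (Reg 12)) (Reg 13)) (Cell 6 (Reg 13) (Num 0))))
     (SetCell 6 (Reg 12) (Num 0) (Div (Sub (Rhs (Idx 0 (Reg 12))) (scal 10)) (Cell 2 (Idx 0 (Reg 12)) (Reg 12)))))"

lemma (in -) sum_split_at:
  fixes f :: "nat \<Rightarrow> real"
  assumes "t < m"
  shows "(\<Sum>u<m. f u) = (\<Sum>u<t. f u) + f t + (\<Sum>j<m - 1 - t. f (t + 1 + j))"
proof -
  have "(\<Sum>u<t + 1 + k. f u) = (\<Sum>u<t. f u) + f t + (\<Sum>j<k. f (t + 1 + j))" for k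
    by (induction k) auto
  from this[of "m - 1 - t"] show ?thesis using assms by simp
qed

text \<open>\<open>\<gamma>\<close> is given as a solution. Each row is 0 beyond its nonzero
  diagonal entry, so substitution recovers \<open>\<gamma>\<close> entry by entry.\<close>

lemma dt_fwd:
  assumes s: "regs s 7 = m" "m \<le> d" "\<And>t. t < m \<Longrightarrow> idxs s 0 t = S ! t"
    and low: "\<And>t u. u < m \<Longrightarrow> t < u \<Longrightarrow> cells s 2 (S ! t) u = 0" "\<And>t. t < m \<Longrightarrow> cells s 2 (S ! t) t \<noteq> 0"
    and sol: "\<And>t. t < m \<Longrightarrow> (\<Sum>u<m. cells s 2 (S ! t) u * \<gamma> u) = b $ (S ! t)"
  shows "dt fwd s (2 + m * (1 + (40 + m * 20))) 0 (\<lambda>s'. \<forall>t<m. cells s' 6 t 0 = \<gamma> t)"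
  unfolding fwd_def
proof (rule dt_conseq[OF dt_cells_loop[where a = 6 and px = "\<lambda>t. t" and py = "\<lambda>_. 0" and N = m and W = "40 + m * 20" and E = 0
      and h = \<gamma>]], goal_cases N inj body)
  case (body t s')
  have "(\<Sum>u<m. cells s 2 (S ! t) u * \<gamma> u) = (\<Sum>u<t. cells s 2 (S ! t) u * \<gamma> u) + cells s 2 (S ! t) t * \<gamma> t
      + (\<Sum>j<m - 1 - t. cells s 2 (S ! t) (t + 1 + j) * \<gamma> (t + 1 + j))"
    by (rule sum_split_at[OF body(1)])
  also have "(\<Sum>j<m - 1 - t. cells s 2 (S ! t) (t + 1 + j) * \<gamma> (t + 1 + j)) = 0"
    using low(1) body(1) by (intro sum.neutral) auto
  finally have \<gamma>: "(b $ (S ! t) - (\<Sum>u<t. cells s 2 (S ! t) u * \<gamma> u)) / cells s 2 (S ! t) t = \<gamma> t"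
    using sol[OF body(1)] low(2)[OF body(1)] by (simp add: field_simps)
  have "6 + 1 + t * 18 \<le> m * 18 + 7" using body(1) by simp
  then show ?case
    by (intro dt_sum_set[where N = t and h = "\<lambda>u. cells s 2 (S ! t) u * \<gamma> u"])
      (use body(1-4) s \<gamma> n in \<open>auto simp: agree_def\<close>)
qed (use s in auto)

text \<open>Substitution in \<open>F\<^sub>S\<^sup>T \<beta> = y\<close> for a single right-hand side avoids computing the matrix \<open>C\<close>.\<close>

definition bwd :: com where
  "bwd = For 12 (Reg 7) (Seq (SetReg 14 (ISub (ISub (Reg 7) (Num 1)) (Reg 12))) (Seq
     (sumto 10 13 (Reg 12) (Mul (Cell 2 (Idx 0 (IAdd (IAdd (Reg 14) (Num 1)) (Reg 13))) (Reg 14))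
        (Cell 6 (IAdd (IAdd (Reg 14) (Num 1)) (Reg 13)) (Num 0))))
     (SetCell 6 (Reg 14) (Num 0) (Div (Sub (Cell 6 (Reg 14) (Num 0)) (scal 10)) (Cell 2 (Idx 0 (Reg 14)) (Reg 14))))))"

lemma dt_bwd:
  assumes s: "regs s 7 = m" "m \<le> d" "\<And>t. t < m \<Longrightarrow> idxs s 0 t = S ! t"
    and low: "\<And>t u. u < m \<Longrightarrow> t < u \<Longrightarrow> cells s 2 (S ! t) u = 0" "\<And>t. t < m \<Longrightarrow> cells s 2 (S ! t) t \<noteq> 0"
    and sol: "\<And>t. t < m \<Longrightarrow> (\<Sum>u<m. cells s 2 (S ! u) t * \<beta> u) = cells s 6 t 0"
  shows "dt bwd s (2 + m * (1 + (60 + m * 40))) 0 (\<lambda>s'. \<forall>t<m. cells s' 6 t 0 = \<beta> t)"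
  unfolding bwd_def
proof (rule dt_conseq[OF dt_cells_loop[where a = 6 and px = "\<lambda>i. m - 1 - i" and py = "\<lambda>_. 0" and N = m and W = "60 + m * 40" and E = 0
      and h = "\<lambda>i. \<beta> (m - 1 - i)"]], goal_cases N inj body w e post)
  case (body i s')
  \<comment> \<open>Pass \<open>i\<close> treats row \<open>m - 1 - i\<close>. The array is
    overwritten in place: entry \<open>t\<close> still holds the right-hand side, while the entries
    beyond it hold the solution.\<close>
  define t where "t = m - 1 - i"
  have t: "t < m" "m - 1 - t = i" using body(1) by (auto simp: t_def)
  have un: "cells s' 6 t 0 = cells s 6 t 0" using body(1) by (intro body(5)) (auto simp: t_def)
  have prev: "cells s' 6 (t + 1 + j) 0 = \<beta> (t + 1 + j)" if "j < i" for j
  proof -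
    \<comment> \<open>Entry \<open>t + 1 + j\<close> was written by pass
      \<open>i - 1 - j\<close>.\<close>
    have "m - 1 - (i - 1 - j) = t + 1 + j" using that body(1) by (auto simp: t_def)
    then show ?thesis using body(4)[of "i - 1 - j"] that by simp
  qed
  have "(\<Sum>u<m. cells s 2 (S ! u) t * \<beta> u) = (\<Sum>u<t. cells s 2 (S ! u) t * \<beta> u) + cells s 2 (S ! t) t * \<beta> t
      + (\<Sum>j<i. cells s 2 (S ! (t + 1 + j)) t * \<beta> (t + 1 + j))"
    using sum_split_at[OF t(1), of "\<lambda>u. cells s 2 (S ! u) t * \<beta> u"] unfolding t(2) .
  also have "(\<Sum>u<t. cells s 2 (S ! u) t * \<beta> u) = 0"
    using low(1) t by (intro sum.neutral) auto
  finally have \<beta>: "(cells s 6 t 0 - (\<Sum>j<i. cells s 2 (S ! (t + 1 + j)) t * \<beta> (t + 1 + j))) / cells s 2 (S ! t) t = \<beta> t"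
    using sol[OF t(1)] low(2)[OF t(1)] by (simp add: field_simps)
  have idx: "idxs s 0 (t + 1 + j) = S ! (t + 1 + j)" if "j < i" for j
    using that body(1) by (intro s(3)) (auto simp: t_def)
  have im: "i < m" by (rule body(1))
  show ?case
    unfolding t_def[symmetric]
  proof (rule dt_Seq[where ?w1.0 = 10 and ?e1.0 = 0 and ?e2.0 = 0 and ?w2.0 = "50 + m * 40" and P = "\<lambda>s2. regs s2 14 = t"], goal_cases S1 S2)
    case S1
    show ?case by (rule dt_SetReg) (use body(2,3) s in \<open>auto simp: agree_def t_def\<close>)
  next
    case (S2 s2)
    have c6: "cells s2 6 = cells s' 6" using S2(2) by (simp add: agree_def)
    show ?case
      unfolding c6[symmetric]
      by (intro dt_sum_set[where N = i and h = "\<lambda>j. cells s 2 (S ! (t + 1 + j)) t * \<beta> (t + 1 + j)"])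
        (use body(2,3) S2 s \<beta> n prev idx un t im in \<open>auto simp: agree_def\<close>)
  qed auto
next
  case (post s')
  show ?case
  proof (intro allI impI)
    fix t assume "t < m"
    then show "cells s' 6 t 0 = \<beta> t" using post(1)[THEN conjunct1, rule_format, of "m - 1 - t"] by simp
  qed
qed (use s in auto)

definition add_pivots :: com where
  "add_pivots = For 12 (Reg 7) (SetCell 0 (Idx 0 (Reg 12)) (Num 0) (Add (Cell 0 (Idx 0 (Reg 12)) (Num 0)) (Cell 6 (Reg 12) (Num 0))))"

lemma (in -) emb_nth: "distinct J \<Longrightarrow> t < length J \<Longrightarrow> emb J v (J ! t) = v $ t"
proof -
  assume J: "distinct J" "t < length J"
  have "emb J v (J ! t) = (\<Sum>u<length J. if u = t then v $ t else 0)"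
    unfolding emb_def using J by (intro sum.cong refl) (auto simp: nth_eq_iff_index_eq)
  then show ?thesis using J by simp
qed

lemma dt_add_pivots:
  assumes s: "regs s 7 = length S" "\<And>t. t < length S \<Longrightarrow> idxs s 0 t = S ! t"
    and S: "distinct S" "set S \<subseteq> {..<n}"
  shows "dt add_pivots s (2 + length S * 20) 0 (\<lambda>s'. \<forall>i<n. cells s' 0 i 0 = cells s 0 i 0 + emb S (vec (length S) (\<lambda>t. cells s 6 t 0)) i)"
  unfolding add_pivots_def
proof (rule dt_conseq[OF dt_cells_loop[where a = 0 and px = "\<lambda>t. S ! t" and py = "\<lambda>_. 0" and N = "length S" and W = 19 and E = 0
      and h = "\<lambda>t. cells s 0 (S ! t) 0 + cells s 6 t 0"]], goal_cases N inj body w e post)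
  case (body t s')
  have "S ! t \<in> set S" using body(1) by simp
  then have "S ! t < n" using S(2) by auto
  moreover have "cells s' 0 (S ! t) 0 = cells s 0 (S ! t) 0"
    using body(1) S(1) by (intro body(5)) (auto simp: nth_eq_iff_index_eq)
  ultimately show ?case by (intro dt_set) (use body(1-3) s n in \<open>auto simp: agree_def\<close>)
next
  case (post s')
  show ?case
  proof (intro allI impI)
    fix i assume "i < n"
    show "cells s' 0 i 0 = cells s 0 i 0 + emb S (vec (length S) (\<lambda>t. cells s 6 t 0)) i"
    proof (cases "i \<in> set S")
      case True
      then obtain t where t: "t < length S" "S ! t = i" by (auto simp: in_set_conv_nth)
      then show ?thesis using post(1) emb_nth[OF S(1) t(1), of "vec (length S) (\<lambda>t. cells s 6 t 0)"] by auto
    next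
      case False
      then have "\<forall>t<length S. S ! t = i \<longrightarrow> (0::nat) \<noteq> 0" by auto
      then show ?thesis using post(1) emb_not_in[OF False] by (metis add.right_neutral)
    qed
  qed
qed (use s S in \<open>auto simp: nth_eq_iff_index_eq\<close>)

definition sub_block :: com where
  "sub_block = For 12 (Reg 9) (SetCell 0 (Idx 3 (Reg 12)) (Num 0) (Sub (Cell 0 (Idx 3 (Reg 12)) (Num 0)) (Cell 8 (Reg 12) (Num 0))))"

lemma dt_sub_block:
  assumes s: "regs s 9 = length J" "\<And>t. t < length J \<Longrightarrow> idxs s 3 t = J ! t"
    and J: "distinct J" "set J \<subseteq> {..<n}"
  shows "dt sub_block s (2 + length J * 20) 0 (\<lambda>s'. \<forall>i<n. cells s' 0 i 0 = cells s 0 i 0 + emb J (vec (length J) (\<lambda>t. - cells s 8 t 0)) i)"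
  unfolding sub_block_def
proof (rule dt_conseq[OF dt_cells_loop[where a = 0 and px = "\<lambda>t. J ! t" and py = "\<lambda>_. 0" and N = "length J" and W = 19 and E = 0
      and h = "\<lambda>t. cells s 0 (J ! t) 0 - cells s 8 t 0"]], goal_cases N inj body w e post)
  case (body t s')
  have "J ! t \<in> set J" using body(1) by simp
  then have "J ! t < n" using J(2) by auto
  moreover have "cells s' 0 (J ! t) 0 = cells s 0 (J ! t) 0"
    using body(1) J(1) by (intro body(5)) (auto simp: nth_eq_iff_index_eq)
  ultimately show ?case by (intro dt_set) (use body(1-3) s n in \<open>auto simp: agree_def\<close>)
next
  case (post s')
  show ?case
  proof (intro allI impI)
    fix i assume "i < n"
    show "cells s' 0 i 0 = cells s 0 i 0 + emb J (vec (length J) (\<lambda>t. - cells s 8 t 0)) i"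
    proof (cases "i \<in> set J")
      case True
      then obtain t where t: "t < length J" "J ! t = i" by (auto simp: in_set_conv_nth)
      then show ?thesis using post(1) emb_nth[OF J(1) t(1), of "vec (length J) (\<lambda>t. - cells s 8 t 0)"] by auto
    next
      case False
      then have "\<forall>t<length J. J ! t = i \<longrightarrow> (0::nat) \<noteq> 0" by auto
      then show ?thesis using post(1) emb_not_in[OF False] by (metis add.right_neutral)
    qed
  qed
qed (use s J in \<open>auto simp: nth_eq_iff_index_eq\<close>)

definition res_init :: com where
  "res_init = For 12 (Reg 0) (Seq
     (sumto 10 13 (Reg 7) (Mul (Entry (Reg 12) (Idx 0 (Reg 13))) (Cell 6 (Reg 13) (Num 0))))
     (SetCell 7 (Reg 12) (Num 0) (Sub (scal 10) (Rhs (Reg 12)))))"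

lemma dt_res_init:
  assumes s: "regs s 0 = n" "regs s 7 = length S" "\<And>t. t < length S \<Longrightarrow> idxs s 0 t = S ! t"
  shows "dt res_init s (2 + n * (1 + (30 + length S * 20))) (n * length S)
    (\<lambda>s'. \<forall>i<n. cells s' 7 i 0 = (\<Sum>t<length S. A $$ (i, S ! t) * cells s 6 t 0) - b $ i)"
  unfolding res_init_def
proof (rule dt_conseq[OF dt_cells_loop[where a = 7 and px = "\<lambda>i. i" and py = "\<lambda>_. 0" and N = n and W = "30 + length S * 20" and E = "length S"
      and h = "\<lambda>i. (\<Sum>t<length S. A $$ (i, S ! t) * cells s 6 t 0) - b $ i"]], goal_cases N inj body)
  case (body i s')
  show ?case
    by (rule dt_sum_set[where N = "length S" and h = "\<lambda>t. A $$ (i, S ! t) * cells s 6 t 0"])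
      (use body(1-3) s n in \<open>auto simp: agree_def\<close>)
qed (use s in auto)

definition save_x0 :: com where
  "save_x0 = For 12 (Reg 0) (SetCell 1 (Reg 12) (Num 0) (Cell 0 (Reg 12) (Num 0)))"

lemma dt_save_x0:
  assumes s: "regs s 0 = n"
  shows "dt save_x0 s (2 + n * 10) 0 (\<lambda>s'. \<forall>i<n. cells s' 1 i 0 = cells s 0 i 0)"
  unfolding save_x0_def
proof (rule dt_conseq[OF dt_cells_loop[where a = 1 and px = "\<lambda>i. i" and py = "\<lambda>_. 0" and N = n and W = 9 and E = 0
      and h = "\<lambda>i. cells s 0 i 0"]], goal_cases N inj body)
  case (body i s')
  show ?case by (rule dt_set) (use body(1-3) s n in \<open>auto simp: agree_def\<close>)
qed (use s in auto)

definition factor_alpha :: com where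
  "factor_alpha = For 12 (Reg 7) (Seq
     (sumto 10 13 (Reg 9) (Mul (Cell 2 (Idx 3 (Reg 13)) (Reg 12)) (Cell 8 (Reg 13) (Num 0))))
     (SetCell 6 (Reg 12) (Num 0) (scal 10)))"

lemma dt_factor_alpha:
  assumes s: "regs s 7 = m" "m \<le> d" "regs s 9 = length J" "\<And>t. t < length J \<Longrightarrow> idxs s 3 t = J ! t"
  shows "dt factor_alpha s (2 + m * (1 + (30 + length J * 20))) 0
    (\<lambda>s'. \<forall>t<m. cells s' 6 t 0 = (\<Sum>j<length J. cells s 2 (J ! j) t * cells s 8 j 0))"
  unfolding factor_alpha_def
proof (rule dt_conseq[OF dt_cells_loop[where a = 6 and px = "\<lambda>i. i" and py = "\<lambda>_. 0" and N = m and W = "30 + length J * 20" and E = 0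
      and h = "\<lambda>t. \<Sum>j<length J. cells s 2 (J ! j) t * cells s 8 j 0"]], goal_cases N inj body)
  case (body t s')
  show ?case
    by (rule dt_sum_set[where N = "length J" and h = "\<lambda>j. cells s 2 (J ! j) t * cells s 8 j 0"])
      (use body(1-3) s n in \<open>auto simp: agree_def\<close>)
qed (use s in auto)

definition res_update :: com where
  "res_update = For 12 (Reg 0) (Seq
     (sumto 11 13 (Reg 9) (Mul (Entry (Reg 12) (Idx 3 (Reg 13))) (Cell 8 (Reg 13) (Num 0)))) (Seq
     (sumto 10 13 (Reg 7) (Mul (Cell 2 (Reg 12) (Reg 13)) (Cell 6 (Reg 13) (Num 0))))
     (SetCell 7 (Reg 12) (Num 0) (Sub (Cell 7 (Reg 12) (Num 0)) (Sub (scal 11) (scal 10))))))"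

lemma dt_res_update:
  assumes s: "regs s 0 = n" "regs s 7 = m" "regs s 9 = length J" "\<And>t. t < length J \<Longrightarrow> idxs s 3 t = J ! t"
  shows "dt res_update s (2 + n * (1 + (60 + (length J * 20 + m * 20)))) (n * length J)
    (\<lambda>s'. \<forall>i<n. cells s' 7 i 0 = cells s 7 i 0 - ((\<Sum>j<length J. A $$ (i, J ! j) * cells s 8 j 0) - (\<Sum>t<m. cells s 2 i t * cells s 6 t 0)))"
  unfolding res_update_def
proof (rule dt_conseq[OF dt_cells_loop[where a = 7 and px = "\<lambda>i. i" and py = "\<lambda>_. 0" and N = n and W = "60 + (length J * 20 + m * 20)" and E = "length J"
      and h = "\<lambda>i. cells s 7 i 0 - ((\<Sum>j<length J. A $$ (i, J ! j) * cells s 8 j 0) - (\<Sum>t<m. cells s 2 i t * cells s 6 t 0))"]], goal_cases N inj body)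
  case (body i s')
  have un: "cells s' 7 i 0 = cells s 7 i 0" by (intro body(5)) auto
  let ?X = "\<Sum>j<length J. A $$ (i, J ! j) * cells s 8 j 0"
  show ?case
  proof (rule dt_Seq[where ?w1.0 = "20 + length J * 20" and ?w2.0 = "40 + m * 20" and ?e1.0 = "length J" and ?e2.0 = 0
        and P = "\<lambda>s2. cells s2 11 0 0 = ?X"], goal_cases S1 S2)
    case S1
    show ?case by (rule dt_sumto) (use body(1-3) s n in \<open>auto simp: agree_def\<close>)
  next
    case (S2 s2)
    have c7: "cells s2 7 = cells s' 7" using S2(2) by (simp add: agree_def)
    show ?case
      unfolding c7[symmetric]
      by (rule dt_sum_set[where N = m and h = "\<lambda>t. cells s 2 i t * cells s 6 t 0"])
        (use body(1-3) S2 s n un in \<open>auto simp: agree_def\<close>)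
  qed auto
qed (use s in auto)

end

section \<open>Drawing a block of distinct indices\<close>

text \<open>\<open>replicate_pmf\<close> puts a draw in front, a loop appends it; for independent
  draws from one law this makes no difference.\<close>

lemma replicate_pmf_snoc: "replicate_pmf (Suc m) p = bind_pmf (replicate_pmf m p) (\<lambda>xs. map_pmf (\<lambda>x. xs @ [x]) p)"
  using replicate_pmf_distrib[of m 1 p]
  by (simp add: replicate_pmf_1 map_pmf_def bind_assoc_pmf bind_return_pmf)

lemma iterp_replicate: "iterp (\<lambda>_ xs. map_pmf (\<lambda>x. xs @ [x]) p) m [] = replicate_pmf m p"
  by (induction m) (simp_all add: replicate_pmf_snoc del: replicate_pmf.simps(2))

text \<open>\<open>remdups\<close> keeps the last occurrence, so position \<open>t\<close> survives
  when its index does not recur later. This form runs through the positions from left to right, as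
  the loop does.\<close>

definition remdups_upto :: "nat list \<Rightarrow> nat \<Rightarrow> nat list" where
  "remdups_upto js m = concat (map (\<lambda>t. if js ! t \<in> set (drop (Suc t) js) then [] else [js ! t]) [0..<m])"

lemma remdups_upto_Suc:
  "remdups_upto js (Suc m) = remdups_upto js m @ (if js ! m \<in> set (drop (Suc m) js) then [] else [js ! m])"
  by (simp add: remdups_upto_def)

lemma remdups_upto_length: "remdups_upto js (length js) = remdups js"
proof (induction js)
  case Nil
  then show ?case by (simp add: remdups_upto_def)
next
  case (Cons x js)
  have "[0..<length (x # js)] = 0 # map Suc [0..<length js]"
    by (simp add: upt_conv_Cons map_Suc_upt del: upt_Suc)
  then have "remdups_upto (x # js) (length (x # js)) = (if x \<in> set js then [] else [x]) @ remdups_upto js (length js)"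
    by (simp add: remdups_upto_def o_def del: upt_Suc cong: if_cong)
  then show ?case using Cons.IH by simp
qed

lemma length_remdups_upto: "length (remdups_upto js m) \<le> m"
  by (induction m) (auto simp: remdups_upto_def)

context scrcd_machine
begin

definition draw :: com where
  "draw = For 12 (Reg 2) (Seq (Sample 8 5 (Reg 0)) (SetIdx 2 (Reg 12) (Reg 8)))"

lemma rt_draw:
  assumes s: "regs s 0 = n" "regs s 2 = l"
  shows "rt draw s (2 + l * (1 + (n + 6))) 0 (replicate_pmf l (index_pmf n (\<lambda>j. cells s 5 j 0)))
    (\<lambda>s' js. length js = l \<and> (\<forall>t<l. idxs s' 2 t = js ! t))"
  unfolding draw_def iterp_replicate[symmetric]
proof (rule rt_For[where N = l and I = "\<lambda>i s' xs. length xs = i \<and> (\<forall>t<i. idxs s' 2 t = xs ! t)" and W = "n + 6" and E = 0],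
    goal_cases N I0 step)
  case (step i s' xs)
  let ?s = "charge 1 0 (set_reg 12 i s')"
  have ag: "regs ?s 0 = n" "regs ?s 12 = i" "cells ?s 5 = cells s 5" using step(3) s by (auto simp: agree_def)
  have "rt (Seq (Sample 8 5 (Reg 0)) (SetIdx 2 (Reg 12) (Reg 8))) ?s (n + 6) 0
    (bind_pmf (index_pmf (ival (Reg 0) ?s) (\<lambda>j. cells ?s 5 j 0)) (\<lambda>x. return_pmf (xs @ [x])))
    (\<lambda>s' ys. length ys = Suc i \<and> (\<forall>t<Suc i. idxs s' 2 t = ys ! t))"
  proof (rule rt_Seq[where P = "\<lambda>s2 j. regs s2 8 = j" and ?w1.0 = "n + 2" and ?w2.0 = 4 and ?e1.0 = 0 and ?e2.0 = 0], goal_cases S1 S2)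
    case S1
    show ?case by (rule rt_Sample) (use ag in auto)
  next
    case (S2 s2 j)
    have ag2: "regs s2 12 = i" "idxs s2 = idxs s'" using S2(2) by (auto simp: agree_def)
    show ?case
      unfolding rt_return_iff
      by (rule dt_SetIdx) (use S2(1) ag2 step(1,2) in \<open>auto simp: nth_append less_Suc_eq\<close>)
  qed auto
  then show ?case using ag by (simp add: map_pmf_def)
qed (use s in auto)

text \<open>Indices are compared only by \<open><\<close>, so equality is the failure of both
  comparisons.\<close>

definition dup_test :: com where
  "dup_test = For 13 (ISub (Reg 2) (IAdd (Reg 12) (Num 1)))
     (IfIdxLess (Idx 2 (Reg 12)) (Idx 2 (IAdd (IAdd (Reg 12) (Num 1)) (Reg 13))) Skip
        (IfIdxLess (Idx 2 (IAdd (IAdd (Reg 12) (Num 1)) (Reg 13))) (Idx 2 (Reg 12)) Skip (SetReg 5 (Num 1))))"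

lemma dt_dup_test:
  assumes s: "regs s 2 = l" "regs s 12 = t" "regs s 5 = 0" "t < l" "length js = l" "\<forall>t<l. idxs s 2 t = js ! t"
  shows "dt dup_test s (5 + l * 40) 0 (\<lambda>s'. regs s' 5 = (if js ! t \<in> set (drop (Suc t) js) then 1 else 0))"
  unfolding dup_test_def
proof (rule dt_For[where N = "l - (t + 1)" and W = 30 and E = 0 and
      I = "\<lambda>u s'. regs s' 5 = (if \<exists>j<u. js ! (t + 1 + j) = js ! t then 1 else 0)"], goal_cases N I0 step fin w)
  case (step u s')
  let ?s = "charge 1 0 (set_reg 13 u s')"
  have ag: "regs s' 12 = t" "idxs s' 2 = idxs s 2" using step(3) s by (auto simp: agree_def)
  have x: "idxs s' 2 t = js ! t" "idxs s' 2 (Suc (t + u)) = js ! Suc (t + u)"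
    using s(4) s(6)[rule_format, of t] s(6)[rule_format, of "Suc (t + u)"] step(1) ag by auto
  show ?case
    by (rule dt_IfIdxLess[where ?w1.0 = 20], rule dt_Skip, use x ag step(2) in \<open>force simp: less_Suc_eq\<close>,
        rule dt_IfIdxLess[where ?w1.0 = 4], rule dt_Skip, use x ag step(2) in \<open>force simp: less_Suc_eq\<close>,
        rule dt_SetReg) (use x ag step(2) in \<open>auto simp: less_Suc_eq\<close>)
next
  case (fin s')
  have "(\<exists>j<l - (t + 1). js ! (t + 1 + j) = js ! t) \<longleftrightarrow> js ! t \<in> set (drop (Suc t) js)"
    using s(4,5) by (auto simp: in_set_conv_nth)
  then show ?case using fin by simp
next
  case w
  have "(l - (t + 1)) * (1 + 30) \<le> l * 31" by simp
  then show ?case using l by simp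
qed (use s in auto)

definition dedup :: com where
  "dedup = Seq (SetReg 9 (Num 0)) (For 12 (Reg 2) (Seq (SetReg 5 (Num 0)) (Seq dup_test
     (IfIdxLess (Reg 5) (Num 1) (Seq (SetIdx 3 (Reg 9) (Idx 2 (Reg 12))) (SetReg 9 (IAdd (Reg 9) (Num 1)))) Skip))))"

lemma dt_dedup:
  assumes s: "regs s 2 = l" "length js = l" "\<And>t. t < l \<Longrightarrow> idxs s 2 t = js ! t"
  shows "dt dedup s (10 + l * (1 + (30 + l * 40))) 0
    (\<lambda>s'. regs s' 9 = length (remdups js) \<and> (\<forall>i<length (remdups js). idxs s' 3 i = remdups js ! i))"
  unfolding dedup_def
proof (rule dt_Seq[where ?w1.0 = 2 and ?e1.0 = 0 and ?e2.0 = 0 and ?w2.0 = "2 + l * (1 + (30 + l * 40))" and P = "\<lambda>s2. regs s2 9 = 0"], goal_cases S1 S2)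
  case S1
  show ?case by (rule dt_SetReg) auto
next
  case (S2 s1)
  show ?case
  proof (rule dt_For[where N = l and W = "30 + l * 40" and E = 0 and
      I = "\<lambda>t s'. regs s' 9 = length (remdups_upto js t) \<and> (\<forall>i<length (remdups_upto js t). idxs s' 3 i = remdups_upto js t ! i)"],
      goal_cases N I0 step fin)
    case (step t s')
    let ?s = "charge 1 0 (set_reg 12 t s')"
    have ag: "regs s' 2 = l" "idxs s' 2 = idxs s 2" using step(3) S2(2) s by (auto simp: agree_def dup_test_def)
    show ?case
    proof (rule dt_Seq[where ?w1.0 = 2 and ?e1.0 = 0 and ?e2.0 = 0 and ?w2.0 = "25 + l * 40" and P = "\<lambda>s2. regs s2 5 = 0"], goal_cases A1 A2)
      case A1
      show ?case by (rule dt_SetReg) auto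
    next
      case (A2 s2)
      have ag2: "regs s2 2 = l" "regs s2 12 = t" "regs s2 9 = regs s' 9" "idxs s2 = idxs s'"
        using A2(2) ag by (auto simp: agree_def)
      have idx2: "\<forall>t<l. idxs s2 2 t = js ! t" using s(3) ag ag2 by simp
      show ?case
      proof (rule dt_Seq[OF dt_dup_test[OF ag2(1,2) A2(1) step(1) s(2) idx2], where ?e2.0 = 0 and ?w2.0 = 20], goal_cases B2)
        case (B2 s3)
        have ag3: "regs s3 12 = t" "regs s3 9 = length (remdups_upto js t)" "idxs s3 = idxs s'"
          using B2(2) ag2 step(2) by (auto simp: agree_def dup_test_def)
        \<comment> \<open>At most \<open>t\<close> survivors precede, so the next one is stored at a
          permitted position.\<close>
        have len: "length (remdups_upto js t) < l" using length_remdups_upto[of js t] step(1) by simp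
        show ?case
        proof (rule dt_IfIdxLess[where ?w1.0 = 15], goal_cases C1 C2)
          case C1
          then have nd: "js ! t \<notin> set (drop (Suc t) js)" using B2(1) by (auto split: if_splits)
          show ?case
          proof (rule dt_Seq[where ?w1.0 = 5 and ?e1.0 = 0 and ?e2.0 = 0 and ?w2.0 = 5 and P = "\<lambda>s4. \<forall>i<Suc (length (remdups_upto js t)). idxs s4 3 i = (remdups_upto js t @ [js ! t]) ! i"], goal_cases E1 E2)
            case E1
            show ?case by (rule dt_SetIdx) (use ag3 ag step(1,2) len s in \<open>auto simp: nth_append less_Suc_eq\<close>)
          next
            case (E2 s4)
            have "regs s4 9 = length (remdups_upto js t)" using E2(2) ag3 by (auto simp: agree_def)
            then show ?case by (intro dt_SetReg) (use E2(1) nd in \<open>auto simp: remdups_upto_Suc\<close>)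
          qed auto
        next
          case C2
          then have "js ! t \<in> set (drop (Suc t) js)" using B2(1) by (auto split: if_splits)
          then show ?case by (intro dt_Skip) (use ag3 step(2) in \<open>auto simp: remdups_upto_Suc\<close>)
        qed auto
      qed auto
    qed auto
  next
    case (fin s')
    then show ?case using remdups_upto_length[of js] s(2) by simp
  qed (use S2 s in \<open>auto simp: agree_def remdups_upto_def\<close>)
qed auto

end

text \<open>Orthogonalizing the rows of a consistent system one by one, and correcting the iterate along each new
  direction, gives its minimum-norm solution.  The convention \<open>x / 0 = 0\<close> takes care of dependent rows.\<close>

definition gs_inv :: "nat \<Rightarrow> (nat \<Rightarrow> nat \<Rightarrow> real) \<Rightarrow> (nat \<Rightarrow> real) \<Rightarrow> nat \<Rightarrow> (nat \<Rightarrow> nat \<Rightarrow> real) \<Rightarrow> (nat \<Rightarrow> real) \<Rightarrow> bool" where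
  "gs_inv q G \<alpha> i U a \<longleftrightarrow>
     (\<forall>j<i. \<forall>k<j. ip q (U j) (U k) = 0) \<and>
     (\<forall>j<i. ip q (U j) (\<lambda>t. \<alpha> t - a t) = 0) \<and>
     (\<forall>w. (\<forall>j<i. ip q (G j) w = 0) \<longrightarrow> (\<forall>j<i. ip q (U j) w = 0) \<and> ip q a w = 0) \<and>
     (\<forall>j<i. \<forall>w. (\<forall>k\<le>j. ip q (U k) w = 0) \<longrightarrow> ip q (G j) w = 0)"

text \<open>Row \<open>i\<close> after \<open>j\<close> projections. Spans are encoded dually,
  through the vectors that they annihilate, so no coefficients are recorded: \<open>g\<close> lies
  in the span of the rows up to \<open>i\<close> and differs from \<open>G i\<close> by a
  combination of the \<open>U k\<close>.\<close>

definition mgs_inv :: "nat \<Rightarrow> (nat \<Rightarrow> nat \<Rightarrow> real) \<Rightarrow> nat \<Rightarrow> (nat \<Rightarrow> nat \<Rightarrow> real) \<Rightarrow> nat \<Rightarrow> (nat \<Rightarrow> real) \<Rightarrow> bool" where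
  "mgs_inv q G i U j g \<longleftrightarrow> (\<forall>k<j. ip q g (U k) = 0) \<and>
     (\<forall>w. (\<forall>k\<le>i. ip q (G k) w = 0) \<longrightarrow> ip q g w = 0) \<and>
     (\<forall>w. (\<forall>k<i. ip q (U k) w = 0) \<longrightarrow> ip q (G i) w = ip q g w)"

lemma ip_self_0_imp: "ip q u u = 0 \<Longrightarrow> ip q u w = 0"
  by (simp add: ip_self_eq_0) (simp add: ip_def)

lemma mgs_inv_init: "(\<And>t. t < q \<Longrightarrow> g t = G i t) \<Longrightarrow> mgs_inv q G i U 0 g"
proof -
  assume g: "\<And>t. t < q \<Longrightarrow> g t = G i t"
  then have "ip q g w = ip q (G i) w" for w by (intro ip_cong) auto
  then show ?thesis by (simp add: mgs_inv_def)
qed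

lemma mgs_inv_step:
  assumes gs: "gs_inv q G \<alpha> i U a" and m: "mgs_inv q G i U j g" and j: "j < i"
    and g': "\<And>t. t < q \<Longrightarrow> g' t = g t - (ip q g (U j) / ip q (U j) (U j)) * U j t"
  shows "mgs_inv q G i U (Suc j) g'"
proof -
  define c where "c = ip q g (U j) / ip q (U j) (U j)"
  have g'w: "ip q g' w = ip q g w - c * ip q (U j) w" for w
  proof -
    have "ip q g' w = ip q (\<lambda>t. g t - c * U j t) w" by (rule ip_cong) (auto simp: g' c_def)
    then show ?thesis by (simp add: ip_diff_left ip_scale_left)
  qed
  have "ip q g' (U k) = 0" if "k < Suc j" for k
  proof (cases "k = j")
    case True
    \<comment> \<open>If \<open>U j\<close> is zero, the quotient defaults to 0, and so is the inner
      product that should be removed.\<close>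
    have "c * ip q (U j) (U j) = ip q g (U j)"
    proof (cases "ip q (U j) (U j) = 0")
      case True
      then have "ip q g (U j) = 0" using ip_self_0_imp[of q "U j" g] by (simp add: ip_comm)
      then show ?thesis using True by simp
    qed (simp add: c_def)
    then show ?thesis using True g'w by simp
  next
    case False
    then have "k < j" using that by simp
    then show ?thesis using g'w m gs j by (simp add: mgs_inv_def gs_inv_def)
  qed
  moreover have "ip q g' w = 0" if w: "\<forall>k\<le>i. ip q (G k) w = 0" for w
  proof -
    have "\<forall>k<i. ip q (G k) w = 0" using w by simp
    then have "ip q (U j) w = 0" using gs j unfolding gs_inv_def by blast
    moreover have "ip q g w = 0" using m w unfolding mgs_inv_def by blast
    ultimately show ?thesis using g'w by simp
  qed
  moreover have "ip q (G i) w = ip q g' w" if w: "\<forall>k<i. ip q (U k) w = 0" for w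
    using m w j g'w unfolding mgs_inv_def by simp
  ultimately show ?thesis unfolding mgs_inv_def by blast
qed

text \<open>The error \<open>\<alpha> - a\<close> is orthogonal to the earlier directions, and on
  such vectors \<open>G i\<close> and \<open>g\<close> agree. Hence the defect of the original
  equation gives the coefficient along \<open>g\<close>, and moving along \<open>g\<close> preserves
  the earlier orthogonalities.\<close>

lemma gs_inv_step:
  assumes gs: "gs_inv q G \<alpha> i U a" and m: "mgs_inv q G i U i g"
    and U: "\<And>j. j < i \<Longrightarrow> U' j = U j" "U' i = g"
    and a': "\<And>t. t < q \<Longrightarrow> a' t = a t + (ip q (G i) (\<lambda>t. \<alpha> t - a t) / ip q g g) * g t"
  shows "gs_inv q G \<alpha> (Suc i) U' a'"
proof -
  define c where "c = ip q (G i) (\<lambda>t. \<alpha> t - a t) / ip q g g"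
  have a'w: "ip q a' w = ip q a w + c * ip q g w" for w
  proof -
    have "ip q a' w = ip q (\<lambda>t. a t + c * g t) w" by (rule ip_cong) (auto simp: a' c_def)
    then show ?thesis by (simp add: ip_add_left ip_scale_left)
  qed
  have ed: "ip q w (\<lambda>t. \<alpha> t - a' t) = ip q w (\<lambda>t. \<alpha> t - a t) - c * ip q w g" for w
    using a'w[of w] by (simp add: ip_diff_right ip_comm[of q w a'] ip_comm[of q w a] ip_comm[of q w g])
  have old: "ip q (U j) (\<lambda>t. \<alpha> t - a t) = 0" if "j < i" for j
    using gs that unfolding gs_inv_def by blast
  have gU: "ip q g (U j) = 0" if "j < i" for j using m that unfolding mgs_inv_def by blast
  have "ip q (U' j) (U' k) = 0" if "j < Suc i" "k < j" for j k
    using that U gU[of k] gs unfolding gs_inv_def by (cases "j = i") auto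
  moreover have "ip q (U' j) (\<lambda>t. \<alpha> t - a' t) = 0" if "j < Suc i" for j
  proof (cases "j = i")
    case True
    have "ip q (G i) (\<lambda>t. \<alpha> t - a t) = ip q g (\<lambda>t. \<alpha> t - a t)"
      using m old unfolding mgs_inv_def by blast
    then have "ip q g (\<lambda>t. \<alpha> t - a t) = c * ip q g g"
      using ip_self_0_imp[of q g "\<lambda>t. \<alpha> t - a t"] by (cases "ip q g g = 0") (auto simp: c_def)
    then show ?thesis using True U ed by simp
  next
    case False
    then have "j < i" using that by simp
    then show ?thesis using ed[of "U j"] old gU U by (simp add: ip_comm[of q "U j" g])
  qed
  moreover have "(\<forall>j<Suc i. ip q (U' j) w = 0) \<and> ip q a' w = 0" if w: "\<forall>j<Suc i. ip q (G j) w = 0" for w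
  proof -
    have "\<forall>j<i. ip q (G j) w = 0" using w by simp
    then have 1: "(\<forall>j<i. ip q (U j) w = 0) \<and> ip q a w = 0" using gs unfolding gs_inv_def by blast
    have "\<forall>k\<le>i. ip q (G k) w = 0" using w by simp
    then have "ip q g w = 0" using m unfolding mgs_inv_def by blast
    then show ?thesis using 1 a'w U by (auto simp: less_Suc_eq)
  qed
  moreover have "ip q (G j) w = 0" if j: "j < Suc i" and w: "\<forall>k\<le>j. ip q (U' k) w = 0" for j w
  proof (cases "j = i")
    case True
    have "\<forall>k<i. ip q (U k) w = 0" using w U True by (metis less_imp_le)
    then have "ip q (G i) w = ip q g w" using m unfolding mgs_inv_def by blast
    then show ?thesis using w[rule_format, of i] U True by simp
  next
    case False
    then have "j < i" using j by simp
    moreover have "\<forall>k\<le>j. ip q (U k) w = 0" using w U \<open>j < i\<close> by simp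
    ultimately show ?thesis using gs unfolding gs_inv_def by blast
  qed
  ultimately show ?thesis unfolding gs_inv_def by blast
qed

lemma gs_inv_init: "(\<And>t. t < q \<Longrightarrow> a t = 0) \<Longrightarrow> gs_inv q G \<alpha> 0 U a"
  by (simp add: gs_inv_def ip_def)

text \<open>The error \<open>w\<close> is orthogonal to all directions, hence to all rows, so it
  lies in the kernel. Both \<open>\<alpha>\<close> and \<open>a\<close> are orthogonal to the
  kernel, so \<open>w\<close> is orthogonal to itself.\<close>

lemma gs_inv_final:
  assumes gs: "gs_inv q G \<alpha> q U a" and ker: "\<And>w. (\<forall>j<q. ip q (G j) w = 0) \<Longrightarrow> ip q \<alpha> w = 0" and t: "t < q"
  shows "a t = \<alpha> t"
proof -
  define w where "w = (\<lambda>t. \<alpha> t - a t)"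
  have U: "\<forall>j<q. ip q (U j) w = 0" using gs unfolding gs_inv_def w_def by blast
  have G: "\<forall>j<q. ip q (G j) w = 0"
  proof (intro allI impI)
    fix j assume "j < q"
    moreover have "\<forall>k\<le>j. ip q (U k) w = 0" using U \<open>j < q\<close> by simp
    ultimately show "ip q (G j) w = 0" using gs unfolding gs_inv_def by blast
  qed
  then have "ip q a w = 0" using gs unfolding gs_inv_def by blast
  moreover have "ip q \<alpha> w = 0" by (rule ker[OF G])
  ultimately have "ip q w w = 0" by (subst w_def) (simp add: ip_diff_left)
  then show ?thesis using t by (simp add: ip_self_eq_0 w_def)
qed

section \<open>The block system in the program\<close>

context scrcd_machine
begin

definition row_build :: com where
  "row_build = For 13 (Reg 9) (Seq
     (sumto 10 14 (Reg 7) (Mul (Cell 2 (Idx 3 (Reg 12)) (Reg 14)) (Cell 2 (Idx 3 (Reg 13)) (Reg 14))))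
     (SetCell 9 (Reg 12) (Reg 13) (Sub (Entry (Idx 3 (Reg 12)) (Idx 3 (Reg 13))) (scal 10))))"

text \<open>Runs before \<open>row_orth\<close> overwrites the row: the defect is that of the
  original equation.\<close>

definition row_residual :: com where
  "row_residual = Seq (sumto 10 13 (Reg 9) (Mul (Cell 9 (Reg 12) (Reg 13)) (Cell 8 (Reg 13) (Num 0))))
     (SetCell 12 (Num 0) (Num 0) (Sub (Cell 7 (Idx 3 (Reg 12)) (Num 0)) (scal 10)))"

text \<open>Modified Gram-Schmidt: each coefficient is taken from the current row, which is
  overwritten in place.\<close>

definition row_orth :: com where
  "row_orth = For 13 (Reg 12) (Seq
     (sumto 10 14 (Reg 9) (Mul (Cell 9 (Reg 12) (Reg 14)) (Cell 9 (Reg 13) (Reg 14)))) (Seq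
     (sumto 11 14 (Reg 9) (Mul (Cell 9 (Reg 13) (Reg 14)) (Cell 9 (Reg 13) (Reg 14))))
     (For 14 (Reg 9) (SetCell 9 (Reg 12) (Reg 14)
       (Sub (Cell 9 (Reg 12) (Reg 14)) (Mul (Div (scal 10) (scal 11)) (Cell 9 (Reg 13) (Reg 14))))))))"

definition row_update :: com where
  "row_update = Seq (sumto 11 13 (Reg 9) (Mul (Cell 9 (Reg 12) (Reg 13)) (Cell 9 (Reg 12) (Reg 13))))
     (For 13 (Reg 9) (SetCell 8 (Reg 13) (Num 0)
       (Add (Cell 8 (Reg 13) (Num 0)) (Mul (Div (scal 12) (scal 11)) (Cell 9 (Reg 12) (Reg 13))))))"

definition solve :: com where
  "solve = Seq (For 12 (Reg 9) (SetCell 8 (Reg 12) (Num 0) (Lit 0)))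
     (For 12 (Reg 9) (Seq row_build (Seq row_residual (Seq row_orth row_update))))"

lemma writes_rows [simp]:
  "wregs row_build = {13, 14}" "widxs row_build = {}" "wcells row_build = {9, 10}"
  "wregs row_residual = {13}" "widxs row_residual = {}" "wcells row_residual = {10, 12}"
  "wregs row_orth = {13, 14}" "widxs row_orth = {}" "wcells row_orth = {9, 10, 11}"
  "wregs row_update = {13}" "widxs row_update = {}" "wcells row_update = {8, 11}"
  by (auto simp: row_build_def row_residual_def row_orth_def row_update_def)

lemma dt_row_build:
  assumes s: "regs s 7 = m" "regs s 9 = q" "regs s 12 = i" "i < q" "q \<le> n" "q \<le> l" "\<forall>t<q. idxs s 3 t = J ! t"
  shows "dt row_build s (2 + q * (1 + (40 + m * 20))) q (\<lambda>s'.
    (\<forall>j<q. cells s' 9 i j = A $$ (J ! i, J ! j) - (\<Sum>t<m. cells s 2 (J ! i) t * cells s 2 (J ! j) t)) \<and>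
    (\<forall>r. r \<noteq> i \<longrightarrow> cells s' 9 r = cells s 9 r))"
  unfolding row_build_def
proof (rule dt_conseq[OF dt_cells_loop[where a = 9 and px = "\<lambda>_. i" and py = "\<lambda>j. j" and N = q and W = "40 + m * 20" and E = 1 and e = q
      and w = "2 + q * (1 + (40 + m * 20))" and h = "\<lambda>j. A $$ (J ! i, J ! j) - (\<Sum>t<m. cells s 2 (J ! i) t * cells s 2 (J ! j) t)"]], goal_cases N inj body w e post)
  case (body j s')
  show ?case
    by (rule dt_sum_set[where N = m and h = "\<lambda>t. cells s 2 (J ! i) t * cells s 2 (J ! j) t"])
      (use body(1-3) s n in \<open>auto simp: agree_def\<close>)
qed (use s in auto)

lemma dt_row_residual:
  assumes s: "regs s 9 = q" "regs s 12 = i" "idxs s 3 i = J ! i"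
  shows "dt row_residual s (40 + q * 20) 0 (\<lambda>s'. cells s' 12 0 0 = cells s 7 (J ! i) 0 - ip q (cells s 9 i) (\<lambda>t. cells s 8 t 0))"
  unfolding row_residual_def
proof (rule dt_conseq[OF dt_sum_set[where N = q and h = "\<lambda>t. cells s 9 i t * cells s 8 t 0" and a = 12 and r = 0 and q = 0 and w = "40 + q * 20" and e = 0
      and y = "cells s 7 (J ! i) 0 - ip q (cells s 9 i) (\<lambda>t. cells s 8 t 0)"]])
qed (use s n in \<open>auto simp: agree_def ip_def\<close>)

lemma dt_row_orth:
  assumes s: "regs s 9 = q" "regs s 12 = i" "i < q" "q \<le> n" "q \<le> l"
    and gs: "gs_inv q G \<alpha> i (cells s 9) a" and g: "\<forall>t<q. cells s 9 i t = G i t"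
  shows "dt row_orth s (2 + i * (1 + (80 + q * 60))) 0 (\<lambda>s'.
    mgs_inv q G i (cells s 9) i (cells s' 9 i) \<and> (\<forall>r. r \<noteq> i \<longrightarrow> cells s' 9 r = cells s 9 r))"
  unfolding row_orth_def
proof (rule dt_For[where N = i and W = "80 + q * 60" and E = 0 and
    I = "\<lambda>j s'. mgs_inv q G i (cells s 9) j (cells s' 9 i) \<and> (\<forall>r. r \<noteq> i \<longrightarrow> cells s' 9 r = cells s 9 r)"], goal_cases N I0 step)
  case I0
  show ?case using mgs_inv_init[of q "cells s 9 i" G i] g by simp
next
  case (step j s')
  let ?s = "charge 1 0 (set_reg 13 j s')" and ?U = "cells s 9"
  let ?c1 = "ip q (cells s' 9 i) (?U j)" and ?c2 = "ip q (?U j) (?U j)"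
  have ag: "regs ?s 9 = q" "regs ?s 12 = i" "regs ?s 13 = j" "cells s' 9 j = ?U j"
    using step(1-3) s by (auto simp: agree_def)
  show ?case
  proof (rule dt_Seq[where ?w1.0 = "20 + q * 20" and ?w2.0 = "50 + q * 40" and ?e1.0 = 0 and ?e2.0 = 0 and P = "\<lambda>s2. cells s2 10 0 0 = ?c1"], goal_cases S1 S2)
    case S1
    show ?case unfolding ip_def by (rule dt_sumto) (use ag n in \<open>auto simp: agree_def\<close>)
  next
    case (S2 s2)
    have ag2: "regs s2 9 = q" "regs s2 12 = i" "regs s2 13 = j" "cells s2 9 = cells s' 9" using ag S2(2) by (auto simp: agree_def)
    show ?case
    proof (rule dt_Seq[where ?w1.0 = "20 + q * 20" and ?w2.0 = "20 + q * 20" and ?e1.0 = 0 and ?e2.0 = 0 and P = "\<lambda>s2. cells s2 11 0 0 = ?c2"], goal_cases S3 S4)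
      case S3
      show ?case unfolding ip_def by (rule dt_sumto) (use ag ag2 n in \<open>auto simp: agree_def\<close>)
    next
      case (S4 s3)
      have ag3: "regs s3 9 = q" "regs s3 12 = i" "regs s3 13 = j" "cells s3 9 = cells s' 9" "cells s3 10 0 0 = ?c1" "cells s3 11 0 0 = ?c2"
        using ag2 S4 S2(1) by (auto simp: agree_def)
      show ?case
      proof (rule dt_conseq[OF dt_cells_loop[where a = 9 and px = "\<lambda>_. i" and py = "\<lambda>t. t" and N = q and W = "19" and E = 0
          and w = "2 + q * 20" and e = 0 and h = "\<lambda>t. cells s' 9 i t - (?c1 / ?c2) * ?U j t"]], goal_cases N inj body w e post)
        case (body t s4)
        have un: "cells s4 9 i t = cells s' 9 i t" using body(5)[of i t] ag3 by auto
        have "cells s4 9 j t = ?U j t" using body(5)[of j t] ag3 ag step(1) by auto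
        then show ?case by (intro dt_set) (use body(1-3) un ag3 s n in \<open>auto simp: agree_def\<close>)
      next
        case (post s4)
        have row: "cells s4 9 i t = cells s' 9 i t - (?c1 / ?c2) * ?U j t" if "t < q" for t
          using post(1)[THEN conjunct1, rule_format, OF that] .
        have "mgs_inv q G i ?U (Suc j) (cells s4 9 i)"
          by (rule mgs_inv_step[OF gs conjunct1[OF step(2)] step(1) row])
        moreover have "cells s4 9 r = ?U r" if "r \<noteq> i" for r
        proof
          fix t
          have "cells s4 9 r t = cells s3 9 r t"
            using post(1)[THEN conjunct2, rule_format, of r t] that by simp
          then show "cells s4 9 r t = ?U r t" using ag3 step(2) that by simp
        qed
        ultimately show ?case by blast
      qed (use ag3 in auto)
    qed auto
  qed auto
qed (use s in auto)

lemma dt_row_update: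
  assumes s: "regs s 9 = q" "regs s 12 = i" "q \<le> n"
  shows "dt row_update s (30 + q * 40) 0 (\<lambda>s'. \<forall>t<q. cells s' 8 t 0 =
    cells s 8 t 0 + (cells s 12 0 0 / ip q (cells s 9 i) (cells s 9 i)) * cells s 9 i t)"
  unfolding row_update_def
proof (rule dt_Seq[where ?w1.0 = "20 + q * 20" and ?w2.0 = "2 + q * 20" and ?e1.0 = 0 and ?e2.0 = 0 and P = "\<lambda>s2. cells s2 11 0 0 = ip q (cells s 9 i) (cells s 9 i)"], goal_cases S1 S2)
  case S1
  show ?case unfolding ip_def by (rule dt_sumto) (use s n in \<open>auto simp: agree_def\<close>)
next
  case (S2 s2)
  have ag2: "regs s2 9 = q" "regs s2 12 = i" "cells s2 9 = cells s 9" "cells s2 8 = cells s 8" "cells s2 12 = cells s 12"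
    using s S2(2) by (auto simp: agree_def)
  show ?case
  proof (rule dt_conseq[OF dt_cells_loop[where a = 8 and px = "\<lambda>t. t" and py = "\<lambda>_. 0" and N = q and W = "19" and E = 0
      and w = "2 + q * 20" and e = 0 and h = "\<lambda>t. cells s 8 t 0 + (cells s 12 0 0 / ip q (cells s 9 i) (cells s 9 i)) * cells s 9 i t"]], goal_cases N inj body w e post)
    case (body t s3)
    have un: "cells s3 8 t 0 = cells s 8 t 0" using body(5)[of t 0] ag2 by auto
    have eq: "regs s3 12 = i" "regs s3 13 = t" "cells s3 11 0 0 = ip q (cells s 9 i) (cells s 9 i)"
      "cells s3 12 = cells s 12" "cells s3 9 = cells s 9"
      using body(2,3) ag2 S2(1) by (auto simp: agree_def)
    show ?case
      by (rule dt_set) (use body(1) s n in \<open>simp_all add: eq un\<close>)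
  next
    case (post s3)
    then show ?case by simp
  qed (use ag2 in auto)
qed auto

text \<open>The hypotheses \<open>sol\<close> and \<open>ker\<close> are the two halves of
  \<open>is_alpha\<close>. Building a row takes of the order of \<open>q m\<close> operations and
  orthogonalizing it at most of the order of \<open>q\<^sup>2\<close>, for each of \<open>q\<close>
  rows.\<close>

lemma dt_solve:
  fixes s J m
  defines "G \<equiv> \<lambda>i j. A $$ (J ! i, J ! j) - (\<Sum>t<m. cells s 2 (J ! i) t * cells s 2 (J ! j) t)"
  assumes s: "regs s 7 = m" "regs s 9 = q" "q \<le> n" "q \<le> l" "\<And>t. t < q \<Longrightarrow> idxs s 3 t = J ! t"
    and sol: "\<And>i. i < q \<Longrightarrow> ip q (G i) \<alpha> = cells s 7 (J ! i) 0"
    and ker: "\<And>w. (\<forall>j<q. ip q (G j) w = 0) \<Longrightarrow> ip q \<alpha> w = 0"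
  shows "dt solve s (10 + q * (200 + q * 200 + q * m * 20 + q * q * 60)) (q * q) (\<lambda>s'. \<forall>t<q. cells s' 8 t 0 = \<alpha> t)"
  unfolding solve_def
proof (rule dt_Seq[where ?w1.0 = "2 + q * 10" and ?e1.0 = 0 and ?e2.0 = "q * q"
      and ?w2.0 = "2 + q * (1 + (150 + q * 200 + q * m * 20 + q * q * 60))" and P = "\<lambda>s'. \<forall>t<q. cells s' 8 t 0 = 0"], goal_cases S1 S2)
  case S1
  show ?case
  proof (rule dt_conseq[OF dt_cells_loop[where a = 8 and px = "\<lambda>t. t" and py = "\<lambda>_. 0" and N = q and W = "9" and E = 0
      and w = "2 + q * 10" and e = 0 and h = "\<lambda>_. 0"]], goal_cases N inj body)
    case (body t s')
    show ?case by (rule dt_set) (use body(1-3) s in \<open>auto simp: agree_def\<close>)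
  qed (use s in auto)
next
  case (S2 s1)
  let ?row = "Seq row_build (Seq row_residual (Seq row_orth row_update))"
  have ag1: "regs s1 7 = m" "regs s1 9 = q" "idxs s1 3 = idxs s 3" "cells s1 2 = cells s 2" "cells s1 7 = cells s 7"
    using S2(2) s by (auto simp: agree_def)
  show ?case
  proof (rule dt_For[where N = q and W = "150 + q * 200 + q * m * 20 + q * q * 60" and E = q and
      I = "\<lambda>i s'. gs_inv q G \<alpha> i (cells s' 9) (\<lambda>t. cells s' 8 t 0)"], goal_cases N I0 step fin)
    case I0
    show ?case using S2(1) by (intro gs_inv_init) simp
  next
    case (step i s')
    let ?s = "charge 1 0 (set_reg 12 i s')"
    have ag: "regs ?s 7 = m" "regs ?s 9 = q" "regs ?s 12 = i" "idxs ?s 3 = idxs s 3" "cells ?s 2 = cells s 2" "cells ?s 7 = cells s 7"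
      using step(3) ag1 by (auto simp: agree_def)
    have gs: "gs_inv q G \<alpha> i (cells ?s 9) (\<lambda>t. cells ?s 8 t 0)" using step(2) by simp
    have idx: "\<forall>t<q. idxs ?s 3 t = J ! t" using s(5) ag(4) by simp
    show ?case
    proof (rule dt_Seq[OF dt_row_build[OF ag(1-3) step(1) s(3,4) idx], where ?w2.0 = "130 + q * 150 + q * q * 60" and ?e2.0 = 0], goal_cases B2 B3 B4)
      case (B2 s2)
      have ag2: "regs s2 9 = q" "regs s2 12 = i" "idxs s2 3 = idxs s 3" "cells s2 7 = cells s 7" "cells s2 8 = cells ?s 8"
        using B2(2) ag by (auto simp: agree_def)
      have idx2: "idxs s2 3 i = J ! i" using ag2(3) s(5)[OF step(1)] by simp
      have row2: "cells s2 9 i t = G i t" if "t < q" for t using B2(1) that ag unfolding G_def by simp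
      have keep2: "cells s2 9 r = cells ?s 9 r" if "r \<noteq> i" for r using B2(1) that by blast
      show ?case
      proof (rule dt_Seq[OF dt_row_residual[OF ag2(1,2) idx2], where ?w2.0 = "80 + q * 130 + q * q * 60" and ?e2.0 = 0], goal_cases C2 C3 C4)
        case (C2 s3)
        have ag3: "regs s3 9 = q" "regs s3 12 = i" "cells s3 8 = cells ?s 8" "cells s3 9 = cells s2 9"
          using C2(2) ag2 by (auto simp: agree_def)
        have rho: "cells s3 12 0 0 = ip q (G i) (\<lambda>t. \<alpha> t - cells ?s 8 t 0)"
        proof -
          have "cells s3 12 0 0 = cells s2 7 (J ! i) 0 - ip q (cells s2 9 i) (\<lambda>t. cells s2 8 t 0)" by (rule C2(1))
          also have "ip q (cells s2 9 i) (\<lambda>t. cells s2 8 t 0) = ip q (G i) (\<lambda>t. cells ?s 8 t 0)"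
            by (rule ip_cong) (auto simp: row2 ag2(5))
          finally show ?thesis using sol[OF step(1)] ag2(4) by (simp add: ip_diff_right)
        qed
        have row3: "\<forall>t<q. cells s3 9 i t = G i t" using row2 ag3(4) by simp
        \<comment> \<open>Row \<open>i\<close> has been overwritten, but the invariant reads only
          the rows before it.\<close>
        have gs_cong: "gs_inv q G \<alpha> i (cells s3 9) (\<lambda>t. cells ?s 8 t 0)"
        proof -
          have "cells s3 9 r = cells ?s 9 r" if "r < i" for r using keep2[of r] that ag3(4) by simp
          then show ?thesis using gs unfolding gs_inv_def by auto
        qed
        show ?case
        proof (rule dt_Seq[OF dt_row_orth[OF ag3(1,2) step(1) s(3,4) gs_cong row3], where ?w2.0 = "30 + q * 40" and ?e2.0 = 0], goal_cases D2 D3 D4)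
          case (D2 s4)
          have ag4: "regs s4 9 = q" "regs s4 12 = i" "cells s4 8 = cells ?s 8" "cells s4 12 = cells s3 12"
            using D2(2) ag3 by (auto simp: agree_def)
          show ?case
          proof (rule dt_conseq[OF dt_row_update[where i = i and q = q]], goal_cases E1 E2 E3 E4)
            case (E4 s5)
            have c9: "cells s5 9 = cells s4 9" using E4(2) by (auto simp: agree_def)
            show ?case
            proof (rule gs_inv_step[OF gs_cong conjunct1[OF D2(1)]])
              show "cells s5 9 j = cells s3 9 j" if "j < i" for j using D2(1) that c9 by simp
              show "cells s5 8 t 0 = cells ?s 8 t 0 + (ip q (G i) (\<lambda>t. \<alpha> t - cells ?s 8 t 0) / ip q (cells s4 9 i) (cells s4 9 i)) * cells s4 9 i t" if "t < q" for t
                using E4(1) that rho ag4 by simp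
            qed (simp add: c9)
          qed (use ag4 s in auto)
        next
          case D3
          have "i * (81 + q * 60) \<le> q * (81 + q * 60)" using step(1) by (intro mult_right_mono) auto
          then show ?case by (simp add: algebra_simps)
        qed auto
      next
        case C3
        show ?case by simp
      qed auto
    next
      case B3
      show ?case by (simp add: algebra_simps)
    qed auto
  next
    case (fin s')
    show ?case using gs_inv_final[OF fin(1) ker] by blast
  qed (use ag1 in auto)
qed (auto simp: algebra_simps)

end

section \<open>Iterated laws of the algorithms as loops\<close>

lemma iterp_Suc_shift: "iterp (\<lambda>_. g) (Suc m) x = bind_pmf (g x) (iterp (\<lambda>_. g) m)"
proof (induction m)
  case 0
  then show ?case by (simp add: bind_return_pmf bind_return_pmf')
next
  case (Suc m)
  have "iterp (\<lambda>_. g) (Suc (Suc m)) x = bind_pmf (bind_pmf (g x) (iterp (\<lambda>_. g) m)) g"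
    unfolding Suc.IH[symmetric] by simp
  then show ?case by (simp add: bind_assoc_pmf)
qed

lemma rpc_iter_iterp: "rpc_iter m st = iterp (\<lambda>_. rpc_step) m st"
  by (induction m arbitrary: st) (simp_all add: iterp_Suc_shift del: iterp.simps(2))

lemma scrcd_iter_iterp: "scrcd_iter k A l S F st = iterp (\<lambda>_. scrcd_step A l S F) k st"
  by (induction k arbitrary: st) (simp_all add: iterp_Suc_shift del: iterp.simps(2))

text \<open>A later element replaces the current minimum only if it is strictly smaller, as ties go
  to the earliest run; the comparison in \<open>boost\<close> is strict accordingly.\<close>

lemma arg_min_list_snoc:
  fixes f :: "'a \<Rightarrow> 'b :: linorder"
  shows "xs \<noteq> [] \<Longrightarrow> arg_min_list f (xs @ [y]) = (if f y < f (arg_min_list f xs) then y else arg_min_list f xs)"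
proof (induction f xs rule: arg_min_list.induct)
  case (2 f x x' xs)
  have "arg_min_list f ((x' # xs) @ [y]) = (if f y < f (arg_min_list f (x' # xs)) then y else arg_min_list f (x' # xs))"
    by (rule 2) simp
  then show ?case by (auto simp: Let_def)
qed auto

lemma arg_min_list_foldl:
  fixes f :: "'a \<Rightarrow> 'b :: linorder"
  shows "arg_min_list f (x # xs) = foldl (\<lambda>z y. if f y < f z then y else z) x xs"
proof (induction xs rule: rev_induct)
  case (snoc y xs)
  then show ?case using arg_min_list_snoc[of "x # xs" f y] by simp
qed simp

lemma replicate_foldl_iterp:
  "map_pmf (foldl g x) (replicate_pmf m p) = iterp (\<lambda>_ z. map_pmf (g z) p) m x"
proof (induction m)
  case (Suc m)
  have "map_pmf (foldl g x) (replicate_pmf (Suc m) p) = bind_pmf (replicate_pmf m p) (\<lambda>xs. map_pmf (\<lambda>y. g (foldl g x xs) y) p)"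
    unfolding replicate_pmf_snoc by (simp add: map_bind_pmf pmf.map_comp o_def)
  also have "\<dots> = bind_pmf (map_pmf (foldl g x) (replicate_pmf m p)) (\<lambda>z. map_pmf (g z) p)"
    by (simp add: bind_map_pmf)
  finally show ?case unfolding Suc.IH by simp
qed simp

text \<open>One run is taken out of the loop, so that every pass has a current best to compare with;
  this leaves \<open>T - 1\<close> passes.\<close>

lemma boosted_iterp:
  assumes "0 < T"
  shows "boosted_rpcholesky A d T = bind_pmf (rpcholesky A d) (iterp (\<lambda>_ z. bind_pmf (rpcholesky A d)
    (\<lambda>y. return_pmf (if tr (A - nystrom A (fst y)) < tr (A - nystrom A (fst z)) then y else z))) (T - 1))"
proof -
  let ?f = "\<lambda>(S, F :: real mat). tr (A - nystrom A S)" and ?p = "rpcholesky A d"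
  obtain T' where T: "T = Suc T'" using assms by (cases T) auto
  have "boosted_rpcholesky A d T = bind_pmf ?p (\<lambda>x. map_pmf (\<lambda>xs. arg_min_list ?f (x # xs)) (replicate_pmf T' ?p))"
    unfolding boosted_rpcholesky_def T by (simp add: map_bind_pmf map_pmf_def bind_assoc_pmf bind_return_pmf)
  also have "\<dots> = bind_pmf ?p (\<lambda>x. iterp (\<lambda>_ z. map_pmf (\<lambda>y. if ?f y < ?f z then y else z) ?p) T' x)"
    unfolding arg_min_list_foldl replicate_foldl_iterp ..
  finally show ?thesis by (simp add: T map_pmf_def case_prod_beta)
qed

lemma (in machine) dt_weaken: "dt c s w e Q \<Longrightarrow> w \<le> w' \<Longrightarrow> e \<le> e' \<Longrightarrow> dt c s w' e' Q"
  by (rule dt_conseq) auto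

section \<open>RPCholesky and boosting in the program\<close>

locale scrcd_system = scrcd_machine +
  fixes xs :: "real vec"
  assumes psd: "psd n A" and xs: "xs \<in> carrier_vec n" "A *\<^sub>v xs = b"
begin

text \<open>Array \<open>di\<close> holds the diagonal of the residual matrix, from which the trace and the sampling weights of both
  algorithms are read off.\<close>

definition rep :: "nat \<Rightarrow> nat \<Rightarrow> nat \<Rightarrow> nat \<Rightarrow> store \<Rightarrow> rpc_state \<Rightarrow> bool" where
  "rep ri ii ci di s = (\<lambda>(S, cs, R). regs s ri = length S \<and> (\<forall>t<length S. idxs s ii t = S ! t) \<and>
     (\<forall>i<n. \<forall>t<length S. cells s ci i t = cs ! t $ i) \<and> (\<forall>i<n. cells s di i 0 = R $$ (i, i)) \<and>
     rpc_inv n A (S, cs, R) \<and> length S \<le> d)"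

text \<open>A positive trace stands for \<open>R \<noteq> 0\<close>. Once the trace is 0 the
  remaining passes change neither pivots nor factor, which realizes early stopping inside a loop of
  fixed length.\<close>

definition rpc_stepc :: com where
  "rpc_stepc = Seq (sumto 10 12 (Reg 0) (Cell 4 (Reg 12) (Num 0))) (IfLess (Lit 0) (scal 10)
     (Seq (Sample 8 4 (Reg 0)) (Seq (SetIdx 1 (Reg 6) (Reg 8)) (Seq rpc_col (Seq rpc_diag (SetReg 6 (IAdd (Reg 6) (Num 1)))))))
     Skip)"

lemma writes_rpc_stepc [simp]:
  "wregs rpc_col = {12, 13}" "widxs rpc_col = {}" "wcells rpc_col = {3, 10}"
  "wregs rpc_diag = {12}" "widxs rpc_diag = {}" "wcells rpc_diag = {4}"
  "wregs rpc_stepc = {6, 8, 12, 13}" "widxs rpc_stepc = {1}" "wcells rpc_stepc = {3, 4, 10}"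
  by (auto simp: rpc_col_def rpc_diag_def rpc_stepc_def)

lemma rpc_upd_simps:
  assumes "dim_row R = n"
  shows "rpc_upd (S, cs, R) j = (S @ [j], cs @ [vec n (\<lambda>i. R $$ (i, j) / sqrt (R $$ (j, j)))],
    mat n n (\<lambda>(i, k). R $$ (i, k) - R $$ (i, j) * R $$ (j, k) / R $$ (j, j)))"
  using assms by (simp add: rpc_upd_def)

lemma dt_pivot:
  assumes s: "regs s 0 = n" "regs s 8 = j" and r: "rep 6 1 3 4 s (S, cs, R)" and len: "length S < d"
    and j: "j < n" "0 < R $$ (j, j)"
  shows "dt (Seq (SetIdx 1 (Reg 6) (Reg 8)) (Seq rpc_col (Seq rpc_diag (SetReg 6 (IAdd (Reg 6) (Num 1))))))
    s (20 + n * (61 + d * 20)) n (\<lambda>s'. rep 6 1 3 4 s' (rpc_upd (S, cs, R) j))"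
proof -
  let ?m = "length S"
  have inv: "rpc_inv n A (S, cs, R)" and rr: "regs s 6 = ?m" "\<And>t. t < ?m \<Longrightarrow> idxs s 1 t = S ! t"
    "\<And>i t. i < n \<Longrightarrow> t < ?m \<Longrightarrow> cells s 3 i t = cs ! t $ i" "\<And>i. i < n \<Longrightarrow> cells s 4 i 0 = R $$ (i, i)"
    using r by (auto simp: rep_def)
  note I = rpc_invD[OF inv]
  have R: "dim_row R = n" using I(5) by auto
  have sym: "R $$ (i, k) = R $$ (k, i)" if "i < n" "k < n" for i k
    using I(6) that by (simp add: psdf_def symf_def)
  define c where "c = vec n (\<lambda>i. R $$ (i, j) / sqrt (R $$ (j, j)))"
  have inv': "rpc_inv n A (rpc_upd (S, cs, R) j)" by (rule rpc_inv_upd[OF inv j])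
  show ?thesis
  proof (rule dt_Seq[where ?w1.0 = 3 and ?w2.0 = "10 + n * (61 + d * 20)" and ?e1.0 = 0 and ?e2.0 = n
        and P = "\<lambda>s'. \<forall>t<Suc ?m. idxs s' 1 t = (S @ [j]) ! t"], goal_cases A B)
    case A
    show ?case by (rule dt_SetIdx) (use rr len s in \<open>auto simp: nth_append less_Suc_eq\<close>)
  next
    case (B s1)
    have ag1: "regs s1 0 = n" "regs s1 6 = ?m" "regs s1 8 = j" "cells s1 = cells s"
      using B(2) s rr by (auto simp: agree_def)
    have w: "2 + n * (1 + (30 + ?m * 20)) \<le> 2 + n * (31 + d * 20)"
      using len by (auto intro!: mult_left_mono)
    show ?case
    proof (rule dt_Seq[OF dt_weaken[OF dt_rpc_col[OF ag1(1-3) len j(1)] w order_refl], where ?w2.0 = "6 + n * 30" and ?e2.0 = 0], goal_cases C)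
      case (C s2)
      have ag2: "regs s2 0 = n" "regs s2 6 = ?m" "cells s2 4 = cells s 4" "idxs s2 = idxs s1"
        using C(2) ag1 by (auto simp: agree_def)
      have col: "cells s2 3 i ?m = c $ i" if "i < n" for i
      proof -
        have "(\<Sum>t<?m. cells s 3 i t * cells s 3 j t) = (\<Sum>t<?m. cs ! t $ i * cs ! t $ j)"
          using rr(3) that j by (intro sum.cong) auto
        then show ?thesis using C(1) that I(7)[OF that j(1)] rr(4)[OF j(1)] ag1 by (simp add: c_def)
      qed
      have old: "cells s2 3 i t = cs ! t $ i" if "i < n" "t < ?m" for i t
        using C(1) that rr(3) ag1 by simp
      show ?case
      proof (rule dt_Seq[OF dt_rpc_diag[OF ag2(1,2) len], where ?w2.0 = 4 and ?e2.0 = 0], goal_cases D)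
        case (D s3)
        have ag3: "regs s3 6 = ?m" "cells s3 3 = cells s2 3" "idxs s3 = idxs s1"
          using D(2) ag2 by (auto simp: agree_def)
        have dg: "cells s3 4 i 0 = R $$ (i, i) - R $$ (i, j) * R $$ (j, i) / R $$ (j, j)" if "i < n" for i
        proof -
          have "c $ i * c $ i = R $$ (i, j) * R $$ (j, i) / R $$ (j, j)"
            using that j sym[OF j(1) that] by (simp add: c_def)
          then show ?thesis using D(1) that col[OF that] rr(4)[OF that] ag2(3) by simp
        qed
        show ?case
          by (rule dt_SetReg)
            (use ag3 B(1) col old dg len inv' I(1) in \<open>auto simp: rep_def rpc_upd_simps[OF R] nth_append less_Suc_eq c_def\<close>)
      qed auto
    qed (auto simp: algebra_simps)
  qed auto
qed

lemma rt_rpc_stepc: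
  assumes s: "regs s 0 = n" and r: "rep 6 1 3 4 s (S, cs, R)" and len: "length S < d"
  shows "rt rpc_stepc s (60 + n * (100 + d * 20)) n (rpc_step (S, cs, R)) (\<lambda>s' st'. rep 6 1 3 4 s' st' \<and> length (fst st') \<le> Suc (length S))"
proof -
  have inv: "rpc_inv n A (S, cs, R)" and dg: "\<And>i. i < n \<Longrightarrow> cells s 4 i 0 = R $$ (i, i)"
    using r by (auto simp: rep_def)
  note I = rpc_invD[OF inv]
  have R: "dim_row R = n" using I(5) by auto
  let ?\<tau> = "\<Sum>i<n. R $$ (i, i)"
  show ?thesis
    unfolding rpc_stepc_def
  proof (rule rt_Seq_dt[where ?w1.0 = "10 + n * 11" and ?w2.0 = "40 + n * (80 + d * 20)" and ?e1.0 = 0 and ?e2.0 = n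
        and P = "\<lambda>s'. cells s' 10 0 0 = ?\<tau>"], goal_cases A B)
    case A
    show ?case by (rule dt_sumto) (use s dg n in \<open>auto simp: agree_def\<close>)
  next
    case (B s1)
    have ag1: "regs s1 0 = n" "rep 6 1 3 4 s1 (S, cs, R)" "\<And>i. i < n \<Longrightarrow> cells s1 4 i 0 = R $$ (i, i)"
      using B(2) s r by (auto simp: agree_def rep_def)
    show ?case
    proof (rule rt_IfLess[where ?w1.0 = "30 + n * (80 + d * 20)" and ?e1.0 = n], goal_cases T F)
      case T
      let ?s = "charge (1 + rcost (Lit 0) + rcost (scal 10)) (entry_count (Lit 0) + entry_count (scal 10)) s1"
      have \<tau>: "0 < ?\<tau>" using T B(1) by simp
      then have "R \<noteq> 0\<^sub>m n n" by auto
      then have step: "rpc_step (S, cs, R) = bind_pmf (index_pmf n (\<lambda>j. R $$ (j, j))) (\<lambda>j. return_pmf (rpc_upd (S, cs, R) j))"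
        unfolding rpc_step_eq R by (simp add: map_pmf_def)
      have ix: "index_pmf n (\<lambda>j. R $$ (j, j)) = index_pmf (ival (Reg 0) ?s) (\<lambda>j. cells ?s 4 j 0)"
        using ag1 by (auto intro!: index_pmf_cong)
      have supp: "j < n \<and> 0 < R $$ (j, j)" if "j \<in> set_pmf (index_pmf n (\<lambda>j. R $$ (j, j)))" for j
        using that set_index_pmf[of n "\<lambda>j. R $$ (j, j)", OF psdf_diag_nonneg[OF I(6)] \<tau>] by simp
      show ?case
        unfolding step ix
      proof (rule rt_Seq[where ?w1.0 = "2 + n" and ?w2.0 = "20 + n * (61 + d * 20)" and ?e1.0 = 0 and ?e2.0 = n
            and P = "\<lambda>s' j. regs s' 8 = j"], goal_cases C D)
        case C
        show ?case by (rule rt_Sample) (use ag1 in auto)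
      next
        case (D s2 j)
        have ag2: "regs s2 0 = n" "rep 6 1 3 4 s2 (S, cs, R)"
          using D(2) ag1 by (auto simp: agree_def rep_def)
        have j: "j < n" "0 < R $$ (j, j)" using supp D(3) unfolding ix by auto
        show ?case
          unfolding rt_return_iff
          by (rule dt_conseq[OF dt_pivot[OF ag2(1) D(1) ag2(2) len j]]) (auto simp: rpc_upd_def Let_def)
      qed (auto simp: algebra_simps)
    next
      case F
      then have "R = 0\<^sub>m n n" using psdf_trace_pos[OF I(6,5)] B(1) by fastforce
      then have step: "rpc_step (S, cs, R) = return_pmf (S, cs, R)" unfolding rpc_step_eq R by simp
      show ?case unfolding step rt_return_iff
        by (rule dt_Skip) (use ag1(2) in \<open>auto simp: rep_def\<close>)
    qed auto
  qed (auto simp: algebra_simps)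
qed

text \<open>\<open>R\<close> is left out: the output \<open>(S, F)\<close> determines it.\<close>

definition out_rep :: "nat \<Rightarrow> nat \<Rightarrow> nat \<Rightarrow> nat \<Rightarrow> store \<Rightarrow> nat list \<times> real mat \<Rightarrow> bool" where
  "out_rep ri ii ci di s = (\<lambda>(S, F). \<exists>cs R. F = mat_of_cols n cs \<and> rep ri ii ci di s (S, cs, R))"

definition rpc_run :: com where
  "rpc_run = Seq (SetReg 6 (Num 0)) (Seq diag_init (For 11 (Reg 1) rpc_stepc))"

lemma writes_rpc_run [simp]:
  "wregs diag_init = {12}" "widxs diag_init = {}" "wcells diag_init = {4}"
  "wregs rpc_run = {6, 8, 11, 12, 13}" "widxs rpc_run = {1}" "wcells rpc_run = {3, 4, 10}"
  by (auto simp: rpc_run_def diag_init_def)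

lemma rt_rpc_run:
  assumes s: "regs s 0 = n" "regs s 1 = d"
  shows "rt rpc_run s (20 + n * 10 + d * (61 + n * (100 + d * 20))) (n + d * n) (rpcholesky A d) (out_rep 6 1 3 4)"
proof -
  have dA: "dim_row A = n" using psd by (auto simp: psd_def)
  have rpc: "rpcholesky A d = map_pmf (\<lambda>(S, cs, R). (S, mat_of_cols n cs)) (iterp (\<lambda>_. rpc_step) d ([], [], A))"
    unfolding rpcholesky_def rpc_iter_iterp dA ..
  have "rt rpc_run s (20 + n * 10 + d * (61 + n * (100 + d * 20))) (n + d * n) (iterp (\<lambda>_. rpc_step) d ([], [], A)) (rep 6 1 3 4)"
    unfolding rpc_run_def
  proof (rule rt_Seq_dt[where ?w1.0 = 2 and ?w2.0 = "10 + n * 10 + d * (61 + n * (100 + d * 20))" and ?e1.0 = 0 and ?e2.0 = "n + d * n"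
        and P = "\<lambda>s'. regs s' 6 = 0"], goal_cases A B)
    case A
    show ?case by (rule dt_SetReg) auto
  next
    case (B s1)
    have ag1: "regs s1 0 = n" "regs s1 1 = d" using B(2) s by (auto simp: agree_def)
    show ?case
    proof (rule rt_Seq_dt[OF dt_diag_init[OF ag1(1)], where ?w2.0 = "2 + d * (1 + (60 + n * (100 + d * 20)))" and ?e2.0 = "d * n"], goal_cases C)
      case (C s2)
      have ag2: "regs s2 0 = n" "regs s2 1 = d" "regs s2 6 = 0" using C(2) ag1 B(1) by (auto simp: agree_def)
      show ?case
      proof (rule rt_For[where N = d and W = "60 + n * (100 + d * 20)" and E = n and
            I = "\<lambda>i s' st. rep 6 1 3 4 s' st \<and> length (fst st) \<le> i"], goal_cases N I0 step)
        case I0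
        show ?case using ag2 C(1) rpc_inv_init[OF psd] by (simp add: rep_def)
      next
        case (step i s' st)
        obtain S cs R where st: "st = (S, cs, R)" by (cases st)
        have len: "length S < d" using step(1,2) by (simp add: st)
        have ag: "regs (charge 1 0 (set_reg 11 i s')) 0 = n" "rep 6 1 3 4 (charge 1 0 (set_reg 11 i s')) (S, cs, R)"
          using step(2,3) ag2 by (auto simp: agree_def rep_def st)
        show ?case
          unfolding st
          by (rule rt_conseq[OF rt_rpc_stepc[OF ag len]]) (use step(2) st in auto)
      qed (use ag2 in auto)
    qed auto
  qed auto
  then show ?thesis
    unfolding rpc by (rule rt_map) (auto simp: out_rep_def)
qed

definition copy :: com where
  "copy = Seq (SetReg 7 (Reg 6)) (Seq copy_idx (Seq copy_diag copy_factor))"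

lemma writes_copy [simp]:
  "wregs copy_idx = {12}" "widxs copy_idx = {0}" "wcells copy_idx = {}"
  "wregs copy_diag = {12}" "widxs copy_diag = {}" "wcells copy_diag = {5}"
  "wregs copy_factor = {12, 13}" "widxs copy_factor = {}" "wcells copy_factor = {2}"
  "wregs copy = {7, 12, 13}" "widxs copy = {0}" "wcells copy = {2, 5}"
  by (auto simp: copy_def copy_idx_def copy_diag_def copy_factor_def)

lemma dt_copy:
  assumes s: "regs s 0 = n" and r: "out_rep 6 1 3 4 s SF"
  shows "dt copy s (20 + d * 10 + n * (20 + d * 10)) 0 (\<lambda>s'. out_rep 7 0 2 5 s' SF)"
proof -
  obtain S cs R where SF: "SF = (S, mat_of_cols n cs)" and r: "rep 6 1 3 4 s (S, cs, R)"
    using r by (cases SF) (auto simp: out_rep_def)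
  let ?m = "length S"
  have len: "?m \<le> d" and rr: "regs s 6 = ?m" using r by (auto simp: rep_def)
  have "dt copy s (20 + d * 10 + n * (20 + d * 10)) 0 (\<lambda>s'. rep 7 0 2 5 s' (S, cs, R))"
    unfolding copy_def
  proof (rule dt_Seq[where ?w1.0 = 2 and ?w2.0 = "10 + d * 10 + n * (20 + d * 10)" and ?e1.0 = 0 and ?e2.0 = 0
        and P = "\<lambda>s'. regs s' 7 = ?m"], goal_cases A B)
    case A
    show ?case by (rule dt_SetReg) (use rr in auto)
  next
    case (B s1)
    have ag1: "regs s1 0 = n" "regs s1 6 = ?m" "idxs s1 = idxs s" "cells s1 = cells s" using B(2) s rr by (auto simp: agree_def)
    have w: "2 + ?m * 10 \<le> 2 + d * 10" using len by simp
    show ?case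
    proof (rule dt_Seq[OF dt_weaken[OF dt_copy_idx[OF ag1(2) len] w order_refl], where ?w2.0 = "6 + n * (20 + d * 10)" and ?e2.0 = 0], goal_cases C)
      case (C s2)
      have ag2: "regs s2 0 = n" "regs s2 6 = ?m" "regs s2 7 = ?m" "cells s2 = cells s" using C(2) ag1 B(1) by (auto simp: agree_def)
      show ?case
      proof (rule dt_Seq[OF dt_copy_diag[OF ag2(1)], where ?w2.0 = "4 + n * (10 + d * 10)" and ?e2.0 = 0], goal_cases D)
        case (D s3)
        have ag3: "regs s3 0 = n" "regs s3 6 = ?m" "regs s3 7 = ?m" "cells s3 3 = cells s 3" "idxs s3 = idxs s2" using D(2) ag2 by (auto simp: agree_def)
        have w: "2 + n * (1 + (2 + ?m * 10)) \<le> 4 + n * (10 + d * 10)"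
          using mult_left_mono[of "1 + (2 + ?m * 10)" "10 + d * 10" n] len by simp
        show ?case
        proof (rule dt_conseq[OF dt_copy_factor[OF ag3(1,2) len] _ w order_refl], goal_cases E)
          case (E s4)
          have "regs s4 7 = ?m" "idxs s4 = idxs s2" "cells s4 5 = cells s3 5" using E(2) ag3 by (auto simp: agree_def)
          then show ?case using E(1) C(1) D(1) ag1 ag2 ag3 r by (auto simp: rep_def)
        qed
      qed (auto simp: algebra_simps)
    qed auto
  qed auto
  then show ?thesis
    by (rule dt_conseq) (auto simp: SF out_rep_def)
qed

text \<open>Runs are compared by traces of Nystrom residuals, which the stored diagonal provides at
  the price of one sum.\<close>

lemma out_rep_trace:
  assumes "out_rep ri ii ci di s SF"
  shows "(\<Sum>i<n. cells s di i 0) = tr (A - nystrom A (fst SF))"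
proof -
  obtain S cs R where SF: "SF = (S, mat_of_cols n cs)" and r: "rep ri ii ci di s (S, cs, R)"
    using assms by (cases SF) (auto simp: out_rep_def)
  have A: "A \<in> carrier_mat n n" using psd by (simp add: psd_def)
  have "rpc_inv n A (S, cs, R)" using r by (simp add: rep_def)
  from rpc_output.tr_residual[OF rpc_output.intro[OF this A]]
  show ?thesis using r by (simp add: SF rep_def)
qed

definition boost :: com where
  "boost = Seq rpc_run (Seq copy (For 10 (ISub (Reg 3) (Num 1)) (Seq rpc_run (Seq
     (sumto 10 12 (Reg 0) (Cell 4 (Reg 12) (Num 0))) (Seq
     (sumto 11 12 (Reg 0) (Cell 5 (Reg 12) (Num 0)))
     (IfLess (scal 10) (scal 11) copy Skip))))))"

lemma writes_boost [simp]:
  "wregs boost = {6, 7, 8, 10, 11, 12, 13}" "widxs boost = {0, 1}" "wcells boost = {2, 3, 4, 5, 10, 11}"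
  by (auto simp: boost_def)

lemma out_rep_agree:
  assumes "out_rep ri ii ci di s SF" "regs s' ri = regs s ri" "idxs s' ii = idxs s ii" "cells s' ci = cells s ci" "cells s' di = cells s di"
  shows "out_rep ri ii ci di s' SF"
  using assms by (auto simp: out_rep_def rep_def)

lemma rt_boost:
  fixes T
  defines "w \<equiv> 20 + n * 10 + d * (61 + n * (100 + d * 20))" and "wc \<equiv> 20 + d * 10 + n * (20 + d * 10)"
  assumes s: "regs s 0 = n" "regs s 1 = d" "regs s 3 = T" and T: "0 < T"
  shows "rt boost s (10 + T * (60 + n * 40 + w + wc)) (T * (n + d * n)) (boosted_rpcholesky A d T) (out_rep 7 0 2 5)"
  unfolding boosted_iterp[OF T] boost_def
proof (rule rt_Seq[OF rt_rpc_run[OF s(1,2), folded w_def], where ?w2.0 = "wc + (4 + (T - 1) * (1 + (50 + n * 40 + w + wc)))" and ?e2.0 = "(T - 1) * (n + d * n)"], goal_cases A w e)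
  case (A s1 SF)
  have ag1: "regs s1 0 = n" "regs s1 1 = d" "regs s1 3 = T" using A(2) s by (auto simp: agree_def)
  show ?case
  proof (rule rt_Seq_dt[OF dt_copy[OF ag1(1) A(1), folded wc_def], where ?w2.0 = "4 + (T - 1) * (1 + (50 + n * 40 + w + wc))" and ?e2.0 = "(T - 1) * (n + d * n)"], goal_cases B)
    case (B s2)
    have ag2: "regs s2 0 = n" "regs s2 1 = d" "regs s2 3 = T" using B(2) ag1 by (auto simp: agree_def)
    show ?case
    proof (rule rt_For[where N = "T - 1" and W = "50 + n * 40 + w + wc" and E = "n + d * n" and I = "\<lambda>_. out_rep 7 0 2 5"], goal_cases N I0 step)
      case I0
      show ?case by (rule out_rep_agree[OF B(1)]) auto
    next
      case (step i s3 z)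
      let ?s = "charge 1 0 (set_reg 10 i s3)"
      have ag3: "regs ?s 0 = n" "regs ?s 1 = d" using step(3) ag2 by (auto simp: agree_def)
      have z: "out_rep 7 0 2 5 ?s z" by (rule out_rep_agree[OF step(2)]) auto
      show ?case
      proof (rule rt_Seq[OF rt_rpc_run[OF ag3, folded w_def], where ?w2.0 = "50 + n * 40 + wc" and ?e2.0 = 0], goal_cases C)
        case (C s4 y)
        have ag4: "regs s4 0 = n" using C(2) ag3 by (auto simp: agree_def)
        have z4: "out_rep 7 0 2 5 s4 z" by (rule out_rep_agree[OF z]) (use C(2) in \<open>auto simp: agree_def\<close>)
        let ?y = "tr (A - nystrom A (fst y))" and ?z = "tr (A - nystrom A (fst z))"
        show ?case
          unfolding rt_return_iff
        proof (rule dt_Seq[where ?w1.0 = "10 + n * 20" and ?w2.0 = "40 + n * 20 + wc" and ?e1.0 = 0 and ?e2.0 = 0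
              and P = "\<lambda>s'. cells s' 10 0 0 = ?y"], goal_cases D E)
          case D
          show ?case unfolding out_rep_trace[OF C(1), symmetric] by (rule dt_sumto) (use ag4 n in \<open>auto simp: agree_def\<close>)
        next
          case (E s5)
          have ag5: "regs s5 0 = n" using E(2) ag4 by (auto simp: agree_def)
          have z5: "out_rep 7 0 2 5 s5 z" by (rule out_rep_agree[OF z4]) (use E(2) in \<open>auto simp: agree_def\<close>)
          have y5: "out_rep 6 1 3 4 s5 y" by (rule out_rep_agree[OF C(1)]) (use E(2) in \<open>auto simp: agree_def\<close>)
          show ?case
          proof (rule dt_Seq[where ?w1.0 = "10 + n * 20" and ?w2.0 = "30 + wc" and ?e1.0 = 0 and ?e2.0 = 0
                and P = "\<lambda>s'. cells s' 11 0 0 = ?z"], goal_cases F G)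
            case F
            show ?case unfolding out_rep_trace[OF z5, symmetric] by (rule dt_sumto) (use ag5 n in \<open>auto simp: agree_def\<close>)
          next
            case (G s6)
            have ag6: "regs s6 0 = n" "cells s6 10 0 0 = ?y" using G(2) ag5 E(1) by (auto simp: agree_def)
            have z6: "out_rep 7 0 2 5 s6 z" by (rule out_rep_agree[OF z5]) (use G(2) in \<open>auto simp: agree_def\<close>)
            have y6: "out_rep 6 1 3 4 s6 y" by (rule out_rep_agree[OF y5]) (use G(2) in \<open>auto simp: agree_def\<close>)
            have "rt (IfLess (scal 10) (scal 11) copy Skip) s6 (30 + wc) 0 (return_pmf (if ?y < ?z then y else z)) (out_rep 7 0 2 5)"
            proof (rule rt_IfLess[where ?w1.0 = wc and ?e1.0 = 0], goal_cases H K)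
              case H
              then have "?y < ?z" using ag6 G(1) by simp
              moreover have "out_rep 6 1 3 4 (charge (1 + rcost (scal 10) + rcost (scal 11)) (entry_count (scal 10) + entry_count (scal 11)) s6) y"
                by (rule out_rep_agree[OF y6]) auto
              ultimately show ?case
                unfolding rt_return_iff by (simp only: if_True) (rule dt_copy[folded wc_def], use ag6 in auto)
            next
              case K
              then have "\<not> ?y < ?z" using ag6 G(1) by simp
              moreover have "out_rep 7 0 2 5 (charge (1 + rcost (scal 10) + rcost (scal 11)) (entry_count (scal 10) + entry_count (scal 11)) s6) z"
                by (rule out_rep_agree[OF z6]) auto
              ultimately show ?case
                unfolding rt_return_iff by (simp only: if_False) (rule dt_Skip)
            qed auto
            then show ?case unfolding rt_return_iff .
          qed auto
        qed auto
      qed auto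
    qed (use ag2 in auto)
  qed auto
next
  case w
  obtain T' where "T = Suc T'" using T by (cases T) auto
  then show ?case by (simp add: algebra_simps)
next
  case e
  obtain T' where "T = Suc T'" using T by (cases T) auto
  then show ?case by simp
qed

end

section \<open>SC-RCD in the program\<close>

context scrcd_system
begin

definition sc_rep :: "real vec \<Rightarrow> nat list \<times> real mat \<Rightarrow> store \<Rightarrow> real vec \<times> real vec \<Rightarrow> bool" where
  "sc_rep x0 SF s = (\<lambda>(x, res). out_rep 7 0 2 5 s SF \<and> dim_vec x = n \<and> dim_vec res = n \<and> dim_vec x0 = n \<and>
     (\<forall>i<n. cells s 0 i 0 = x $ i) \<and> (\<forall>i<n. cells s 7 i 0 = res $ i) \<and> (\<forall>i<n. cells s 1 i 0 = x0 $ i))"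

lemma rep_output:
  assumes "rep ri ii ci di s (S, cs, R)"
  shows "rpc_output n A S cs R"
  using assms psd by (intro rpc_output.intro) (auto simp: rep_def psd_def)

definition scrcd_pre :: com where
  "scrcd_pre = Seq fwd (Seq bwd (Seq add_pivots (Seq res_init save_x0)))"

lemma writes_pre [simp]:
  "wregs fwd = {12, 13}" "widxs fwd = {}" "wcells fwd = {6, 10}"
  "wregs bwd = {12, 13, 14}" "widxs bwd = {}" "wcells bwd = {6, 10}"
  "wregs add_pivots = {12}" "widxs add_pivots = {}" "wcells add_pivots = {0}"
  "wregs res_init = {12, 13}" "widxs res_init = {}" "wcells res_init = {7, 10}"
  "wregs save_x0 = {12}" "widxs save_x0 = {}" "wcells save_x0 = {1}"
  "wregs scrcd_pre = {12, 13, 14}" "widxs scrcd_pre = {}" "wcells scrcd_pre = {0, 1, 6, 7, 10}"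
  by (auto simp: scrcd_pre_def fwd_def bwd_def add_pivots_def res_init_def save_x0_def)

lemma pivots_le_n: "rpc_inv n A (S, cs, R) \<Longrightarrow> length S \<le> n"
  using rpc_invD(2,3)[of n A S cs R] card_mono[of "{..<n}" "set S"] by (simp add: distinct_card)

text \<open>The iterate is not cleared by a command: the input store is zero and boosting does not
  write array 0, whence the hypothesis on it. Array 6 holds \<open>\<gamma>\<close> between the two
  substitutions and \<open>\<beta>\<close> afterwards.\<close>

lemma dt_scrcd_pre:
  assumes s: "regs s 0 = n" and r: "out_rep 7 0 2 5 s (S, F)" and c0: "\<And>i. i < n \<Longrightarrow> cells s 0 i 0 = 0"
  shows "dt scrcd_pre s (20 + n * (200 + d * 100)) (n * d)
    (\<lambda>s'. sc_rep (fst (scrcd_init A b S F)) (S, F) s' (scrcd_init A b S F))"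
proof -
  obtain cs R where F: "F = mat_of_cols n cs" and r': "rep 7 0 2 5 s (S, cs, R)"
    using r by (auto simp: out_rep_def)
  interpret rpc_output n A S cs R F "submat F S [0..<length S]" "inv_mat (submat F S [0..<length S])"
    unfolding F by (rule rep_output[OF r'])
  let ?m = "length S" and ?L = "inv_mat (submat F S [0..<length S])"
  have len: "?m \<le> d" "?m \<le> n" and rr: "regs s 7 = ?m" "\<And>t. t < ?m \<Longrightarrow> idxs s 0 t = S ! t"
    and F2: "\<And>i t. i < n \<Longrightarrow> t < ?m \<Longrightarrow> cells s 2 i t = F $$ (i, t)"
    using r' pivots_le_n[OF inv] F_index by (auto simp: rep_def)
  have low: "\<And>t u. u < ?m \<Longrightarrow> t < u \<Longrightarrow> cells s 2 (S ! t) u = 0" "\<And>t. t < ?m \<Longrightarrow> cells s 2 (S ! t) t \<noteq> 0"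
    using rpcI(9,10) S_nth F2 F_index by (auto simp: order.strict_trans, (metis less_irrefl)?)
  have SS: "distinct S" "set S \<subseteq> {..<n}" using rpcI by auto
  define \<gamma> where "\<gamma> = ?L *\<^sub>v subvec b S"
  define \<beta> where "\<beta> = ?L\<^sup>T *\<^sub>v \<gamma>"
  have dim: "dim_vec (subvec b S) = ?m" "dim_vec \<gamma> = ?m" "dim_vec \<beta> = ?m"
    using L_props(1) by (auto simp: subvec_def \<gamma>_def \<beta>_def)
  have g: "(\<Sum>u<?m. cells s 2 (S ! t) u * \<gamma> $ u) = b $ (S ! t)" if "t < ?m" for t
    using L_solves[OF dim(1) that] F2 S_nth[OF that] that by (simp add: \<gamma>_def subvec_def)
  have bt: "(\<Sum>u<?m. cells s 2 (S ! u) t * \<beta> $ u) = \<gamma> $ t" if "t < ?m" for t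
    using LT_solves[OF dim(2) that] F2 S_nth that by (simp add: \<beta>_def)
  have dA: "dim_row A = n" using A by simp
  have db: "dim_vec b = n" using xs A by auto
  have init: "scrcd_init A b S F = (add_at (0\<^sub>v n) S \<beta>, submat A [0..<n] S *\<^sub>v \<beta> - b)"
    unfolding scrcd_init_def Let_def dA rows_of_F \<gamma>_def[symmetric] \<beta>_def[symmetric] ..
  have CS: "submat A [0..<n] S \<in> carrier_mat n ?m" by (intro carrier_matI) auto
  have res: "(submat A [0..<n] S *\<^sub>v \<beta> - b) $ i = (\<Sum>t<?m. A $$ (i, S ! t) * \<beta> $ t) - b $ i" if "i < n" for i
  proof -
    have "(submat A [0..<n] S *\<^sub>v \<beta>) $ i = (\<Sum>t<?m. A $$ (i, S ! t) * \<beta> $ t)"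
      unfolding mult_mat_vec_index[OF CS dim(3) that] mvf_def using that by (intro sum.cong refl) (simp add: submat_def)
    then show ?thesis using that db by (simp del: index_mult_mat_vec)
  qed
  have wf: "2 + ?m * (1 + (40 + ?m * 20)) \<le> 2 + n * (41 + d * 20)"
    using mult_mono[OF len(2), of "41 + ?m * 20" "41 + d * 20"] len by simp
  have wb: "2 + ?m * (1 + (60 + ?m * 40)) \<le> 2 + n * (61 + d * 40)"
    using mult_mono[OF len(2), of "61 + ?m * 40" "61 + d * 40"] len by simp
  have wa: "2 + ?m * 20 \<le> 2 + n * 20" using len by simp
  have wr: "2 + n * (1 + (30 + ?m * 20)) \<le> 2 + n * (31 + d * 20)"
    using mult_left_mono[of "31 + ?m * 20" "31 + d * 20" n] len by simp
  have er: "n * ?m \<le> n * d" using len by simp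
  have "dt fwd s (2 + n * (41 + d * 20)) 0 (\<lambda>s'. \<forall>t<?m. cells s' 6 t 0 = \<gamma> $ t)"
    by (rule dt_weaken[OF dt_fwd[where m = ?m and S = S] wf order_refl]) (use rr len low g in auto)
  then show ?thesis
    unfolding scrcd_pre_def
  proof (rule dt_Seq[where ?w2.0 = "10 + n * (150 + d * 60)" and ?e2.0 = "n * d"], goal_cases B)
    case (B s1)
    have ag1: "regs s1 0 = n" "regs s1 7 = ?m" "idxs s1 = idxs s" "cells s1 2 = cells s 2" using B(2) s rr by (auto simp: agree_def)
    have "dt bwd s1 (2 + n * (61 + d * 40)) 0 (\<lambda>s'. \<forall>t<?m. cells s' 6 t 0 = \<beta> $ t)"
      by (rule dt_weaken[OF dt_bwd[where m = ?m and S = S] wb order_refl]) (use ag1 rr len low bt B(1) in auto)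
    then show ?case
    proof (rule dt_Seq[where ?w2.0 = "8 + n * (89 + d * 20)" and ?e2.0 = "n * d"], goal_cases C)
      case (C s2)
      have ag2: "regs s2 0 = n" "regs s2 7 = ?m" "idxs s2 = idxs s" "cells s2 2 = cells s 2" "cells s2 0 = cells s 0"
        using C(2) B(2) ag1 by (auto simp: agree_def)
      have idx2: "\<And>t. t < ?m \<Longrightarrow> idxs s2 0 t = S ! t" using rr ag2 by simp
      have "dt add_pivots s2 (2 + n * 20) 0 (\<lambda>s'. \<forall>i<n. cells s' 0 i 0 = emb S \<beta> i)"
      proof (rule dt_conseq[OF dt_add_pivots[OF ag2(2) idx2 SS] _ wa order_refl], goal_cases A2 D)
        case (D s')
        have "emb S (vec ?m (\<lambda>t. cells s2 6 t 0)) i = emb S \<beta> i" for i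
          unfolding emb_def using C(1) by (intro sum.cong) auto
        then show ?case using D(1) c0 ag2 by simp
      qed
      then show ?case
      proof (rule dt_Seq[where ?w2.0 = "6 + n * (69 + d * 20)" and ?e2.0 = "n * d"], goal_cases D)
        case (D s3)
        have ag3: "regs s3 0 = n" "regs s3 7 = ?m" "idxs s3 = idxs s" "cells s3 2 = cells s 2" "cells s3 6 = cells s2 6"
          using D(2) ag2 by (auto simp: agree_def)
        have "dt res_init s3 (2 + n * (31 + d * 20)) (n * d) (\<lambda>s'. \<forall>i<n. cells s' 7 i 0 = (submat A [0..<n] S *\<^sub>v \<beta> - b) $ i)"
          by (rule dt_conseq[OF dt_res_init[where S = S] _ wr er]) (use ag3 rr C(1) res in auto)
        then show ?case
        proof (rule dt_Seq[where ?w2.0 = "2 + n * 10" and ?e2.0 = 0], goal_cases E)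
          case (E s4)
          have ag4: "regs s4 0 = n" "regs s4 7 = ?m" "idxs s4 = idxs s" "cells s4 2 = cells s 2" "cells s4 0 = cells s3 0"
            using E(2) ag3 by (auto simp: agree_def)
          show ?case
          proof (rule dt_conseq[OF dt_save_x0[OF ag4(1)]], goal_cases G)
            case (G s5)
            have ag5: "regs s5 7 = regs s 7" "idxs s5 = idxs s" "cells s5 2 = cells s 2" "cells s5 0 = cells s3 0" "cells s5 7 = cells s4 7" "cells s5 5 = cells s 5"
              using G(2) E(2) D(2) C(2) B(2) ag4 rr by (auto simp: agree_def)
            have "out_rep 7 0 2 5 s5 (S, F)"
              by (rule out_rep_agree[OF r]) (use ag5 in auto)
            moreover have "add_at (0\<^sub>v n) S \<beta> $ i = emb S \<beta> i" if "i < n" for i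
              using that by (simp add: add_at_index)
            ultimately show ?case
              unfolding init fst_conv sc_rep_def using G(1) D(1) E(1) ag5 ag4 db by simp
          qed auto
        qed (auto simp: algebra_simps)
      qed (auto simp: algebra_simps)
    qed (auto simp: algebra_simps)
  qed (auto simp: algebra_simps)
qed

text \<open>\<open>res_update\<close> precedes \<open>bwd\<close> because array 6 holds
  \<open>F\<^sub>J\<^sup>T \<alpha>\<close> until substitution overwrites it with
  \<open>\<beta>\<close>; the residual vector is updated from the former, the pivot entries of the
  iterate from the latter.\<close>

definition scrcd_block :: com where
  "scrcd_block = Seq dedup (Seq solve (Seq factor_alpha (Seq res_update (Seq bwd (Seq sub_block add_pivots)))))"

definition scrcd_iterc :: com where
  "scrcd_iterc = Seq (sumto 10 12 (Reg 0) (Cell 5 (Reg 12) (Num 0))) (IfLess (Lit 0) (scal 10) (Seq draw scrcd_block) Skip)"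

lemma writes_iter [simp]:
  "wregs draw = {8, 12}" "widxs draw = {2}" "wcells draw = {}"
  "wregs dedup = {5, 9, 12, 13}" "widxs dedup = {3}" "wcells dedup = {}"
  "wregs solve = {12, 13, 14}" "widxs solve = {}" "wcells solve = {8, 9, 10, 11, 12}"
  "wregs factor_alpha = {12, 13}" "widxs factor_alpha = {}" "wcells factor_alpha = {6, 10}"
  "wregs res_update = {12, 13}" "widxs res_update = {}" "wcells res_update = {7, 10, 11}"
  "wregs sub_block = {12}" "widxs sub_block = {}" "wcells sub_block = {0}"
  "wregs scrcd_block = {5, 9, 12, 13, 14}" "widxs scrcd_block = {3}" "wcells scrcd_block = {0, 6, 7, 8, 9, 10, 11, 12}"
  "wregs scrcd_iterc = {5, 8, 9, 12, 13, 14}" "widxs scrcd_iterc = {2, 3}" "wcells scrcd_iterc = {0, 6, 7, 8, 9, 10, 11, 12}"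
  by (auto simp: draw_def dedup_def dup_test_def solve_def factor_alpha_def res_update_def sub_block_def scrcd_block_def scrcd_iterc_def)

lemma dt_scrcd_block:
  assumes s: "regs s 0 = n" "regs s 2 = l" "length js = l" "\<And>t. t < l \<Longrightarrow> idxs s 2 t = js ! t" and js: "set js \<subseteq> {..<n}"
    and r: "sc_rep x0 (S, F) s (x, res)" and sinv: "rpc_output.sc_inv n A S xs (x, res)"
  shows "dt scrcd_block s (100 + n * (200 + d * 60 + l * 20) + l * (300 + l * 300 + l * d * 20 + l * l * 60) + d * l * 20) (n * l + n * l)
    (\<lambda>s'. sc_rep x0 (S, F) s' (sc_upd A S F (x, res) js))"
proof -
  have r0: "out_rep 7 0 2 5 s (S, F)" using r by (simp add: sc_rep_def)
  obtain cs R where F: "F = mat_of_cols n cs" and r': "rep 7 0 2 5 s (S, cs, R)"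
    using r0 by (auto simp: out_rep_def)
  interpret rpc_output n A S cs R F "submat F S [0..<length S]" "inv_mat (submat F S [0..<length S])"
    unfolding F by (rule rep_output[OF r'])
  let ?m = "length S"
  have len: "?m \<le> d" "?m \<le> n" and rr: "regs s 7 = ?m" "\<And>t. t < ?m \<Longrightarrow> idxs s 0 t = S ! t"
    and F2: "\<And>i t. i < n \<Longrightarrow> t < ?m \<Longrightarrow> cells s 2 i t = F $$ (i, t)"
    using r' pivots_le_n[OF rpc_output.inv[OF rep_output[OF r']]] F_index by (auto simp: rep_def)
  have low: "\<And>t u. u < ?m \<Longrightarrow> t < u \<Longrightarrow> cells s 2 (S ! t) u = 0" "\<And>t. t < ?m \<Longrightarrow> cells s 2 (S ! t) t \<noteq> 0"
    using rpcI(9,10) S_nth F2 F_index by (auto simp: order.strict_trans, (metis less_irrefl)?)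
  have SS: "distinct S" "set S \<subseteq> {..<n}" using rpcI by auto
  have vecs: "dim_vec x = n" "dim_vec res = n" "dim_vec x0 = n" "\<And>i. i < n \<Longrightarrow> cells s 0 i 0 = x $ i"
    "\<And>i. i < n \<Longrightarrow> cells s 7 i 0 = res $ i" "\<And>i. i < n \<Longrightarrow> cells s 1 i 0 = x0 $ i"
    using r by (auto simp: sc_rep_def)
  define J where "J = remdups js"
  let ?q = "length J"
  have J: "distinct J" "set J \<subseteq> {..<n}" using js by (auto simp: J_def)
  have Jn: "J ! a < n" if "a < ?q" for a using J(2) nth_mem[OF that] by auto
  \<comment> \<open>Distinct indices below \<open>n\<close> among \<open>l\<close> draws: both
    bounds hold, so the \<open>q\<^sup>2\<close> entries of the block take at most
    \<open>n l\<close> evaluations.\<close>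
  have q: "?q \<le> n" "?q \<le> l"
    using card_mono[OF _ J(2)] distinct_card[OF J(1)] length_remdups_leq[of js] s(3) by (auto simp: J_def)
  obtain \<alpha> where al: "is_alpha J res \<alpha>"
    using is_alpha_exists[OF J(2) sc_inv_err(1)[OF sinv]] by blast
  have da: "dim_vec \<alpha> = ?q" using al by (simp add: is_alpha_def)
  define y where "y = (\<lambda>t. \<Sum>j<?q. F $$ (J ! j, t) * \<alpha> $ j)"
  obtain \<beta> where \<beta>: "dim_vec \<beta> = ?m" "\<forall>t<?m. (\<Sum>u<?m. F $$ (S ! u, t) * \<beta> $ u) = y t"
    using tri_solvable[of y] by blast
  have upd: "sc_upd A S F (x, res) js =
    (vec n (\<lambda>i. x $ i + emb J (- \<alpha>) i + emb S \<beta> i),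
     vec n (\<lambda>i. res $ i - ((\<Sum>j<?q. A $$ (i, J ! j) * \<alpha> $ j) - (\<Sum>t<?m. F $$ (i, t) * y t))))"
    unfolding y_def by (rule sc_upd_eq[OF J_def js vecs(1,2) al \<beta>(1)]) (use \<beta>(2) in \<open>simp add: y_def\<close>)
  define G where "G = (\<lambda>i j. A $$ (J ! i, J ! j) - (\<Sum>t<?m. cells s 2 (J ! i) t * cells s 2 (J ! j) t))"
  have GR: "G i j = R $$ (J ! i, J ! j)" if "i < ?q" "j < ?q" for i j
    using A_index[OF Jn[OF that(1)] Jn[OF that(2)]] F2 Jn that by (simp add: G_def)
  have Gip: "ip ?q (G i) w = mvf ?q (\<lambda>a b. R $$ (J ! a, J ! b)) w i" if "i < ?q" for i w
    unfolding ip_def mvf_def using GR[OF that] by (intro sum.cong) auto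
  let ?ws = "10 + l * (200 + l * 200 + l * d * 20 + l * l * 60)"
  have ws: "10 + ?q * (200 + ?q * 200 + ?q * ?m * 20 + ?q * ?q * 60) \<le> ?ws"
    using q len by (intro add_mono mult_mono order_refl) auto
  have es: "?q * ?q \<le> n * l" using q by (intro mult_mono) auto
  have wf: "2 + ?m * (1 + (30 + ?q * 20)) \<le> 2 + (n * 31 + d * l * 20)"
  proof -
    have "?m * (?q * 20) \<le> d * (l * 20)" using q len by (intro mult_mono) auto
    then show ?thesis using len by (simp add: algebra_simps)
  qed
  have wr: "2 + n * (1 + (60 + (?q * 20 + ?m * 20))) \<le> 2 + n * (61 + l * 20 + d * 20)"
    using mult_left_mono[of "61 + (?q * 20 + ?m * 20)" "61 + l * 20 + d * 20" n] len q by simp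
  have er: "n * ?q \<le> n * l" using q by simp
  have wb: "2 + ?m * (1 + (60 + ?m * 40)) \<le> 2 + n * (61 + d * 40)"
    using mult_mono[OF len(2), of "61 + ?m * 40" "61 + d * 40"] len by simp
  have wa: "2 + ?m * 20 \<le> 2 + n * 20" and wx: "2 + ?q * 20 \<le> 2 + l * 20" using len q by auto
  show ?thesis
    unfolding scrcd_block_def
  proof (rule dt_Seq[OF dt_dedup[OF s(2-4), folded J_def], where
        ?w2.0 = "80 + n * (200 + d * 60 + l * 20) + l * (250 + l * 250 + l * d * 20 + l * l * 60) + d * l * 20" and ?e2.0 = "n * l + n * l"], goal_cases A B w e)
    case (B s1)
    have ag1: "regs s1 0 = n" "regs s1 7 = ?m" "regs s1 9 = ?q" "idxs s1 0 = idxs s 0" "cells s1 = cells s"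
      using B s rr by (auto simp: agree_def)
    have idx1: "\<And>t. t < ?q \<Longrightarrow> idxs s1 3 t = J ! t" using B(1) by simp
    have "dt solve s1 ?ws (n * l) (\<lambda>s'. \<forall>t<?q. cells s' 8 t 0 = \<alpha> $ t)"
    proof (rule dt_weaken[OF dt_solve[where m = ?m and q = ?q and J = J and \<alpha> = "fn_of_vec \<alpha>"] ws es], goal_cases m q q1 q2 idx sol ker)
      case (sol i)
      show ?case using Gip[OF sol] al sol vecs(5)[OF Jn[OF sol]] ag1 by (simp add: is_alpha_def G_def)
    next
      case (ker w)
      then have "\<forall>a<?q. mvf ?q (\<lambda>a b. R $$ (J ! a, J ! b)) w a = 0" using Gip ag1 by (simp add: G_def)
      then show ?case using al by (simp add: is_alpha_def)
    qed (use ag1 idx1 q in auto)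
    then show ?case
    proof (rule dt_Seq[where ?w2.0 = "70 + n * (200 + d * 60 + l * 20) + l * 50 + d * l * 20" and ?e2.0 = "n * l"], goal_cases C)
      case (C s2)
      have ag2: "regs s2 0 = n" "regs s2 7 = ?m" "regs s2 9 = ?q" "idxs s2 = idxs s1" "cells s2 2 = cells s 2" "cells s2 7 = cells s 7" "cells s2 0 = cells s 0"
        using C(2) ag1 by (auto simp: agree_def)
      have "dt factor_alpha s2 (2 + (n * 31 + d * l * 20)) 0 (\<lambda>s'. \<forall>t<?m. cells s' 6 t 0 = y t)"
      proof (rule dt_conseq[OF dt_factor_alpha[where m = ?m and J = J] _ wf order_refl], goal_cases a b c e f)
        case (f s')
        then show ?case using C(1) F2 Jn ag2 by (simp add: y_def)
      qed (use ag2 idx1 len in auto)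
      then show ?case
      proof (rule dt_Seq[where ?w2.0 = "60 + n * (160 + d * 60 + l * 20) + l * 50" and ?e2.0 = "n * l"], goal_cases D)
        case (D s3)
        have ag3: "regs s3 0 = n" "regs s3 7 = ?m" "regs s3 9 = ?q" "idxs s3 = idxs s1" "cells s3 2 = cells s 2" "cells s3 7 = cells s 7" "cells s3 0 = cells s 0" "cells s3 8 = cells s2 8"
          using D(2) ag2 by (auto simp: agree_def)
        have "dt res_update s3 (2 + n * (61 + l * 20 + d * 20)) (n * l) (\<lambda>s'. \<forall>i<n. cells s' 7 i 0 =
          res $ i - ((\<Sum>j<?q. A $$ (i, J ! j) * \<alpha> $ j) - (\<Sum>t<?m. F $$ (i, t) * y t)))"
        proof (rule dt_conseq[OF dt_res_update[where m = ?m and J = J] _ wr er], goal_cases a b c e f)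
          case (f s')
          then show ?case using C(1) D(1) F2 ag3 vecs(5) by simp
        qed (use ag3 idx1 in auto)
        then show ?case
        proof (rule dt_Seq[where ?w2.0 = "50 + n * (90 + d * 40) + l * 50" and ?e2.0 = 0], goal_cases E)
          case (E s4)
          have ag4: "regs s4 0 = n" "regs s4 7 = ?m" "regs s4 9 = ?q" "idxs s4 = idxs s1" "cells s4 2 = cells s 2" "cells s4 0 = cells s 0" "cells s4 8 = cells s2 8" "cells s4 6 = cells s3 6"
            using E(2) ag3 by (auto simp: agree_def)
          have "dt bwd s4 (2 + n * (61 + d * 40)) 0 (\<lambda>s'. \<forall>t<?m. cells s' 6 t 0 = \<beta> $ t)"
            by (rule dt_weaken[OF dt_bwd[where m = ?m and S = S] wb order_refl])
              (use ag4 ag1 rr len low D(1) \<beta>(2) F2 S_nth in auto)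
          then show ?case
          proof (rule dt_Seq[where ?w2.0 = "40 + n * 20 + l * 50" and ?e2.0 = 0], goal_cases H)
            case (H s5)
            have ag5: "regs s5 0 = n" "regs s5 7 = ?m" "regs s5 9 = ?q" "idxs s5 = idxs s1" "cells s5 2 = cells s 2" "cells s5 0 = cells s 0" "cells s5 8 = cells s2 8" "cells s5 7 = cells s4 7"
              using H(2) ag4 by (auto simp: agree_def)
            have "dt sub_block s5 (2 + l * 20) 0 (\<lambda>s'. \<forall>i<n. cells s' 0 i 0 = x $ i + emb J (- \<alpha>) i)"
            proof (rule dt_conseq[OF dt_sub_block[OF _ _ J] _ wx order_refl], goal_cases a c f)
              case (f s')
              have "emb J (vec ?q (\<lambda>t. - cells s5 8 t 0)) i = emb J (- \<alpha>) i" for i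
                unfolding emb_def using C(1) ag5 da by (intro sum.cong) auto
              then show ?case using f(1) ag5 vecs(4) by simp
            qed (use ag5 idx1 in auto)
            then show ?case
            proof (rule dt_Seq[where ?w2.0 = "2 + n * 20" and ?e2.0 = 0], goal_cases K)
              case (K s6)
              have ag6: "regs s6 0 = n" "regs s6 7 = ?m" "idxs s6 = idxs s1" "cells s6 6 = cells s5 6"
                using K(2) ag5 by (auto simp: agree_def)
              have idx6: "\<And>t. t < ?m \<Longrightarrow> idxs s6 0 t = S ! t" using rr ag6 ag1 by simp
              show ?case
              proof (rule dt_conseq[OF dt_add_pivots[OF ag6(2) idx6 SS] _ wa order_refl], goal_cases A7 M)
                case (M s7)
                have "emb S (vec ?m (\<lambda>t. cells s6 6 t 0)) i = emb S \<beta> i" for i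
                  unfolding emb_def using H(1) ag6 by (intro sum.cong) auto
                then have x7: "\<forall>i<n. cells s7 0 i 0 = x $ i + emb J (- \<alpha>) i + emb S \<beta> i" using M(1) K(1) by simp
                have ag7: "regs s7 7 = regs s 7" "idxs s7 0 = idxs s 0" "cells s7 2 = cells s 2" "cells s7 5 = cells s 5" "cells s7 1 = cells s 1" "cells s7 7 = cells s4 7"
                  using M(2) K(2) H(2) E(2) D(2) C(2) B(2) by (auto simp: agree_def)
                have "out_rep 7 0 2 5 s7 (S, F)" by (rule out_rep_agree[OF r0]) (use ag7 in auto)
                then show ?case
                  unfolding upd sc_rep_def using x7 E(1) ag7 vecs(3,6) by simp
              qed
            qed (auto simp: algebra_simps)
          qed (auto simp: algebra_simps)
        qed (auto simp: algebra_simps)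
      qed (auto simp: algebra_simps)
    qed (auto simp: algebra_simps)
  qed (auto simp: algebra_simps)
qed

text \<open>\<open>sc_inv\<close> accompanies the coupling because the consistency of a block system
  rests on the residual vector being of the form \<open>R z\<close>.\<close>

lemma rt_scrcd_iterc:
  fixes x0 SF
  defines "wb \<equiv> 100 + n * (200 + d * 60 + l * 20) + l * (300 + l * 300 + l * d * 20 + l * l * 60) + d * l * 20"
  assumes s: "regs s 0 = n" "regs s 2 = l" and SF: "SF = (S, F)"
    and r: "sc_rep x0 SF s st" and sinv: "rpc_output.sc_inv n A S xs st"
  shows "rt scrcd_iterc s (50 + n * 20 + l * (7 + n) + wb) (n * l + n * l) (scrcd_step A l S F st)
    (\<lambda>s' st'. sc_rep x0 SF s' st' \<and> rpc_output.sc_inv n A S xs st')"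
proof -
  have r0: "out_rep 7 0 2 5 s (S, F)" using r unfolding SF sc_rep_def by (cases st) simp
  obtain cs R where F: "F = mat_of_cols n cs" and r': "rep 7 0 2 5 s (S, cs, R)"
    using r0 by (auto simp: out_rep_def)
  interpret rpc_output n A S cs R F "submat F S [0..<length S]" "inv_mat (submat F S [0..<length S])"
    unfolding F by (rule rep_output[OF r'])
  have dg: "\<And>i. i < n \<Longrightarrow> cells s 5 i 0 = R $$ (i, i)" using r' by (auto simp: rep_def)
  obtain x res where st: "st = (x, res)" by (cases st)
  have "rt scrcd_iterc s (50 + n * 20 + l * (7 + n) + wb) (n * l + n * l) (scrcd_step A l S F st) (sc_rep x0 SF)"
    unfolding scrcd_iterc_def
  proof (rule rt_Seq_dt[where ?w1.0 = "10 + n * 20" and ?w2.0 = "30 + l * (7 + n) + wb" and ?e1.0 = 0 and ?e2.0 = "n * l + n * l"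
        and P = "\<lambda>s'. cells s' 10 0 0 = (\<Sum>i<n. R $$ (i, i))"], goal_cases A B)
    case A
    show ?case by (rule dt_sumto) (use s dg n in \<open>auto simp: agree_def\<close>)
  next
    case (B s1)
    have ag1: "regs s1 0 = n" "regs s1 2 = l" "cells s1 5 = cells s 5" using B(2) s by (auto simp: agree_def)
    have r1: "sc_rep x0 SF s1 st"
      unfolding sc_rep_def SF using r out_rep_agree[OF r0, of s1] B(2) by (auto simp: agree_def sc_rep_def st)
    show ?case
    proof (rule rt_IfLess[where ?w1.0 = "10 + l * (7 + n) + wb" and ?e1.0 = "n * l + n * l"], goal_cases T F)
      case T
      let ?s = "charge (1 + rcost (Lit 0) + rcost (scal 10)) (entry_count (Lit 0) + entry_count (scal 10)) s1"
      have "R \<noteq> 0\<^sub>m n n" using T B(1) by auto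
      then have step: "scrcd_step A l S F st = bind_pmf (replicate_pmf l (index_pmf n (\<lambda>j. R $$ (j, j)))) (\<lambda>js. return_pmf (sc_upd A S F st js))"
        unfolding scrcd_step_R by (simp add: map_pmf_def)
      have ix: "index_pmf n (\<lambda>j. R $$ (j, j)) = index_pmf n (\<lambda>j. cells ?s 5 j 0)"
        using ag1 dg by (intro index_pmf_cong) simp
      have ags: "regs ?s 0 = n" "regs ?s 2 = l" using ag1 by auto
      show ?case
        unfolding step ix
      proof (rule rt_Seq[OF rt_draw[OF ags], where ?w2.0 = wb and ?e2.0 = "n * l + n * l"], goal_cases C)
        case (C s2 js)
        have ag2: "regs s2 0 = n" "regs s2 2 = l" using C(2) ag1 by (auto simp: agree_def)
        have js: "set js \<subseteq> {..<n}"
          using C(3) set_index_pmf_R[OF \<open>R \<noteq> 0\<^sub>m n n\<close>] unfolding ix[symmetric] by (auto simp: set_replicate_pmf)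
        have r1': "out_rep 7 0 2 5 s1 (S, F)" using r1 unfolding SF sc_rep_def by (cases st) simp
        have "out_rep 7 0 2 5 s2 (S, F)"
          by (rule out_rep_agree[OF r1']) (use C(2) in \<open>auto simp: agree_def\<close>)
        then have r2: "sc_rep x0 (S, F) s2 (x, res)"
          using r1 C(2) unfolding st sc_rep_def SF by (simp add: agree_def)
        show ?case
          unfolding rt_return_iff wb_def st SF
          by (rule dt_scrcd_block) (use ag2 C(1) js r2 sinv st in auto)
      qed (auto simp: algebra_simps)
    next
      case F
      then have "R = 0\<^sub>m n n" using psdf_trace_pos[OF psd_R R_carrier] B(1) by fastforce
      then have step: "scrcd_step A l S F st = return_pmf st" unfolding scrcd_step_R by simp
      have r1': "out_rep 7 0 2 5 s1 (S, F)" using r1 unfolding SF sc_rep_def by (cases st) simp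
      show ?case
        unfolding step rt_return_iff
        by (rule dt_Skip) (use r1 out_rep_agree[OF r1'] in \<open>auto simp: sc_rep_def st SF\<close>)
    qed auto
  qed auto
  then show ?thesis
    by (rule rt_conseq) (use sc_step_support[OF sinv] in auto)
qed

text \<open>Register 0 holds \<open>n\<close> up to the last command, which puts the number of
  pivots there for \<open>result\<close>.\<close>

definition main :: com where
  "main = Seq boost (Seq scrcd_pre (Seq (For 10 (Reg 4) scrcd_iterc) (SetReg 0 (Reg 7))))"

lemma rt_main:
  fixes T k
  defines "wr \<equiv> 20 + n * 10 + d * (61 + n * (100 + d * 20))" and "wc \<equiv> 20 + d * 10 + n * (20 + d * 10)"
    and "wi \<equiv> 50 + n * 20 + l * (7 + n) + (100 + n * (200 + d * 60 + l * 20) + l * (300 + l * 300 + l * d * 20 + l * l * 60) + d * l * 20)"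
  assumes T: "0 < T"
  shows "rt main (input_store n d l T k) (50 + T * (60 + n * 40 + wr + wc) + n * (200 + d * 100) + k * (1 + wi))
    (T * (n + d * n) + n * d + k * (n * l + n * l)) (boosted_scrcd A b d l T k) (\<lambda>s' out. result n s' = out)"
proof -
  let ?s = "input_store n d l T k"
  have s: "regs ?s 0 = n" "regs ?s 1 = d" "regs ?s 2 = l" "regs ?s 3 = T" "regs ?s 4 = k" "cells ?s = (\<lambda>_ _ _. 0)"
    by (auto simp: input_store_def)
  have law: "boosted_scrcd A b d l T k = bind_pmf (boosted_rpcholesky A d T) (\<lambda>SF.
    bind_pmf (iterp (\<lambda>_. scrcd_step A l (fst SF) (snd SF)) k (scrcd_init A b (fst SF) (snd SF)))
      (\<lambda>st. return_pmf (fst SF, snd SF, fst (scrcd_init A b (fst SF) (snd SF)), fst st)))"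
    unfolding boosted_scrcd_def scrcd_iter_iterp Let_def by (simp add: case_prod_unfold)
  show ?thesis
    unfolding law main_def
  proof (rule rt_Seq[OF rt_boost[OF s(1,2,4) T, folded wr_def wc_def],
        where ?w2.0 = "40 + n * (200 + d * 100) + k * (1 + wi)" and ?e2.0 = "n * d + k * (n * l + n * l)"], goal_cases Z)
    case (Z s1 SF)
    obtain S F where SF: "SF = (S, F)" by (cases SF)
    define st0 where "st0 = scrcd_init A b S F"
    have ag1: "regs s1 0 = n" "regs s1 2 = l" "regs s1 4 = k" "\<And>i. i < n \<Longrightarrow> cells s1 0 i 0 = 0"
      using Z(2) s by (auto simp: agree_def)
    obtain cs R where F: "F = mat_of_cols n cs" and r': "rep 7 0 2 5 s1 (S, cs, R)"
      using Z(1) by (auto simp: out_rep_def SF)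
    interpret rpc_output n A S cs R F "submat F S [0..<length S]" "inv_mat (submat F S [0..<length S])"
      unfolding F by (rule rep_output[OF r'])
    show ?case
      unfolding SF fst_conv snd_conv st0_def[symmetric]
    proof (rule rt_Seq_dt[OF dt_scrcd_pre[OF ag1(1) Z(1)[unfolded SF] ag1(4), folded st0_def],
          where ?w2.0 = "10 + k * (1 + wi)" and ?e2.0 = "k * (n * l + n * l)"], goal_cases i B)
      case (B s2)
      have ag2: "regs s2 0 = n" "regs s2 2 = l" "regs s2 4 = k" using B(2) ag1 by (auto simp: agree_def)
      show ?case
      proof (rule rt_Seq[where ?w1.0 = "2 + k * (1 + wi)" and ?e1.0 = "k * (n * l + n * l)" and ?w2.0 = 2 and ?e2.0 = 0
            and P = "\<lambda>s' st. sc_rep (fst st0) (S, F) s' st"], goal_cases C D)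
        case C
        show ?case
        proof (rule rt_For[where N = k and W = wi and E = "n * l + n * l" and
              I = "\<lambda>_ s' st. sc_rep (fst st0) (S, F) s' st \<and> sc_inv xs st"], goal_cases N I0 step)
          case I0
          have "sc_inv xs st0" unfolding st0_def by (rule sc_init_inv[OF xs])
          moreover have "out_rep 7 0 2 5 s2 (S, F)" using B(1) unfolding sc_rep_def by (cases st0) simp
          ultimately show ?case using B(1) out_rep_agree[of 7 0 2 5 s2 "(S, F)"] by (auto simp: sc_rep_def)
        next
          case (step i s' st)
          let ?s' = "charge 1 0 (set_reg 10 i s')"
          have ag: "regs ?s' 0 = n" "regs ?s' 2 = l" using step(3) ag2 by (auto simp: agree_def)
          have "out_rep 7 0 2 5 s' (S, F)" using step(2) unfolding sc_rep_def by (cases st) simp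
          then have "sc_rep (fst st0) (S, F) ?s' st"
            using step(2) out_rep_agree[of 7 0 2 5 s' "(S, F)" ?s'] by (auto simp: sc_rep_def)
          then show ?case
            unfolding wi_def by (rule rt_scrcd_iterc[OF ag refl _ conjunct2[OF step(2)]])
        qed (use ag2 in auto)
      next
        case (D s3 st)
        obtain x res where st: "st = (x, res)" by (cases st)
        have r3: "out_rep 7 0 2 5 s3 (S, F)" and v3: "dim_vec x = n" "dim_vec (fst st0) = n"
          "\<And>i. i < n \<Longrightarrow> cells s3 0 i 0 = x $ i" "\<And>i. i < n \<Longrightarrow> cells s3 1 i 0 = fst st0 $ i"
          using D(1) by (auto simp: sc_rep_def st)
        obtain cs' R' where F': "F = mat_of_cols n cs'" and r3': "rep 7 0 2 5 s3 (S, cs', R')"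
          using r3 by (auto simp: out_rep_def)
        have rr: "regs s3 7 = length S" "\<And>t. t < length S \<Longrightarrow> idxs s3 0 t = S ! t" "length cs' = length S"
          "\<And>i t. i < n \<Longrightarrow> t < length S \<Longrightarrow> cells s3 2 i t = cs' ! t $ i"
          using r3' rpc_invD(1) by (auto simp: rep_def)
        have "map (idxs s3 0) [0..<length S] = S" using rr by (intro nth_equalityI) auto
        moreover have "mat n (length S) (\<lambda>(i, j). cells s3 2 i j) = F"
          unfolding F' using rr by (intro eq_matI) (auto simp: mat_of_cols_index)
        moreover have "vec n (\<lambda>i. cells s3 1 i 0) = fst st0" "vec n (\<lambda>i. cells s3 0 i 0) = x"
          using v3 by (auto intro!: eq_vecI)
        ultimately show ?case
          unfolding rt_return_iff by (intro dt_SetReg) (auto simp: result_def rr st)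
      qed auto
    qed auto
  qed (auto simp: algebra_simps)
qed

end

section \<open>Cost bounds\<close>

text \<open>A positive tail sum contains a nonzero eigenvalue, so it is at least
  \<open>lambda_min_pos A\<close>. This lets \<open>n ln (1 / \<epsilon>)\<close> be charged to
  \<open>n\<^sup>2 \<kappa> ln (1 / \<epsilon>)\<close>.\<close>

lemma tail_cond_ge:
  assumes psd: "psd n A" and nz: "A \<noteq> 0\<^sub>m n n"
  shows "1 / real n \<le> tail_cond A (approx_rank A d)"
proof -
  define r where "r = approx_rank A d"
  note r = approx_rank_props[OF psd nz, of d, folded r_def]
  obtain q e where es: "eigsys n A q e" using psd_eigsys[OF psd] by blast
  have lam: "0 < lambda_min_pos A" by (rule lambda_min_pos_gt_0[OF psd nz])
  have dA: "dim_row A = n" using psd by (auto simp: psd_def)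
  have nn: "\<And>k. k < n \<Longrightarrow> 0 \<le> e k" using es by (simp add: eigsys_def)
  have "\<exists>k\<in>{r..<n}. e k \<noteq> 0"
  proof (rule ccontr)
    assume "\<not> ?thesis"
    then have "(\<Sum>k\<in>{r..<n}. e k) = 0" by (intro sum.neutral) auto
    then show False using r(2) by (simp add: tail_sum_eigsys[OF es])
  qed
  then obtain k where k: "k \<in> {r..<n}" "e k \<noteq> 0" by blast
  have "lambda_min_pos A \<le> e k" using es k by (simp add: eigsys_def)
  also have "e k \<le> tail_sum A r"
    unfolding tail_sum_eigsys[OF es] using k nn by (intro member_le_sum) auto
  finally have "1 \<le> tail_sum A r / lambda_min_pos A" using lam by simp
  then have "1 / (real n - real r) * 1 \<le> 1 / (real n - real r) * (tail_sum A r / lambda_min_pos A)"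
    using r(1) by (intro mult_left_mono) auto
  moreover have "1 / real n \<le> 1 / (real n - real r)" using r(1) by (intro divide_left_mono) auto
  ultimately show ?thesis unfolding r_def tail_cond_def dA by linarith
qed

text \<open>The additive constants, from the 2 inside the logarithm and from rounding, become a
  multiple of \<open>ln (1 / \<epsilon>)\<close> because this is at least
  \<open>ln (1 / \<epsilon>0)\<close>.\<close>

lemma boost_runs_le:
  assumes "0 < \<epsilon>" "\<epsilon> \<le> \<epsilon>0" "\<epsilon>0 < 1"
  shows "real (boost_runs \<epsilon>) \<le> (2 / ln (1 / \<epsilon>0) + 2) * ln (1 / \<epsilon>)"
proof -
  have e0: "0 < ln (1 / \<epsilon>0)" using assms by simp
  have le: "ln (1 / \<epsilon>0) \<le> ln (1 / \<epsilon>)" using assms by (simp add: ln_div)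
  have "log 2 (2 / \<epsilon>) = 1 + ln (1 / \<epsilon>) / ln 2"
    using assms by (simp add: log_def ln_div field_simps)
  moreover have "ln (1 / \<epsilon>) / ln 2 \<le> ln (1 / \<epsilon>) / (1 / 2)"
    using ln2_ge_two_thirds e0 le by (intro divide_left_mono) auto
  moreover have "0 \<le> log 2 (2 / \<epsilon>)" using assms by simp
  ultimately have "real (boost_runs \<epsilon>) \<le> 2 + 2 * ln (1 / \<epsilon>)"
    unfolding boost_runs_def by simp linarith
  moreover have "2 \<le> 2 / ln (1 / \<epsilon>0) * ln (1 / \<epsilon>)" using e0 le by (simp add: field_simps)
  ultimately show ?thesis unfolding distrib_right by linarith
qed

text \<open>The 1 from rounding up is at most \<open>(n / l) K\<close> since
  \<open>K \<ge> l / n\<close>; the summand \<open>ln 2\<close> of the logarithm is absorbed as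
  \<open>ln (1 / \<epsilon>)\<close> is bounded away from 0.\<close>

lemma scrcd_iterations_le:
  fixes d :: nat
  assumes psd: "psd n A" and nz: "A \<noteq> 0\<^sub>m n n" and l: "1 \<le> l" and e: "0 < \<epsilon>" "\<epsilon> \<le> \<epsilon>0" "\<epsilon>0 < 1"
  defines "K \<equiv> max (tail_cond A (approx_rank A d) * ln (1 / \<epsilon>)) (real l / real n)"
  shows "real (scrcd_iterations A d l \<epsilon>) \<le> (4 / ln (1 / \<epsilon>0) + 5) * (real n / real l * K)"
proof -
  let ?\<kappa> = "tail_cond A (approx_rank A d)"
  have e0: "0 < ln (1 / \<epsilon>0)" using e by simp
  have le: "ln (1 / \<epsilon>0) \<le> ln (1 / \<epsilon>)" using e by (simp add: ln_div)
  have dA: "dim_row A = n" using psd by (auto simp: psd_def)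
  have n: "0 < n" using approx_rank_props(1)[OF psd nz, of d] by simp
  have k0: "0 \<le> ?\<kappa>" using tail_cond_ge[OF psd nz, of d] n by (meson divide_nonneg_nonneg of_nat_0_le_iff order_trans zero_le_one)
  have "ln (2 / \<epsilon>) = ln 2 + ln (1 / \<epsilon>)" using e by (simp add: ln_div)
  moreover have "ln 2 \<le> (1::real)" using ln_le_minus_one[of 2] by simp
  moreover have "1 \<le> 1 / ln (1 / \<epsilon>0) * ln (1 / \<epsilon>)" using e0 le by (simp add: field_simps)
  ultimately have l2: "ln (2 / \<epsilon>) \<le> (1 / ln (1 / \<epsilon>0) + 1) * ln (1 / \<epsilon>)" unfolding distrib_right by linarith
  have x0: "0 \<le> 4 * (real n / real l) * ?\<kappa> * ln (2 / \<epsilon>)" using k0 e by simp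
  have 1: "real (scrcd_iterations A d l \<epsilon>) \<le> 4 * (real n / real l) * ?\<kappa> * ln (2 / \<epsilon>) + 1"
    unfolding scrcd_iterations_def dA using x0 by linarith
  have "4 * (real n / real l) * ?\<kappa> * ln (2 / \<epsilon>) \<le> 4 * (real n / real l) * ?\<kappa> * ((1 / ln (1 / \<epsilon>0) + 1) * ln (1 / \<epsilon>))"
    using k0 l2 by (intro mult_left_mono) auto
  also have "\<dots> = 4 * (1 / ln (1 / \<epsilon>0) + 1) * (real n / real l) * (?\<kappa> * ln (1 / \<epsilon>))" by (simp add: mult_ac)
  also have "\<dots> \<le> 4 * (1 / ln (1 / \<epsilon>0) + 1) * (real n / real l) * K"
    using e0 by (intro mult_left_mono) (auto simp: K_def)
  also have "4 * (1 / ln (1 / \<epsilon>0) + 1) * (real n / real l) * K = (4 / ln (1 / \<epsilon>0) + 4) * (real n / real l * K)"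
    by (simp add: algebra_simps)
  finally have 2: "4 * (real n / real l) * ?\<kappa> * ln (2 / \<epsilon>) \<le> (4 / ln (1 / \<epsilon>0) + 4) * (real n / real l * K)" .
  have 3: "1 \<le> real n / real l * K"
  proof -
    have "real n / real l * (real l / real n) \<le> real n / real l * K" by (intro mult_left_mono) (auto simp: K_def)
    then show ?thesis using n l by simp
  qed
  have "(4 / ln (1 / \<epsilon>0) + 5) * (real n / real l * K) = (4 / ln (1 / \<epsilon>0) + 4) * (real n / real l * K) + real n / real l * K"
    unfolding distrib_right by simp
  then show ?thesis using 1 2 3 by linarith
qed

text \<open>\<open>d \<le> d\<^sup>2\<close> for natural numbers absorbs the terms linear in
  \<open>d\<close>; the summand \<open>n\<close> remains for \<open>d = 0\<close>.\<close>

lemma run_cost_bound: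
  assumes n: "0 < (n::nat)"
  shows "60 + n * 40 + (20 + n * 10 + d * (61 + n * (100 + d * 20))) + (20 + d * 10 + n * (20 + d * 10)) \<le> 300 * (n + n * d * d)"
proof -
  have "d \<le> n * d * d" using mult_le_mono[of 1 n d "d * d"] n by (simp add: mult.assoc)
  moreover have "n * d \<le> n * d * d" by (cases d) auto
  moreover have "60 + n * 40 + (20 + n * 10 + d * (61 + n * (100 + d * 20))) + (20 + d * 10 + n * (20 + d * 10))
    = 100 + 70 * n + 71 * d + 110 * (n * d) + 20 * (n * d * d)"
    by (simp add: algebra_simps)
  moreover have "300 * (n + n * d * d) = 300 * n + 300 * (n * d * d)" by simp
  ultimately show ?thesis using n by linarith
qed

lemma iter_cost_bound:
  assumes n: "0 < (n::nat)" and l: "0 < l"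
  shows "1 + (50 + n * 20 + l * (7 + n) + (100 + n * (200 + d * 60 + l * 20) + l * (300 + l * 300 + l * d * 20 + l * l * 60) + d * l * 20))
    \<le> 700 * (n * (d + l) + l * l * l + l * l * d)"
proof -
  have "1 \<le> n * l" using n l by (simp add: Suc_le_eq)
  moreover have "n \<le> n * l" "l \<le> n * l" using n l by auto
  moreover have "l * l \<le> l * l * l" "d * l \<le> l * l * d" using l by auto
  moreover have "1 + (50 + n * 20 + l * (7 + n) + (100 + n * (200 + d * 60 + l * 20) + l * (300 + l * 300 + l * d * 20 + l * l * 60) + d * l * 20))
    = 151 + 220 * n + 307 * l + 21 * (n * l) + 60 * (n * d) + 300 * (l * l) + 20 * (l * l * d) + 60 * (l * l * l) + 20 * (d * l)"
    by (simp add: algebra_simps)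
  moreover have "700 * (n * (d + l) + l * l * l + l * l * d) = 700 * (n * d) + 700 * (n * l) + 700 * (l * l * l) + 700 * (l * l * d)"
    by (simp add: algebra_simps)
  ultimately show ?thesis by linarith
qed

lemma UIs_subset: "UIs n d l \<subseteq> {..<10} \<times> {..<n + d + l}"
  by (auto simp: UIs_def)

lemma UCs_subset: "UCs n d l \<subseteq> {..<20} \<times> ({..<n} \<times> {..<d + l} \<union> {..<n + d + l} \<times> {0})"
  by (auto simp: UCs_def)

lemma storage_bound:
  assumes n: "0 < n" and l: "0 < l" and "used_idxs s \<subseteq> UIs n d l" "used_cells s \<subseteq> UCs n d l"
  shows "storage s \<le> 80 * (n * (d + l))"
proof -
  have "card (used_idxs s) \<le> card ({..<10::nat} \<times> {..<n + d + l})"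
    using assms(3) UIs_subset by (intro card_mono) blast+
  also have "\<dots> = 10 * (n + d + l)" by (simp add: card_cartesian_product)
  finally have 1: "card (used_idxs s) \<le> 10 * (n + d + l)" .
  have "card (used_cells s) \<le> card ({..<20::nat} \<times> ({..<n} \<times> {..<d + l} \<union> {..<n + d + l} \<times> {0::nat}))"
    using assms(4) UCs_subset by (intro card_mono) blast+
  also have "\<dots> = 20 * card ({..<n} \<times> {..<d + l} \<union> {..<n + d + l} \<times> {0::nat})" by (simp add: card_cartesian_product)
  also have "card ({..<n} \<times> {..<d + l} \<union> {..<n + d + l} \<times> {0::nat}) \<le> n * (d + l) + (n + d + l)"
    by (rule order_trans[OF card_Un_le]) (simp add: card_cartesian_product)
  finally have 2: "card (used_cells s) \<le> 20 * (n * (d + l) + (n + d + l))" by simp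
  define p where "p = n * (d + l)"
  have p: "n \<le> p" "d + l \<le> p" using n l by (auto simp: p_def)
  have "card (used_idxs s) + card (used_cells s) \<le> 10 * (n + d + l) + 20 * (p + (n + d + l))"
    by (rule add_mono[OF 1 2[folded p_def]])
  also have "\<dots> = 30 * n + 30 * (d + l) + 20 * p" by simp
  also have "\<dots> \<le> 80 * p" using p by simp
  finally have "card (used_idxs s) + card (used_cells s) \<le> 80 * p" .
  then show ?thesis unfolding storage_def p_def .
qed

text \<open>\<open>X\<close> is \<open>N / L\<close> times the cost of an iteration. Terms of order
  \<open>N\<close> and \<open>N lam\<close> are charged to \<open>N\<^sup>2 K\<close>, itself at
  most \<open>X K\<close>, by the two lower bounds on \<open>K\<close>; a term \<open>N D\<close>
  without logarithm gains the factor \<open>lam\<close> at the price of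
  \<open>1 / lam0\<close>.\<close>

lemma cost_arithmetic:
  fixes N D L T k lam lam0 kap K cT ck :: real
  assumes N: "1 \<le> N" and D: "0 \<le> D" "D \<le> D\<^sup>2" and L: "1 \<le> L" and lam: "0 < lam0" "lam0 \<le> lam"
    and T: "T \<le> cT * lam" and k: "k \<le> ck * (N / L * K)" and c0: "0 \<le> cT" "0 \<le> ck"
    and K: "lam / N \<le> K" "L / N \<le> K"
  defines "X \<equiv> N\<^sup>2 * (D + L) / L + N * L\<^sup>2 + N * L * D" and "c \<equiv> 1000 * (1 + cT + ck + 1 / lam0)"
  shows "300 * (T * (N + N * D\<^sup>2)) + (250 * N + 100 * (N * D)) + 700 * (k * (N * (D + L) + L ^ 3 + L\<^sup>2 * D))
      \<le> c * (N * D\<^sup>2 * lam) + c * (X * K)"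
    and "T * (N + D * N) + N * D + k * (2 * (N * L)) \<le> c * (N * D * lam) + c * (N\<^sup>2 * K)"
proof -
  have lam': "0 < lam" using lam by simp
  have K0: "0 \<le> K" using K(2) N L by (meson divide_nonneg_nonneg order_trans zero_le_one)
  have Nlam: "N * lam \<le> N\<^sup>2 * K"
    using mult_left_mono[OF K(1), of "N\<^sup>2"] N by (simp add: power2_eq_square)
  have NL: "N * L \<le> N\<^sup>2 * K"
    using mult_left_mono[OF K(2), of "N\<^sup>2"] N by (simp add: power2_eq_square)
  have "N * 1 \<le> N * L" using N L by (intro mult_left_mono) auto
  then have NN: "N \<le> N\<^sup>2 * K" using NL by simp
  have X: "X = N / L * (N * (D + L) + L ^ 3 + L\<^sup>2 * D)"
    using L by (simp add: X_def field_simps power2_eq_square power3_eq_cube)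
  have "N\<^sup>2 \<le> X"
  proof -
    have "N\<^sup>2 * 1 \<le> N\<^sup>2 * ((D + L) / L)" using D L by (intro mult_left_mono) auto
    moreover have "0 \<le> N * L\<^sup>2" "0 \<le> N * L * D" using N D L by auto
    ultimately show ?thesis unfolding X_def by simp
  qed
  then have NX: "N\<^sup>2 * K \<le> X * K" using K0 by (rule mult_right_mono)
  have inv: "y \<le> 1 / lam0 * (y * lam)" if "0 \<le> y" for y
  proof -
    have "y * lam0 \<le> y * lam" using that lam by (intro mult_left_mono) auto
    then show ?thesis using lam by (simp add: field_simps)
  qed
  have ND0: "0 \<le> N * D" "0 \<le> N * D\<^sup>2" using N D by auto
  have p1: "T * (N + N * D\<^sup>2) \<le> cT * (X * K) + cT * (N * D\<^sup>2 * lam)"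
  proof -
    have "T * (N + N * D\<^sup>2) \<le> cT * lam * (N + N * D\<^sup>2)" using T ND0 N by (intro mult_right_mono) auto
    also have "\<dots> = cT * (N * lam) + cT * (N * D\<^sup>2 * lam)" by (simp add: algebra_simps)
    also have "cT * (N * lam) \<le> cT * (X * K)" using Nlam NX c0 by (intro mult_left_mono) auto
    finally show ?thesis by simp
  qed
  have p2: "N * D \<le> 1 / lam0 * (N * D\<^sup>2 * lam)"
  proof (rule order_trans[OF _ inv[OF ND0(2)]])
    show "N * D \<le> N * D\<^sup>2" using D N by (intro mult_left_mono) auto
  qed
  have p3: "k * (N * (D + L) + L ^ 3 + L\<^sup>2 * D) \<le> ck * (X * K)"
  proof -
    have "k * (N * (D + L) + L ^ 3 + L\<^sup>2 * D) \<le> ck * (N / L * K) * (N * (D + L) + L ^ 3 + L\<^sup>2 * D)"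
      using k N D L by (intro mult_right_mono) auto
    then show ?thesis by (simp add: X mult_ac)
  qed
  have XK: "0 \<le> X * K" using NX K0 N by (meson mult_nonneg_nonneg order_trans zero_le_power2)
  have NDl: "0 \<le> N * D\<^sup>2 * lam" "0 \<le> N * D * lam" using ND0 lam' by auto
  have il: "0 \<le> 1 / lam0" using lam by simp
  have cb: "300 * cT + 100 * (1 / lam0) \<le> c" "300 * cT + 250 + 700 * ck \<le> c" "cT + 1 / lam0 \<le> c" "cT + 2 * ck \<le> c"
    unfolding c_def distrib_left using c0 il by linarith+
  have "300 * (T * (N + N * D\<^sup>2)) + (250 * N + 100 * (N * D)) + 700 * (k * (N * (D + L) + L ^ 3 + L\<^sup>2 * D))
    \<le> (300 * cT + 100 * (1 / lam0)) * (N * D\<^sup>2 * lam) + (300 * cT + 250 + 700 * ck) * (X * K)"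
  proof -
    have "(300 * cT + 100 * (1 / lam0)) * y + (300 * cT + 250 + 700 * ck) * z
      = 300 * (cT * z + cT * y) + (250 * z + 100 * (1 / lam0 * y)) + 700 * (ck * z)" for y z
      by (simp add: algebra_simps)
    moreover have "250 * N \<le> 250 * (X * K)" using NN NX by simp
    ultimately show ?thesis
      by (simp only:) (intro add_mono mult_left_mono p1 p2 p3, auto)
  qed
  also have "\<dots> \<le> c * (N * D\<^sup>2 * lam) + c * (X * K)"
    using c0 il by (intro add_mono mult_right_mono NDl XK cb)
  finally show "300 * (T * (N + N * D\<^sup>2)) + (250 * N + 100 * (N * D)) + 700 * (k * (N * (D + L) + L ^ 3 + L\<^sup>2 * D))
      \<le> c * (N * D\<^sup>2 * lam) + c * (X * K)" .
  have q1: "T * (N + D * N) \<le> cT * (N\<^sup>2 * K) + cT * (N * D * lam)"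
  proof -
    have "T * (N + D * N) \<le> cT * lam * (N + D * N)" using T D N by (intro mult_right_mono) auto
    also have "\<dots> = cT * (N * lam) + cT * (N * D * lam)" by (simp add: algebra_simps)
    also have "cT * (N * lam) \<le> cT * (N\<^sup>2 * K)" using Nlam c0 by (intro mult_left_mono) auto
    finally show ?thesis by simp
  qed
  have q3: "k * (2 * (N * L)) \<le> 2 * ck * (N\<^sup>2 * K)"
  proof -
    have "k * (2 * (N * L)) \<le> ck * (N / L * K) * (2 * (N * L))" using k N L by (intro mult_right_mono) auto
    then show ?thesis using L by (simp add: power2_eq_square mult_ac)
  qed
  have N2K: "0 \<le> N\<^sup>2 * K" using K0 by simp
  have "T * (N + D * N) + N * D + k * (2 * (N * L)) \<le> (cT + 1 / lam0) * (N * D * lam) + (cT + 2 * ck) * (N\<^sup>2 * K)"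
  proof -
    have "(cT + 1 / lam0) * y + (cT + 2 * ck) * z = (cT * z + cT * y) + 1 / lam0 * y + 2 * ck * z" for y z
      by (simp add: algebra_simps)
    then show ?thesis
      by (simp only:) (intro add_mono q1 q3 inv[OF ND0(1)])
  qed
  also have "\<dots> \<le> c * (N * D * lam) + c * (N\<^sup>2 * K)"
    using c0 il by (intro add_mono mult_right_mono NDl N2K cb)
  finally show "T * (N + D * N) + N * D + k * (2 * (N * L)) \<le> c * (N * D * lam) + c * (N\<^sup>2 * K)" .
qed

section \<open>The uniform program and its costs\<close>

text \<open>The commands mention no parameter of the locales that define them, so the exported
  constant takes no arguments: one term serves all inputs.\<close>

definition scrcd_program :: com where
  "scrcd_program = scrcd_system.main"

lemma scrcd_program_rel:
  assumes n: "0 < n" and psd: "psd n A" and xs: "xs \<in> carrier_vec n" "A *\<^sub>v xs = b" and l: "0 < l" and T: "0 < T"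
  shows "rel_pmf (\<lambda>s out. ops s \<le> 300 * (T * (n + n * d * d)) + (250 * n + 100 * (n * d)) + 700 * (k * (n * (d + l) + l * l * l + l * l * d)) \<and>
      evals s \<le> T * (n + d * n) + n * d + k * (n * l + n * l) \<and> storage s \<le> 80 * (n * (d + l)) \<and> result n s = out)
    (run A b scrcd_program (input_store n d l T k)) (boosted_scrcd A b d l T k)"
proof -
  interpret scrcd_system A b n d l xs
    by unfold_locales (use assms in auto)
  have i: "ops (input_store n d l T k) = 0" "evals (input_store n d l T k) = 0"
    "used_idxs (input_store n d l T k) = {}" "used_cells (input_store n d l T k) = {}"
    by (auto simp: input_store_def)
  from rt_main[OF T, of k] show ?thesis
    unfolding rt_def scrcd_program_def
  proof (rule pmf.rel_mono_strong)
    fix s out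
    assume *: "costs (50 + T * (60 + n * 40 + (20 + n * 10 + d * (61 + n * (100 + d * 20))) + (20 + d * 10 + n * (20 + d * 10))) + n * (200 + d * 100) +
        k * (1 + (50 + n * 20 + l * (7 + n) + (100 + n * (200 + d * 60 + l * 20) + l * (300 + l * 300 + l * d * 20 + l * l * 60) + d * l * 20))))
      (T * (n + d * n) + n * d + k * (n * l + n * l)) (input_store n d l T k) s \<and> result n s = out"
    have "T * (60 + n * 40 + (20 + n * 10 + d * (61 + n * (100 + d * 20))) + (20 + d * 10 + n * (20 + d * 10))) \<le> T * (300 * (n + n * d * d))"
      by (intro mult_left_mono run_cost_bound[OF n]) simp
    moreover have "k * (1 + (50 + n * 20 + l * (7 + n) + (100 + n * (200 + d * 60 + l * 20) + l * (300 + l * 300 + l * d * 20 + l * l * 60) + d * l * 20)))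
        \<le> k * (700 * (n * (d + l) + l * l * l + l * l * d))"
      by (intro mult_left_mono iter_cost_bound[OF n l]) simp
    moreover have "50 + n * (200 + d * 100) \<le> 250 * n + 100 * (n * d)" using n by (simp add: algebra_simps)
    moreover have "T * (300 * (n + n * d * d)) = 300 * (T * (n + n * d * d))" by simp
    moreover have "k * (700 * (n * (d + l) + l * l * l + l * l * d)) = 700 * (k * (n * (d + l) + l * l * l + l * l * d))" by simp
    ultimately have "ops s \<le> 300 * (T * (n + n * d * d)) + (250 * n + 100 * (n * d)) + 700 * (k * (n * (d + l) + l * l * l + l * l * d))"
      using * i unfolding costs_def by linarith
    moreover have "storage s \<le> 80 * (n * (d + l))"
      using * i by (intro storage_bound[OF n l]) (auto simp: costs_def)
    ultimately show "ops s \<le> 300 * (T * (n + n * d * d)) + (250 * n + 100 * (n * d)) + 700 * (k * (n * (d + l) + l * l * l + l * l * d)) \<and>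
      evals s \<le> T * (n + d * n) + n * d + k * (n * l + n * l) \<and> storage s \<le> 80 * (n * (d + l)) \<and> result n s = out"
      using * i by (auto simp: costs_def)
  qed
qed

lemma scrcd_program_implements: "implements_scrcd scrcd_program"
  unfolding implements_scrcd_def
proof (intro allI impI, elim conjE bexE)
  fix n :: nat and A :: "real mat" and b :: "real vec" and d l T k :: nat and x :: "real vec"
  assume "0 < n" "psd n A" "0 < l" "0 < T" "x \<in> carrier_vec n" "A *\<^sub>v x = b"
  then have "rel_pmf (\<lambda>s out. result n s = out) (run A b scrcd_program (input_store n d l T k)) (boosted_scrcd A b d l T k)"
    by (intro pmf.rel_mono_strong[OF scrcd_program_rel]) auto
  then have "rel_pmf (=) (map_pmf (result n) (run A b scrcd_program (input_store n d l T k))) (boosted_scrcd A b d l T k)"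
    by (simp add: pmf.rel_map)
  then show "map_pmf (result n) (run A b scrcd_program (input_store n d l T k)) = boosted_scrcd A b d l T k"
    by (simp add: pmf.rel_eq)
qed

lemma scrcd_program_cost:
  assumes e0: "0 < \<epsilon>0" "\<epsilon>0 < 1"
  shows "\<exists>c > 0. \<forall>n A b xs d l \<epsilon>.
    psd n A \<and> A \<noteq> 0\<^sub>m n n \<and> xs \<in> carrier_vec n \<and> A *\<^sub>v xs = b \<and> 1 \<le> l \<and> 0 < \<epsilon> \<and> \<epsilon> \<le> \<epsilon>0 \<longrightarrow>
    (let N = real n; D = real d; L = real l;
         \<kappa> = tail_cond A (approx_rank A d);
         K = max (\<kappa> * ln (1 / \<epsilon>)) (L / N)
     in \<forall>s \<in> set_pmf (run A b scrcd_program
           (input_store n d l (boost_runs \<epsilon>) (scrcd_iterations A d l \<epsilon>))).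
          real (ops s) \<le> c * (N * D\<^sup>2 * ln (1 / \<epsilon>))
                           + c * ((N\<^sup>2 * (D + L) / L + N * L\<^sup>2 + N * L * D) * K)
        \<and> real (evals s) \<le> c * (N * D * ln (1 / \<epsilon>)) + c * (N\<^sup>2 * K)
        \<and> real (storage s) \<le> c * (N * (D + L)))"
proof -
  define lam0 where "lam0 = ln (1 / \<epsilon>0)"
  define cT where "cT = 2 / lam0 + 2"
  define ck where "ck = 4 / lam0 + 5"
  define c where "c = 1000 * (1 + cT + ck + 1 / lam0)"
  have l0: "0 < lam0" using e0 by (simp add: lam0_def)
  have c0: "0 \<le> cT" "0 \<le> ck" using l0 by (auto simp: cT_def ck_def)
  have c80: "80 \<le> c" using c0 l0 unfolding c_def by (simp add: add_nonneg_nonneg)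
  show ?thesis
  proof (intro exI[of _ c] conjI allI impI)
    show "0 < c" using c80 by simp
  next
    fix n :: nat and A :: "real mat" and b xs :: "real vec" and d l :: nat and \<epsilon> :: real
    assume H: "psd n A \<and> A \<noteq> 0\<^sub>m n n \<and> xs \<in> carrier_vec n \<and> A *\<^sub>v xs = b \<and> 1 \<le> l \<and> 0 < \<epsilon> \<and> \<epsilon> \<le> \<epsilon>0"
    then have psd: "psd n A" and nz: "A \<noteq> 0\<^sub>m n n" and xs: "xs \<in> carrier_vec n" "A *\<^sub>v xs = b" and l: "1 \<le> l" "0 < l" and e: "0 < \<epsilon>" "\<epsilon> \<le> \<epsilon>0" "\<epsilon> < 1"
      using e0 by auto
    define T k where "T = boost_runs \<epsilon>" and "k = scrcd_iterations A d l \<epsilon>"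
    define kap K where "kap = tail_cond A (approx_rank A d)" and "K = max (kap * ln (1 / \<epsilon>)) (real l / real n)"
    have n: "0 < n" using approx_rank_props(1)[OF psd nz, of d] by simp
    have T0: "0 < T" unfolding T_def by (rule boost_runs_bound(1)[OF e(1,3)])
    have lam: "lam0 \<le> ln (1 / \<epsilon>)" using e e0 by (simp add: lam0_def ln_div)
    have T: "real T \<le> cT * ln (1 / \<epsilon>)"
      unfolding T_def cT_def lam0_def by (rule boost_runs_le[OF e(1,2) e0(2)])
    have k: "real k \<le> ck * (real n / real l * K)"
      unfolding k_def ck_def lam0_def K_def kap_def by (rule scrcd_iterations_le[OF psd nz l(1) e(1,2) e0(2)])
    have K1: "ln (1 / \<epsilon>) / real n \<le> K"
    proof -
      have "1 / real n * ln (1 / \<epsilon>) \<le> kap * ln (1 / \<epsilon>)"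
        unfolding kap_def using tail_cond_ge[OF psd nz] lam l0 by (intro mult_right_mono) auto
      then show ?thesis by (simp add: K_def)
    qed
    have dd: "real d \<le> (real d)\<^sup>2"
      by (cases d) (auto simp: power2_eq_square)
    note ca = cost_arithmetic[of "real n" "real d" "real l" lam0 "ln (1 / \<epsilon>)" "real T" cT "real k" ck K, folded c_def]
    have ca1: "300 * (real T * (real n + real n * (real d)\<^sup>2)) + (250 * real n + 100 * (real n * real d)) + 700 * (real k * (real n * (real d + real l) + real l ^ 3 + (real l)\<^sup>2 * real d))
      \<le> c * (real n * (real d)\<^sup>2 * ln (1 / \<epsilon>)) + c * (((real n)\<^sup>2 * (real d + real l) / real l + real n * (real l)\<^sup>2 + real n * real l * real d) * K)"
      by (rule ca(1)) (use n l dd l0 lam T k c0 K1 in \<open>auto simp: K_def\<close>)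
    have ca2: "real T * (real n + real d * real n) + real n * real d + real k * (2 * (real n * real l)) \<le> c * (real n * real d * ln (1 / \<epsilon>)) + c * ((real n)\<^sup>2 * K)"
      by (rule ca(2)) (use n l dd l0 lam T k c0 K1 in \<open>auto simp: K_def\<close>)
    have "real (ops s) \<le> c * (real n * (real d)\<^sup>2 * ln (1 / \<epsilon>)) + c * (((real n)\<^sup>2 * (real d + real l) / real l + real n * (real l)\<^sup>2 + real n * real l * real d) * K)
        \<and> real (evals s) \<le> c * (real n * real d * ln (1 / \<epsilon>)) + c * ((real n)\<^sup>2 * K)
        \<and> real (storage s) \<le> c * (real n * (real d + real l))"
      if s: "s \<in> set_pmf (run A b scrcd_program (input_store n d l T k))" for s
    proof -
      \<comment> \<open>A coupling relates every final store in the support to some outcome, so the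
        bounds are worst-case.\<close>
      obtain out where *: "ops s \<le> 300 * (T * (n + n * d * d)) + (250 * n + 100 * (n * d)) + 700 * (k * (n * (d + l) + l * l * l + l * l * d))"
        "evals s \<le> T * (n + d * n) + n * d + k * (n * l + n * l)" "storage s \<le> 80 * (n * (d + l))"
        using rel_setD1[OF rel_pmf_imp_rel_set[OF scrcd_program_rel[OF n psd xs l(2) T0]] s] by blast
      have "real (ops s) \<le> real (300 * (T * (n + n * d * d)) + (250 * n + 100 * (n * d)) + 700 * (k * (n * (d + l) + l * l * l + l * l * d)))"
        using *(1) by (rule of_nat_mono)
      also have "\<dots> = 300 * (real T * (real n + real n * (real d)\<^sup>2)) + (250 * real n + 100 * (real n * real d)) + 700 * (real k * (real n * (real d + real l) + real l ^ 3 + (real l)\<^sup>2 * real d))"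
        by (simp add: power2_eq_square power3_eq_cube)
      finally have 1: "real (ops s) \<le> \<dots>" .
      have "real (evals s) \<le> real (T * (n + d * n) + n * d + k * (n * l + n * l))"
        using *(2) by (rule of_nat_mono)
      also have "\<dots> = real T * (real n + real d * real n) + real n * real d + real k * (2 * (real n * real l))" by simp
      finally have 2: "real (evals s) \<le> \<dots>" .
      have "real (storage s) \<le> real (80 * (n * (d + l)))" using *(3) by (rule of_nat_mono)
      also have "\<dots> = 80 * (real n * (real d + real l))" by simp
      also have "\<dots> \<le> c * (real n * (real d + real l))" using c80 by (intro mult_right_mono) auto
      finally show ?thesis using 1 2 ca1 ca2 by linarith
    qed
    then show "let N = real n; D = real d; L = real l;
         \<kappa> = tail_cond A (approx_rank A d);
         K = max (\<kappa> * ln (1 / \<epsilon>)) (L / N)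
     in \<forall>s \<in> set_pmf (run A b scrcd_program
           (input_store n d l (boost_runs \<epsilon>) (scrcd_iterations A d l \<epsilon>))).
          real (ops s) \<le> c * (N * D\<^sup>2 * ln (1 / \<epsilon>))
                           + c * ((N\<^sup>2 * (D + L) / L + N * L\<^sup>2 + N * L * D) * K)
        \<and> real (evals s) \<le> c * (N * D * ln (1 / \<epsilon>)) + c * (N\<^sup>2 * K)
        \<and> real (storage s) \<le> c * (N * (D + L))"
      unfolding Let_def kap_def[symmetric] K_def[symmetric] T_def[symmetric] k_def[symmetric] by blast
  qed
qed

theorem theorem1p7:
  shows
    "(\<forall>n A b xs d l \<epsilon>.
        psd n A \<and> A \<noteq> 0\<^sub>m n n \<and> xs \<in> carrier_vec n \<and> A *\<^sub>v xs = b \<and> 1 \<le> l \<and> 0 < \<epsilon> \<and> \<epsilon> < 1 \<longrightarrow>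
        (\<integral>\<^sup>+ (S, F, x0, xk).
            ennreal ((energy_norm A (xk - xs))\<^sup>2) / ennreal ((energy_norm A (x0 - xs))\<^sup>2)
          \<partial>measure_pmf (boosted_scrcd A b d l (boost_runs \<epsilon>) (scrcd_iterations A d l \<epsilon>)))
        \<le> ennreal \<epsilon>)
     \<and>
     (\<exists>prog. implements_scrcd prog \<and>
       (\<forall>\<epsilon>\<^sub>0. 0 < \<epsilon>\<^sub>0 \<and> \<epsilon>\<^sub>0 < 1 \<longrightarrow> (\<exists>c > 0. \<forall>n A b xs d l \<epsilon>.
          psd n A \<and> A \<noteq> 0\<^sub>m n n \<and> xs \<in> carrier_vec n \<and> A *\<^sub>v xs = b \<and> 1 \<le> l \<and> 0 < \<epsilon> \<and> \<epsilon> \<le> \<epsilon>\<^sub>0 \<longrightarrow>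
          (let N = real n; D = real d; L = real l;
               \<kappa> = tail_cond A (approx_rank A d);
               K = max (\<kappa> * ln (1 / \<epsilon>)) (L / N)
           in \<forall>s \<in> set_pmf (run A b prog
                 (input_store n d l (boost_runs \<epsilon>) (scrcd_iterations A d l \<epsilon>))).
                real (ops s) \<le> c * (N * D\<^sup>2 * ln (1 / \<epsilon>))
                                 + c * ((N\<^sup>2 * (D + L) / L + N * L\<^sup>2 + N * L * D) * K)
              \<and> real (evals s) \<le> c * (N * D * ln (1 / \<epsilon>)) + c * (N\<^sup>2 * K)
              \<and> real (storage s) \<le> c * (N * (D + L))))))"
  using scrcd_accuracy scrcd_program_implements scrcd_program_cost by blast

end
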